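(* Let $G<SL_2(\mathbb{R})$ be a Fuchsian group which has cofinite volume but is not cocompact, and let $\mu$ be a probability distribution on $G$ with finite first moment in the word metric, whose support generates $G$ as a semigroup. Then the harmonic measure $\nu$ determined by $\mu$ is singular with respect to Lebesgue measure on the boundary $S^1=\partial\mathbb{H}^2$ of the hyperbolic plane.
   Context: A Fuchsian group is a discrete subgroup of $SL_2(\mathbb{R})$; cofinite volume, not cocompact, means $G\backslash\mathbb{H}^2$ has finite area and is non-compact. Let $d_G$ be the word metric on $G$ for a finite generating set; finite first moment means $\int_G d_G(1,g)\,d\mu(g)<\infty$. The random walk is $w_n=g_1g_2\cdots g_n$ with $g_i$ independent of law $\mu$; for a basepoint $x_0\in\mathbb{H}^2$, $w_nx_0$ converges almost surely to a point of $S^1$, and the harmonic measure is $\nu(A)=\mathrm{Prob}(\lim_n w_nx_0\in A)$ for measurable $A\subseteq S^1$. Two measures are (mutually) singular if there is a set of full measure for one and measure zero for the other. *)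

theory Defs
  imports
    "HOL-Probability.Probability"
    "HOL-Algebra.Generated_Groups"
    "HOL-Algebra.Group_Action"
begin

section \<open>Generating sets and word metrics\<close>

text \<open>Products of one or more elements of \<open>S\<close>; the identity is not included for free.\<close>

inductive_set semigroup_generate :: "('a, 'b) monoid_scheme \<Rightarrow> 'a set \<Rightarrow> 'a set"
  for G and S where
    incl: "s \<in> S \<Longrightarrow> s \<in> semigroup_generate G S"
  | mult: "\<lbrakk>g \<in> semigroup_generate G S; h \<in> semigroup_generate G S\<rbrakk>
            \<Longrightarrow> g \<otimes>\<^bsub>G\<^esub> h \<in> semigroup_generate G S"

text \<open>The value is meaningful only for \<open>g\<close> in the subgroup generated by \<open>S\<close>.\<close>

definition word_length :: "('a, 'b) monoid_scheme \<Rightarrow> 'a set \<Rightarrow> 'a \<Rightarrow> nat" where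
  "word_length G S g =
     (LEAST n. \<exists>xs. length xs = n \<and> set xs \<subseteq> S \<union> m_inv G ` S \<and> foldr (\<otimes>\<^bsub>G\<^esub>) xs \<one>\<^bsub>G\<^esub> = g)"

definition word_metric :: "('a, 'b) monoid_scheme \<Rightarrow> 'a set \<Rightarrow> 'a \<Rightarrow> 'a \<Rightarrow> nat" where
  "word_metric G S g h = word_length G S (inv\<^bsub>G\<^esub> g \<otimes>\<^bsub>G\<^esub> h)"


section \<open>Fuchsian groups\<close>

definition SL2R :: "(real^2^2) monoid" where
  "SL2R = \<lparr>carrier = {A. det A = 1}, mult = (**), one = mat 1\<rparr>"

lemma SL2R_simps [simp]:
  "carrier SL2R = {A. det A = 1}" "A \<otimes>\<^bsub>SL2R\<^esub> B = A ** B" "\<one>\<^bsub>SL2R\<^esub> = mat 1"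
  by (simp_all add: SL2R_def)

lemma group_SL2R: "group SL2R"
proof (rule groupI)
  fix A assume A: "A \<in> carrier SL2R"
  then have "invertible A"
    by (simp add: invertible_det_nz)
  then obtain B where B: "B ** A = mat 1"
    by (auto simp: invertible_def)
  then have "det B * det A = 1"
    by (metis det_mul det_I)
  with A B show "\<exists>B\<in>carrier SL2R. B \<otimes>\<^bsub>SL2R\<^esub> A = \<one>\<^bsub>SL2R\<^esub>"
    by (intro bexI[of _ B]) auto
qed (auto simp: det_mul matrix_mul_assoc)

definition upper_half_plane :: "complex set" where
  "upper_half_plane = {z. Im z > 0}"

definition mobius :: "real^2^2 \<Rightarrow> complex \<Rightarrow> complex" where
  "mobius A z = (of_real (A$1$1) * z + of_real (A$1$2)) / (of_real (A$2$1) * z + of_real (A$2$2))"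

definition fuchsian :: "(real^2^2) set \<Rightarrow> bool" where
  "fuchsian G \<longleftrightarrow> subgroup G SL2R \<and> topological_space_class.discrete G"

abbreviation mobius_orbit :: "(real^2^2) set \<Rightarrow> complex \<Rightarrow> complex set" where
  "mobius_orbit G \<equiv> orbit (SL2R\<lparr>carrier := G\<rparr>) mobius"

text \<open>The quotient of the upper half plane by \<open>G\<close>, as the set of orbits with the quotient topology.\<close>

definition quotient_surface :: "(real^2^2) set \<Rightarrow> complex set topology" where
  "quotient_surface G =
     topology (\<lambda>U. U \<subseteq> orbits (SL2R\<lparr>carrier := G\<rparr>) upper_half_plane mobius \<and>
                   open {z \<in> upper_half_plane. mobius_orbit G z \<in> U})"

lemma openin_quotient_surface:
  "openin (quotient_surface G) U \<longleftrightarrow>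
     U \<subseteq> orbits (SL2R\<lparr>carrier := G\<rparr>) upper_half_plane mobius \<and>
     open {z \<in> upper_half_plane. mobius_orbit G z \<in> U}"
proof -
  let ?P = "\<lambda>z U. z \<in> upper_half_plane \<and> mobius_orbit G z \<in> U"
  have "{z. ?P z (U \<inter> V)} = {z. ?P z U} \<inter> {z. ?P z V}" for U V by auto
  moreover have "{z. ?P z (\<Union>\<U>)} = (\<Union>U\<in>\<U>. {z. ?P z U})" for \<U> by auto
  ultimately have "istopology (\<lambda>U. U \<subseteq> orbits (SL2R\<lparr>carrier := G\<rparr>) upper_half_plane mobius \<and>
                   open {z. ?P z U})"
    unfolding istopology_def by (auto intro!: open_Int open_UN)
  then show ?thesis
    unfolding quotient_surface_def by (simp add: topology_inverse')
qed

lemma quotient_map_quotient_surface: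
  "quotient_map (top_of_set upper_half_plane) (quotient_surface G) (mobius_orbit G)"
proof -
  let ?H = "upper_half_plane" and ?Q = "orbits (SL2R\<lparr>carrier := G\<rparr>) upper_half_plane mobius"
  have o: "open ?H"
    by (simp add: upper_half_plane_def open_halfspace_Im_gt)
  have Q: "?Q = mobius_orbit G ` ?H"
    unfolding orbits_def by blast
  have "{z \<in> ?H. mobius_orbit G z \<in> ?Q} = ?H"
    unfolding Q by blast
  with o have "openin (quotient_surface G) ?Q"
    by (simp only: openin_quotient_surface) simp
  moreover have "U \<subseteq> ?Q" if "openin (quotient_surface G) U" for U
    using that by (simp only: openin_quotient_surface)
  ultimately have top: "topspace (quotient_surface G) = ?Q"
    unfolding topspace_def by blast
  have "openin (top_of_set ?H) {z \<in> ?H. mobius_orbit G z \<in> U} \<longleftrightarrow> openin (quotient_surface G) U"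
    if "U \<subseteq> ?Q" for U
    unfolding openin_quotient_surface openin_open_eq[OF o] using that by blast
  with top Q show ?thesis
    by (simp only: quotient_map_def topspace_euclidean_subtopology) simp
qed

definition cocompact :: "(real^2^2) set \<Rightarrow> bool" where
  "cocompact G \<longleftrightarrow> compact_space (quotient_surface G)"

definition hyperbolic_area :: "complex measure" where
  "hyperbolic_area = density lborel (\<lambda>z. indicator upper_half_plane z * ennreal (1 / (Im z)\<^sup>2))"

definition fundamental_set :: "(real^2^2) set \<Rightarrow> complex set \<Rightarrow> bool" where
  "fundamental_set G F \<longleftrightarrow>
     F \<in> sets borel \<and> F \<subseteq> upper_half_plane \<and>
     (\<forall>z\<in>upper_half_plane. \<exists>!w. w \<in> F \<inter> mobius_orbit G z)"

text \<open>The area of the quotient is the hyperbolic area of a Borel set of orbit representatives.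
  For discrete \<open>G\<close> such sets exist and all of them have the same area.\<close>

definition finite_covolume :: "(real^2^2) set \<Rightarrow> bool" where
  "finite_covolume G \<longleftrightarrow> (\<exists>F. fundamental_set G F \<and> emeasure hyperbolic_area F < \<infinity>)"


section \<open>Random walks and harmonic measure\<close>

text \<open>The boundary circle of the hyperbolic plane is the unit circle, the upper half plane being
  identified with the unit disc by the Cayley transform.\<close>

definition cayley :: "complex \<Rightarrow> complex" where
  "cayley z = (z - \<i>) / (z + \<i>)"

definition borel_circle :: "complex measure" where
  "borel_circle = restrict_space borel (sphere 0 1)"

definition lebesgue_circle :: "complex measure" where
  "lebesgue_circle = distr (restrict_space lborel {0..<2*pi}) borel_circle cis"

text \<open>The space of independent increments: \<open>\<omega> 0, \<omega> 1, \<dots>\<close> are \<open>g\<^sub>1, g\<^sub>2, \<dots>\<close>.\<close>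

definition increment_space :: "(real^2^2) pmf \<Rightarrow> (nat \<Rightarrow> real^2^2) measure" where
  "increment_space \<mu> = (\<Pi>\<^sub>M n\<in>UNIV. measure_pmf \<mu>)"

primrec walk :: "(nat \<Rightarrow> real^2^2) \<Rightarrow> nat \<Rightarrow> real^2^2" where
  "walk \<omega> 0 = mat 1"
| "walk \<omega> (Suc n) = walk \<omega> n ** \<omega> n"

definition walk_tendsto :: "complex \<Rightarrow> (nat \<Rightarrow> real^2^2) \<Rightarrow> complex \<Rightarrow> bool" where
  "walk_tendsto x0 \<omega> \<xi> \<longleftrightarrow> (\<lambda>n. cayley (mobius (walk \<omega> n) x0)) \<longlonglongrightarrow> \<xi>"

definition harmonic_measure :: "(real^2^2) pmf \<Rightarrow> complex \<Rightarrow> complex measure" where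
  "harmonic_measure \<mu> x0 =
     measure_of (sphere 0 1) (sets borel_circle)
       (\<lambda>A. emeasure (increment_space \<mu>)
              {\<omega> \<in> space (increment_space \<mu>). \<exists>\<xi>\<in>A. walk_tendsto x0 \<omega> \<xi>})"

lemma space_borel_circle [simp]: "space borel_circle = sphere 0 1"
  by (simp add: borel_circle_def space_restrict_space)

lemma space_harmonic_measure [simp]: "space (harmonic_measure \<mu> x0) = sphere 0 1"
  using sets.space_closed[of borel_circle]
  by (simp add: harmonic_measure_def space_measure_of_conv)

lemma sets_harmonic_measure [simp]: "sets (harmonic_measure \<mu> x0) = sets borel_circle"
  using sets.space_closed[of borel_circle] sets.sigma_sets_eq[of borel_circle]
  by (simp add: harmonic_measure_def)

lemma measurable_walk: "(\<lambda>\<omega>. walk \<omega> n) \<in> borel_measurable (increment_space \<mu>)"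
proof (induction n)
  case (Suc n)
  have 1: "(\<lambda>\<omega>. \<omega> n) \<in> borel_measurable (increment_space \<mu>)"
    unfolding increment_space_def
    by (rule measurable_compose[OF measurable_component_singleton[of n]]) auto
  have "continuous_on UNIV (\<lambda>(A, B). A ** B :: real^2^2)"
    unfolding matrix_matrix_mult_def by (auto simp: case_prod_unfold intro!: continuous_intros)
  then have "(\<lambda>(A, B). A ** B :: real^2^2) \<in> borel_measurable borel"
    by (rule borel_measurable_continuous_onI)
  then have "(\<lambda>(A, B). A ** B :: real^2^2) \<in> borel_measurable (borel \<Otimes>\<^sub>M borel)"
    by (simp add: borel_prod)
  from measurable_compose[OF measurable_Pair[OF Suc.IH 1] this] show ?case
    by simp
qed simp

lemma emeasure_harmonic_measure:
  assumes "A \<in> sets borel_circle"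
  shows "emeasure (harmonic_measure \<mu> x0) A =
           emeasure (increment_space \<mu>)
             {\<omega> \<in> space (increment_space \<mu>). \<exists>\<xi>\<in>A. walk_tendsto x0 \<omega> \<xi>}"
proof (rule emeasure_measure_of[OF harmonic_measure_def])
  let ?M = "increment_space \<mu>"
  let ?E = "\<lambda>A. {\<omega> \<in> space ?M. \<exists>\<xi>\<in>A. walk_tendsto x0 \<omega> \<xi>}"
  let ?X = "\<lambda>\<omega> n. cayley (mobius (walk \<omega> n) x0)"
  have comp: "(\<lambda>A :: real^2^2. A $ i $ j) \<in> borel_measurable borel" for i j
    by (intro borel_measurable_continuous_onI continuous_intros)
  have [measurable]: "(\<lambda>\<omega>. walk \<omega> n $ i $ j) \<in> borel_measurable ?M" for n i j
    by (rule measurable_compose[OF measurable_walk comp])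
  have X [measurable]: "(\<lambda>\<omega>. ?X \<omega> n) \<in> borel_measurable ?M" for n
    unfolding cayley_def mobius_def by measurable
  have meas: "?E B \<in> sets ?M" if B: "B \<in> sets borel_circle" for B
  proof -
    have B': "B \<in> sets borel"
      using B unfolding borel_circle_def by (subst (asm) sets_restrict_space_iff) auto
    have lim_meas: "(\<lambda>\<omega>. lim (?X \<omega>)) \<in> borel_measurable ?M"
      using X by (rule borel_measurable_lim_metric)
    have "?E B = {\<omega> \<in> space ?M. Cauchy (?X \<omega>) \<and> lim (?X \<omega>) \<in> B}"
      unfolding walk_tendsto_def Cauchy_convergent_iff
      by (auto simp: convergent_LIMSEQ_iff limI intro: convergentI)
    also have "\<dots> \<in> sets ?M"
    proof (rule sets.sets_Collect_conj)
      show "{\<omega> \<in> space ?M. Cauchy (?X \<omega>)} \<in> sets ?M"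
        using X by (rule sets_Collect_Cauchy)
      have "(\<lambda>\<omega>. lim (?X \<omega>)) -` B \<inter> space ?M \<in> sets ?M"
        using lim_meas B' by (rule measurable_sets)
      then show "{\<omega> \<in> space ?M. lim (?X \<omega>) \<in> B} \<in> sets ?M"
        by (simp add: vimage_def Int_def conj_commute)
    qed
    finally show ?thesis .
  qed
  show "countably_additive (sets (harmonic_measure \<mu> x0)) (\<lambda>A. emeasure ?M (?E A))"
  proof (rule countably_additiveI)
    fix B :: "nat \<Rightarrow> complex set"
    assume B: "range B \<subseteq> sets (harmonic_measure \<mu> x0)" "disjoint_family B"
    have "disjoint_family (\<lambda>i. ?E (B i))"
      using B(2) LIMSEQ_unique unfolding disjoint_family_on_def walk_tendsto_def by blast
    moreover have "range (\<lambda>i. ?E (B i)) \<subseteq> sets ?M"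
      using B(1) meas by auto
    ultimately have "(\<Sum>i. emeasure ?M (?E (B i))) = emeasure ?M (\<Union>i. ?E (B i))"
      by (rule suminf_emeasure[rotated])
    also have "(\<Union>i. ?E (B i)) = ?E (\<Union>i. B i)"
      by auto
    finally show "(\<Sum>i. emeasure ?M (?E (B i))) = emeasure ?M (?E (\<Union>i. B i))" .
  qed
  show "positive (sets (harmonic_measure \<mu> x0)) (\<lambda>A. emeasure ?M (?E A))"
    by (simp add: positive_def)
  show "A \<in> sets (harmonic_measure \<mu> x0)"
    using assms by simp
  show "sets borel_circle \<subseteq> Pow (sphere 0 1)"
    using sets.space_closed[of borel_circle] by simp
qed

definition mutually_singular :: "'a measure \<Rightarrow> 'a measure \<Rightarrow> bool" where
  "mutually_singular M N \<longleftrightarrow>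
     (\<exists>A \<in> sets M \<inter> sets N. emeasure M (space M - A) = 0 \<and> emeasure N A = 0)"

end

theory Submission imports Defs begin

text \<open>The lattice contains a parabolic element, normalised to \<open>z \<mapsto> z + 1\<close>. By a Khinchin type argument
  Lebesgue almost every real \<open>x\<close> lies deep in infinitely many cusps: for every \<open>N\<close> there is a lattice
  element with lower row \<open>(c, d)\<close>, \<open>c \<ge> N\<close>, such that \<open>M = 1 / \<bar>c (c x + d)\<bar>\<close> is at least \<open>N ln c\<close>;
  a geodesic ray ending at \<open>x\<close> crosses about \<open>M\<close> unit translates inside the horoball at \<open>- d / c\<close>.

  On the other hand non-amenability makes the return probabilities of the random walk decay
  exponentially, so that the matrix norms of \<open>w\<^sub>n\<close> grow exponentially, while the first moment
  makes the word length of \<open>w\<^sub>n\<close> at most linear in \<open>n\<close> and the increments subexponential. If the walk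
  converges to \<open>x\<close>, it does so exponentially fast, so at some time of order \<open>ln c + ln M\<close> it has crossed
  the \<open>M\<close> translates; as crossing them costs a word length proportional to \<open>M \<ge> N ln c\<close>, this
  contradicts the linear bound once \<open>N\<close> is large. Hence the limit points of the walk avoid a set of full measure.\<close>

section \<open>Two by two matrices and Moebius maps\<close>

lemma mat2_eq_iff:
  "A = (B :: real^2^2) \<longleftrightarrow> A$1$1 = B$1$1 \<and> A$1$2 = B$1$2 \<and> A$2$1 = B$2$1 \<and> A$2$2 = B$2$2"
  by (auto simp: vec_eq_iff forall_2)

lemma mat2_mult [simp]:
  "((A :: real^2^2) ** B)$i$j = A$i$1 * B$1$j + A$i$2 * B$2$j"
  by (simp add: matrix_matrix_mult_def sum_2)

lemma mat2_one [simp]: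
  "(mat 1 :: real^2^2)$1$1 = 1" "(mat 1 :: real^2^2)$1$2 = 0"
  "(mat 1 :: real^2^2)$2$1 = 0" "(mat 1 :: real^2^2)$2$2 = 1"
  by (auto simp: mat_def)

definition M2 :: "real \<Rightarrow> real \<Rightarrow> real \<Rightarrow> real \<Rightarrow> real^2^2" where
  "M2 a b c d = vector [vector [a, b], vector [c, d]]"

lemma M2_nth [simp]:
  "M2 a b c d $1$1 = a" "M2 a b c d $1$2 = b" "M2 a b c d $2$1 = c" "M2 a b c d $2$2 = d"
  by (simp_all add: M2_def)

lemma det_M2 [simp]: "det (M2 a b c d) = a * d - b * c"
  by (simp add: det_2)

definition adj2 :: "real^2^2 \<Rightarrow> real^2^2" where
  "adj2 A = M2 (A$2$2) (- A$1$2) (- A$2$1) (A$1$1)"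

lemma adj2_nth [simp]:
  "adj2 A $1$1 = A$2$2" "adj2 A $1$2 = - A$1$2" "adj2 A $2$1 = - A$2$1" "adj2 A $2$2 = A$1$1"
  by (simp_all add: adj2_def)

lemma det_adj2 [simp]: "det (adj2 A) = det A"
  by (simp add: det_2)

lemma adj2_adj2 [simp]: "adj2 (adj2 A) = A"
  by (simp add: mat2_eq_iff)

lemma adj2_mult: "adj2 (A ** B) = adj2 B ** adj2 A"
  by (simp add: mat2_eq_iff)

lemma adj2_inverse:
  assumes "det A = 1"
  shows "A ** adj2 A = mat 1" "adj2 A ** A = mat 1"
  using assms by (auto simp: mat2_eq_iff det_2 algebra_simps)

lemma adj2_cancel:
  assumes "det A = 1"
  shows "A ** (adj2 A ** B) = B" "adj2 A ** (A ** B) = B" "(B ** A) ** adj2 A = B" "(B ** adj2 A) ** A = B"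
  using adj2_inverse[OF assms] by (simp_all add: matrix_mul_assoc) (simp_all flip: matrix_mul_assoc)

lemma m_inv_SL2R: "det A = 1 \<Longrightarrow> m_inv SL2R A = adj2 A"
  using group.inv_equality[OF group_SL2R, of "adj2 A" A] by (simp add: adj2_inverse)

lemma subgroup_SL2R_D:
  assumes "subgroup G SL2R"
  shows "A \<in> G \<Longrightarrow> det A = 1" "A \<in> G \<Longrightarrow> adj2 A \<in> G" "mat 1 \<in> G"
    "A \<in> G \<Longrightarrow> B \<in> G \<Longrightarrow> A ** B \<in> G"
proof -
  show det: "A \<in> G \<Longrightarrow> det A = 1" for A
    using subgroup.subset[OF assms] by auto
  show "A \<in> G \<Longrightarrow> adj2 A \<in> G"
    using subgroup.m_inv_closed[OF assms, of A] det m_inv_SL2R by simp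
  show "mat 1 \<in> G" using subgroup.one_closed[OF assms] by simp
  show "A \<in> G \<Longrightarrow> B \<in> G \<Longrightarrow> A ** B \<in> G"
    using subgroup.m_closed[OF assms, of A B] by simp
qed

definition sqn :: "real^2^2 \<Rightarrow> real" where
  "sqn A = (A$1$1)\<^sup>2 + (A$1$2)\<^sup>2 + (A$2$1)\<^sup>2 + (A$2$2)\<^sup>2"

lemma sqn_norm: "sqn A = (norm A)\<^sup>2"
  by (simp add: sqn_def norm_vec_def L2_set_def sum_2)

lemma sqn_nonneg [simp]: "0 \<le> sqn A"
  by (simp add: sqn_def)

lemma sqn_adj2 [simp]: "sqn (adj2 A) = sqn A"
  by (simp add: sqn_def)

lemma cauchy2: "(a * x + b * y)\<^sup>2 \<le> (a\<^sup>2 + b\<^sup>2) * (x\<^sup>2 + (y::real)\<^sup>2)"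
proof -
  have "(a\<^sup>2 + b\<^sup>2) * (x\<^sup>2 + y\<^sup>2) - (a * x + b * y)\<^sup>2 = (a * y - b * x)\<^sup>2"
    by (simp add: power2_eq_square algebra_simps)
  then show ?thesis by (smt (verit) zero_le_power2)
qed

lemma sqn_mult: "sqn (A ** B) \<le> sqn A * sqn B"
proof -
  have "sqn (A ** B) \<le>
    ((A$1$1)\<^sup>2 + (A$1$2)\<^sup>2) * ((B$1$1)\<^sup>2 + (B$2$1)\<^sup>2) + ((A$1$1)\<^sup>2 + (A$1$2)\<^sup>2) * ((B$1$2)\<^sup>2 + (B$2$2)\<^sup>2)
    + ((A$2$1)\<^sup>2 + (A$2$2)\<^sup>2) * ((B$1$1)\<^sup>2 + (B$2$1)\<^sup>2) + ((A$2$1)\<^sup>2 + (A$2$2)\<^sup>2) * ((B$1$2)\<^sup>2 + (B$2$2)\<^sup>2)"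
    unfolding sqn_def mat2_mult by (intro add_mono cauchy2)
  also have "\<dots> = sqn A * sqn B"
    unfolding sqn_def by (simp add: algebra_simps)
  finally show ?thesis .
qed

lemma norm_mat2_mult: "norm ((A :: real^2^2) ** B) \<le> norm A * norm (B :: real^2^2)"
  using sqn_mult[of A B] by (simp add: sqn_norm flip: power_mult_distrib)

lemma norm_adj2 [simp]: "norm (adj2 A) = norm A"
  using sqn_adj2[of A] by (simp add: sqn_norm)

lemma norm_mat2_nth: "\<bar>A$i$j\<bar> \<le> norm (A :: real^2^2)"
  using component_le_norm_cart[of "A$i" j] Finite_Cartesian_Product.norm_nth_le[of A i] by linarith

abbreviation autf :: "real^2^2 \<Rightarrow> complex \<Rightarrow> complex" where
  "autf A z \<equiv> of_real (A$2$1) * z + of_real (A$2$2)"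

lemma det_row2: assumes "det (A::real^2^2) = 1" shows "A$2$1 \<noteq> 0 \<or> A$2$2 \<noteq> 0"
  using assms by (auto simp: det_2)

lemma autf_nz: assumes "det A = 1" "Im z > 0" shows "autf A z \<noteq> 0"
proof
  assume "autf A z = 0"
  then have "Im (autf A z) = 0" "Re (autf A z) = 0" by simp_all
  with assms(2) have "A$2$1 = 0" "A$2$2 = 0" by auto
  with det_row2[OF assms(1)] show False by auto
qed

lemma cmod_autf: "(cmod (autf A z))\<^sup>2 = (A$2$1 * Re z + A$2$2)\<^sup>2 + (A$2$1 * Im z)\<^sup>2"
  by (simp add: cmod_power2)

lemma mobius_Im: assumes "det A = 1" "Im z > 0"
  shows "Im (mobius A z) = Im z / (cmod (autf A z))\<^sup>2"
proof -
  have "Im (mobius A z) = (A$1$1 * A$2$2 - A$1$2 * A$2$1) * Im z / (cmod (autf A z))\<^sup>2"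
    unfolding mobius_def by (simp add: Im_divide cmod_power2 algebra_simps)
  then show ?thesis using assms(1) by (simp add: det_2)
qed

lemma mobius_Im_pos: "det A = 1 \<Longrightarrow> Im z > 0 \<Longrightarrow> Im (mobius A z) > 0"
  by (simp add: mobius_Im autf_nz)

lemma mobius_one [simp]: "mobius (mat 1) z = z"
  by (simp add: mobius_def)

lemma autf_mult: assumes "det B = 1" "Im z > 0"
  shows "autf (A ** B) z = autf A (mobius B z) * autf B z"
  using autf_nz[OF assms] by (simp add: mobius_def field_simps)

lemma mobius_mult: assumes "det A = 1" "det B = 1" "Im z > 0"
  shows "mobius (A ** B) z = mobius A (mobius B z)"
proof -
  have 1: "of_real ((A**B)$1$1) * z + of_real ((A**B)$1$2)
      = (of_real (A$1$1) * mobius B z + of_real (A$1$2)) * autf B z"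
    using autf_nz[OF assms(2,3)] by (simp add: mobius_def field_simps)
  show ?thesis
    unfolding mobius_def[of "A**B"] 1 autf_mult[OF assms(2,3)] mobius_def[of A]
    using autf_nz[OF assms(2,3)] by simp
qed

lemma mobius_adj2: assumes "det A = 1" "Im z > 0"
  shows "mobius (adj2 A) (mobius A z) = z" "mobius A (mobius (adj2 A) z) = z"
  using mobius_mult[of "adj2 A" A z] mobius_mult[of A "adj2 A" z] assms
  by (simp_all add: adj2_inverse)

lemma mobius_diff: assumes "det A = 1" "autf A z \<noteq> 0" "autf A w \<noteq> 0"
  shows "mobius A z - mobius A w = (z - w) / (autf A z * autf A w)"
proof -
  have "mobius A z - mobius A w =
     of_real (A$1$1 * A$2$2 - A$1$2 * A$2$1) * (z - w) / (autf A z * autf A w)"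
    using assms(2,3) unfolding mobius_def by (simp add: divide_simps) (simp add: algebra_simps)
  also have "A$1$1 * A$2$2 - A$1$2 * A$2$1 = 1" using assms(1) by (simp add: det_2)
  finally show ?thesis by simp
qed

section \<open>Hyperbolic area\<close>

definition cplx :: "real^2 \<Rightarrow> complex" where "cplx v = Complex (v$1) (v$2)"
definition vec2 :: "complex \<Rightarrow> real^2" where "vec2 z = vector [Re z, Im z]"

lemma vec2_cplx [simp]: "vec2 (cplx v) = v" "cplx (vec2 z) = z"
  by (simp_all add: vec2_def cplx_def vec_eq_iff forall_2)

lemma vec2_nth [simp]: "vec2 z $ 1 = Re z" "vec2 z $ 2 = Im z"
  by (simp_all add: vec2_def)

lemma Re_Im_cplx [simp]: "Re (cplx v) = v$1" "Im (cplx v) = v$2"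
  by (simp_all add: cplx_def)

lemma bounded_linear_cplx: "bounded_linear cplx"
  by (rule linear_conv_bounded_linear[THEN iffD1], rule linearI) (simp_all add: complex_eq_iff)

lemma bounded_linear_vec2: "bounded_linear vec2"
  by (rule linear_conv_bounded_linear[THEN iffD1], rule linearI) (simp_all add: vec_eq_iff forall_2)

lemma borel_cplx [measurable]: "cplx \<in> borel_measurable borel" "vec2 \<in> borel_measurable borel"
  using bounded_linear_cplx bounded_linear_vec2
  by (auto intro!: borel_measurable_continuous_onI linear_continuous_on)

lemma lborel_complex_vec: "distr lborel borel cplx = lborel"
proof (rule lborel_eqI[symmetric])
  fix l u :: complex assume le: "\<And>b. b \<in> Basis \<Longrightarrow> l \<bullet> b \<le> u \<bullet> b"
  have "cplx -` box l u = box (vec2 l) (vec2 u)"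
    by (auto simp: mem_box Basis_complex_def inner_complex_def Basis_vec_def inner_axis forall_2)
  then have "emeasure (distr lborel borel cplx) (box l u) = emeasure lborel (box (vec2 l) (vec2 u))"
    by (subst emeasure_distr) auto
  also have "\<dots> = ennreal (\<Prod>b\<in>Basis. (vec2 u - vec2 l) \<bullet> b)"
    using le[of 1] le[of \<i>]
    by (intro emeasure_lborel_box) (auto simp: Basis_complex_def inner_complex_def Basis_vec_def inner_axis UNIV_2)
  also have "(\<Prod>b\<in>Basis. (vec2 u - vec2 l) \<bullet> b) = (\<Prod>b\<in>Basis. (u - l) \<bullet> b)"
  proof -
    have B: "(Basis :: (real^2) set) = {axis 1 1, axis 2 1}"
      by (auto simp: Basis_vec_def UNIV_2)
    have "axis 1 1 \<noteq> (axis 2 1 :: real^2)" by (simp add: axis_eq_axis)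
    then show ?thesis
      unfolding B by (simp add: Basis_complex_def inner_axis inner_complex_def)
  qed
  finally show "emeasure (distr lborel borel cplx) (box l u) = ennreal (\<Prod>b\<in>Basis. (u - l) \<bullet> b)" .
qed simp

lemma lborel_complex_pair: "distr (lborel \<Otimes>\<^sub>M lborel) borel (\<lambda>(x, y). Complex x y) = lborel"
proof (rule lborel_eqI[symmetric])
  have m: "(\<lambda>(x, y). Complex x y) \<in> borel_measurable borel"
    by (intro borel_measurable_continuous_onI) (auto simp: case_prod_unfold intro!: continuous_intros)
  then have m': "(\<lambda>(x, y). Complex x y) \<in> borel_measurable (lborel \<Otimes>\<^sub>M lborel)"
    by (simp add: lborel_prod)
  fix l u :: complex assume le: "\<And>b. b \<in> Basis \<Longrightarrow> l \<bullet> b \<le> u \<bullet> b"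
  have "(\<lambda>(x, y). Complex x y) -` box l u = {Re l<..<Re u} \<times> {Im l<..<Im u}"
    by (auto simp: mem_box Basis_complex_def inner_complex_def)
  then have "emeasure (distr (lborel \<Otimes>\<^sub>M lborel) borel (\<lambda>(x, y). Complex x y)) (box l u)
     = emeasure (lborel \<Otimes>\<^sub>M lborel) ({Re l<..<Re u} \<times> {Im l<..<Im u})"
    using m' by (subst emeasure_distr) (auto simp: space_pair_measure)
  also have "\<dots> = ennreal ((Re u - Re l) * (Im u - Im l))"
    using le[of 1] le[of \<i>]
    by (subst lborel.emeasure_pair_measure_Times)
       (auto simp: Basis_complex_def inner_complex_def ennreal_mult)
  finally show "emeasure (distr (lborel \<Otimes>\<^sub>M lborel) borel (\<lambda>(x, y). Complex x y)) (box l u)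
     = ennreal (\<Prod>b\<in>Basis. (u - l) \<bullet> b)"
    by (simp add: Basis_complex_def inner_complex_def)
qed simp

lemma emeasure_lborel_complex_Times:
  assumes "X \<in> sets borel" "Y \<in> sets borel"
  shows "emeasure lborel {z. Re z \<in> X \<and> Im z \<in> Y} = emeasure lborel X * emeasure lborel Y"
proof -
  have m: "(\<lambda>(x, y). Complex x y) \<in> borel_measurable (lborel \<Otimes>\<^sub>M lborel)"
    unfolding lborel_prod
    by (simp, intro borel_measurable_continuous_onI) (auto simp: case_prod_unfold intro!: continuous_intros)
  have s: "{z. Re z \<in> X \<and> Im z \<in> Y} \<in> sets borel"
  proof -
    have "{z. Re z \<in> X \<and> Im z \<in> Y} = Re -` X \<inter> Im -` Y" by auto
    then show ?thesis using assms by (auto intro!: measurable_sets_borel[OF _ assms(1)] measurable_sets_borel[OF _ assms(2)] sets.Int)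
  qed
  have "emeasure lborel {z. Re z \<in> X \<and> Im z \<in> Y} =
    emeasure (distr (lborel \<Otimes>\<^sub>M lborel) borel (\<lambda>(x, y). Complex x y)) {z. Re z \<in> X \<and> Im z \<in> Y}"
    by (simp add: lborel_complex_pair)
  also have "\<dots> = emeasure (lborel \<Otimes>\<^sub>M lborel) (X \<times> Y)"
    using m s by (subst emeasure_distr) (auto simp: space_pair_measure intro!: arg_cong[where f="emeasure _"])
  also have "\<dots> = emeasure lborel X * emeasure lborel Y"
    using assms by (intro lborel.emeasure_pair_measure_Times) auto
  finally show ?thesis .
qed

lemma measurable_mobius [measurable]: "mobius A \<in> borel_measurable borel"
  unfolding mobius_def by measurable

lemma borel_upper_half_plane [measurable, simp]: "upper_half_plane \<in> sets borel"
  unfolding upper_half_plane_def by measurable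

lemma sets_hyperbolic_area [simp, measurable_cong]: "sets hyperbolic_area = sets borel"
  by (simp add: hyperbolic_area_def)

lemma emeasure_hyperbolic_area:
  assumes "B \<in> sets borel" "B \<subseteq> upper_half_plane"
  shows "emeasure hyperbolic_area B = (\<integral>\<^sup>+z. ennreal (1 / (Im z)\<^sup>2) * indicator B z \<partial>lborel)"
  unfolding hyperbolic_area_def using assms
  by (subst emeasure_density) (auto intro!: nn_integral_cong split: split_indicator)

lemma mobius_has_derivative:
  assumes "det A = 1" "autf A z \<noteq> 0"
  shows "(mobius A has_field_derivative 1 / (autf A z)\<^sup>2) (at z)"
proof -
  have "of_real (A$1$1 * A$2$2 - A$1$2 * A$2$1) = (1 :: complex)" using assms(1) by (simp add: det_2)
  then have 1: "of_real (A$1$1) * of_real (A$2$2) = 1 + (of_real (A$1$2) * of_real (A$2$1) :: complex)"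
    by (simp add: algebra_simps)
  show ?thesis
    unfolding mobius_def[abs_def] using assms(2)
    apply (auto intro!: derivative_eq_intros)
    apply (simp add: field_simps power2_eq_square)
    using 1 by (simp add: algebra_simps)
qed

text \<open>The Jacobian of a Moebius map at \<open>z\<close> is \<open>1 / \<bar>c z + d\<bar>\<^sup>4\<close>, which cancels against the
  density \<open>1 / y\<^sup>2\<close>.\<close>

lemma hyperbolic_area_image:
  assumes A: "det A = 1" and B: "B \<in> sets borel" "B \<subseteq> upper_half_plane"
    and B': "mobius A ` B \<in> sets borel"
  shows "emeasure hyperbolic_area (mobius A ` B) = emeasure hyperbolic_area B"
proof -
  define f :: "real^2 \<Rightarrow> real^1" where "f v = vec (1 / (v$2)\<^sup>2)" for v
  define g where "g v = vec2 (mobius A (cplx v))" for v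
  define S where "S = vec2 ` B"
  define g' where "g' v = (\<lambda>h. vec2 (1 / (autf A (cplx v))\<^sup>2 * cplx h))" for v
  have Sv: "vec2 ` D = cplx -` D" for D by (auto simp: image_iff) (metis vec2_cplx(1))
  have S: "S \<in> sets borel" and gS: "g ` S = cplx -` (mobius A ` B)" and gS': "g ` S \<in> sets borel"
  proof -
    show "S \<in> sets borel" unfolding S_def Sv using B(1) by (rule measurable_sets_borel[OF borel_cplx(1)])
    show gS: "g ` S = cplx -` (mobius A ` B)"
      unfolding S_def g_def image_image using Sv[of "mobius A ` B"] by (simp add: image_image)
    show "g ` S \<in> sets borel" unfolding gS using B' by (rule measurable_sets_borel[OF borel_cplx(1)])
  qed
  have pos: "v$2 > 0" if "v \<in> S" for v
    using that B(2) by (auto simp: S_def upper_half_plane_def)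
  have posg: "v$2 > 0" if "v \<in> g ` S" for v
    using that mobius_Im_pos[OF A] pos by (auto simp: g_def)
  have nz: "autf A (cplx v) \<noteq> 0" if "v \<in> S" for v
    using autf_nz[OF A, of "cplx v"] pos[OF that] by simp
  have der: "(g has_derivative g' v) (at v within S)" if "v \<in> S" for v
  proof -
    have "(mobius A has_derivative (\<lambda>h. 1 / (autf A (cplx v))\<^sup>2 * h)) (at (cplx v) within UNIV)"
      using mobius_has_derivative[OF A nz[OF that]] by (simp only: has_field_derivative_def)
    then have "((\<lambda>v. mobius A (cplx v)) has_derivative (\<lambda>h. 1 / (autf A (cplx v))\<^sup>2 * cplx h)) (at v within S)"
      using has_derivative_compose[OF bounded_linear.has_derivative[OF bounded_linear_cplx has_derivative_ident]] by simp
    then show ?thesis unfolding g_def g'_def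
      using bounded_linear.has_derivative[OF bounded_linear_vec2] by simp
  qed
  have inj: "inj_on g S"
  proof (rule inj_onI)
    fix v w assume vw: "v \<in> S" "w \<in> S" "g v = g w"
    have "mobius A (cplx v) = mobius A (cplx w)"
      using arg_cong[OF vw(3), of cplx] by (simp add: g_def)
    then have "mobius (adj2 A) (mobius A (cplx v)) = mobius (adj2 A) (mobius A (cplx w))"
      by (rule arg_cong)
    moreover have "Im (cplx v) > 0" "Im (cplx w) > 0" using pos[OF vw(1)] pos[OF vw(2)] by simp_all
    ultimately have "cplx v = cplx w" by (simp only: mobius_adj2(1)[OF A])
    from arg_cong[OF this, of vec2] show "v = w" by simp
  qed
  have jac: "\<bar>det (matrix (g' v))\<bar> = 1 / (cmod (autf A (cplx v)))^4" for v
  proof -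
    define w where "w = 1 / (autf A (cplx v))\<^sup>2"
    have "det (matrix (g' v)) = (Re w)\<^sup>2 + (Im w)\<^sup>2"
      unfolding det_2 matrix_def g'_def w_def[symmetric]
      by (simp add: axis_def power2_eq_square)
    also have "\<dots> = (cmod w)\<^sup>2" by (simp add: cmod_power2)
    also have "\<dots> = 1 / (cmod (autf A (cplx v)))^4"
      unfolding w_def by (simp add: norm_divide norm_power power_divide flip: power_mult)
    finally show ?thesis by simp
  qed
  have eq: "\<bar>det (matrix (g' v))\<bar> *\<^sub>R f (g v) = f v" if "v \<in> S" for v
  proof -
    have "Im (mobius A (cplx v)) = v$2 / (cmod (autf A (cplx v)))\<^sup>2"
      using mobius_Im[OF A, of "cplx v"] pos[OF that] by simp
    then show ?thesis
      unfolding jac f_def g_def using nz[OF that] pos[OF that]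
      by (auto simp: vec_eq_iff power_divide power_mult[symmetric])
  qed
  have iff: "f absolutely_integrable_on S \<and> integral S f = b
     \<longleftrightarrow> f absolutely_integrable_on (g ` S) \<and> integral (g ` S) f = b" for b
  proof -
    have "(\<lambda>v. \<bar>det (matrix (g' v))\<bar> *\<^sub>R f (g v)) absolutely_integrable_on S \<longleftrightarrow> f absolutely_integrable_on S"
      using eq by (intro set_integrable_cong) auto
    moreover have "integral S (\<lambda>v. \<bar>det (matrix (g' v))\<bar> *\<^sub>R f (g v)) = integral S f"
      using eq by (intro integral_cong) auto
    ultimately show ?thesis
      using has_absolute_integral_change_of_variables[OF _ der inj, of f b] S by simp
  qed
  define f1 :: "real^2 \<Rightarrow> real" where "f1 v = 1 / (v$2)\<^sup>2" for v
  have f1f: "f1 = (\<lambda>v. f v $ 1)" by (simp add: f1_def f_def fun_eq_iff)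
  have f1m [measurable]: "f1 \<in> borel_measurable borel"
  proof -
    have "(\<lambda>v. 1 / (Im (cplx v))\<^sup>2) \<in> borel_measurable borel" by measurable
    then show ?thesis by (simp add: f1_def[abs_def])
  qed
  have nn: "(\<integral>\<^sup>+v. ennreal (f1 v) * indicator T v \<partial>lborel) =
      (if f absolutely_integrable_on T then ennreal (integral T f $ 1) else \<infinity>)" if T: "T \<in> sets borel" for T
  proof -
    have int1: "f absolutely_integrable_on T \<longleftrightarrow> f1 absolutely_integrable_on T"
      unfolding f1f by (simp add: absolutely_integrable_on_1_iff)
    have meas: "(\<lambda>v. indicator T v *\<^sub>R f1 v) \<in> borel_measurable lborel"
      using T by measurable
    have int2: "f1 absolutely_integrable_on T \<longleftrightarrow> set_integrable lborel T f1"
      unfolding set_integrable_def using meas by (rule integrable_completion)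
    have nneq: "(\<integral>\<^sup>+v. ennreal (f1 v) * indicator T v \<partial>lborel) = (\<integral>\<^sup>+v. ennreal (norm (indicator T v *\<^sub>R f1 v)) \<partial>lborel)"
      by (intro nn_integral_cong) (auto simp: f1_def split: split_indicator)
    show ?thesis
    proof (cases "f absolutely_integrable_on T")
      case True
      then have i: "set_integrable lborel T f1" using int1 int2 by simp
      then have "(\<integral>\<^sup>+v. ennreal (indicator T v *\<^sub>R f1 v) \<partial>lborel) = ennreal (LINT v:T|lborel. f1 v)"
        unfolding set_integrable_def set_lebesgue_integral_def
        by (intro nn_integral_eq_integral) (auto simp: f1_def split: split_indicator)
      also have "(LINT v:T|lborel. f1 v) = integral T f1"
        using set_borel_integral_eq_integral(2)[OF i] .
      also have "integral T f1 = integral T f $ 1"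
        unfolding f1f using True absolutely_integrable_on_def[of T f]
        by (simp add: integral_component_eq_cart)
      finally have "(\<integral>\<^sup>+v. ennreal (indicator T v *\<^sub>R f1 v) \<partial>lborel) = ennreal (integral T f $ 1)" .
      moreover have "(\<integral>\<^sup>+v. ennreal (f1 v) * indicator T v \<partial>lborel) = (\<integral>\<^sup>+v. ennreal (indicator T v *\<^sub>R f1 v) \<partial>lborel)"
        by (intro nn_integral_cong) (auto split: split_indicator)
      ultimately show ?thesis using True by simp
    next
      case False
      then have "\<not> integrable lborel (\<lambda>v. indicator T v *\<^sub>R f1 v)"
        using int1 int2 by (simp add: set_integrable_def)
      then have "\<not> (\<integral>\<^sup>+v. ennreal (norm (indicator T v *\<^sub>R f1 v)) \<partial>lborel) < \<infinity>"
        using meas integrable_iff_bounded by blast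
      then show ?thesis unfolding nneq using False by (simp add: less_top[symmetric])
    qed
  qed
  have area: "emeasure hyperbolic_area D = (\<integral>\<^sup>+v. ennreal (f1 v) * indicator (cplx -` D) v \<partial>lborel)"
    if D: "D \<in> sets borel" "D \<subseteq> upper_half_plane" for D
  proof -
    have "emeasure hyperbolic_area D = (\<integral>\<^sup>+z. ennreal (1 / (Im z)\<^sup>2) * indicator D z \<partial>distr lborel borel cplx)"
      unfolding lborel_complex_vec by (rule emeasure_hyperbolic_area[OF D])
    also have "\<dots> = (\<integral>\<^sup>+v. ennreal (1 / (Im (cplx v))\<^sup>2) * indicator D (cplx v) \<partial>lborel)"
      using D by (intro nn_integral_distr) auto
    finally show ?thesis by (simp add: f1_def indicator_def)
  qed
  have im: "mobius A ` B \<subseteq> upper_half_plane"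
    using mobius_Im_pos[OF A] B(2) by (auto simp: upper_half_plane_def)
  have SB: "S = cplx -` B" unfolding S_def by (rule Sv)
  show ?thesis
    unfolding area[OF B] area[OF B' im] gS[symmetric] SB[symmetric] nn[OF S] nn[OF gS']
    using iff[of "integral S f"] iff[of "integral (g ` S) f"] by auto
qed

lemma hyperbolic_area_translate:
  assumes A: "det A = 1" and B: "B \<in> sets borel" and F: "F \<in> sets borel"
    "B \<subseteq> upper_half_plane" "F \<subseteq> upper_half_plane"
  shows "emeasure hyperbolic_area {z\<in>B. mobius A z \<in> F} = emeasure hyperbolic_area {w\<in>F. mobius (adj2 A) w \<in> B}"
proof -
  have e: "mobius A ` {z\<in>B. mobius A z \<in> F} = {w\<in>F. mobius (adj2 A) w \<in> B}" (is "mobius A ` ?B = ?F")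
  proof (intro equalityI subsetI)
    fix w assume "w \<in> mobius A ` {z\<in>B. mobius A z \<in> F}"
    then show "w \<in> {w\<in>F. mobius (adj2 A) w \<in> B}"
      using mobius_adj2(1)[OF A] F(2) by (auto simp: upper_half_plane_def subset_eq)
  next
    fix w assume "w \<in> {w\<in>F. mobius (adj2 A) w \<in> B}"
    then show "w \<in> mobius A ` {z\<in>B. mobius A z \<in> F}"
      using mobius_adj2(2)[OF A, of w] F(3) by (intro image_eqI[of _ _ "mobius (adj2 A) w"]) (auto simp: upper_half_plane_def)
  qed
  have sB: "?B \<in> sets borel"
  proof -
    have "?B = B \<inter> mobius A -` F" by auto
    then show ?thesis using B F by (auto intro: measurable_sets_borel[OF measurable_mobius])
  qed
  have sF: "?F \<in> sets borel"
  proof -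
    have "?F = F \<inter> mobius (adj2 A) -` B" by auto
    then show ?thesis using B F by (auto intro: measurable_sets_borel[OF measurable_mobius])
  qed
  have "?B \<subseteq> upper_half_plane" using F(2) by blast
  from hyperbolic_area_image[OF A sB this, unfolded e, OF sF] show ?thesis by (rule sym)
qed

lemma area_le_multiplicity:
  fixes N :: real
  assumes G: "subgroup G SL2R" "countable G" and fund: "fundamental_set G F"
    and B: "B \<in> sets borel" "B \<subseteq> upper_half_plane"
    and F': "F' \<in> sets borel" "\<And>w g. w \<in> F \<Longrightarrow> g \<in> G \<Longrightarrow> mobius g w \<in> B \<Longrightarrow> w \<in> F'"
    and N: "\<And>w. w \<in> upper_half_plane \<Longrightarrow> finite {g\<in>G. mobius g w \<in> B} \<and> real (card {g\<in>G. mobius g w \<in> B}) \<le> N"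
  shows "emeasure hyperbolic_area B \<le> ennreal N * emeasure hyperbolic_area F'"
proof -
  note Gd = subgroup_SL2R_D[OF G(1)]
  have F: "F \<in> sets borel" "F \<subseteq> upper_half_plane" using fund by (auto simp: fundamental_set_def)
  have ex: "\<exists>g\<in>G. mobius g z \<in> F" if z: "z \<in> upper_half_plane" for z
  proof -
    from fund z obtain w where "w \<in> F \<inter> mobius_orbit G z" unfolding fundamental_set_def by metis
    then show ?thesis by (auto simp: orbit_def)
  qed
  let ?M = "hyperbolic_area"
  have adjbij: "card {g\<in>G. mobius (adj2 g) w \<in> B} = card {g\<in>G. mobius g w \<in> B} \<and>
      (finite {g\<in>G. mobius (adj2 g) w \<in> B} = finite {g\<in>G. mobius g w \<in> B})" for w
  proof -
    have "bij_betw adj2 {g\<in>G. mobius (adj2 g) w \<in> B} {g\<in>G. mobius g w \<in> B}"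
      by (rule bij_betw_byWitness[where f'=adj2]) (auto intro: Gd)
    then show ?thesis using bij_betw_same_card bij_betw_finite by blast
  qed
  have sB: "{z\<in>B. mobius g z \<in> F} \<in> sets borel" for g
  proof -
    have "{z\<in>B. mobius g z \<in> F} = B \<inter> mobius g -` F" by auto
    then show ?thesis using B F by (auto intro: measurable_sets_borel[OF measurable_mobius])
  qed
  have sF: "{z\<in>F. mobius (adj2 g) z \<in> B} \<in> sets borel" for g
  proof -
    have "{z\<in>F. mobius (adj2 g) z \<in> B} = F \<inter> mobius (adj2 g) -` B" by auto
    then show ?thesis using B F by (auto intro: measurable_sets_borel[OF measurable_mobius])
  qed
  have "emeasure ?M B = (\<integral>\<^sup>+z. indicator B z \<partial>?M)"
    using B by simp
  also have "\<dots> \<le> (\<integral>\<^sup>+z. \<integral>\<^sup>+g. indicator {z\<in>B. mobius g z \<in> F} z \<partial>count_space G \<partial>?M)"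
  proof (intro nn_integral_mono)
    fix z
    show "(indicator B z :: ennreal) \<le> (\<integral>\<^sup>+g. indicator {z\<in>B. mobius g z \<in> F} z \<partial>count_space G)"
    proof (cases "z \<in> B")
      case True
      then obtain g where g: "g \<in> G" "mobius g z \<in> F" using ex B by blast
      have "(1::ennreal) = (\<integral>\<^sup>+h. indicator {g} h \<partial>count_space G)"
        using g by (simp add: nn_integral_count_space_indicator)
      also have "\<dots> \<le> (\<integral>\<^sup>+g. indicator {z\<in>B. mobius g z \<in> F} z \<partial>count_space G)"
        using g True by (intro nn_integral_mono) (auto split: split_indicator)
      finally show ?thesis using True by simp
    qed simp
  qed
  also have "\<dots> = (\<integral>\<^sup>+g. \<integral>\<^sup>+z. indicator {z\<in>B. mobius g z \<in> F} z \<partial>?M \<partial>count_space G)"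
    using sB by (intro nn_integral_count_space_nn_integral G) simp
  also have "\<dots> = (\<integral>\<^sup>+g. emeasure ?M {z\<in>B. mobius g z \<in> F} \<partial>count_space G)"
    using sB by (intro nn_integral_cong) simp
  also have "\<dots> = (\<integral>\<^sup>+g. emeasure ?M {w\<in>F. mobius (adj2 g) w \<in> B} \<partial>count_space G)"
    using Gd(1) B F by (intro nn_integral_cong hyperbolic_area_translate) auto
  also have "\<dots> = (\<integral>\<^sup>+g. \<integral>\<^sup>+w. indicator {w\<in>F. mobius (adj2 g) w \<in> B} w \<partial>?M \<partial>count_space G)"
    using sF by (intro nn_integral_cong) simp
  also have "\<dots> = (\<integral>\<^sup>+w. \<integral>\<^sup>+g. indicator {w\<in>F. mobius (adj2 g) w \<in> B} w \<partial>count_space G \<partial>?M)"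
    using sF by (intro nn_integral_count_space_nn_integral[symmetric] G) simp
  also have "\<dots> \<le> (\<integral>\<^sup>+w. ennreal N * indicator F' w \<partial>?M)"
  proof (intro nn_integral_mono)
    fix w
    let ?K = "{g\<in>G. mobius (adj2 g) w \<in> B}"
    show "(\<integral>\<^sup>+g. indicator {w\<in>F. mobius (adj2 g) w \<in> B} w \<partial>count_space G) \<le> ennreal N * indicator F' w"
    proof (cases "w \<in> F \<and> w \<in> F'")
      case True
      then have w: "w \<in> upper_half_plane" using F by auto
      have "(\<integral>\<^sup>+g. indicator {w\<in>F. mobius (adj2 g) w \<in> B} w \<partial>count_space G) = (\<integral>\<^sup>+g. indicator ?K g \<partial>count_space G)"
        using True by (intro nn_integral_cong) (auto split: split_indicator)
      also have "\<dots> = emeasure (count_space G) ?K"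
        by (intro nn_integral_indicator) auto
      also have "\<dots> = ennreal (card ?K)"
        using N[OF w] adjbij[of w] by (subst emeasure_count_space_finite) (auto simp: ennreal_of_nat_eq_real_of_nat)
      also have "\<dots> \<le> ennreal N"
        using N[OF w] adjbij[of w] by (intro ennreal_leI) auto
      finally show ?thesis using True by simp
    next
      case False
      then have "(\<integral>\<^sup>+g. indicator {w\<in>F. mobius (adj2 g) w \<in> B} w \<partial>count_space G) = (\<integral>\<^sup>+g. 0 \<partial>count_space G)"
        using F'(2) Gd(2) by (intro nn_integral_cong) (auto split: split_indicator)
      then show ?thesis by simp
    qed
  qed
  also have "\<dots> = ennreal N * emeasure ?M F'"
    using F' by (simp add: nn_integral_cmult_indicator)
  finally show ?thesis .
qed

section \<open>Discrete groups of matrices\<close>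

definition gap :: "(real^2^2) set \<Rightarrow> real \<Rightarrow> bool" where
  "gap G \<delta> \<longleftrightarrow> (\<forall>g\<in>G. g \<noteq> mat 1 \<longrightarrow> norm (g - mat 1) \<ge> \<delta>)"

lemma fuchsian_gap:
  assumes "fuchsian G"
  obtains \<delta> where "\<delta> > 0" "gap G \<delta>"
proof -
  have "mat 1 \<in> G" using assms subgroup_SL2R_D(3) by (auto simp: fuchsian_def)
  then have "mat 1 isolated_in G"
    using assms by (auto simp: fuchsian_def discrete_def)
  then obtain e where "e > 0" "\<forall>y\<in>G. dist (mat 1) y < e \<longrightarrow> y = mat 1"
    using isolated_in_dist_Ex_iff by blast
  then show ?thesis
    by (intro that[of e]) (auto simp: gap_def dist_norm norm_minus_commute not_less)
qed

lemma norm_le_sum4: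
  "norm (A :: real^2^2) \<le> \<bar>A$1$1\<bar> + \<bar>A$1$2\<bar> + \<bar>A$2$1\<bar> + \<bar>A$2$2\<bar>"
proof -
  have "norm A \<le> (\<Sum>i\<in>UNIV. norm (A$i))"
    unfolding norm_vec_def by (rule L2_set_le_sum) simp
  also have "\<dots> \<le> (\<Sum>i\<in>UNIV. \<Sum>j\<in>UNIV. norm (A$i$j))"
    by (intro sum_mono) (subst norm_vec_def, rule L2_set_le_sum, simp)
  finally show ?thesis by (simp add: sum_2)
qed

lemma mat2_diff_distrib:
  "(A :: real^2^2) ** (B - C) = A ** B - A ** C" "((B :: real^2^2) - C) ** A = B ** A - C ** A"
  by (simp_all add: mat2_eq_iff algebra_simps)

lemma floor_box_card:
  fixes r :: real assumes "r \<ge> 0"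
  shows "real (card {\<lfloor>-r\<rfloor>..\<lfloor>r\<rfloor>}) \<le> 2 * r + 2"
proof -
  have "real (card {\<lfloor>-r\<rfloor>..\<lfloor>r\<rfloor>}) = real_of_int (\<lfloor>r\<rfloor> + 1 - \<lfloor>-r\<rfloor>)"
    using assms by simp linarith
  also have "\<dots> \<le> 2 * r + 2" by linarith
  finally show ?thesis .
qed

lemma separated_card:
  fixes T :: "(real^2^2) set"
  assumes R: "\<And>A. A \<in> T \<Longrightarrow> norm A \<le> R" and R0: "R \<ge> 0" and e: "\<eta> > 0"
    and sep: "\<And>A B. A \<in> T \<Longrightarrow> B \<in> T \<Longrightarrow> A \<noteq> B \<Longrightarrow> norm (A - B) \<ge> \<eta>"
  shows "finite T \<and> real (card T) \<le> (8 * R / \<eta> + 2)^4"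
proof -
  define F where "F x = \<lfloor>4 * x / \<eta>\<rfloor>" for x :: real
  define f where "f A = (F (A$1$1), F (A$1$2), F (A$2$1), F (A$2$2))" for A :: "real^2^2"
  let ?I = "{\<lfloor>-(4 * R / \<eta>)\<rfloor>..\<lfloor>4 * R / \<eta>\<rfloor>}"
  let ?P = "?I \<times> ?I \<times> ?I \<times> ?I"
  have close: "\<bar>x - y\<bar> < \<eta> / 4" if "F x = F y" for x y
  proof -
    have "\<bar>4 * x / \<eta> - 4 * y / \<eta>\<bar> < 1" using that unfolding F_def by linarith
    moreover have "4 * x / \<eta> - 4 * y / \<eta> = 4 * (x - y) / \<eta>" by (simp add: diff_divide_distrib right_diff_distrib)
    ultimately have "\<bar>4 * (x - y) / \<eta>\<bar> < 1" by simp
    then have "\<bar>4 * (x - y)\<bar> / \<eta> < 1" using e by (simp only: abs_divide abs_of_pos)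
    then have "\<bar>4 * (x - y)\<bar> < \<eta>" using e by (simp only: pos_divide_less_eq mult_1)
    moreover have "\<bar>4 * (x - y)\<bar> = 4 * \<bar>x - y\<bar>" by (simp only: abs_mult abs_numeral)
    ultimately show ?thesis by simp
  qed
  have inj: "inj_on f T"
  proof (rule inj_onI, rule ccontr)
    fix A B assume AB: "A \<in> T" "B \<in> T" "f A = f B" "A \<noteq> B"
    have "norm (A - B) < \<eta>"
      using norm_le_sum4[of "A - B"] AB(3) close[of "A$1$1" "B$1$1"] close[of "A$1$2" "B$1$2"]
        close[of "A$2$1" "B$2$1"] close[of "A$2$2" "B$2$2"] by (simp add: f_def)
    with sep[OF AB(1,2,4)] show False by simp
  qed
  have FI: "F x \<in> ?I" if "\<bar>x\<bar> \<le> R" for x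
  proof -
    have "- (4 * R / \<eta>) \<le> 4 * x / \<eta>" "4 * x / \<eta> \<le> 4 * R / \<eta>"
      using that e by (auto simp: field_simps)
    then show ?thesis unfolding F_def by (auto intro: floor_mono)
  qed
  have sub: "f ` T \<subseteq> ?P"
  proof
    fix p assume "p \<in> f ` T"
    then obtain A where A: "A \<in> T" "p = f A" by auto
    have "\<bar>A$i$j\<bar> \<le> R" for i j using norm_mat2_nth[of A i j] R[OF A(1)] by linarith
    then show "p \<in> ?P" unfolding A(2) f_def using FI by blast
  qed
  have fin: "finite ?P" by simp
  have "finite T" using inj sub fin finite_subset finite_imageD by metis
  moreover have "real (card T) \<le> (8 * R / \<eta> + 2)^4"
  proof -
    have "card T = card (f ` T)" using inj by (simp add: card_image)
    also have "\<dots> \<le> card ?P" using sub fin by (rule card_mono[rotated])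
    also have "card ?P = (card ?I)^4" by (simp only: card_cartesian_product) (simp add: power4_eq_xxxx)
    finally have "real (card T) \<le> (real (card ?I))^4"
      by (metis of_nat_le_iff of_nat_power)
    also have "\<dots> \<le> (8 * R / \<eta> + 2)^4"
      using floor_box_card[of "4 * R / \<eta>"] R0 e by (intro power_mono) auto
    finally show ?thesis .
  qed
  ultimately show ?thesis ..
qed

lemma gap_card:
  assumes G: "subgroup G SL2R" and gap: "gap G \<delta>" "\<delta> > 0" and R: "R > 0"
  shows "finite {g\<in>G. norm g \<le> R} \<and> real (card {g\<in>G. norm g \<le> R}) \<le> (8 * R\<^sup>2 / \<delta> + 2)^4"
proof -
  note Gd = subgroup_SL2R_D[OF G]
  have "norm (A - B) \<ge> \<delta> / R" if A: "A \<in> G" "norm A \<le> R" and B: "B \<in> G" and ne: "A \<noteq> B" for A B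
  proof -
    have eq: "adj2 A ** B - mat 1 = adj2 A ** (B - A)"
      using adj2_inverse(2)[OF Gd(1)[OF A(1)]] by (simp add: mat2_diff_distrib)
    have "adj2 A ** B \<noteq> mat 1"
      using ne adj2_cancel(1)[OF Gd(1)[OF A(1)], of B] by (metis matrix_mul_rid)
    then have "\<delta> \<le> norm (adj2 A ** (B - A))"
      using gap(1) Gd A B unfolding gap_def eq[symmetric] by blast
    also have "\<dots> \<le> norm (adj2 A) * norm (B - A)" by (rule norm_mat2_mult)
    also have "\<dots> \<le> R * norm (B - A)" using A by (intro mult_right_mono) auto
    finally show ?thesis using R by (simp add: field_simps norm_minus_commute)
  qed
  then have "finite {g\<in>G. norm g \<le> R} \<and> real (card {g\<in>G. norm g \<le> R}) \<le> (8 * R / (\<delta> / R) + 2)^4"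
    using R gap(2) by (intro separated_card) auto
  then show ?thesis by (simp add: power2_eq_square mult.assoc)
qed

lemma gap_countable:
  assumes G: "subgroup G SL2R" and gap: "gap G \<delta>" "\<delta> > 0"
  shows "countable G"
proof -
  have "\<exists>n. norm g \<le> real (Suc n)" for g :: "real^2^2"
    using real_arch_simple[of "norm g"] by (metis le_SucI of_nat_mono order_trans order_refl)
  then have eq: "G = (\<Union>n\<in>UNIV. {g\<in>G. norm g \<le> real (Suc n)})" by blast
  have "countable {g\<in>G. norm g \<le> real (Suc n)}" for n
    using gap_card[OF assms, of "real (Suc n)"] by (simp add: countable_finite)
  then have "countable (\<Union>n\<in>(UNIV::nat set). {g\<in>G. norm g \<le> real (Suc n)})"
    by (intro countable_UN) auto
  then show ?thesis unfolding eq[symmetric] .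
qed

definition conjugate_by :: "real^2^2 \<Rightarrow> (real^2^2) set \<Rightarrow> (real^2^2) set" where
  "conjugate_by P G = (\<lambda>A. adj2 P ** A ** P) ` G"

lemma conjugate_by_mem: "det P = 1 \<Longrightarrow> A \<in> conjugate_by P G \<longleftrightarrow> P ** A ** adj2 P \<in> G"
proof
  assume P: "det P = 1"
  show "A \<in> conjugate_by P G \<Longrightarrow> P ** A ** adj2 P \<in> G"
    using P by (auto simp: conjugate_by_def adj2_cancel matrix_mul_assoc[symmetric] adj2_inverse)
  assume "P ** A ** adj2 P \<in> G"
  then show "A \<in> conjugate_by P G"
    unfolding conjugate_by_def using P
    by (intro image_eqI[of _ _ "P ** A ** adj2 P"]) (auto simp: adj2_cancel matrix_mul_assoc[symmetric] adj2_inverse)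
qed

lemma conjugate_by_subgroup:
  assumes G: "subgroup G SL2R" and P: "det P = 1"
  shows "subgroup (conjugate_by P G) SL2R"
proof -
  note Gd = subgroup_SL2R_D[OF G]
  have det: "det A = 1" if "A \<in> conjugate_by P G" for A
    using that Gd(1) P by (auto simp: conjugate_by_def det_mul)
  have inv: "adj2 A \<in> conjugate_by P G" if "A \<in> conjugate_by P G" for A
    using that Gd(2) P by (auto simp: conjugate_by_def adj2_mult matrix_mul_assoc)
  show ?thesis
  proof (rule group.subgroupI[OF group_SL2R])
    show "conjugate_by P G \<subseteq> carrier SL2R" using det by auto
    show "conjugate_by P G \<noteq> {}" using Gd(3) by (auto simp: conjugate_by_def)
    show "m_inv SL2R A \<in> conjugate_by P G" if "A \<in> conjugate_by P G" for A
      using inv that det m_inv_SL2R by simp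
    show "A \<otimes>\<^bsub>SL2R\<^esub> B \<in> conjugate_by P G" if "A \<in> conjugate_by P G" "B \<in> conjugate_by P G" for A B
    proof -
      from that obtain a b where ab: "a \<in> G" "b \<in> G" "A = adj2 P ** a ** P" "B = adj2 P ** b ** P"
        by (auto simp: conjugate_by_def)
      have "A ** B = adj2 P ** (a ** b) ** P"
        using P by (simp add: ab adj2_cancel matrix_mul_assoc[symmetric])
      then show ?thesis using Gd(4)[OF ab(1,2)] by (auto simp: conjugate_by_def)
    qed
  qed
qed

lemma conjugate_by_gap:
  assumes P: "det P = 1" and gap: "gap G \<delta>" "\<delta> > 0"
  shows "\<exists>\<delta>'>0. gap (conjugate_by P G) \<delta>'"
proof -
  have P0: "norm P > 0" using P by (metis det_0 zero_less_norm_iff zero_neq_one mat_0 )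
  have "norm (A - mat 1) \<ge> \<delta> / (norm P)\<^sup>2" if A: "A \<in> conjugate_by P G" "A \<noteq> mat 1" for A
  proof -
    have ne: "P ** A ** adj2 P \<noteq> mat 1"
    proof
      assume e: "P ** A ** adj2 P = mat 1"
      have "A = adj2 P ** (P ** A ** adj2 P) ** P"
        using P by (simp add: adj2_cancel matrix_mul_assoc[symmetric] adj2_inverse)
      then have "A = mat 1" unfolding e using P by (simp add: adj2_inverse)
      with A show False by simp
    qed
    have "P ** (A - mat 1) ** adj2 P = P ** A ** adj2 P - mat 1"
      using P by (simp add: mat2_diff_distrib adj2_inverse)
    then have "\<delta> \<le> norm (P ** (A - mat 1) ** adj2 P)"
      using ne A(1) gap(1) conjugate_by_mem[OF P] unfolding gap_def by auto
    also have "\<dots> \<le> norm (P ** (A - mat 1)) * norm (adj2 P)" by (rule norm_mat2_mult)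
    also have "\<dots> \<le> norm P * norm (A - mat 1) * norm (adj2 P)"
      by (intro mult_right_mono norm_mat2_mult) auto
    finally show ?thesis using P0 by (simp add: field_simps power2_eq_square)
  qed
  then show ?thesis using gap(2) P0
    by (intro exI[of _ "\<delta> / (norm P)\<^sup>2"]) (auto simp: gap_def)
qed

lemma conjugate_by_finite_covolume:
  assumes G: "subgroup G SL2R" and P: "det P = 1" and fin: "finite_covolume G"
  shows "finite_covolume (conjugate_by P G)"
proof -
  note Gd = subgroup_SL2R_D[OF G]
  from fin obtain F where F: "fundamental_set G F" "emeasure hyperbolic_area F < \<infinity>"
    by (auto simp: finite_covolume_def)
  have Fb: "F \<in> sets borel" "F \<subseteq> upper_half_plane" using F by (auto simp: fundamental_set_def)
  define F' where "F' = {z\<in>upper_half_plane. mobius P z \<in> F}"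
  have F'b: "F' \<in> sets borel"
  proof -
    have "F' = upper_half_plane \<inter> mobius P -` F" by (auto simp: F'_def)
    then show ?thesis using Fb by (auto intro: measurable_sets_borel[OF measurable_mobius])
  qed
  have "emeasure hyperbolic_area F' = emeasure hyperbolic_area {w\<in>F. mobius (adj2 P) w \<in> upper_half_plane}"
    unfolding F'_def using Fb by (intro hyperbolic_area_translate P) auto
  also have "\<dots> \<le> emeasure hyperbolic_area F" using Fb by (intro emeasure_mono) auto
  finally have area: "emeasure hyperbolic_area F' < \<infinity>" using F(2) by (rule le_less_trans)
  have orb: "w \<in> mobius_orbit (conjugate_by P G) z \<longleftrightarrow> mobius P w \<in> mobius_orbit G (mobius P z)"
    if z: "z \<in> upper_half_plane" and w: "w \<in> upper_half_plane" for z w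
  proof -
    have z': "Im z > 0" and w': "Im w > 0" using z w by (auto simp: upper_half_plane_def)
    have eq: "mobius (adj2 P ** g ** P) z = mobius (adj2 P) (mobius g (mobius P z))" if "g \<in> G" for g
      using mobius_mult[of "adj2 P ** g" P z] mobius_mult[of "adj2 P" g "mobius P z"] P z' Gd(1)[OF that]
        mobius_Im_pos[OF P z'] by (simp add: det_mul)
    have "w = mobius (adj2 P ** g ** P) z \<longleftrightarrow> mobius P w = mobius g (mobius P z)" if "g \<in> G" for g
      unfolding eq[OF that]
      using mobius_adj2[OF P] w' mobius_Im_pos[OF Gd(1)[OF that] mobius_Im_pos[OF P z']] by metis
    then show ?thesis by (auto simp: orbit_def conjugate_by_def)
  qed
  have "fundamental_set (conjugate_by P G) F'"
    unfolding fundamental_set_def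
  proof (intro conjI ballI F'b)
    show "F' \<subseteq> upper_half_plane" by (auto simp: F'_def)
    fix z assume z: "z \<in> upper_half_plane"
    then have "mobius P z \<in> upper_half_plane" using mobius_Im_pos[OF P] by (simp add: upper_half_plane_def)
    with F(1) obtain v where v: "v \<in> F \<inter> mobius_orbit G (mobius P z)"
      and uni: "\<And>v'. v' \<in> F \<inter> mobius_orbit G (mobius P z) \<Longrightarrow> v' = v"
      unfolding fundamental_set_def by metis
    have vH: "Im v > 0" using v Fb by (auto simp: upper_half_plane_def)
    show "\<exists>!w. w \<in> F' \<inter> mobius_orbit (conjugate_by P G) z"
    proof (rule ex1I[of _ "mobius (adj2 P) v"])
      have H: "mobius (adj2 P) v \<in> upper_half_plane"
        using mobius_Im_pos[of "adj2 P" v] P vH by (simp add: upper_half_plane_def)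
      show "mobius (adj2 P) v \<in> F' \<inter> mobius_orbit (conjugate_by P G) z"
        using v H orb[OF z H] mobius_adj2(2)[OF P vH] by (auto simp: F'_def)
      fix w assume w: "w \<in> F' \<inter> mobius_orbit (conjugate_by P G) z"
      then have wH: "w \<in> upper_half_plane" by (auto simp: F'_def)
      have "mobius P w = v" using w orb[OF z wH] by (intro uni) (auto simp: F'_def)
      then show "w = mobius (adj2 P) v"
        using mobius_adj2(1)[OF P, of w] wH by (auto simp: upper_half_plane_def)
    qed
  qed
  with area show ?thesis by (auto simp: finite_covolume_def)
qed

section \<open>Small elements commute\<close>

text \<open>Two matrices commute iff the vectors \<open>(b, c, a - d)\<close> are parallel.\<close>

lemma commute_iff:
  "(A :: real^2^2) ** B = B ** A \<longleftrightarrow>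
     A$1$2 * B$2$1 = B$1$2 * A$2$1 \<and> (A$1$1 - A$2$2) * B$1$2 = (B$1$1 - B$2$2) * A$1$2 \<and>
     (A$1$1 - A$2$2) * B$2$1 = (B$1$1 - B$2$2) * A$2$1"
  by (auto simp: mat2_eq_iff algebra_simps)

lemma commute_scale:
  assumes AB: "(A :: real^2^2) ** B = B ** A" and A: "A$1$2 \<noteq> 0 \<or> A$2$1 \<noteq> 0 \<or> A$1$1 \<noteq> A$2$2"
  obtains y where "B$1$2 = y * A$1$2" "B$2$1 = y * A$2$1" "B$1$1 - B$2$2 = y * (A$1$1 - A$2$2)"
proof -
  note c = AB[unfolded commute_iff]
  consider "A$1$2 \<noteq> 0" | "A$2$1 \<noteq> 0" | "A$1$1 - A$2$2 \<noteq> 0" using A by auto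
  then show ?thesis
  proof cases
    case 1 then show ?thesis using c by (intro that[of "B$1$2 / A$1$2"]) (auto simp: field_simps)
  next
    case 2 then show ?thesis using c by (intro that[of "B$2$1 / A$2$1"]) (auto simp: field_simps)
  next
    case 3 then show ?thesis using c
      by (intro that[of "(B$1$1 - B$2$2) / (A$1$1 - A$2$2)"]) (auto simp: field_simps)
  qed
qed

lemma nonscalar:
  assumes "det (A :: real^2^2) = 1" "A \<noteq> mat 1" "A$1$1 + A$2$2 \<noteq> -2"
  shows "A$1$2 \<noteq> 0 \<or> A$2$1 \<noteq> 0 \<or> A$1$1 \<noteq> A$2$2"
proof (rule ccontr)
  assume n: "\<not> ?thesis"
  then have "A$1$1 * A$1$1 = 1" using assms(1) by (auto simp: det_2)
  then have "A$1$1 = 1 \<or> A$1$1 = -1" by (simp add: square_eq_1_iff)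
  with n assms(2,3) show False by (auto simp: mat2_eq_iff)
qed

lemma commute_trans:
  assumes "det A = 1" "A \<noteq> mat 1" "A$1$1 + A$2$2 \<noteq> -2" "A ** B = B ** A" "A ** C = C ** A"
  shows "B ** C = C ** (B :: real^2^2)"
proof -
  note ns = nonscalar[OF assms(1-3)]
  obtain y where y: "B$1$2 = y * A$1$2" "B$2$1 = y * A$2$1" "B$1$1 - B$2$2 = y * (A$1$1 - A$2$2)"
    using commute_scale[OF assms(4) ns] .
  obtain z where z: "C$1$2 = z * A$1$2" "C$2$1 = z * A$2$1" "C$1$1 - C$2$2 = z * (A$1$1 - A$2$2)"
    using commute_scale[OF assms(5) ns] .
  show ?thesis unfolding commute_iff y z by simp
qed

lemma commute_conj:
  assumes A: "det (A :: real^2^2) = 1" "A$1$1 + A$2$2 \<noteq> 2" "A$1$1 + A$2$2 \<noteq> -2"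
    and B: "det B = 1" "B$1$1 + B$2$2 \<noteq> 0"
    and c: "A ** (B ** A ** adj2 B) = (B ** A ** adj2 B) ** A"
  shows "A ** B = B ** A"
proof -
  define C where "C = B ** A ** adj2 B"
  have detC: "det C = 1" using A B by (simp add: C_def det_mul)
  have CB: "C ** B = B ** A" using B by (simp add: C_def adj2_cancel)
  have trC: "C$1$1 + C$2$2 = A$1$1 + A$2$2"
  proof -
    have "C$1$1 + C$2$2 = (A$1$1 + A$2$2) * (B$1$1 * B$2$2 - B$1$2 * B$2$1)"
      by (simp add: C_def algebra_simps)
    then show ?thesis using B by (simp add: det_2)
  qed
  have ne: "A \<noteq> mat 1" using A(2) by auto
  obtain y where y: "C$1$2 = y * A$1$2" "C$2$1 = y * A$2$1" "C$1$1 - C$2$2 = y * (A$1$1 - A$2$2)"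
    using commute_scale[OF c[folded C_def] nonscalar[OF A(1) ne A(3)]] .
  have disc: "(M$1$1 - M$2$2)\<^sup>2 + 4 * M$1$2 * M$2$1 = (M$1$1 + M$2$2)\<^sup>2 - 4" if "det M = 1" for M :: "real^2^2"
    using that by (simp add: det_2 power2_eq_square algebra_simps)
  have "y\<^sup>2 * ((A$1$1 - A$2$2)\<^sup>2 + 4 * A$1$2 * A$2$1) = (C$1$1 - C$2$2)\<^sup>2 + 4 * C$1$2 * C$2$1"
    unfolding y by (simp add: power2_eq_square algebra_simps)
  then have "y\<^sup>2 * ((A$1$1 + A$2$2)\<^sup>2 - 4) = (A$1$1 + A$2$2)\<^sup>2 - 4"
    unfolding disc[OF detC] disc[OF A(1)] trC .
  moreover have "(A$1$1 + A$2$2)\<^sup>2 - 4 \<noteq> 0"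
    using A(2,3) square_eq_iff[of "A$1$1 + A$2$2" 2] by (auto simp: power2_eq_square)
  ultimately have "y = 1 \<or> y = -1" by (simp add: power2_eq_1_iff)
  then show ?thesis
  proof
    assume "y = 1"
    with y trC have "C = A" by (simp add: mat2_eq_iff)
    with CB show ?thesis by simp
  next
    assume "y = -1"
    with y trC have C: "C$1$1 = A$2$2" "C$2$2 = A$1$1" "C$1$2 = - A$1$2" "C$2$1 = - A$2$1" by auto
    let ?t = "B$1$1 + B$2$2"
    have e: "A$2$2 * B$1$1 - A$1$2 * B$2$1 = B$1$1 * A$1$1 + B$1$2 * A$2$1"
      "A$2$2 * B$1$2 - A$1$2 * B$2$2 = B$1$1 * A$1$2 + B$1$2 * A$2$2"
      "A$1$1 * B$2$1 - A$2$1 * B$1$1 = B$2$1 * A$1$1 + B$2$2 * A$2$1"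
      "A$1$1 * B$2$2 - A$2$1 * B$1$2 = B$2$1 * A$1$2 + B$2$2 * A$2$2"
      using CB unfolding mat2_eq_iff by (simp_all add: C algebra_simps)
    have "?t * A$1$2 = 0" "?t * A$2$1 = 0" using e(2,3) by (simp_all add: algebra_simps)
    moreover have "?t * (A$1$1 - A$2$2) = 0" using e(1,4) by (simp add: algebra_simps)
    ultimately have "A$1$2 = 0" "A$2$1 = 0" "A$1$1 = A$2$2" using B(2) by auto
    then show ?thesis using nonscalar[OF A(1) ne A(3)] by auto
  qed
qed

lemma small_trace:
  assumes "norm ((A :: real^2^2) - mat 1) \<le> 1/20" shows "\<bar>A$1$1 + A$2$2 - 2\<bar> \<le> 1/10"
proof -
  have "\<bar>A$1$1 - 1\<bar> \<le> 1/20" "\<bar>A$2$2 - 1\<bar> \<le> 1/20"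
    using norm_mat2_nth[of "A - mat 1" 1 1] norm_mat2_nth[of "A - mat 1" 2 2] assms by simp_all
  then have "\<bar>(A$1$1 - 1) + (A$2$2 - 1)\<bar> \<le> 1/20 + 1/20"
    by (intro order_trans[OF abs_triangle_ineq] add_mono)
  then show ?thesis by simp
qed

lemma small_norm: assumes "norm ((A :: real^2^2) - mat 1) \<le> 1/20" shows "norm A \<le> 3/2"
proof -
  have "(norm (mat 1 :: real^2^2))\<^sup>2 = 2" by (simp add: sqn_norm[symmetric] sqn_def)
  also have "\<dots> \<le> (29/20 :: real)\<^sup>2" by (simp add: power2_eq_square)
  finally have "norm (mat 1 :: real^2^2) \<le> 29/20" by (rule power2_le_imp_le) simp
  then show ?thesis using assms norm_triangle_ineq[of "A - mat 1" "mat 1"] by simp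
qed

lemma small_commute:
  assumes G: "subgroup G SL2R" and gap: "gap G \<delta>" "\<delta> > 0"
    and npar: "\<And>A. A \<in> G \<Longrightarrow> A$1$1 + A$2$2 = 2 \<Longrightarrow> A = mat 1"
    and A: "A \<in> G" "norm (A - mat 1) \<le> 1/20" and B: "B \<in> G" "norm (B - mat 1) \<le> 1/20"
  shows "A ** B = B ** A"
proof (cases "A = mat 1")
  case False
  note Gd = subgroup_SL2R_D[OF G]
  define b where "b = rec_nat B (\<lambda>_ X. A ** (X ** adj2 A ** adj2 X))"
  have b0: "b 0 = B" and bS: "b (Suc k) = A ** (b k ** adj2 A ** adj2 (b k))" for k by (simp_all add: b_def)
  have bG: "b k \<in> G" for k
    by (induction k) (auto simp: b0 bS B A intro!: Gd)
  have small: "norm (b k - mat 1) \<le> (1/20) * (1/4)^k" for k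
  proof (induction k)
    case 0 then show ?case using B by (simp add: b0)
  next
    case (Suc k)
    let ?X = "b k"
    have X: "norm (?X - mat 1) \<le> 1/20"
      using Suc mult_left_mono[OF power_le_one[of "1/4::real" k], of "1/20"] by simp
    have 1: "b (Suc k) - mat 1 = ((A - mat 1) ** (?X - mat 1) - (?X - mat 1) ** (A - mat 1)) ** (adj2 A ** adj2 ?X)"
    proof -
      have "(A - mat 1) ** (?X - mat 1) - (?X - mat 1) ** (A - mat 1) = A ** ?X - ?X ** A"
        by (simp add: mat2_eq_iff algebra_simps)
      moreover have "?X ** A ** (adj2 A ** adj2 ?X) = mat 1"
        using adj2_cancel[OF Gd(1)[OF A(1)]] adj2_inverse[OF Gd(1)[OF bG]]
        by (simp add: matrix_mul_assoc[symmetric])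
      ultimately show ?thesis by (simp add: bS mat2_diff_distrib matrix_mul_assoc)
    qed
    have "norm (b (Suc k) - mat 1) \<le>
       norm ((A - mat 1) ** (?X - mat 1) - (?X - mat 1) ** (A - mat 1)) * norm (adj2 A ** adj2 ?X)"
      unfolding 1 by (rule norm_mat2_mult)
    also have "\<dots> \<le> (2 * (1/20 * norm (?X - mat 1))) * (3/2 * (3/2))"
    proof (intro mult_mono)
      have "norm ((A - mat 1) ** (?X - mat 1)) \<le> 1/20 * norm (?X - mat 1)"
        by (rule order_trans[OF norm_mat2_mult]) (intro mult_right_mono A norm_ge_zero)
      moreover have "norm ((?X - mat 1) ** (A - mat 1)) \<le> 1/20 * norm (?X - mat 1)"
        by (rule order_trans[OF norm_mat2_mult], subst mult.commute) (intro mult_right_mono A norm_ge_zero)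
      ultimately show "norm ((A - mat 1) ** (?X - mat 1) - (?X - mat 1) ** (A - mat 1)) \<le> 2 * (1/20 * norm (?X - mat 1))"
        using norm_triangle_ineq4[of "(A - mat 1) ** (?X - mat 1)" "(?X - mat 1) ** (A - mat 1)"] by linarith
      show "norm (adj2 A ** adj2 ?X) \<le> 3/2 * (3/2)"
        by (rule order_trans[OF norm_mat2_mult]) (intro mult_mono, use small_norm[OF A(2)] small_norm[OF X] in auto)
    qed auto
    also have "\<dots> \<le> 1/4 * norm (?X - mat 1)" by simp
    also have "\<dots> \<le> (1/20) * (1/4)^Suc k" using Suc by simp
    finally show ?case .
  qed
  have small': "norm (b k - mat 1) \<le> 1/20" for k
    using small[of k] mult_left_mono[OF power_le_one[of "1/4::real" k], of "1/20"] by simp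
  obtain K where "(1/4::real)^K < \<delta>" using real_arch_pow_inv[of \<delta> "1/4"] gap(2) by auto
  then have "norm (b K - mat 1) < \<delta>" using small[of K] gap(2) by simp
  then have bK: "b K = mat 1" using gap(1) bG[of K] unfolding gap_def by force
  have trA: "A$1$1 + A$2$2 \<noteq> 2" "A$1$1 + A$2$2 \<noteq> -2"
    using npar[OF A(1)] False small_trace[OF A(2)] by auto
  have down: "A ** b k = b k ** A" if c: "A ** b (Suc k) = b (Suc k) ** A" for k
  proof (rule commute_conj[OF Gd(1)[OF A(1)] trA Gd(1)[OF bG]])
    show "b k $1$1 + b k $2$2 \<noteq> 0" using small_trace[OF small'[of k]] by auto
    define D where "D = b k ** adj2 A ** adj2 (b k)"
    have "A ** (A ** D) = A ** (D ** A)" using c by (simp add: bS D_def matrix_mul_assoc)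
    then have "adj2 A ** (A ** (A ** D)) = adj2 A ** (A ** (D ** A))" by simp
    then have "A ** D = D ** A" by (simp add: adj2_cancel[OF Gd(1)[OF A(1)]])
    moreover have "adj2 D = b k ** A ** adj2 (b k)" by (simp add: D_def adj2_mult matrix_mul_assoc)
    moreover have "A ** adj2 D = adj2 D ** A" if "A ** D = D ** A"
      using that unfolding commute_iff by (auto simp: algebra_simps)
    ultimately show "A ** (b k ** A ** adj2 (b k)) = (b k ** A ** adj2 (b k)) ** A" by simp
  qed
  have "A ** b (K - j) = b (K - j) ** A" if "j \<le> K" for j
    using that
  proof (induction j)
    case 0 then show ?case by (simp add: bK)
  next
    case (Suc j)
    then have "Suc (K - Suc j) = K - j" by simp
    with Suc down[of "K - Suc j"] show ?case by simp
  qed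
  from this[of K] show ?thesis by (simp add: b0)
qed simp

section \<open>A non-uniform lattice contains a parabolic element\<close>

definition two_cosh :: "complex \<Rightarrow> real" where "two_cosh z = ((Re z)\<^sup>2 + (Im z)\<^sup>2 + 1) / Im z"

lemma mobius_i:
  assumes "det A = 1"
  shows "Im (mobius A \<i>) = 1 / ((A$2$1)\<^sup>2 + (A$2$2)\<^sup>2)"
    "Re (mobius A \<i>) = (A$1$1 * A$2$1 + A$1$2 * A$2$2) / ((A$2$1)\<^sup>2 + (A$2$2)\<^sup>2)"
    "(A$2$1)\<^sup>2 + (A$2$2)\<^sup>2 > 0"
proof -
  show "Im (mobius A \<i>) = 1 / ((A$2$1)\<^sup>2 + (A$2$2)\<^sup>2)"
    using mobius_Im[OF assms, of \<i>] by (simp add: cmod_autf add.commute)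
  show "Re (mobius A \<i>) = (A$1$1 * A$2$1 + A$1$2 * A$2$2) / ((A$2$1)\<^sup>2 + (A$2$2)\<^sup>2)"
    unfolding mobius_def by (simp add: Re_divide algebra_simps)
  show "(A$2$1)\<^sup>2 + (A$2$2)\<^sup>2 > 0"
    using det_row2[OF assms] by (simp add: sum_power2_gt_zero_iff)
qed

text \<open>Both sides are \<open>2 cosh d(\<i>, A \<i>)\<close>.\<close>

lemma sqn_eq_two_cosh:
  assumes "det A = 1" shows "sqn A = two_cosh (mobius A \<i>)"
proof -
  define q where "q = (A$2$1)\<^sup>2 + (A$2$2)\<^sup>2"
  define p where "p = (A$1$1)\<^sup>2 + (A$1$2)\<^sup>2"
  define r where "r = A$1$1 * A$2$1 + A$1$2 * A$2$2"
  have q: "q > 0" using mobius_i(3)[OF assms] by (simp add: q_def)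
  have pq: "r\<^sup>2 + 1 = p * q"
  proof -
    have "r\<^sup>2 + (det A)\<^sup>2 = p * q"
      by (simp add: r_def p_def q_def det_2 power2_eq_square algebra_simps)
    then show ?thesis using assms by simp
  qed
  have "two_cosh (mobius A \<i>) = ((r / q)\<^sup>2 + (1 / q)\<^sup>2 + 1) / (1 / q)"
    unfolding two_cosh_def mobius_i(1,2)[OF assms] q_def r_def ..
  also have "\<dots> = (r\<^sup>2 + 1) / q + q" using q by (simp add: field_simps power2_eq_square)
  also have "\<dots> = p + q" unfolding pq using q by simp
  finally show ?thesis by (simp add: sqn_def p_def q_def)
qed

lemma two_cosh_ge: assumes "Im z > 0" shows "two_cosh z \<ge> 2"
proof -
  have "2 * Im z \<le> (Im z)\<^sup>2 + 1" using sum_squares_bound[of "Im z" 1] by simp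
  also have "\<dots> \<le> (Re z)\<^sup>2 + (Im z)\<^sup>2 + 1" by simp
  finally show ?thesis using assms by (simp add: two_cosh_def field_simps)
qed

definition dilation :: "real \<Rightarrow> real^2^2" where "dilation s = M2 (sqrt s) 0 0 (1 / sqrt s)"
definition rotation :: "real \<Rightarrow> real^2^2" where "rotation t = M2 (cos t) (sin t) (- sin t) (cos t)"
definition point_matrix :: "complex \<Rightarrow> real^2^2" where
  "point_matrix z = M2 (sqrt (Im z)) (Re z / sqrt (Im z)) 0 (1 / sqrt (Im z))"

lemma det_dilation [simp]: "s > 0 \<Longrightarrow> det (dilation s) = 1" by (simp add: dilation_def)
lemma det_rotation [simp]: "det (rotation t) = 1"
  using sin_cos_squared_add3[of t] by (simp add: rotation_def add.commute)
lemma det_point_matrix [simp]: "Im z > 0 \<Longrightarrow> det (point_matrix z) = 1" by (simp add: point_matrix_def)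

lemma dilation_mult: "s > 0 \<Longrightarrow> t > 0 \<Longrightarrow> dilation s ** dilation t = dilation (s * t)"
  by (simp add: mat2_eq_iff dilation_def real_sqrt_mult)

lemma rotation_mult: "rotation s ** rotation t = rotation (s + t)"
  by (simp add: mat2_eq_iff rotation_def cos_add sin_add algebra_simps)

lemma mobius_dilation: "s > 0 \<Longrightarrow> mobius (dilation s) z = of_real s * z"
  using real_sqrt_mult_self[of s] unfolding mobius_def dilation_def
  by (simp add: field_simps flip: of_real_mult)

lemma adj2_dilation: "s > 0 \<Longrightarrow> adj2 (dilation s) = dilation (1 / s)"
  by (simp add: mat2_eq_iff dilation_def real_sqrt_divide)

lemma mobius_point_matrix: "Im z > 0 \<Longrightarrow> mobius (point_matrix z) \<i> = z"
  using mobius_i[of "point_matrix z"] by (intro complex_eqI) (auto simp: point_matrix_def power_divide)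

lemma sqn_dilation: "s > 0 \<Longrightarrow> sqn (dilation s) = s + 1 / s"
  by (simp add: sqn_def dilation_def power_divide)

lemma sqn_rotation_left: "sqn (rotation t ** A) = sqn A"
proof -
  have *: "(cos t * x + sin t * y)\<^sup>2 + (- sin t * x + cos t * y)\<^sup>2 = x\<^sup>2 + y\<^sup>2" for x y
  proof -
    have "(c * x + s * y)\<^sup>2 + (- s * x + c * y)\<^sup>2 = (s\<^sup>2 + c\<^sup>2) * (x\<^sup>2 + y\<^sup>2)" for c s :: real
      by (simp add: power2_eq_square algebra_simps)
    from this[of "cos t" "sin t"] show ?thesis by simp
  qed
  show ?thesis
    unfolding sqn_def using *[of "A$1$1" "A$2$1"] *[of "A$1$2" "A$2$2"] by (simp add: rotation_def)
qed

lemma sqn_mult_dilation: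
  assumes "r \<ge> 1" shows "sqn (A ** dilation r) \<le> r * sqn A"
proof -
  have r: "1 / r \<le> r" using assms mult_mono[of 1 r 1 r] by (simp add: field_simps)
  have "sqn (A ** dilation r) = r * ((A$1$1)\<^sup>2 + (A$2$1)\<^sup>2) + (1 / r) * ((A$1$2)\<^sup>2 + (A$2$2)\<^sup>2)"
    using assms by (simp add: sqn_def dilation_def power_mult_distrib power_divide field_simps)
  also have "\<dots> \<le> r * ((A$1$1)\<^sup>2 + (A$2$1)\<^sup>2) + r * ((A$1$2)\<^sup>2 + (A$2$2)\<^sup>2)"
    using r by (intro add_left_mono mult_right_mono) auto
  also have "\<dots> = r * sqn A" by (simp add: sqn_def algebra_simps)
  finally show ?thesis .
qed

lemma polar_decomposition:
  assumes z: "Im z > 0"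
  obtains t s where "t \<in> {-pi/2..pi/2}" "s \<ge> 1" "z = mobius (rotation t ** dilation s) \<i>"
proof -
  define f where "f t = Re (mobius (rotation t) z)" for t
  have cont: "continuous_on {0..pi/2} f"
  proof -
    have nz: "of_real (- sin t) * z + of_real (cos t) \<noteq> 0" for t
      using autf_nz[OF det_rotation z, of t] by (simp add: rotation_def)
    have "f = (\<lambda>t. Re ((of_real (cos t) * z + of_real (sin t)) / (of_real (- sin t) * z + of_real (cos t))))"
      by (simp add: f_def rotation_def mobius_def fun_eq_iff)
    then show ?thesis using nz by (auto intro!: continuous_intros simp del: of_real_minus)
  qed
  moreover have f0: "f 0 = Re z" by (simp add: f_def rotation_def mobius_def)
  moreover have f1: "f (pi/2) = - Re z / ((Re z)\<^sup>2 + (Im z)\<^sup>2)"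
    by (simp add: f_def rotation_def mobius_def Re_divide power2_eq_square)
  moreover have pos: "(Re z)\<^sup>2 + (Im z)\<^sup>2 > 0" using z by (simp add: sum_power2_gt_zero_iff)
  ultimately have "\<exists>t. 0 \<le> t \<and> t \<le> pi/2 \<and> f t = 0"
  proof (cases "Re z \<le> 0")
    case True
    then have "f (pi/2) \<ge> 0" unfolding f1 using pos by (intro divide_nonneg_pos) auto
    then show ?thesis using f0 True cont by (intro IVT') auto
  next
    case False
    then have "f (pi/2) \<le> 0" unfolding f1 using pos by (intro divide_nonpos_pos) auto
    then show ?thesis using f0 False cont by (intro IVT2') auto
  qed
  then obtain t where t: "0 \<le> t" "t \<le> pi/2" "Re (mobius (rotation t) z) = 0" unfolding f_def by auto
  define s where "s = Im (mobius (rotation t) z)"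
  have s: "s > 0" unfolding s_def using z by (simp add: mobius_Im_pos)
  have rz: "mobius (rotation t) z = of_real s * \<i>" using t by (simp add: s_def complex_eq_iff)
  have ad: "adj2 (rotation t) = rotation (-t)" by (simp add: mat2_eq_iff rotation_def)
  have zs: "z = mobius (rotation (-t)) (of_real s * \<i>)"
    using mobius_adj2(1)[OF det_rotation z, of t] unfolding rz ad by simp
  show ?thesis
  proof (cases "s \<ge> 1")
    case True
    then show ?thesis using t zs
      by (intro that[of "-t" s]) (auto simp: mobius_mult mobius_dilation)
  next
    case False
    have "mobius (rotation (pi/2)) (of_real (1/s) * \<i>) = of_real s * \<i>"
      using s by (simp add: rotation_def mobius_def field_simps complex_eq_iff)
    moreover have "mobius (rotation (-t)) (mobius (rotation (pi/2)) (of_real (1/s) * \<i>)) = mobius (rotation (-t) ** rotation (pi/2)) (of_real (1/s) * \<i>)"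
      using s by (intro mobius_mult[symmetric]) auto
    ultimately have "z = mobius (rotation (pi/2 - t)) (of_real (1/s) * \<i>)"
      using zs by (simp add: rotation_mult)
    then show ?thesis using t False s
      by (intro that[of "pi/2 - t" "1/s"]) (auto simp: mobius_mult mobius_dilation)
  qed
qed

lemma not_cocompact_point:
  assumes G: "subgroup G SL2R" and nc: "\<not> cocompact G"
  shows "\<exists>z\<in>upper_half_plane. \<forall>g\<in>G. two_cosh (mobius g z) > R"
proof (rule ccontr)
  assume "\<not> ?thesis"
  then have ex: "\<exists>g\<in>G. two_cosh (mobius g z) \<le> R" if "z \<in> upper_half_plane" for z
    using that by (auto simp: not_less)
  note Gd = subgroup_SL2R_D[OF G]
  define K where "K = {z. (Re z)\<^sup>2 + (Im z)\<^sup>2 + 1 \<le> R * Im z}"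
  have R2: "R \<ge> 2"
  proof -
    obtain g where "g \<in> G" "two_cosh (mobius g \<i>) \<le> R" using ex[of \<i>] by (auto simp: upper_half_plane_def)
    moreover have "two_cosh (mobius g \<i>) \<ge> 2" using \<open>g \<in> G\<close> Gd(1) by (intro two_cosh_ge mobius_Im_pos) auto
    ultimately show ?thesis by simp
  qed
  have KH: "K \<subseteq> upper_half_plane"
  proof
    fix z assume "z \<in> K"
    then have "0 < R * Im z" unfolding K_def
      by (smt (verit) mem_Collect_eq zero_le_power2)
    then show "z \<in> upper_half_plane" using R2 by (simp add: upper_half_plane_def zero_less_mult_iff)
  qed
  have "compact K"
    unfolding compact_eq_bounded_closed
  proof
    show "closed K" unfolding K_def by (intro closed_Collect_le continuous_intros)
    have "cmod z \<le> R" if "z \<in> K" for z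
    proof -
      have "cmod z * cmod z \<le> R * Im z"
        using that cmod_power2[of z] by (simp add: K_def power2_eq_square)
      also have "\<dots> \<le> R * cmod z" using R2 abs_Im_le_cmod[of z] by (intro mult_left_mono) auto
      finally show ?thesis using R2 by (cases "z = 0") (auto simp: mult_le_cancel_right)
    qed
    then show "bounded K" by (auto simp: bounded_iff)
  qed
  then have "compactin (top_of_set upper_half_plane) K"
    using KH by (simp add: compactin_subtopology)
  then have c: "compactin (quotient_surface G) (mobius_orbit G ` K)"
    using quotient_imp_continuous_map[OF quotient_map_quotient_surface] image_compactin by blast
  have "topspace (quotient_surface G) = mobius_orbit G ` upper_half_plane"
    using quotient_imp_surjective_map[OF quotient_map_quotient_surface, of G] by simp
  moreover have "mobius_orbit G ` upper_half_plane \<subseteq> mobius_orbit G ` K"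
  proof
    fix o1 assume "o1 \<in> mobius_orbit G ` upper_half_plane"
    then obtain z where z: "z \<in> upper_half_plane" "o1 = mobius_orbit G z" by auto
    then obtain g where g: "g \<in> G" "two_cosh (mobius g z) \<le> R" using ex by blast
    have zp: "Im z > 0" using z by (simp add: upper_half_plane_def)
    have gz: "Im (mobius g z) > 0" using zp Gd(1)[OF g(1)] by (simp add: mobius_Im_pos)
    have "mobius g z \<in> K" using g(2) gz by (simp add: K_def two_cosh_def field_simps)
    moreover have "mobius_orbit G (mobius g z) = mobius_orbit G z"
    proof (intro equalityI subsetI)
      fix w assume "w \<in> mobius_orbit G (mobius g z)"
      then obtain h where "h \<in> G" "w = mobius h (mobius g z)" by (auto simp: orbit_def)
      then show "w \<in> mobius_orbit G z"
        using mobius_mult[of h g z] Gd(1) Gd(4) g(1) zp by (auto simp: orbit_def intro!: exI[of _ "h ** g"])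
    next
      fix w assume "w \<in> mobius_orbit G z"
      then obtain h where h: "h \<in> G" "w = mobius h z" by (auto simp: orbit_def)
      have "w = mobius (h ** adj2 g) (mobius g z)"
        using mobius_mult[of h "adj2 g" "mobius g z"] h Gd(1) g(1) zp gz by (simp add: mobius_adj2)
      then show "w \<in> mobius_orbit G (mobius g z)"
        using Gd(2,4) g(1) h(1) by (auto simp: orbit_def)
    qed
    ultimately show "o1 \<in> mobius_orbit G ` K" using z by auto
  qed
  ultimately have "mobius_orbit G ` K = topspace (quotient_surface G)"
    using KH by auto
  with c have "cocompact G" by (simp add: cocompact_def compact_space_def)
  with nc show False by simp
qed

text \<open>A geodesic ray from \<open>\<i>\<close> along which the distance to the orbit of \<open>\<i>\<close> grows at full speed.
  Such segments of unbounded length exist because the quotient is not compact.\<close>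

lemma escaping_ray:
  assumes G: "subgroup G SL2R" and nc: "\<not> cocompact G"
  shows "\<exists>\<theta>. \<forall>g\<in>G. \<forall>t\<ge>1. sqn (g ** rotation \<theta> ** dilation t) \<ge> t / 2"
proof -
  note Gd = subgroup_SL2R_D[OF G]
  have "\<exists>\<theta> s. \<theta> \<in> {-pi/2..pi/2} \<and> s \<ge> real n \<and> s \<ge> 1 \<and>
     (\<forall>g\<in>G. \<forall>t. 1 \<le> t \<and> t \<le> s \<longrightarrow> sqn (g ** rotation \<theta> ** dilation t) \<ge> t / 2)" for n
  proof -
    obtain z where z: "Im z > 0" "\<And>g. g \<in> G \<Longrightarrow> two_cosh (mobius g z) > real n + 1"
      using not_cocompact_point[OF G nc, of "real n + 1"] by (auto simp: upper_half_plane_def)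
    define U where "U = (\<lambda>g. two_cosh (mobius g z)) ` G"
    have U2: "x \<ge> 2" if "x \<in> U" for x
      using that Gd(1) z(1) by (auto simp: U_def intro!: two_cosh_ge mobius_Im_pos)
    have Une: "U \<noteq> {}" using Gd(3) by (auto simp: U_def)
    have bdd: "bdd_below U" using U2 by (intro bdd_belowI)
    have "Inf U \<ge> 2" using U2 Une by (intro cInf_greatest)
    then have "Inf U < 2 * Inf U" by simp
    then obtain x where x: "x \<in> U" "x < 2 * Inf U"
      using cInf_less_iff[OF Une bdd] by blast
    then obtain g0 where g0: "g0 \<in> G" "two_cosh (mobius g0 z) < 2 * Inf U" by (auto simp: U_def)
    define w where "w = mobius g0 z"
    have w: "Im w > 0" using g0 Gd(1) z by (simp add: w_def mobius_Im_pos)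
    have wmin: "two_cosh w \<le> 2 * two_cosh (mobius g w)" if g: "g \<in> G" for g
    proof -
      have "mobius g w = mobius (g ** g0) z" using mobius_mult[of g g0 z] Gd(1) g g0 z by (simp add: w_def)
      then have "two_cosh (mobius g w) \<in> U" using Gd(4) g g0 by (auto simp: U_def)
      then have "Inf U \<le> two_cosh (mobius g w)" using bdd by (rule cInf_lower)
      then show ?thesis using g0(2) by (simp add: w_def)
    qed
    have wn: "two_cosh w > real n + 1" using z(2) g0 by (simp add: w_def)
    obtain \<theta> s where \<theta>: "\<theta> \<in> {-pi/2..pi/2}" "s \<ge> 1" "w = mobius (rotation \<theta> ** dilation s) \<i>"
      using polar_decomposition[OF w] .
    have det: "det (rotation \<theta> ** dilation s) = 1" using \<theta> by (simp add: det_mul)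
    have uw: "two_cosh w = s + 1 / s"
      using sqn_eq_two_cosh[OF det] \<theta> by (simp add: sqn_rotation_left sqn_dilation)
    have "1 / s \<le> 1" using \<theta> by simp
    then have sn: "s \<ge> real n" using uw wn by linarith
    have "sqn (g ** rotation \<theta> ** dilation t) \<ge> t / 2" if g: "g \<in> G" and t: "1 \<le> t" "t \<le> s" for g t
    proof -
      have "s \<le> two_cosh w" using uw \<theta> by simp
      also have "\<dots> \<le> 2 * two_cosh (mobius g w)" by (rule wmin[OF g])
      also have "mobius g w = mobius (g ** (rotation \<theta> ** dilation s)) \<i>"
        using mobius_mult[of g "rotation \<theta> ** dilation s" \<i>] det Gd(1)[OF g] \<theta>(3) by simp
      also have "two_cosh (mobius (g ** (rotation \<theta> ** dilation s)) \<i>) = sqn (g ** (rotation \<theta> ** dilation s))"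
        using det Gd(1)[OF g] by (intro sqn_eq_two_cosh[symmetric]) (simp add: det_mul)
      also have "g ** (rotation \<theta> ** dilation s) = (g ** rotation \<theta> ** dilation t) ** dilation (s / t)"
        using t by (simp add: matrix_mul_assoc[symmetric] dilation_mult)
      also have "2 * sqn ((g ** rotation \<theta> ** dilation t) ** dilation (s / t)) \<le> 2 * (s / t * sqn (g ** rotation \<theta> ** dilation t))"
        using t by (intro mult_left_mono sqn_mult_dilation) auto
      finally show ?thesis using t by (simp add: field_simps)
    qed
    then show ?thesis using \<theta> sn by (intro exI[of _ \<theta>] exI[of _ s]) auto
  qed
  then obtain \<theta> s where \<theta>: "\<And>n. \<theta> n \<in> {-pi/2..pi/2}" and s: "\<And>n. s n \<ge> real n" "\<And>n::nat. s n \<ge> 1"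
    and far: "\<And>n g t. g \<in> G \<Longrightarrow> 1 \<le> t \<Longrightarrow> t \<le> s n \<Longrightarrow> sqn (g ** rotation (\<theta> n) ** dilation t) \<ge> t / 2"
    by metis
  have "compact {-pi/2..pi/2 :: real}" by simp
  then obtain l r where lr: "strict_mono r" "(\<theta> \<circ> r) \<longlonglongrightarrow> l"
    using \<theta> unfolding compact_def by metis
  have "sqn (g ** rotation l ** dilation t) \<ge> t / 2" if g: "g \<in> G" and t: "t \<ge> 1" for g t
  proof (rule tendsto_lowerbound)
    show "((\<lambda>n. sqn (g ** rotation ((\<theta> \<circ> r) n) ** dilation t)) \<longlongrightarrow> sqn (g ** rotation l ** dilation t)) sequentially"
      unfolding sqn_def mat2_mult rotation_def M2_nth by (intro tendsto_intros lr)
    obtain N where N: "real N \<ge> t" using real_arch_simple by blast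
    have "t / 2 \<le> sqn (g ** rotation ((\<theta> \<circ> r) n) ** dilation t)" if "n \<ge> N" for n
    proof -
      have "real N \<le> real (r n)" using that seq_suble[OF lr(1), of n] by simp
      then have "t \<le> s (r n)" using N s(1)[of "r n"] by linarith
      then show ?thesis using far[OF g t, of "r n"] by simp
    qed
    then show "\<forall>\<^sub>F n in sequentially. t / 2 \<le> sqn (g ** rotation ((\<theta> \<circ> r) n) ** dilation t)"
      by (auto simp: eventually_sequentially)
  qed simp
  then show ?thesis by blast
qed

definition whitney_box :: "real \<Rightarrow> complex set" where
  "whitney_box s = {z. Re z \<in> {-s..s} \<and> Im z \<in> {s..2 * s}}"

lemma whitney_box_borel [simp]: "whitney_box s \<in> sets borel"
  unfolding whitney_box_def by measurable

lemma whitney_box_H: "s > 0 \<Longrightarrow> whitney_box s \<subseteq> upper_half_plane"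
  by (auto simp: whitney_box_def upper_half_plane_def)

lemma area_whitney_box:
  assumes s: "s > 0" shows "emeasure hyperbolic_area (whitney_box s) \<ge> ennreal (1 / 2)"
proof -
  have "ennreal (1 / 2) = ennreal (1 / (4 * s\<^sup>2)) * ennreal (2 * s * s)"
    using s by (subst ennreal_mult[symmetric]) (auto simp: power2_eq_square)
  also have "ennreal (2 * s * s) = emeasure lborel (whitney_box s)"
    unfolding whitney_box_def using s by (subst emeasure_lborel_complex_Times) (auto simp: ennreal_mult)
  also have "ennreal (1 / (4 * s\<^sup>2)) * emeasure lborel (whitney_box s) = (\<integral>\<^sup>+z. ennreal (1 / (4 * s\<^sup>2)) * indicator (whitney_box s) z \<partial>lborel)"
    by (simp add: nn_integral_cmult_indicator)
  also have "\<dots> \<le> (\<integral>\<^sup>+z. ennreal (1 / (Im z)\<^sup>2) * indicator (whitney_box s) z \<partial>lborel)"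
  proof (intro nn_integral_mono)
    fix z show "ennreal (1 / (4 * s\<^sup>2)) * indicator (whitney_box s) z \<le> ennreal (1 / (Im z)\<^sup>2) * indicator (whitney_box s) z"
    proof (cases "z \<in> whitney_box s")
      case True
      then have z: "0 < Im z" "Im z \<le> 2 * s" using s by (auto simp: whitney_box_def)
      then have "(Im z)\<^sup>2 \<le> (2 * s)\<^sup>2" by (intro power_mono) auto
      then have "1 / (4 * s\<^sup>2) \<le> 1 / (Im z)\<^sup>2" using z s by (intro divide_left_mono) (auto simp: power_mult_distrib)
      then show ?thesis using True by (simp add: ennreal_leI)
    qed simp
  qed
  also have "\<dots> = emeasure hyperbolic_area (whitney_box s)"
    using whitney_box_H[OF s] by (intro emeasure_hyperbolic_area[symmetric]) auto
  finally show ?thesis .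
qed

lemma whitney_box_sqn:
  assumes "z1 \<in> whitney_box s" "s > 0" "z2 \<in> whitney_box t" "t > 0" "det h = 1" "mobius h z1 = z2"
  shows "sqn (adj2 (dilation t) ** h ** dilation s) \<le> 36"
proof -
  have u6: "two_cosh (mobius (adj2 (dilation s)) z) \<le> 6" if "z \<in> whitney_box s" "s > 0" for z s
  proof -
    have m: "mobius (adj2 (dilation s)) z = of_real (1 / s) * z"
      using that by (simp only: adj2_dilation mobius_dilation zero_less_divide_1_iff)
    have b: "(Re z / s)\<^sup>2 \<le> 1" "(Im z / s)\<^sup>2 \<le> 4" "Im z / s \<ge> 1"
    proof -
      have "\<bar>Re z / s\<bar> \<le> 1" "\<bar>Im z / s\<bar> \<le> 2" using that by (auto simp: whitney_box_def abs_le_iff field_simps)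
      then have "(Re z / s)\<^sup>2 \<le> 1\<^sup>2" "(Im z / s)\<^sup>2 \<le> 2\<^sup>2"
        by (simp_all only: abs_le_square_iff[symmetric] abs_one abs_numeral)
      then show "(Re z / s)\<^sup>2 \<le> 1" "(Im z / s)\<^sup>2 \<le> 4" by simp_all
      show "Im z / s \<ge> 1" using that by (auto simp: whitney_box_def field_simps)
    qed
    have "two_cosh (mobius (adj2 (dilation s)) z) = ((Re z / s)\<^sup>2 + (Im z / s)\<^sup>2 + 1) / (Im z / s)"
      unfolding m two_cosh_def by simp
    also have "\<dots> \<le> 6 / 1" using b by (intro frac_le) auto
    finally show ?thesis by simp
  qed
  have i1: "Im z1 > 0" using assms by (auto simp: whitney_box_def)
  define X where "X = adj2 (dilation t) ** h ** dilation s"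
  define Y where "Y = adj2 (dilation s) ** point_matrix z1"
  have dY: "det Y = 1" using i1 assms by (simp add: Y_def det_mul)
  have dX: "det X = 1" using assms by (simp add: X_def det_mul)
  have XY: "X ** Y = adj2 (dilation t) ** (h ** point_matrix z1)"
    using assms by (simp add: X_def Y_def matrix_mul_assoc[symmetric] adj2_cancel)
  have "mobius Y \<i> = mobius (adj2 (dilation s)) z1"
    unfolding Y_def using i1 assms by (simp add: mobius_mult mobius_point_matrix)
  then have sY: "sqn Y \<le> 6" using sqn_eq_two_cosh[OF dY] u6[OF assms(1,2)] by simp
  have "mobius (X ** Y) \<i> = mobius (adj2 (dilation t)) z2"
    unfolding XY using i1 assms mobius_mult[of "adj2 (dilation t)" "h ** point_matrix z1" \<i>] mobius_mult[of h "point_matrix z1" \<i>]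
    by (simp add: det_mul mobius_point_matrix)
  then have sXY: "sqn (X ** Y) \<le> 6"
    using sqn_eq_two_cosh[of "X ** Y"] dX dY u6[OF assms(3,4)] by (simp add: det_mul)
  have "sqn X = sqn (X ** Y ** adj2 Y)" using adj2_cancel(3)[OF dY, of X] by simp
  also have "\<dots> \<le> sqn (X ** Y) * sqn (adj2 Y)" by (rule sqn_mult)
  also have "\<dots> \<le> 6 * 6" using sXY sY by (intro mult_mono) auto
  finally show ?thesis by (simp add: X_def)
qed

lemma thin_along_ray:
  assumes G: "subgroup G SL2R" "countable G" and fin: "finite_covolume G"
    and ray: "\<And>g t. g \<in> G \<Longrightarrow> t \<ge> 1 \<Longrightarrow> sqn (g ** dilation t) \<ge> t / 2" and e: "\<epsilon> > 0"
  shows "\<exists>s0\<ge>1. \<forall>s\<ge>s0. \<exists>h\<in>G. h \<noteq> mat 1 \<and> norm (adj2 (dilation s) ** h ** dilation s - mat 1) < \<epsilon>"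
proof (rule ccontr)
  assume neg: "\<not> ?thesis"
  note Gd = subgroup_SL2R_D[OF G(1)]
  have unb: "\<exists>s\<ge>s0. s \<ge> 1 \<and> gap (conjugate_by (dilation s) G) \<epsilon>" for s0
  proof -
    from neg have "\<not> (\<forall>s\<ge>max s0 1. \<exists>h\<in>G. h \<noteq> mat 1 \<and> norm (adj2 (dilation s) ** h ** dilation s - mat 1) < \<epsilon>)"
      by (metis max.cobounded2)
    then obtain s where s: "s \<ge> max s0 1"
      "\<And>h. h \<in> G \<Longrightarrow> h \<noteq> mat 1 \<Longrightarrow> norm (adj2 (dilation s) ** h ** dilation s - mat 1) \<ge> \<epsilon>"
      by (auto simp: not_less)
    have "gap (conjugate_by (dilation s) G) \<epsilon>"
      unfolding gap_def
    proof (intro ballI impI)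
      fix g assume g: "g \<in> conjugate_by (dilation s) G" "g \<noteq> mat 1"
      then obtain h where h: "h \<in> G" "g = adj2 (dilation s) ** h ** dilation s" by (auto simp: conjugate_by_def)
      have "h \<noteq> mat 1" using g(2) h(2) s(1) by (auto simp: adj2_inverse)
      with s(2)[OF h(1)] h(2) show "\<epsilon> \<le> norm (g - mat 1)" by simp
    qed
    with s(1) show ?thesis by auto
  qed
  have "\<exists>f. \<forall>n::nat. (f n \<ge> 1 \<and> gap (conjugate_by (dilation (f n)) G) \<epsilon>) \<and> f (Suc n) \<ge> 145 * f n"
    by (rule dependent_nat_choice) (use unb in blast)+
  then obtain \<sigma> where \<sigma>: "\<And>n::nat. \<sigma> n \<ge> (1::real)" "\<And>n. gap (conjugate_by (dilation (\<sigma> n)) G) \<epsilon>" "\<And>n. \<sigma> (Suc n) \<ge> 145 * \<sigma> n"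
    by blast
  have pos: "\<sigma> n > 0" for n using \<sigma>(1)[of n] by linarith
  have grow: "\<sigma> j \<ge> 145 * \<sigma> i" if "i < j" for i j
    using that
  proof (induction j)
    case (Suc j)
    show ?case
    proof (cases "i = j")
      case False
      with Suc have "145 * \<sigma> i \<le> \<sigma> j" by simp
      also have "\<dots> \<le> \<sigma> (Suc j)" using \<sigma>(3)[of j] pos[of j] by simp
      finally show ?thesis .
    qed (use \<sigma>(3) in simp)
  qed simp
  have noback: False if h: "h \<in> G" "mobius h z1 = z2" and z: "z1 \<in> whitney_box (\<sigma> i)" "z2 \<in> whitney_box (\<sigma> j)" and ij: "i < j" for h z1 z2 i j
  proof -
    let ?X = "adj2 (dilation (\<sigma> j)) ** h ** dilation (\<sigma> i)"
    have X: "sqn ?X \<le> 36" using whitney_box_sqn[OF z(1) pos z(2) pos Gd(1)[OF h(1)] h(2)] .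
    have "\<sigma> j / 2 \<le> sqn (adj2 h ** dilation (\<sigma> j))" using ray[OF Gd(2)[OF h(1)] \<sigma>(1)] .
    also have "\<dots> = sqn (adj2 (adj2 h ** dilation (\<sigma> j)))" by simp
    also have "adj2 (adj2 h ** dilation (\<sigma> j)) = ?X ** adj2 (dilation (\<sigma> i))"
      using adj2_cancel(3)[OF det_dilation[OF pos]] by (simp add: adj2_mult)
    also have "sqn \<dots> \<le> sqn ?X * sqn (adj2 (dilation (\<sigma> i)))" by (rule sqn_mult)
    also have "\<dots> \<le> 36 * (2 * \<sigma> i)"
    proof (intro mult_mono X)
      have "1 / \<sigma> i \<le> 1" using \<sigma>(1)[of i] by simp
      then show "sqn (adj2 (dilation (\<sigma> i))) \<le> 2 * \<sigma> i" using \<sigma>(1)[of i] unfolding sqn_adj2 sqn_dilation[OF pos] by linarith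
    qed auto
    finally have "\<sigma> j \<le> 144 * \<sigma> i" by simp
    then show False using grow[OF ij] pos[of i] by simp
  qed
  have same: "i = j" if h: "h \<in> G" "mobius h z1 = z2" and z: "z1 \<in> whitney_box (\<sigma> i)" "z2 \<in> whitney_box (\<sigma> j)" for h z1 z2 i j
  proof (rule ccontr)
    assume "i \<noteq> j"
    moreover have "Im z1 > 0" using z(1) pos[of i] by (auto simp: whitney_box_def)
    then have "mobius (adj2 h) z2 = z1" using h Gd(1) mobius_adj2(1) by blast
    ultimately show False using noback[OF h z] noback[OF Gd(2)[OF h(1)] _ z(2,1)] by linarith
  qed
  obtain F where F: "fundamental_set G F" "emeasure hyperbolic_area F < \<infinity>"
    using fin by (auto simp: finite_covolume_def)
  define N where "N = (8 * 6\<^sup>2 / \<epsilon> + 2 :: real)^4"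
  have bound: "ennreal (real m / 2) \<le> ennreal N * emeasure hyperbolic_area F" for m
  proof -
    define B where "B = (\<Union>j\<in>{..<m}. whitney_box (\<sigma> j))"
    have "ennreal (real m / 2) = (\<Sum>j<m. ennreal (1 / 2))"
      by (subst sum_ennreal) auto
    also have "\<dots> \<le> (\<Sum>j<m. emeasure hyperbolic_area (whitney_box (\<sigma> j)))"
      by (intro sum_mono area_whitney_box pos)
    also have "\<dots> = emeasure hyperbolic_area B"
      unfolding B_def
    proof (intro sum_emeasure)
      have "whitney_box (\<sigma> i) \<inter> whitney_box (\<sigma> j) = {}" if "i \<noteq> j" for i j
        using same[OF Gd(3) mobius_one, of _ i j] that by blast
      then show "disjoint_family_on (\<lambda>j. whitney_box (\<sigma> j)) {..<m}" by (auto simp: disjoint_family_on_def)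
    qed auto
    also have "\<dots> \<le> ennreal N * emeasure hyperbolic_area F"
    proof (rule area_le_multiplicity[OF G F(1)])
      show "B \<in> sets borel" "B \<subseteq> upper_half_plane" unfolding B_def using whitney_box_H[OF pos] by auto
      show "F \<in> sets borel" using F by (simp add: fundamental_set_def)
      fix w assume "w \<in> upper_half_plane"
      then have w: "Im w > 0" by (simp add: upper_half_plane_def)
      let ?S = "{g\<in>G. mobius g w \<in> B}"
      show "finite ?S \<and> real (card ?S) \<le> N"
      proof (cases "?S = {}")
        case True show ?thesis unfolding True using e by (simp add: N_def)
      next
        case False
        then obtain g0 i where g0: "g0 \<in> G" "mobius g0 w \<in> whitney_box (\<sigma> i)" by (auto simp: B_def)
        have iw: "Im (mobius g0 w) > 0" using g0 Gd(1) w by (simp add: mobius_Im_pos)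
        define \<phi> where "\<phi> g = adj2 (dilation (\<sigma> i)) ** (g ** adj2 g0) ** dilation (\<sigma> i)" for g
        let ?T = "{A\<in>conjugate_by (dilation (\<sigma> i)) G. norm A \<le> 6}"
        have T: "finite ?T \<and> real (card ?T) \<le> N"
          unfolding N_def using gap_card[OF conjugate_by_subgroup[OF G(1) det_dilation[OF pos]] \<sigma>(2) e, of 6] by simp
        have "\<phi> g \<in> ?T" if g: "g \<in> ?S" for g
        proof -
          from g obtain j where j: "g \<in> G" "mobius g w \<in> whitney_box (\<sigma> j)" by (auto simp: B_def)
          have h: "g ** adj2 g0 \<in> G" using j g0 Gd by blast
          have m: "mobius (g ** adj2 g0) (mobius g0 w) = mobius g w"
            using mobius_mult[of g "adj2 g0" "mobius g0 w"] j g0 Gd(1) w iw by (simp add: mobius_adj2)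
          have "i = j" using same[OF h m g0(2) j(2)] .
          with j(2) have "mobius g w \<in> whitney_box (\<sigma> i)" by simp
          from whitney_box_sqn[OF g0(2) pos this pos Gd(1)[OF h] m] have "sqn (\<phi> g) \<le> 36"
            unfolding \<phi>_def .
          then have "(norm (\<phi> g))\<^sup>2 \<le> 6\<^sup>2" unfolding sqn_norm by simp
          then have "norm (\<phi> g) \<le> 6" by (rule power2_le_imp_le) simp
          then show ?thesis using h by (auto simp: conjugate_by_def \<phi>_def)
        qed
        then have sub: "\<phi> ` ?S \<subseteq> ?T" by blast
        have inj: "inj_on \<phi> ?S"
        proof (rule inj_onI)
          fix g h assume gh: "\<phi> g = \<phi> h"
          let ?d = "dilation (\<sigma> i)"
          have inv: "?d ** \<phi> k ** adj2 ?d ** g0 = k" for k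
            unfolding \<phi>_def
            by (simp add: matrix_mul_assoc[symmetric] adj2_cancel[OF det_dilation[OF pos[of i]]]
                adj2_inverse[OF det_dilation[OF pos[of i]]] adj2_inverse[OF Gd(1)[OF g0(1)]])
          show "g = h" using inv[of g] inv[of h] gh by metis
        qed
        have "finite (\<phi> ` ?S)" using sub T by (meson finite_subset)
        then have "finite ?S" using inj by (rule finite_imageD)
        moreover have "card ?S \<le> card ?T" using card_inj_on_le[OF inj sub] T by simp
        ultimately show ?thesis using T by linarith
      qed
    qed auto
    finally show ?thesis .
  qed
  define c where "c = ennreal N * emeasure hyperbolic_area F"
  have "c < \<infinity>" unfolding c_def using F(2) by (simp add: ennreal_mult_less_top)
  then obtain r where r: "r \<ge> 0" "c = ennreal r" by (cases c) auto
  obtain m where m: "real m > 2 * r" using reals_Archimedean2 by blast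
  have "ennreal (real m / 2) \<le> ennreal r" using bound[of m] r by (simp add: c_def)
  then show False using m r by simp
qed

theorem exists_parabolic:
  assumes G: "fuchsian G" and fin: "finite_covolume G" and nc: "\<not> cocompact G"
  shows "\<exists>A\<in>G. A \<noteq> mat 1 \<and> A$1$1 + A$2$2 = 2"
proof (rule ccontr)
  assume neg: "\<not> ?thesis"
  have Gs: "subgroup G SL2R" using G by (simp add: fuchsian_def)
  obtain \<delta>0 where \<delta>0: "\<delta>0 > 0" "gap G \<delta>0" using fuchsian_gap[OF G] .
  obtain \<theta> where \<theta>: "\<And>g t. g \<in> G \<Longrightarrow> t \<ge> 1 \<Longrightarrow> sqn (g ** rotation \<theta> ** dilation t) \<ge> t / 2"
    using escaping_ray[OF Gs nc] by blast
  define H where "H = conjugate_by (rotation \<theta>) G"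
  have Hs: "subgroup H SL2R" unfolding H_def using conjugate_by_subgroup[OF Gs det_rotation] .
  note Hd = subgroup_SL2R_D[OF Hs]
  obtain \<delta> where \<delta>: "\<delta> > 0" "gap H \<delta>" using conjugate_by_gap[OF det_rotation \<delta>0(2,1)] H_def by blast
  have Hc: "countable H" using gap_countable[OF Hs \<delta>(2,1)] .
  have Hf: "finite_covolume H" unfolding H_def using conjugate_by_finite_covolume[OF Gs det_rotation fin] .
  have tr_conj: "(adj2 P ** A ** P)$1$1 + (adj2 P ** A ** P)$2$2 = A$1$1 + A$2$2" if "det P = 1" for A P :: "real^2^2"
  proof -
    have "(adj2 P ** A ** P)$1$1 + (adj2 P ** A ** P)$2$2 = (A$1$1 + A$2$2) * det P"
      by (simp add: det_2 algebra_simps)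
    with that show ?thesis by simp
  qed
  have npar: "A = mat 1" if "A \<in> H" "A$1$1 + A$2$2 = 2" for A
  proof -
    from that(1) obtain B where B: "B \<in> G" "A = adj2 (rotation \<theta>) ** B ** rotation \<theta>" by (auto simp: H_def conjugate_by_def)
    then have "B = mat 1" using neg that(2) tr_conj[OF det_rotation] by metis
    then show ?thesis using B adj2_inverse[OF det_rotation] by simp
  qed
  have ray: "sqn (g ** dilation t) \<ge> t / 2" if "g \<in> H" "t \<ge> 1" for g t
  proof -
    have "rotation \<theta> ** g ** adj2 (rotation \<theta>) \<in> G" using that conjugate_by_mem[OF det_rotation] by (simp add: H_def)
    from \<theta>[OF this that(2)] show ?thesis
      using adj2_cancel(4)[OF det_rotation] by (simp add: sqn_rotation_left matrix_mul_assoc[symmetric] adj2_inverse)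
  qed
  define D where "D k h = adj2 (dilation (2^k)) ** h ** dilation (2^k)" for k :: nat and h
  have Dh: "D k h $1$1 = h$1$1" "D k h $1$2 = h$1$2 / 2^k" "D k h $2$1 = h$2$1 * 2^k" "D k h $2$2 = h$2$2" for k h
  proof -
    have "sqrt (2^k) * sqrt (2^k) = 2^k" by simp
    then show "D k h $1$1 = h$1$1" "D k h $1$2 = h$1$2 / 2^k" "D k h $2$1 = h$2$1 * 2^k" "D k h $2$2 = h$2$2"
      by (simp_all add: D_def dilation_def field_simps)
  qed
  define Near where "Near k \<epsilon> = {h\<in>H. h \<noteq> mat 1 \<and> norm (D k h - mat 1) < \<epsilon>}" for k \<epsilon>
  have thin: "\<exists>k0. \<forall>k\<ge>k0. Near k \<epsilon> \<noteq> {}" if e: "\<epsilon> > 0" for \<epsilon>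
  proof -
    obtain s0 where s0: "s0 \<ge> 1" "\<And>s. s \<ge> s0 \<Longrightarrow> \<exists>h\<in>H. h \<noteq> mat 1 \<and> norm (adj2 (dilation s) ** h ** dilation s - mat 1) < \<epsilon>"
      using thin_along_ray[OF Hs Hc Hf ray e] by blast
    obtain k0 where k0: "s0 < 2^k0" using real_arch_pow[of 2 s0] by auto
    have "Near k \<epsilon> \<noteq> {}" if "k \<ge> k0" for k
    proof -
      have "2^k0 \<le> (2::real)^k" using that by (rule power_increasing) simp
      with k0 have "s0 \<le> 2^k" by linarith
      from s0(2)[OF this] show ?thesis by (auto simp: Near_def D_def)
    qed
    then show ?thesis by blast
  qed
  have comm1: "g ** h = h ** g" if g: "g \<in> Near k (1/20)" and h: "h \<in> Near k (1/20)" for g h k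
  proof -
    let ?d = "dilation (2^k)"
    have d: "det ?d = 1" by simp
    obtain \<delta>' where \<delta>': "\<delta>' > 0" "gap (conjugate_by ?d H) \<delta>'" using conjugate_by_gap[OF d \<delta>(2,1)] by blast
    have "D k g ** D k h = D k h ** D k g"
    proof (rule small_commute[OF conjugate_by_subgroup[OF Hs d] \<delta>'(2,1)])
      show "A = mat 1" if A: "A \<in> conjugate_by ?d H" "A$1$1 + A$2$2 = 2" for A
      proof -
        from A obtain B where B: "B \<in> H" "A = adj2 ?d ** B ** ?d" by (auto simp: conjugate_by_def)
        then have "B = mat 1" using npar A(2) tr_conj[OF d] by metis
        then show ?thesis using B adj2_inverse[OF d] by simp
      qed
      show "D k g \<in> conjugate_by ?d H" "D k h \<in> conjugate_by ?d H" using g h by (auto simp: D_def conjugate_by_def Near_def)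
      show "norm (D k g - mat 1) \<le> 1/20" "norm (D k h - mat 1) \<le> 1/20" using g h by (auto simp: Near_def)
    qed
    then show ?thesis unfolding commute_iff Dh by (simp add: mult.assoc[symmetric])
  qed
  have shift: "h \<in> Near k (1/20)" if h: "h \<in> Near (Suc k) (1/80)" for h k
  proof -
    have b: "\<bar>(D (Suc k) h - mat 1)$i$j\<bar> \<le> 1/80" for i j
      using h norm_mat2_nth[of "D (Suc k) h - mat 1" i j] by (auto simp: Near_def)
    have gen: "p\<^sup>2 + (2 * B)\<^sup>2 + C\<^sup>2 + q\<^sup>2 \<le> 4 * (p\<^sup>2 + B\<^sup>2 + (2 * C)\<^sup>2 + q\<^sup>2)" for p q B C :: real
      by (simp add: power_mult_distrib)
    have e: "h$1$2 / 2^k = 2 * (h$1$2 / 2^Suc k)" "h$2$1 * 2^Suc k = 2 * (h$2$1 * 2^k)" by simp_all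
    have "(norm (D k h - mat 1))\<^sup>2 \<le> 4 * (norm (D (Suc k) h - mat 1))\<^sup>2"
      using gen[of "h$1$1 - 1" "h$1$2 / 2^Suc k" "h$2$1 * 2^k" "h$2$2 - 1", folded e]
      unfolding sqn_norm[symmetric] sqn_def vector_minus_component Dh mat2_one by simp
    then have "(norm (D k h - mat 1))\<^sup>2 \<le> (2 * norm (D (Suc k) h - mat 1))\<^sup>2" by (simp add: power_mult_distrib)
    then have "norm (D k h - mat 1) \<le> 2 * norm (D (Suc k) h - mat 1)" by (rule power2_le_imp_le) simp
    then show ?thesis using h by (auto simp: Near_def)
  qed
  have tr2: "h$1$1 + h$2$2 \<noteq> -2" "h$1$1 > 0" if "h \<in> Near k (1/20)" for h k
    using that small_trace[of "D k h"] norm_mat2_nth[of "D k h - mat 1" 1 1] by (auto simp: Near_def Dh)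
  have near_mono: "Near k x \<subseteq> Near k y" if "x \<le> y" for k x y using that by (auto simp: Near_def)
  obtain k0 where k0: "\<And>k. k \<ge> k0 \<Longrightarrow> Near k (1/80) \<noteq> {}" using thin[of "1/80"] by auto
  obtain h where h: "h \<in> Near k0 (1/80)" using k0[of k0] by auto
  have hH: "h \<in> H" "h \<noteq> mat 1" using h by (auto simp: Near_def)
  have htr: "h$1$1 + h$2$2 \<noteq> -2" "h$1$1 > 0" using tr2[of h k0] near_mono[of "1/80" "1/20" k0] h by auto
  have comm: "h ** g = g ** h" if "g \<in> Near (k0 + n) (1/80)" for g n
    using that
  proof (induction n arbitrary: g)
    case 0
    then show ?case using comm1[of h k0 g] near_mono[of "1/80" "1/20" k0] h by auto
  next
    case (Suc n)
    obtain f where f: "f \<in> Near (k0 + n) (1/80)" using k0[of "k0 + n"] by auto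
    then have f': "f \<in> Near (k0 + n) (1/20)" using near_mono[of "1/80" "1/20"] by auto
    have "g ** f = f ** g" using comm1[OF shift f'] Suc.prems by simp
    moreover have "f \<in> H" "f \<noteq> mat 1" using f by (auto simp: Near_def)
    ultimately show ?case
      using commute_trans[OF Hd(1)[OF \<open>f \<in> H\<close>] \<open>f \<noteq> mat 1\<close> tr2(1)[OF f'], of h g] Suc.IH[OF f] by simp
  qed
  note ns = nonscalar[OF Hd(1)[OF hH(1)] hH(2) htr(1)]
  have ex: "\<exists>y. \<bar>y\<bar> * (\<bar>h$1$2\<bar> + \<epsilon>) \<ge> \<delta> / 2 \<and> \<bar>y * h$2$1\<bar> < \<epsilon> \<and> \<bar>y * (h$1$1 - h$2$2)\<bar> < \<epsilon> " if e: "0 < \<epsilon>" "\<epsilon> < 1/80" "\<epsilon> < \<delta>/16" for \<epsilon>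
  proof -
    obtain k1 where k1: "\<And>k. k \<ge> k1 \<Longrightarrow> Near k (\<epsilon>/2) \<noteq> {}" using thin[of "\<epsilon>/2"] e by auto
    define k where "k = k0 + k1"
    obtain g where g: "g \<in> Near k (\<epsilon>/2)" using k1[of k] by (auto simp: k_def)
    then have g80: "g \<in> Near (k0 + k1) (1/80)" using near_mono[of "\<epsilon>/2" "1/80"] e by (auto simp: k_def)
    obtain y where y: "g$1$2 = y * h$1$2" "g$2$1 = y * h$2$1" "g$1$1 - g$2$2 = y * (h$1$1 - h$2$2)"
      using commute_scale[OF comm[OF g80] ns] .
    have b: "\<bar>(D k g - mat 1)$i$j\<bar> < \<epsilon>/2" for i j
      using g norm_mat2_nth[of "D k g - mat 1" i j] by (auto simp: Near_def)
    have b1: "\<bar>g$1$1 - 1\<bar> < \<epsilon>/2" "\<bar>g$2$2 - 1\<bar> < \<epsilon>/2" "\<bar>g$2$1 * 2^k\<bar> < \<epsilon>/2"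
      using b[of 1 1] b[of 2 2] b[of 2 1] by (simp_all add: Dh)
    have c: "\<bar>g$2$1\<bar> < \<epsilon>/2"
    proof -
      have "\<bar>g$2$1\<bar> * 1 \<le> \<bar>g$2$1\<bar> * 2^k" by (intro mult_left_mono) auto
      also have "\<dots> < \<epsilon>/2" using b1(3) by (simp add: abs_mult)
      finally show ?thesis by simp
    qed
    have "\<delta> \<le> norm (g - mat 1)" using \<delta>(2) g by (auto simp: gap_def Near_def)
    also have "\<dots> \<le> \<bar>g$1$1 - 1\<bar> + \<bar>g$1$2\<bar> + \<bar>g$2$1\<bar> + \<bar>g$2$2 - 1\<bar>"
      using norm_le_sum4[of "g - mat 1"] by simp
    finally have n: "\<delta> \<le> \<bar>g$1$1 - 1\<bar> + \<bar>g$1$2\<bar> + \<bar>g$2$1\<bar> + \<bar>g$2$2 - 1\<bar>" .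
    have "\<delta> / 2 \<le> x2" if "\<delta> \<le> x1 + x2 + x3 + x4" "x1 < \<epsilon>/2" "x3 < \<epsilon>/2" "x4 < \<epsilon>/2" for x1 x2 x3 x4
      using that e by linarith
    from this[OF n b1(1) c b1(2)] have "\<delta> / 2 \<le> \<bar>y\<bar> * \<bar>h$1$2\<bar>" by (simp add: y abs_mult)
    also have "\<dots> \<le> \<bar>y\<bar> * (\<bar>h$1$2\<bar> + \<epsilon>)" using e by (intro mult_left_mono) auto
    finally have 1: "\<bar>y\<bar> * (\<bar>h$1$2\<bar> + \<epsilon>) \<ge> \<delta> / 2" .
    have "\<bar>(g$1$1 - 1) - (g$2$2 - 1)\<bar> \<le> \<bar>g$1$1 - 1\<bar> + \<bar>g$2$2 - 1\<bar>" by (rule abs_triangle_ineq4)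
    also have "\<dots> < \<epsilon>/2 + \<epsilon>/2" by (intro add_strict_mono b1)
    finally have "\<bar>y * (h$1$1 - h$2$2)\<bar> < \<epsilon>" unfolding y(3)[symmetric] by simp
    moreover have "\<bar>y * h$2$1\<bar> < \<epsilon>" using c e(1) unfolding y(2)[symmetric] by linarith
    ultimately show ?thesis using 1 by blast
  qed
  define M where "M = \<bar>h$1$2\<bar> + 1"
  have M: "M > 0" by (simp add: M_def)
  have zero: "v = 0" if v: "v = h$2$1 \<or> v = h$1$1 - h$2$2" for v
  proof (rule ccontr)
    assume "v \<noteq> 0"
    define \<epsilon> where "\<epsilon> = Min {1/100, \<delta>/20, \<delta> * \<bar>v\<bar> / (4 * M)}"
    have "\<epsilon> \<le> 1/100" "\<epsilon> \<le> \<delta>/20" and e4: "\<epsilon> \<le> \<delta> * \<bar>v\<bar> / (4 * M)" by (simp_all add: \<epsilon>_def)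
    moreover have e0: "0 < \<epsilon>" using \<delta>(1) M \<open>v \<noteq> 0\<close> by (simp add: \<epsilon>_def)
    ultimately have e: "0 < \<epsilon>" "\<epsilon> < 1/80" "\<epsilon> < \<delta>/16" using \<delta>(1) by linarith+
    obtain y where y: "\<bar>y\<bar> * (\<bar>h$1$2\<bar> + \<epsilon>) \<ge> \<delta> / 2" "\<bar>y * v\<bar> < \<epsilon>" using ex[OF e(1-3)] v by auto
    have "\<bar>h$1$2\<bar> + \<epsilon> \<le> M" unfolding M_def using e(2) by simp
    then have "\<bar>y\<bar> * (\<bar>h$1$2\<bar> + \<epsilon>) \<le> \<bar>y\<bar> * M" by (intro mult_left_mono) simp_all
    with y(1) have "\<delta> / 2 \<le> \<bar>y\<bar> * M" by (rule order_trans)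
    then have "\<delta> / 2 * \<bar>v\<bar> \<le> \<bar>y\<bar> * M * \<bar>v\<bar>" by (rule mult_right_mono) simp
    also have "\<dots> = \<bar>y * v\<bar> * M" by (simp add: abs_mult)
    also have "\<dots> < \<epsilon> * M" using y(2) M by simp
    also have "\<dots> \<le> \<delta> * \<bar>v\<bar> / (4 * M) * M" using e4 M by (intro mult_right_mono) auto
    also have "\<dots> = \<delta> * \<bar>v\<bar> / 4" using M by simp
    finally have lt: "\<delta> / 2 * \<bar>v\<bar> < \<delta> * \<bar>v\<bar> / 4" .
    have "\<delta> * \<bar>v\<bar> > 0" using \<delta>(1) \<open>v \<noteq> 0\<close> by simp
    then show False using lt by (simp only: times_divide_eq_left)
  qed
  have "h$2$1 = 0" "h$1$1 = h$2$2" using zero[of "h$2$1"] zero[of "h$1$1 - h$2$2"] by simp_all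
  then have "h$1$1 * h$1$1 = 1" using Hd(1)[OF hH(1)] by (simp add: det_2)
  then have "h$1$1 = 1" using htr(2) by (simp add: square_eq_1_iff)
  then have "h$1$1 + h$2$2 = 2" using \<open>h$1$1 = h$2$2\<close> by simp
  from npar[OF hH(1) this] hH(2) show False by contradiction
qed

lemma parabolic_normal_form:
  assumes G: "subgroup G SL2R" and A: "A \<in> G" "A \<noteq> mat 1" "A$1$1 + A$2$2 = 2"
  obtains P where "det P = 1" "M2 1 1 0 1 \<in> conjugate_by P G"
proof -
  note Gd = subgroup_SL2R_D[OF G]
  have main: "\<exists>P. det P = 1 \<and> M2 1 1 0 1 \<in> conjugate_by P G"
    if B: "B \<in> G" "B$1$1 + B$2$2 = 2" "B$2$1 < 0 \<or> B$2$1 = 0 \<and> B$1$2 > 0" for B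
  proof -
    define p where "p = B$1$1 - 1"
    have B11: "B$1$1 = 1 + p" "B$2$2 = 1 - p" using B(2) by (auto simp: p_def)
    have dB: "p\<^sup>2 + B$1$2 * B$2$1 = 0" using Gd(1)[OF B(1)] by (simp add: det_2 B11 power2_eq_square algebra_simps)
    have "\<exists>P. det P = 1 \<and> B ** P = P ** M2 1 1 0 1"
    proof (cases "B$2$1 < 0")
      case True
      define x where "x = 1 / sqrt (- B$2$1)"
      have x: "x\<^sup>2 * B$2$1 = -1" using True by (simp add: x_def power_divide)
      have c1: "(1 + p) * p + B$1$2 * B$2$1 = p" using dB by (simp add: power2_eq_square algebra_simps)
      have "det (M2 (x * p) x (x * B$2$1) 0) = 1" using x by (simp add: power2_eq_square algebra_simps)
      moreover have "B ** M2 (x * p) x (x * B$2$1) 0 = M2 (x * p) x (x * B$2$1) 0 ** M2 1 1 0 1"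
      proof -
        have "(1 + p) * (x * p) + B$1$2 * (x * B$2$1) = x * ((1 + p) * p + B$1$2 * B$2$1)" by (simp add: algebra_simps)
        then show ?thesis unfolding c1 by (simp add: mat2_eq_iff B11 algebra_simps)
      qed
      ultimately show ?thesis by blast
    next
      case False
      with B have q: "B$2$1 = 0" "B$1$2 > 0" by auto
      with dB have "p = 0" by simp
      have "B ** dilation (B$1$2) = dilation (B$1$2) ** M2 1 1 0 1"
        using q \<open>p = 0\<close> by (simp add: mat2_eq_iff B11 dilation_def field_simps)
      then show ?thesis using q by (intro exI[of _ "dilation (B$1$2)"]) auto
    qed
    then obtain P where P: "det P = 1" "B ** P = P ** M2 1 1 0 1" by blast
    then have "adj2 P ** B ** P = M2 1 1 0 1" by (simp add: matrix_mul_assoc[symmetric] adj2_cancel)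
    then show ?thesis using P B(1) by (auto simp: conjugate_by_def intro!: exI[of _ P] image_eqI[of _ _ B])
  qed
  have "A$2$1 \<noteq> 0 \<or> A$1$2 \<noteq> 0"
  proof (rule ccontr)
    assume n: "\<not> ?thesis"
    moreover have "A$2$2 = 2 - A$1$1" using A(3) by simp
    ultimately have "A$1$1 * (2 - A$1$1) = 1" using Gd(1)[OF A(1)] by (simp add: det_2)
    then have "(A$1$1 - 1)\<^sup>2 = 0" by (simp add: power2_eq_square algebra_simps)
    with n A(2,3) show False by (auto simp: mat2_eq_iff)
  qed
  then have "(A$2$1 < 0 \<or> A$2$1 = 0 \<and> A$1$2 > 0) \<or> (adj2 A $2$1 < 0 \<or> adj2 A $2$1 = 0 \<and> adj2 A $1$2 > 0)"
    by auto
  then have "\<exists>P. det P = 1 \<and> M2 1 1 0 1 \<in> conjugate_by P G"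
    using main[OF A(1) A(3)] main[OF Gd(2)[OF A(1)]] A(3) by (auto simp: add.commute)
  then show ?thesis using that by blast
qed

section \<open>Lattices containing the translation by one\<close>

abbreviation trans :: "real \<Rightarrow> real^2^2" where "trans t \<equiv> M2 1 t 0 1"

locale cusped =
  fixes \<Gamma> :: "(real^2^2) set" and \<delta>0 :: real
  assumes sub: "subgroup \<Gamma> SL2R" and gap: "gap \<Gamma> \<delta>0" and gap_pos: "\<delta>0 > 0"
    and unit_translation: "trans 1 \<in> \<Gamma>"
begin

lemmas det1 = subgroup_SL2R_D(1)[OF sub]
lemmas adj_closed = subgroup_SL2R_D(2)[OF sub]
lemmas one_closed = subgroup_SL2R_D(3)[OF sub]
lemmas mult_closed = subgroup_SL2R_D(4)[OF sub]

lemma countable_group: "countable \<Gamma>"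
  using gap_countable[OF sub gap gap_pos] .

lemma no_limit_one:
  assumes "\<And>n::nat. g n \<in> \<Gamma>" "\<And>n. g n \<noteq> mat 1"
    and "(\<lambda>n. g n $1$1) \<longlonglongrightarrow> 1" "(\<lambda>n. g n $1$2) \<longlonglongrightarrow> 0" "(\<lambda>n. g n $2$1) \<longlonglongrightarrow> 0" "(\<lambda>n. g n $2$2) \<longlonglongrightarrow> 1"
  shows False
proof -
  have "(\<lambda>n. \<bar>g n $1$1 - 1\<bar> + \<bar>g n $1$2\<bar> + \<bar>g n $2$1\<bar> + \<bar>g n $2$2 - 1\<bar>) \<longlonglongrightarrow> \<bar>1 - 1\<bar> + \<bar>0\<bar> + \<bar>0\<bar> + \<bar>1 - 1\<bar>"
    by (intro tendsto_intros assms)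
  then have lim: "(\<lambda>n. \<bar>g n $1$1 - 1\<bar> + \<bar>g n $1$2\<bar> + \<bar>g n $2$1\<bar> + \<bar>g n $2$2 - 1\<bar>) \<longlonglongrightarrow> 0" by simp
  have "\<delta>0 \<le> \<bar>g n $1$1 - 1\<bar> + \<bar>g n $1$2\<bar> + \<bar>g n $2$1\<bar> + \<bar>g n $2$2 - 1\<bar>" for n
    using gap assms(1,2)[of n] norm_le_sum4[of "g n - mat 1"] by (force simp: gap_def)
  then have "\<delta>0 \<le> 0" by (intro LIMSEQ_le_const[OF lim]) auto
  with gap_pos show False by simp
qed

text \<open>Shimizu's lemma: the conjugates \<open>g\<^sub>n T g\<^sub>n\<^sup>-\<^sup>1\<close>, iterated, would accumulate at \<open>T\<close>.\<close>

lemma shimizu: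
  assumes g: "g \<in> \<Gamma>" and c: "g$2$1 \<noteq> 0" shows "\<bar>g$2$1\<bar> \<ge> 1"
proof (rule ccontr)
  assume "\<not> ?thesis"
  then have c1: "\<bar>g$2$1\<bar> < 1" by simp
  define s where "s = rec_nat g (\<lambda>_ h. h ** trans 1 ** adj2 h)"
  have s0: "s 0 = g" and sS: "s (Suc n) = s n ** trans 1 ** adj2 (s n)" for n by (simp_all add: s_def)
  have sG: "s n \<in> \<Gamma>" for n
    by (induction n) (auto simp: s0 sS g intro!: mult_closed adj_closed unit_translation)
  define a where "a n = s n $1$1" for n
  define c where "c n = s n $2$1" for n
  have dets: "s n $1$1 * s n $2$2 - s n $1$2 * s n $2$1 = 1" for n using det1[OF sG[of n]] by (simp add: det_2)
  have e: "s (Suc n) $1$1 = 1 - a n * c n" "s (Suc n) $1$2 = (a n)\<^sup>2" "s (Suc n) $2$1 = - (c n)\<^sup>2"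
     "s (Suc n) $2$2 = 1 + a n * c n" for n
    unfolding sS a_def c_def using dets[of n] by (simp_all add: power2_eq_square algebra_simps)
  have aS: "a (Suc n) = 1 - a n * c n" and cS: "c (Suc n) = - (c n)\<^sup>2" for n
    using e[of n] by (simp_all add: a_def c_def)
  have cb: "\<bar>c n\<bar> \<le> \<bar>g$2$1\<bar>^(n+1) \<and> c n \<noteq> 0" for n
  proof (induction n)
    case 0 then show ?case using assms by (simp add: c_def s0)
  next
    case (Suc n)
    have "\<bar>c n\<bar> \<le> \<bar>g$2$1\<bar>^(n+1)" using Suc by simp
    also have "\<dots> \<le> \<bar>g$2$1\<bar>^1" using c1 by (intro power_decreasing) auto
    finally have "\<bar>c n\<bar> \<le> \<bar>g$2$1\<bar>" by simp
    then have "\<bar>c n\<bar> * \<bar>c n\<bar> \<le> \<bar>g$2$1\<bar> * \<bar>g$2$1\<bar>^(n+1)" using Suc by (intro mult_mono) auto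
    then show ?case using Suc by (simp add: cS abs_mult power2_eq_square)
  qed
  have cc: "\<bar>c n\<bar> \<le> \<bar>g$2$1\<bar>" for n
  proof -
    have "\<bar>c n\<bar> \<le> \<bar>g$2$1\<bar>^(n+1)" using cb by simp
    also have "\<dots> \<le> \<bar>g$2$1\<bar>^1" using c1 by (intro power_decreasing) auto
    finally show ?thesis by simp
  qed
  define M where "M = max \<bar>a 0\<bar> (1 / (1 - \<bar>g$2$1\<bar>))"
  have M0: "M \<ge> 0" by (simp add: M_def)
  have M1: "1 + M * \<bar>g$2$1\<bar> \<le> M"
  proof -
    have "1 / (1 - \<bar>g$2$1\<bar>) \<le> M" by (simp add: M_def)
    then have "1 \<le> M * (1 - \<bar>g$2$1\<bar>)" using c1 by (simp add: field_simps)
    then show ?thesis by (simp add: algebra_simps)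
  qed
  have ab: "\<bar>a n\<bar> \<le> M" for n
  proof (induction n)
    case 0 then show ?case by (simp add: M_def)
  next
    case (Suc n)
    have "\<bar>a (Suc n)\<bar> \<le> 1 + \<bar>a n\<bar> * \<bar>c n\<bar>"
      unfolding aS using abs_triangle_ineq4[of 1 "a n * c n"] by (simp add: abs_mult)
    also have "\<dots> \<le> 1 + M * \<bar>g$2$1\<bar>" using Suc cc[of n] M0 by (intro add_left_mono mult_mono) auto
    finally show ?case using M1 by simp
  qed
  have clim: "c \<longlonglongrightarrow> 0"
  proof (rule Lim_null_comparison)
    have "(\<lambda>n. \<bar>g$2$1\<bar>^n * \<bar>g$2$1\<bar>) \<longlonglongrightarrow> 0 * \<bar>g$2$1\<bar>"
      using c1 by (intro tendsto_intros LIMSEQ_power_zero) auto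
    then show "(\<lambda>n. \<bar>g$2$1\<bar>^(n+1)) \<longlonglongrightarrow> 0" by (simp add: mult.commute)
    show "\<forall>\<^sub>F n in sequentially. norm (c n) \<le> \<bar>g$2$1\<bar>^(n+1)" using cb by (intro always_eventually) auto
  qed
  have aclim: "(\<lambda>n. a n * c n) \<longlonglongrightarrow> 0"
  proof (rule Lim_null_comparison)
    have "(\<lambda>n. M * \<bar>c n\<bar>) \<longlonglongrightarrow> M * \<bar>0\<bar>" by (intro tendsto_intros clim)
    then show "(\<lambda>n. M * \<bar>c n\<bar>) \<longlonglongrightarrow> 0" by simp
    show "\<forall>\<^sub>F n in sequentially. norm (a n * c n) \<le> M * \<bar>c n\<bar>"
      using ab by (intro always_eventually) (auto simp: abs_mult intro!: mult_right_mono)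
  qed
  have aSlim: "(\<lambda>n. a (Suc n)) \<longlonglongrightarrow> 1 - 0" unfolding aS by (intro tendsto_intros aclim)
  define h where "h n = adj2 (trans 1) ** s (Suc (Suc n))" for n
  show False
  proof (rule no_limit_one[of h])
    show "h n \<in> \<Gamma>" for n unfolding h_def by (intro mult_closed adj_closed unit_translation sG)
    show "h n \<noteq> mat 1" for n
    proof
      assume "h n = mat 1"
      then have "h n $2$1 = 0" by simp
      then have "c (Suc (Suc n)) = 0" by (simp add: h_def c_def)
      with cb show False by blast
    qed
    have ac1: "(\<lambda>n. a (Suc n) * c (Suc n)) \<longlonglongrightarrow> 0" and c1: "(\<lambda>n. c (Suc n)) \<longlonglongrightarrow> 0"
      using aclim clim LIMSEQ_Suc by blast+
    have "(\<lambda>n. 1 - a (Suc n) * c (Suc n) - (- (c (Suc n))\<^sup>2)) \<longlonglongrightarrow> 1 - 0 - (- 0\<^sup>2)"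
      by (intro tendsto_intros ac1 c1)
    then show "(\<lambda>n. h n $1$1) \<longlonglongrightarrow> 1" by (simp add: h_def e)
    have "(\<lambda>n. (a (Suc n))\<^sup>2 - (1 + a (Suc n) * c (Suc n))) \<longlonglongrightarrow> (1 - 0)\<^sup>2 - (1 + 0)"
      by (intro tendsto_intros ac1 aSlim)
    then show "(\<lambda>n. h n $1$2) \<longlonglongrightarrow> 0" by (simp add: h_def e algebra_simps)
    have "(\<lambda>n. - (c (Suc n))\<^sup>2) \<longlonglongrightarrow> - 0\<^sup>2" by (intro tendsto_intros c1)
    then show "(\<lambda>n. h n $2$1) \<longlonglongrightarrow> 0" by (simp add: h_def e)
    have "(\<lambda>n. 1 + a (Suc n) * c (Suc n)) \<longlonglongrightarrow> 1 + 0" by (intro tendsto_intros ac1)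
    then show "(\<lambda>n. h n $2$2) \<longlonglongrightarrow> 1" by (simp add: h_def e)
  qed
qed

lemma upper_triangular:
  assumes g: "g \<in> \<Gamma>" and c: "g$2$1 = 0"
  shows "g$1$1 = g$2$2" "(g$2$2)\<^sup>2 = 1"
proof -
  have no: "\<not> \<bar>h$1$1\<bar> < 1" if h: "h \<in> \<Gamma>" "h$2$1 = 0" for h
  proof
    assume a: "\<bar>h$1$1\<bar> < 1"
    have dh: "h$1$1 * h$2$2 = 1" using det1[OF h(1)] h(2) by (simp add: det_2)
    then have hnz: "h$1$1 \<noteq> 0" by auto
    define s where "s = rec_nat (trans 1) (\<lambda>_ k. h ** k ** adj2 h)"
    have s0: "s 0 = trans 1" and sS: "s (Suc n) = h ** s n ** adj2 h" for n by (simp_all add: s_def)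
    have sG: "s n \<in> \<Gamma>" for n
      by (induction n) (auto simp: s0 sS intro!: mult_closed adj_closed unit_translation h)
    have s: "s n = trans ((h$1$1)^(2*n))" for n
    proof (induction n)
      case (Suc n)
      show ?case unfolding sS Suc
        using dh h(2) by (simp add: mat2_eq_iff algebra_simps)
    qed (simp add: s0)
    show False
    proof (rule no_limit_one[OF sG])
      show "s n \<noteq> mat 1" for n using hnz by (simp add: s mat2_eq_iff)
      have "\<bar>(h$1$1)\<^sup>2\<bar> < 1" using a by (simp add: abs_square_less_1)
      then have "(\<lambda>n. ((h$1$1)\<^sup>2)^n) \<longlonglongrightarrow> 0" by (intro LIMSEQ_power_zero) simp
      then show "(\<lambda>n. s n $1$2) \<longlonglongrightarrow> 0" by (simp add: s power_mult)
    qed (simp_all add: s)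
  qed
  have dg: "g$1$1 * g$2$2 = 1" using det1[OF g] c by (simp add: det_2)
  have "\<not> \<bar>g$1$1\<bar> < 1" using no[OF g c] .
  moreover have "\<not> \<bar>g$2$2\<bar> < 1" using no[OF adj_closed[OF g]] c by simp
  moreover have "\<bar>g$1$1\<bar> * \<bar>g$2$2\<bar> = 1" using dg by (metis abs_mult abs_one)
  ultimately have "\<bar>g$2$2\<bar> = 1"
    by (smt (verit, best) mult_le_cancel_right1 mult_le_cancel_left1)
  then show "(g$2$2)\<^sup>2 = 1" by (metis power2_abs power_one)
  then have "g$2$2 * g$2$2 = 1" by (simp add: power2_eq_square)
  with dg show "g$1$1 = g$2$2" by (metis mult_right_cancel mult_zero_right zero_neq_one)
qed

lemma trans_closed: "trans (of_int n) \<in> \<Gamma>"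
proof -
  have nat: "trans (of_nat m) \<in> \<Gamma>" for m
  proof (induction m)
    case 0 have "trans 0 = mat 1" by (simp add: mat2_eq_iff)
    then show ?case using one_closed by simp
  next
    case (Suc m)
    have "trans (of_nat (Suc m)) = trans 1 ** trans (of_nat m)" by (simp add: mat2_eq_iff)
    then show ?case using mult_closed[OF unit_translation Suc] by simp
  qed
  show ?thesis
  proof (cases "n \<ge> 0")
    case True then show ?thesis using nat[of "nat n"] by simp
  next
    case False
    have "adj2 (trans (of_nat (nat (-n)))) \<in> \<Gamma>" by (intro adj_closed nat)
    moreover have "adj2 (trans (of_nat (nat (-n)))) = trans (of_int n)" using False by (simp add: mat2_eq_iff)
    ultimately show ?thesis by simp
  qed
qed

text \<open>\<open>c d' - c' d\<close> is the lower left entry of \<open>h g\<^sup>-\<^sup>1\<close>.\<close>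

lemma rows:
  assumes g: "g \<in> \<Gamma>" and h: "h \<in> \<Gamma>"
  shows "\<bar>g$2$1 * h$2$2 - h$2$1 * g$2$2\<bar> \<ge> 1 \<or>
    (h$2$1 = g$2$1 \<and> h$2$2 = g$2$2) \<or> (h$2$1 = - g$2$1 \<and> h$2$2 = - g$2$2)"
proof -
  define k where "k = h ** adj2 g"
  have k: "k \<in> \<Gamma>" unfolding k_def by (intro mult_closed adj_closed g h)
  have k21: "k$2$1 = h$2$1 * g$2$2 - h$2$2 * g$2$1" by (simp add: k_def)
  have hk: "h = k ** g" unfolding k_def using adj2_cancel(4)[OF det1[OF g]] by simp
  show ?thesis
  proof (cases "k$2$1 = 0")
    case False
    then have "\<bar>k$2$1\<bar> \<ge> 1" using shimizu k by blast
    then show ?thesis unfolding k21 by (simp add: abs_minus_commute mult.commute)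
  next
    case True
    then have "(k$2$2)\<^sup>2 = 1" using upper_triangular(2)[OF k] by simp
    then have "k$2$2 = 1 \<or> k$2$2 = -1" by (simp add: power2_eq_1_iff)
    moreover have "h$2$1 = k$2$2 * g$2$1" "h$2$2 = k$2$2 * g$2$2"
      unfolding hk using True by simp_all
    ultimately show ?thesis by auto
  qed
qed

lemma same_row:
  assumes g: "g \<in> \<Gamma>" and h: "h \<in> \<Gamma>" and row: "h$2$1 = g$2$1" "h$2$2 = g$2$2" and z: "Im z > 0"
  shows "h ** adj2 g = trans (Re (mobius h z) - Re (mobius g z))"
proof -
  define k where "k = h ** adj2 g"
  have k: "k \<in> \<Gamma>" unfolding k_def by (intro mult_closed adj_closed g h)
  have dg: "g$1$1 * g$2$2 - g$1$2 * g$2$1 = 1" using det1[OF g] by (simp add: det_2)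
  have k2: "k$2$1 = 0" "k$2$2 = 1" using dg row by (simp_all add: k_def algebra_simps)
  then have k1: "k$1$1 = 1" using upper_triangular(1)[OF k] by simp
  have hk: "h = k ** g" unfolding k_def using adj2_cancel(4)[OF det1[OF g]] by simp
  have "mobius h z = mobius k (mobius g z)" unfolding hk by (rule mobius_mult[OF det1[OF k] det1[OF g] z])
  also have "\<dots> = mobius g z + of_real (k$1$2)" by (simp add: mobius_def k1 k2)
  finally have "k$1$2 = Re (mobius h z) - Re (mobius g z)" by simp
  then show ?thesis by (simp add: mat2_eq_iff k1 k2 k_def[symmetric])
qed

definition strip_bound :: real where "strip_bound = (32 / \<delta>0 + 2)^4"

lemma strip_bound_pos: "strip_bound > 0" unfolding strip_bound_def using gap_pos by (intro zero_less_power add_pos_pos divide_pos_pos) auto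

text \<open>Rows with equal sign, equal shape and equal rounded slope of \<open>c z + d\<close> coincide, since
  the cross products of the vectors \<open>c z + d\<close> are at least \<open>Im z\<close> otherwise.\<close>

lemma orbit_points_in_strip:
  assumes z: "Im z > 0" and Y: "Y > 0"
  defines "S \<equiv> {g\<in>\<Gamma>. Re (mobius g z) \<in> {0..1} \<and> Im (mobius g z) \<in> {Y..2 * Y}}"
  shows "finite S \<and> real (card S) \<le> 4 * (2 / Y + 2) * strip_bound"
proof -
  define v where "v g = autf g z" for g
  define p where "p g \<longleftrightarrow> \<bar>Re (v g)\<bar> \<ge> \<bar>Im (v g)\<bar>" for g
  define m where "m g = (if p g then Im (v g) / Re (v g) else Re (v g) / Im (v g))" for g
  define key where "key g = (p g, g$2$1 > 0 \<or> g$2$1 = 0 \<and> g$2$2 > 0, \<lfloor>m g / Y\<rfloor>)" for g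
  let ?K = "UNIV \<times> UNIV \<times> {\<lfloor>-(1/Y)\<rfloor>..\<lfloor>1/Y\<rfloor>} :: (bool \<times> bool \<times> int) set"
  have vn: "(cmod (v g))\<^sup>2 \<le> Im z / Y" if "g \<in> S" for g
  proof -
    have g: "g \<in> \<Gamma>" "Im (mobius g z) \<ge> Y" using that by (auto simp: S_def)
    have "Y \<le> Im z / (cmod (v g))\<^sup>2" using g mobius_Im[OF det1[OF g(1)] z] by (simp add: v_def)
    moreover have "(cmod (v g))\<^sup>2 > 0" using autf_nz[OF det1[OF g(1)] z] by (simp add: v_def)
    ultimately show ?thesis using Y by (simp add: field_simps)
  qed
  have vnz: "Re (v g) \<noteq> 0 \<or> Im (v g) \<noteq> 0" if "g \<in> S" for g
    using that autf_nz[OF det1 z, of g] by (auto simp: S_def v_def complex_eq_iff)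
  have m1: "\<bar>m g\<bar> \<le> 1" if "g \<in> S" for g
    using vnz[OF that] by (auto simp: m_def p_def abs_divide divide_le_eq_1)
  have keyK: "key g \<in> ?K" if "g \<in> S" for g
  proof -
    have "-1 \<le> m g" "m g \<le> 1" using m1[OF that] by linarith+
    then have "-(1/Y) \<le> m g / Y" "m g / Y \<le> 1 / Y" using Y by (simp_all add: field_simps)
    then show ?thesis by (auto simp: key_def intro: floor_mono)
  qed
  have cross: "Re (v g) * Im (v h) - Im (v g) * Re (v h) = Im z * (g$2$2 * h$2$1 - g$2$1 * h$2$2)" for g h
    by (simp add: v_def algebra_simps)
  have rowkey: "h$2$1 = g$2$1 \<and> h$2$2 = g$2$2" if gh: "g \<in> S" "h \<in> S" "key g = key h" for g h
  proof -
    have gG: "g \<in> \<Gamma>" "h \<in> \<Gamma>" using gh by (auto simp: S_def)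
    have fl: "\<lfloor>m g / Y\<rfloor> = \<lfloor>m h / Y\<rfloor>" and pp: "p g = p h" using gh(3) by (auto simp: key_def)
    have "\<bar>m g / Y - m h / Y\<bar> < 1" using fl by linarith
    moreover have "m g / Y - m h / Y = (m g - m h) / Y" by (simp add: diff_divide_distrib)
    ultimately have "\<bar>m g - m h\<bar> / Y < 1" using Y by (simp add: abs_divide)
    then have md: "\<bar>m g - m h\<bar> < Y" using Y by (simp add: field_simps)
    have sq: "\<bar>x * y\<bar> \<le> Im z / Y" if "x\<^sup>2 \<le> Im z / Y" "y\<^sup>2 \<le> Im z / Y" for x y
    proof -
      have "2 * \<bar>x * y\<bar> \<le> x\<^sup>2 + y\<^sup>2" using sum_squares_bound[of "\<bar>x\<bar>" "\<bar>y\<bar>"] by (simp add: abs_mult)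
      with that show ?thesis by linarith
    qed
    have Reb: "(Re (v k))\<^sup>2 \<le> Im z / Y" "(Im (v k))\<^sup>2 \<le> Im z / Y" if "k \<in> S" for k
      using vn[OF that] unfolding cmod_power2 by (smt (verit) zero_le_power2)+
    have small: "\<bar>Re (v g) * Im (v h) - Im (v g) * Re (v h)\<bar> < Im z"
    proof (cases "p g")
      case True
      then have nz: "Re (v g) \<noteq> 0" "Re (v h) \<noteq> 0"
        using pp vnz[OF gh(1)] vnz[OF gh(2)] by (auto simp: p_def)
      have "Re (v g) * Im (v h) - Im (v g) * Re (v h) = (m h - m g) * (Re (v g) * Re (v h))"
        using nz True pp by (simp add: m_def field_simps)
      then have "\<bar>Re (v g) * Im (v h) - Im (v g) * Re (v h)\<bar> = \<bar>m g - m h\<bar> * \<bar>Re (v g) * Re (v h)\<bar>"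
        by (simp add: abs_mult abs_minus_commute)
      also have "\<dots> < Y * \<bar>Re (v g) * Re (v h)\<bar>" using md nz by (intro mult_strict_right_mono) auto
      also have "\<dots> \<le> Y * (Im z / Y)" using Y Reb gh by (intro mult_left_mono sq) auto
      finally show ?thesis using Y by simp
    next
      case False
      then have nz: "Im (v g) \<noteq> 0" "Im (v h) \<noteq> 0"
        using pp by (auto simp: p_def)
      have "Re (v g) * Im (v h) - Im (v g) * Re (v h) = (m g - m h) * (Im (v g) * Im (v h))"
        using nz False pp by (simp add: m_def field_simps)
      then have "\<bar>Re (v g) * Im (v h) - Im (v g) * Re (v h)\<bar> = \<bar>m g - m h\<bar> * \<bar>Im (v g) * Im (v h)\<bar>"
        by (simp add: abs_mult)
      also have "\<dots> < Y * \<bar>Im (v g) * Im (v h)\<bar>" using md nz by (intro mult_strict_right_mono) auto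
      also have "\<dots> \<le> Y * (Im z / Y)" using Y Reb gh by (intro mult_left_mono sq) auto
      finally show ?thesis using Y by simp
    qed
    then have "\<bar>g$2$2 * h$2$1 - g$2$1 * h$2$2\<bar> < 1" unfolding cross using z by (simp add: abs_mult)
    then have "\<not> \<bar>g$2$1 * h$2$2 - h$2$1 * g$2$2\<bar> \<ge> 1"
      by (simp add: abs_minus_commute mult.commute)
    then have "(h$2$1 = g$2$1 \<and> h$2$2 = g$2$2) \<or> (h$2$1 = - g$2$1 \<and> h$2$2 = - g$2$2)"
      using rows[OF gG] by blast
    moreover have "(g$2$1 > 0 \<or> g$2$1 = 0 \<and> g$2$2 > 0) = (h$2$1 > 0 \<or> h$2$1 = 0 \<and> h$2$2 > 0)"
      using gh(3) by (simp add: key_def)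
    ultimately show ?thesis using det_row2[OF det1[OF gG(1)]] by auto
  qed
  define N1 where "N1 = {A\<in>\<Gamma>. norm A \<le> 2}"
  have N1: "finite N1 \<and> real (card N1) \<le> strip_bound"
    unfolding N1_def strip_bound_def using gap_card[OF sub gap gap_pos, of 2] by simp
  define Sk where "Sk k = {g\<in>S. key g = k}" for k
  have fiber: "finite (Sk k) \<and> card (Sk k) \<le> card N1" for k
  proof (cases "Sk k = {}")
    case False
    then obtain g0 where g0: "g0 \<in> S" "key g0 = k" by (auto simp: Sk_def)
    have g0G: "g0 \<in> \<Gamma>" using g0 by (auto simp: S_def)
    have "g ** adj2 g0 \<in> N1" if "g \<in> Sk k" for g
    proof -
      have g: "g \<in> S" "key g0 = key g" using that g0 by (auto simp: Sk_def)
      have gG: "g \<in> \<Gamma>" using g by (auto simp: S_def)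
      define t where "t = Re (mobius g z) - Re (mobius g0 z)"
      have eq: "g ** adj2 g0 = trans t"
        unfolding t_def using rowkey[OF g0(1) g(1,2)] by (intro same_row g0G gG z) auto
      have "Re (mobius g z) \<in> {0..1}" "Re (mobius g0 z) \<in> {0..1}" using g g0 by (auto simp: S_def)
      then have "\<bar>t\<bar> \<le> 1" by (auto simp: t_def)
      then have "t\<^sup>2 \<le> 1" by (simp add: abs_square_le_1)
      then have "(norm (trans t))\<^sup>2 \<le> 2\<^sup>2" by (simp add: sqn_norm[symmetric] sqn_def)
      then have "norm (trans t) \<le> 2" by (rule power2_le_imp_le) simp
      moreover have "g ** adj2 g0 \<in> \<Gamma>" by (intro mult_closed adj_closed gG g0G)
      ultimately show ?thesis unfolding N1_def eq by simp
    qed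
    then have sub: "(\<lambda>g. g ** adj2 g0) ` Sk k \<subseteq> N1" by blast
    have inj: "inj_on (\<lambda>g. g ** adj2 g0) (Sk k)"
      by (rule inj_on_inverseI[of _ "\<lambda>h. h ** g0"]) (simp add: adj2_cancel[OF det1[OF g0G]])
    have "finite ((\<lambda>g. g ** adj2 g0) ` Sk k)" using sub N1 by (meson finite_subset)
    then have "finite (Sk k)" using inj by (rule finite_imageD)
    then show ?thesis using card_inj_on_le[OF inj sub] N1 by simp
  qed simp
  have SU: "S = (\<Union>k\<in>?K. Sk k)" using keyK by (auto simp: Sk_def)
  have finK: "finite ?K" by simp
  have "finite S" unfolding SU using fiber finK by blast
  moreover have "real (card S) \<le> 4 * (2 / Y + 2) * strip_bound"
  proof -
    have "card S \<le> (\<Sum>k\<in>?K. card (Sk k))" unfolding SU by (rule card_UN_le[OF finK])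
    also have "\<dots> \<le> (\<Sum>k\<in>?K. card N1)" using fiber by (intro sum_mono) auto
    also have "\<dots> = card ?K * card N1" by simp
    finally have "real (card S) \<le> real (card ?K) * real (card N1)" by (metis of_nat_le_iff of_nat_mult)
    also have "real (card ?K) = 4 * real (card {\<lfloor>-(1/Y)\<rfloor>..\<lfloor>1/Y\<rfloor>})"
      by (simp only: card_cartesian_product card_UNIV_bool of_nat_mult)
    also have "\<dots> * real (card N1) \<le> 4 * (2 / Y + 2) * strip_bound"
      using floor_box_card[of "1/Y"] Y N1 strip_bound_pos by (intro mult_mono) auto
    finally show ?thesis .
  qed
  ultimately show ?thesis ..
qed

end

locale cusped_lattice = cusped +
  assumes covol: "finite_covolume \<Gamma>"
begin

definition low_reals :: "real \<Rightarrow> real \<Rightarrow> real set" where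
  "low_reals Y \<delta> = {x\<in>{0..1}. \<forall>y\<in>{Y<..<2 * Y}. \<forall>g\<in>\<Gamma>. Im (mobius g (Complex x y)) \<le> \<delta>}"

lemma low_reals_borel:
  assumes Y: "Y > 0" shows "low_reals Y \<delta> \<in> sets borel"
proof -
  have "open {x. Im (mobius g (Complex x y)) > \<delta>}" if g: "g \<in> \<Gamma>" and y: "y > 0" for g y
  proof (rule open_Collect_less)
    have "(\<lambda>x. Im (mobius g (Complex x y))) = (\<lambda>x. y / ((g$2$1 * x + g$2$2)\<^sup>2 + (g$2$1 * y)\<^sup>2))"
      using y mobius_Im[OF det1[OF g]] by (simp add: cmod_autf fun_eq_iff del: of_real_mult)
    moreover have "(g$2$1 * x + g$2$2)\<^sup>2 + (g$2$1 * y)\<^sup>2 \<noteq> 0" for x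
      using y det_row2[OF det1[OF g]] by (auto simp: sum_power2_eq_zero_iff)
    ultimately show "continuous_on UNIV (\<lambda>x. Im (mobius g (Complex x y)))"
      by (simp only:) (intro continuous_intros ballI)
  qed (intro continuous_intros)
  then have "open (\<Union>y\<in>{Y<..<2 * Y}. \<Union>g\<in>\<Gamma>. {x. Im (mobius g (Complex x y)) > \<delta>})"
    using Y by (intro open_UN ballI) auto
  moreover have "low_reals Y \<delta> = {0..1} - (\<Union>y\<in>{Y<..<2 * Y}. \<Union>g\<in>\<Gamma>. {x. Im (mobius g (Complex x y)) > \<delta>})"
    unfolding low_reals_def by (fastforce simp: not_less)
  ultimately show ?thesis by auto
qed

lemma recurrence:
  assumes e: "\<epsilon> > 0"
  shows "\<exists>\<delta>>0. \<forall>Y. 0 < Y \<and> Y \<le> 1 \<longrightarrow> measure lborel (low_reals Y \<delta>) \<le> \<epsilon>"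
proof -
  obtain F where F: "fundamental_set \<Gamma> F" "emeasure hyperbolic_area F < \<infinity>"
    using covol by (auto simp: finite_covolume_def)
  have Fb: "F \<in> sets borel" "F \<subseteq> upper_half_plane" using F by (auto simp: fundamental_set_def)
  define Fd where "Fd n = {w\<in>F. \<forall>g\<in>\<Gamma>. Im (mobius g w) \<le> 1 / real (Suc n)}" for n
  have Fdb: "Fd n \<in> sets borel" for n
  proof -
    have "Fd n = F \<inter> (\<Inter>g\<in>\<Gamma>. mobius g -` {w. Im w \<le> 1 / real (Suc n)})" by (auto simp: Fd_def)
    moreover have "(\<Inter>g\<in>\<Gamma>. mobius g -` {w. Im w \<le> 1 / real (Suc n)}) \<in> sets borel"
    proof (rule sets.countable_INT'')
      show "countable \<Gamma>" by (rule countable_group)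
      show "UNIV \<in> sets borel" by simp
      have "{w. Im w \<le> 1 / real (Suc n)} \<in> sets borel" by measurable
      then show "mobius g -` {w. Im w \<le> 1 / real (Suc n)} \<in> sets borel" for g
        by (rule measurable_sets_borel[OF measurable_mobius])
    qed
    ultimately show ?thesis using Fb by simp
  qed
  have dec: "decseq Fd"
  proof -
    have "1 / real (Suc n) \<le> 1 / real (Suc m)" if "m \<le> n" for m n using that by (intro divide_left_mono) auto
    then show ?thesis unfolding decseq_def Fd_def by (blast intro: order_trans)
  qed
  have "(\<Inter>n. Fd n) = {}"
  proof -
    have False if w: "\<And>n. w \<in> Fd n" for w
    proof -
      have "Im w > 0" using w[of 0] Fb by (auto simp: Fd_def upper_half_plane_def)
      then obtain n where n: "1 / real (Suc n) < Im w" using nat_approx_posE by blast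
      have "Im (mobius (mat 1) w) \<le> 1 / real (Suc n)" using w[of n] one_closed by (auto simp: Fd_def)
      with n show False by simp
    qed
    then show ?thesis by blast
  qed
  moreover have "(\<lambda>n. emeasure hyperbolic_area (Fd n)) \<longlonglongrightarrow> emeasure hyperbolic_area (\<Inter>n. Fd n)"
  proof (rule Lim_emeasure_decseq)
    show "range Fd \<subseteq> sets hyperbolic_area" using Fdb by auto
    show "decseq Fd" by (rule dec)
    have "emeasure hyperbolic_area (Fd n) \<le> emeasure hyperbolic_area F" for n
      using Fb by (intro emeasure_mono) (auto simp: Fd_def)
    then show "emeasure hyperbolic_area (Fd n) \<noteq> \<infinity>" for n using F(2) by (metis leD infinity_ennreal_def top.not_eq_extremum)
  qed
  ultimately have lim: "(\<lambda>n. emeasure hyperbolic_area (Fd n)) \<longlonglongrightarrow> 0" by simp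
  define c where "c = \<epsilon> / (64 * strip_bound)"
  have c: "c > 0" using e strip_bound_pos by (simp add: c_def)
  have "\<forall>\<^sub>F n in sequentially. emeasure hyperbolic_area (Fd n) < ennreal c"
    using lim c by (intro order_tendstoD) auto
  then obtain n where n: "emeasure hyperbolic_area (Fd n) < ennreal c"
    by (auto simp: eventually_sequentially)
  define \<delta> where "\<delta> = 1 / real (Suc n)"
  have "measure lborel (low_reals Y \<delta>) \<le> \<epsilon>" if Y: "0 < Y" "Y \<le> 1" for Y
  proof -
    define B where "B = {z. Re z \<in> low_reals Y \<delta> \<and> Im z \<in> {Y<..<2 * Y}}"
    note Xb = low_reals_borel[OF Y(1), of \<delta>]
    have Bb: "B \<in> sets borel"
    proof -
      have "B = Re -` low_reals Y \<delta> \<inter> Im -` {Y<..<2 * Y}" by (auto simp: B_def)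
      then show ?thesis using Xb
        by (auto intro!: sets.Int measurable_sets_borel[OF _ Xb] measurable_sets_borel[of Im])
    qed
    have BH: "B \<subseteq> upper_half_plane" using Y by (auto simp: B_def upper_half_plane_def)
    have Xfin: "emeasure lborel (low_reals Y \<delta>) \<le> 1"
    proof -
      have "emeasure lborel (low_reals Y \<delta>) \<le> emeasure lborel {0..1::real}" by (intro emeasure_mono) (auto simp: low_reals_def)
      then show ?thesis by simp
    qed
    then have Xe: "emeasure lborel (low_reals Y \<delta>) = ennreal (measure lborel (low_reals Y \<delta>))"
      by (intro emeasure_eq_ennreal_measure) (auto simp: top_unique)
    have "ennreal (1 / (4 * Y\<^sup>2)) * emeasure lborel B = (\<integral>\<^sup>+z. ennreal (1 / (4 * Y\<^sup>2)) * indicator B z \<partial>lborel)"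
      using Bb by (simp add: nn_integral_cmult_indicator)
    also have "\<dots> \<le> (\<integral>\<^sup>+z. ennreal (1 / (Im z)\<^sup>2) * indicator B z \<partial>lborel)"
    proof (intro nn_integral_mono)
      fix z show "ennreal (1 / (4 * Y\<^sup>2)) * indicator B z \<le> ennreal (1 / (Im z)\<^sup>2) * indicator B z"
      proof (cases "z \<in> B")
        case True
        then have zz: "0 < Im z" "Im z \<le> 2 * Y" using Y by (auto simp: B_def)
        then have "(Im z)\<^sup>2 \<le> (2 * Y)\<^sup>2" by (intro power_mono) auto
        then have "1 / (4 * Y\<^sup>2) \<le> 1 / (Im z)\<^sup>2" using zz Y by (intro divide_left_mono) (auto simp: power_mult_distrib)
        then show ?thesis using True by (simp add: ennreal_leI)
      qed simp
    qed
    also have "\<dots> = emeasure hyperbolic_area B"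
      by (intro emeasure_hyperbolic_area[symmetric] Bb BH)
    also have "\<dots> \<le> ennreal (4 * (2 / Y + 2) * strip_bound) * emeasure hyperbolic_area (Fd n)"
    proof (rule area_le_multiplicity[OF sub countable_group F(1) Bb BH Fdb])
      fix w g assume w: "w \<in> F" "g \<in> \<Gamma>" "mobius g w \<in> B"
      have wH: "Im w > 0" using w Fb by (auto simp: upper_half_plane_def)
      have "Im (mobius h w) \<le> 1 / real (Suc n)" if h: "h \<in> \<Gamma>" for h
      proof -
        have "mobius (h ** adj2 g) (mobius g w) = mobius h w"
          using mobius_mult[of h "adj2 g" "mobius g w"] det1[OF h] det1[OF w(2)] mobius_Im_pos[OF det1[OF w(2)] wH] wH
          by (simp add: mobius_adj2)
        moreover have "h ** adj2 g \<in> \<Gamma>" using h w by (intro mult_closed adj_closed)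
        moreover have "Complex (Re (mobius g w)) (Im (mobius g w)) = mobius g w" by simp
        ultimately show ?thesis using w(3) unfolding B_def low_reals_def \<delta>_def
          by (metis (no_types, lifting) mem_Collect_eq)
      qed
      then show "w \<in> Fd n" using w by (simp add: Fd_def)
    next
      fix w assume "w \<in> upper_half_plane"
      then have w: "Im w > 0" by (simp add: upper_half_plane_def)
      let ?S = "{g\<in>\<Gamma>. Re (mobius g w) \<in> {0..1} \<and> Im (mobius g w) \<in> {Y..2 * Y}}"
      have sub: "{g\<in>\<Gamma>. mobius g w \<in> B} \<subseteq> ?S" by (auto simp: B_def low_reals_def)
      note S = orbit_points_in_strip[OF w Y(1)]
      have "finite {g\<in>\<Gamma>. mobius g w \<in> B}" using sub S by (meson finite_subset)
      moreover have "card {g\<in>\<Gamma>. mobius g w \<in> B} \<le> card ?S" using sub S by (intro card_mono) auto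
      ultimately show "finite {g\<in>\<Gamma>. mobius g w \<in> B} \<and> real (card {g\<in>\<Gamma>. mobius g w \<in> B}) \<le> 4 * (2 / Y + 2) * strip_bound"
        using S by linarith
    qed
    also have "\<dots> \<le> ennreal (4 * (2 / Y + 2) * strip_bound) * ennreal c" using n by (intro mult_left_mono) auto
    also have "\<dots> = ennreal (4 * (2 / Y + 2) * strip_bound * c)"
      using Y strip_bound_pos c by (subst ennreal_mult[symmetric]) auto
    also have "emeasure lborel B = ennreal (measure lborel (low_reals Y \<delta>)) * ennreal Y"
      unfolding B_def using Xb Y by (subst emeasure_lborel_complex_Times) (auto simp: Xe)
    also have "ennreal (1 / (4 * Y\<^sup>2)) * (ennreal (measure lborel (low_reals Y \<delta>)) * ennreal Y) = ennreal (measure lborel (low_reals Y \<delta>) / (4 * Y))"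
      using Y by (subst ennreal_mult[symmetric], simp, simp, subst ennreal_mult[symmetric]) (auto simp: power2_eq_square field_simps)
    finally have "measure lborel (low_reals Y \<delta>) / (4 * Y) \<le> 4 * (2 / Y + 2) * strip_bound * c"
      using Y strip_bound_pos c by (subst (asm) ennreal_le_iff) auto
    then have "measure lborel (low_reals Y \<delta>) \<le> 4 * (2 / Y + 2) * strip_bound * c * (4 * Y)"
      using Y by (subst (asm) pos_divide_le_eq) auto
    also have "\<dots> = (32 + 32 * Y) * (strip_bound * c)" using Y by (simp add: field_simps)
    also have "\<dots> \<le> 64 * (strip_bound * c)" using Y strip_bound_pos c by (intro mult_right_mono) auto
    also have "\<dots> = \<epsilon>" using strip_bound_pos by (simp add: c_def)
    finally show ?thesis .
  qed
  moreover have "\<delta> > 0" by (simp add: \<delta>_def)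
  ultimately show ?thesis by blast
qed

end

section \<open>Covering and second moment lemmas\<close>

lemma separated_reals_card:
  fixes f :: "'a \<Rightarrow> real"
  assumes s: "s > 0" and ab: "a \<le> b" and f: "\<And>u. u \<in> S \<Longrightarrow> f u \<in> {a..b}"
    and sep: "\<And>u v. u \<in> S \<Longrightarrow> v \<in> S \<Longrightarrow> u \<noteq> v \<Longrightarrow> \<bar>f u - f v\<bar> \<ge> s"
  shows "finite S \<and> real (card S) \<le> (b - a) / s + 1"
proof -
  define k where "k u = nat \<lfloor>(f u - a) / s\<rfloor>" for u
  have nn: "(f u - a) / s \<ge> 0" if "u \<in> S" for u using f[OF that] s by simp
  have inj: "inj_on k S"
  proof (rule inj_onI, rule ccontr)
    fix u v assume uv: "u \<in> S" "v \<in> S" "k u = k v" "u \<noteq> v"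
    have "\<lfloor>(f u - a) / s\<rfloor> = \<lfloor>(f v - a) / s\<rfloor>"
      using uv(3) nn[OF uv(1)] nn[OF uv(2)] by (simp add: k_def eq_nat_nat_iff)
    then have "\<bar>(f u - a) / s - (f v - a) / s\<bar> < 1" by linarith
    moreover have "(f u - a) / s - (f v - a) / s = (f u - f v) / s" by (simp add: diff_divide_distrib)
    ultimately have "\<bar>f u - f v\<bar> / s < 1" using s by (simp add: abs_divide)
    then have "\<bar>f u - f v\<bar> < s" using s by simp
    with sep[OF uv(1,2,4)] show False by simp
  qed
  have sub: "k ` S \<subseteq> {..nat \<lfloor>(b - a) / s\<rfloor>}"
  proof
    fix i assume "i \<in> k ` S"
    then obtain u where u: "u \<in> S" "i = k u" by auto
    have "(f u - a) / s \<le> (b - a) / s" using f[OF u(1)] s by (simp add: divide_right_mono)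
    then show "i \<in> {..nat \<lfloor>(b - a) / s\<rfloor>}" unfolding u(2) k_def by (simp add: nat_mono floor_mono)
  qed
  have "finite (k ` S)" using sub by (rule finite_subset) simp
  then have fin: "finite S" using inj by (rule finite_imageD)
  have "card S \<le> card {..nat \<lfloor>(b - a) / s\<rfloor>}" using card_inj_on_le[OF inj sub] by simp
  then have "real (card S) \<le> real (nat \<lfloor>(b - a) / s\<rfloor>) + 1" by simp
  also have "\<dots> \<le> (b - a) / s + 1" using ab s by (simp add: of_nat_nat)
  finally show ?thesis using fin by blast
qed

lemma second_moment:
  fixes A :: "'i \<Rightarrow> 'a set"
  assumes J: "finite J" and A: "\<And>i. i \<in> J \<Longrightarrow> A i \<in> sets M" "\<And>i. i \<in> J \<Longrightarrow> emeasure M (A i) < \<infinity>"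
    and q: "\<And>i j. i \<in> J \<Longrightarrow> j \<in> J \<Longrightarrow> i \<noteq> j \<Longrightarrow> measure M (A i \<inter> A j) \<le> C * measure M (A i) * measure M (A j)"
    and C: "C > 0" and S: "(\<Sum>i\<in>J. measure M (A i)) \<ge> 1 / C"
  shows "measure M (\<Union>i\<in>J. A i) \<ge> 1 / (2 * C)"
proof -
  define U where "U = (\<Union>i\<in>J. A i)"
  define S where "S = (\<Sum>i\<in>J. measure M (A i))"
  define f :: "'a \<Rightarrow> real" where "f x = (\<Sum>i\<in>J. indicator (A i) x)" for x
  have Sp: "S > 0" using S C by (simp add: S_def) (meson divide_pos_pos less_le_trans zero_less_one)
  have Am: "A i \<in> fmeasurable M" if "i \<in> J" for i using A that by (intro fmeasurableI) auto
  have Um: "U \<in> fmeasurable M" unfolding U_def using J Am by (intro fmeasurable.finite_UN) auto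
  have AAm: "A i \<inter> A j \<in> fmeasurable M" if "i \<in> J" "j \<in> J" for i j using Am that by (intro fmeasurable.Int) auto
  have int: "integrable M (indicator B :: 'a \<Rightarrow> real)" "(\<integral>x. indicator B x \<partial>M) = measure M B" if "B \<in> fmeasurable M" for B
    using that by (auto simp: fmeasurable_def intro!: integrable_real_indicator)
  have fint: "integrable M f" "(\<integral>x. f x \<partial>M) = S"
    unfolding f_def S_def using int Am by (auto intro!: Bochner_Integration.integrable_sum simp: Bochner_Integration.integral_sum)
  have f2: "f x * f x = (\<Sum>i\<in>J. \<Sum>j\<in>J. indicator (A i \<inter> A j) x)" for x
    by (simp add: f_def sum_product indicator_inter_arith)
  have f2int: "integrable M (\<lambda>x. f x * f x)" "(\<integral>x. f x * f x \<partial>M) = (\<Sum>i\<in>J. \<Sum>j\<in>J. measure M (A i \<inter> A j))"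
    unfolding f2 using int AAm by (auto intro!: Bochner_Integration.integrable_sum simp: Bochner_Integration.integral_sum)
  have "(\<integral>x. f x * f x \<partial>M) \<le> (\<Sum>i\<in>J. \<Sum>j\<in>J. (if i = j then measure M (A i) else 0) + C * measure M (A i) * measure M (A j))"
    unfolding f2int
  proof (intro sum_mono)
    fix i j assume "i \<in> J" "j \<in> J"
    then show "measure M (A i \<inter> A j) \<le> (if i = j then measure M (A i) else 0) + C * measure M (A i) * measure M (A j)"
      using q C by auto
  qed
  also have "\<dots> = S + (\<Sum>i\<in>J. \<Sum>j\<in>J. C * measure M (A i) * measure M (A j))"
    using J by (simp add: sum.distrib S_def)
  also have "(\<Sum>i\<in>J. \<Sum>j\<in>J. C * measure M (A i) * measure M (A j)) = C * S * S"
  proof -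
    have "C * (S * S) = C * (\<Sum>i\<in>J. \<Sum>j\<in>J. measure M (A i) * measure M (A j))"
      by (simp only: S_def sum_product)
    also have "\<dots> = (\<Sum>i\<in>J. \<Sum>j\<in>J. C * (measure M (A i) * measure M (A j)))"
      by (simp only: sum_distrib_left)
    finally show ?thesis by (simp only: mult.assoc)
  qed
  finally have I2: "(\<integral>x. f x * f x \<partial>M) \<le> S + C * S * S" .
  have fU: "f x = f x * indicator U x" for x
    by (auto simp: f_def U_def indicator_def)
  have gen: "0 \<le> (\<integral>x. f x * f x \<partial>M) - 2 * l * S + l * l * measure M U" for l
  proof -
    have "0 \<le> (\<integral>x. (f x - l * indicator U x) * (f x - l * indicator U x) \<partial>M)" by (intro integral_nonneg_AE) auto
    also have "(\<lambda>x. (f x - l * indicator U x) * (f x - l * indicator U x)) = (\<lambda>x. f x * f x - 2 * l * f x + l * l * indicator U x)"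
    proof
      fix x show "(f x - l * indicator U x) * (f x - l * indicator U x) = f x * f x - 2 * l * f x + l * l * indicator U x"
        using fU[of x] by (cases "x \<in> U") (auto simp: algebra_simps)
    qed
    also have "(\<integral>x. f x * f x - 2 * l * f x + l * l * indicator U x \<partial>M) = (\<integral>x. f x * f x \<partial>M) - 2 * l * S + l * l * measure M U"
      using f2int(1) fint int[OF Um] by simp
    finally show ?thesis .
  qed
  have Upos: "measure M U > 0"
  proof (rule ccontr)
    assume "\<not> ?thesis"
    then have "measure M U = 0" using measure_nonneg[of M U] by linarith
    then have "0 \<le> (\<integral>x. f x * f x \<partial>M) - 2 * l * S" for l using gen[of l] by simp
    from this[of "(S + C * S * S + 1) / (2 * S)"] show False using I2 Sp by simp
  qed
  have "S * S \<le> (\<integral>x. f x * f x \<partial>M) * measure M U"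
    using gen[of "S / measure M U"] Upos by (simp add: field_simps)
  also have "\<dots> \<le> (S + C * S * S) * measure M U" using I2 Upos by (intro mult_right_mono) auto
  finally have "S \<le> (1 + C * S) * measure M U" using Sp by (simp add: algebra_simps) (metis (no_types, opaque_lifting) distrib_left mult.assoc mult.commute mult_le_cancel_left_pos)
  moreover have "1 \<le> C * S" using S C by (simp add: S_def field_simps)
  then have "(1 + C * S) * measure M U \<le> (2 * C * S) * measure M U" using Upos by (intro mult_right_mono) auto
  ultimately have "S \<le> S * (2 * C * measure M U)" by (simp add: mult.assoc mult.left_commute)
  then have "1 \<le> 2 * C * measure M U" using Sp by simp
  then show ?thesis using C by (simp add: U_def field_simps)
qed

text \<open>A weak form of the Lebesgue density theorem, by Vitali covering.\<close>

lemma density_null: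
  fixes Z E :: "real set"
  assumes Z: "Z \<in> sets borel" and E: "E \<in> sets borel" and disj: "Z \<inter> E = {}" and c: "c > 0"
    and dens: "\<And>x \<eta>. x \<in> Z \<Longrightarrow> \<eta> > 0 \<Longrightarrow> \<exists>s. 0 < s \<and> s < \<eta> \<and> emeasure lborel (E \<inter> ball x s) \<ge> ennreal (c * s)"
  shows "negligible Z"
proof -
  have main: "negligible W" if W: "W \<in> sets borel" "W \<subseteq> Z" "bounded W" for W
  proof (rule ccontr)
    assume "\<not> negligible W"
    then have W0: "emeasure lborel W \<noteq> 0"
      using W null_setsI[of lborel W] null_sets_completionI[of W lborel] by (auto simp: negligible_iff_null_sets)
    have "emeasure lborel W < \<infinity>" using W(3) by (rule emeasure_bounded_finite)
    then obtain w where Ww: "emeasure lborel W = ennreal w" "w \<ge> 0" by (cases "emeasure lborel W") auto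
    with W0 have w: "w > 0" by (cases "w = 0") auto
    define e where "e = c * w / 4"
    have e: "e > 0" using c w by (simp add: e_def)
    obtain U where U: "open U" "W \<subseteq> U" "emeasure lborel (U - W) < e"
      using outer_regular_lborel[OF W(1) e] .
    define K where "K = {(x, s). s > 0 \<and> ball x s \<subseteq> U \<and> emeasure lborel (E \<inter> ball x s) \<ge> ennreal (c * s)}"
    have cov: "\<exists>i. i \<in> K \<and> x \<in> ball (fst i) (snd i) \<and> snd i < d" if x: "x \<in> W" and d: "d > 0" for x d
    proof -
      obtain r where r: "r > 0" "ball x r \<subseteq> U" using U x openE by blast
      obtain s where s: "0 < s" "s < min d r" "emeasure lborel (E \<inter> ball x s) \<ge> ennreal (c * s)"
        using dens[of x "min d r"] W x d r by auto
      have "ball x s \<subseteq> U" using r s by auto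
      with s show ?thesis by (intro exI[of _ "(x, s)"]) (auto simp: K_def)
    qed
    obtain C where C: "countable C" "C \<subseteq> K"
      "pairwise (\<lambda>i j. disjnt (ball (fst i) (snd i)) (ball (fst j) (snd j))) C"
      "negligible (W - (\<Union>i\<in>C. ball (fst i) (snd i)))"
      using Vitali_covering_theorem_balls[of W K fst snd, OF cov] by blast
    define D where "D = (\<lambda>i. ball (fst i :: real) (snd i :: real))"
    have "D i \<subseteq> U" if "i \<in> C" for i
      using subsetD[OF C(2) that] by (simp add: K_def D_def case_prod_beta)
    then have UD: "(\<Union>i\<in>C. D i) \<subseteq> U" by blast
    have djD: "disjoint_family_on D C" using C(3) by (auto simp: disjoint_family_on_def pairwise_def disjnt_def D_def)
    have em: "emeasure lborel (\<Union>i\<in>C. D i) = (\<integral>\<^sup>+i. emeasure lborel (D i) \<partial>count_space C)"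
      using C(1) djD by (intro emeasure_UN_countable) (auto simp: D_def)
    have em2: "emeasure lborel (\<Union>i\<in>C. E \<inter> D i) = (\<integral>\<^sup>+i. emeasure lborel (E \<inter> D i) \<partial>count_space C)"
    proof (intro emeasure_UN_countable)
      show "disjoint_family_on (\<lambda>i. E \<inter> D i) C" using djD unfolding disjoint_family_on_def by blast
    qed (use C(1) E in \<open>auto simp: D_def\<close>)
    have le: "emeasure lborel (D i) \<le> ennreal (2 / c) * emeasure lborel (E \<inter> D i)" if i: "i \<in> C" for i
    proof -
      have s: "snd i > 0" "emeasure lborel (E \<inter> D i) \<ge> ennreal (c * snd i)" using C(2) i by (auto simp: K_def D_def)
      have "D i = {fst i - snd i<..<fst i + snd i}" by (auto simp: D_def dist_real_def)
      then have "emeasure lborel (D i) = ennreal (2 * snd i)" using s by simp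
      also have "\<dots> = ennreal (2 / c) * ennreal (c * snd i)" using c s by (subst ennreal_mult[symmetric]) auto
      also have "\<dots> \<le> ennreal (2 / c) * emeasure lborel (E \<inter> D i)" using s by (intro mult_left_mono) auto
      finally show ?thesis .
    qed
    have UDb: "(\<Union>i\<in>C. D i) \<in> sets borel"
      using C(1) by (intro sets.countable_UN'') (auto simp: D_def)
    have "emeasure lborel W \<le> emeasure lborel ((\<Union>i\<in>C. D i) \<union> (W - (\<Union>i\<in>C. D i)))"
      using W UDb by (intro emeasure_mono) auto
    also have "\<dots> \<le> emeasure lborel (\<Union>i\<in>C. D i) + emeasure lborel (W - (\<Union>i\<in>C. D i))"
      using W UDb by (intro emeasure_subadditive) auto
    also have "emeasure lborel (W - (\<Union>i\<in>C. D i)) = 0"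
    proof -
      have b: "W - (\<Union>i\<in>C. D i) \<in> sets borel" using W UDb by auto
      then have "emeasure lborel (W - (\<Union>i\<in>C. D i)) = emeasure lebesgue (W - (\<Union>i\<in>C. D i))" by simp
      also have "\<dots> = 0" using C(4) unfolding D_def by (simp add: negligible_iff_null_sets null_setsD1)
      finally show ?thesis .
    qed
    also have "emeasure lborel (\<Union>i\<in>C. D i) + 0 \<le> ennreal (2 / c) * emeasure lborel (\<Union>i\<in>C. E \<inter> D i)"
    proof -
      have "emeasure lborel (\<Union>i\<in>C. D i) \<le> (\<integral>\<^sup>+i. ennreal (2 / c) * emeasure lborel (E \<inter> D i) \<partial>count_space C)"
        unfolding em using le by (intro nn_integral_mono) auto
      also have "\<dots> = ennreal (2 / c) * emeasure lborel (\<Union>i\<in>C. E \<inter> D i)"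
        unfolding em2 by (intro nn_integral_cmult) auto
      finally show ?thesis by simp
    qed
    also have "\<dots> \<le> ennreal (2 / c) * emeasure lborel (U - W)"
      using UD disj W U(1) by (intro mult_left_mono emeasure_mono) auto
    also have "\<dots> \<le> ennreal (2 / c) * ennreal e" using U(3) by (intro mult_left_mono) auto
    finally have "ennreal w \<le> ennreal (2 / c) * ennreal e" unfolding Ww .
    moreover have "ennreal (2 / c) * ennreal e = ennreal (w / 2)"
      using c e by (subst ennreal_mult[symmetric]) (auto simp: e_def)
    ultimately have "w \<le> w / 2" using w by simp
    with w show False by simp
  qed
  have "negligible (\<Union>n::nat. Z \<inter> {- real n..real n})"
    using Z by (intro negligible_Union_nat main) auto
  moreover have "(\<Union>n::nat. Z \<inter> {- real n..real n}) = Z"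
  proof -
    have "\<exists>n::nat. - real n \<le> x \<and> x \<le> real n" for x :: real
    proof -
      obtain n :: nat where "\<bar>x\<bar> \<le> real n" using real_arch_simple by blast
      then show ?thesis by (intro exI[of _ n] conjI) linarith+
    qed
    then show ?thesis by auto
  qed
  ultimately show ?thesis by simp
qed

section \<open>Cusps and the Khinchin property\<close>

lemma fmeasurable_real_interval [simp, intro]:
  "{a..b} \<in> fmeasurable lborel" "{a<..<b} \<in> fmeasurable lborel" for a b :: real
proof -
  show 1: "{a..b} \<in> fmeasurable lborel"
    by (cases "a \<le> b") (auto simp: fmeasurable_def)
  show "{a<..<b} \<in> fmeasurable lborel"
    by (rule fmeasurableI2[OF 1]) auto
qed

definition cusp_of :: "real \<times> real \<Rightarrow> real" where "cusp_of v = - snd v / fst v"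

context cusped
begin

text \<open>Rows are normalised by \<open>c > 0\<close>; the cusp of a row is \<open>- d / c = g\<^sup>-\<^sup>1 \<infinity>\<close>.\<close>

definition cusp_rows :: "(real \<times> real) set" where
  "cusp_rows = {v. fst v > 0 \<and> (\<exists>g\<in>\<Gamma>. \<exists>s\<in>{1, -1}. g$2$1 = s * fst v \<and> g$2$2 = s * snd v)}"

lemma cusp_rows_I: "g \<in> \<Gamma> \<Longrightarrow> g$2$1 \<noteq> 0 \<Longrightarrow> (\<bar>g$2$1\<bar>, sgn (g$2$1) * g$2$2) \<in> cusp_rows"
  by (auto simp: cusp_rows_def sgn_if abs_if intro!: bexI[of _ g])

lemma cusp_rows_D:
  assumes "v \<in> cusp_rows"
  obtains g where "g \<in> \<Gamma>" "\<bar>g$2$1\<bar> = fst v" "\<And>x. \<bar>g$2$1 * x + g$2$2\<bar> = fst v * \<bar>x - cusp_of v\<bar>"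
proof -
  from assms obtain g s where g: "g \<in> \<Gamma>" "s \<in> {1, -1}" "g$2$1 = s * fst v" "g$2$2 = s * snd v" "fst v > 0"
    unfolding cusp_rows_def by blast
  have "\<bar>g$2$1 * x + g$2$2\<bar> = fst v * \<bar>x - cusp_of v\<bar>" for x
  proof -
    have "g$2$1 * x + g$2$2 = s * (fst v * (x - cusp_of v))" using g by (auto simp: cusp_of_def field_simps)
    then have "\<bar>g$2$1 * x + g$2$2\<bar> = \<bar>s\<bar> * (fst v * \<bar>x - cusp_of v\<bar>)" using g(5) by (simp add: abs_mult)
    then show ?thesis using g(2) by auto
  qed
  moreover have "\<bar>g$2$1\<bar> = fst v" using g by (auto simp: abs_mult)
  ultimately show ?thesis using that g(1) by blast
qed

lemma cusp_rows_ge1: assumes "v \<in> cusp_rows" shows "fst v \<ge> 1"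
proof -
  obtain g where g: "g \<in> \<Gamma>" "\<bar>g$2$1\<bar> = fst v" using cusp_rows_D[OF assms] by metis
  have "fst v > 0" using assms by (auto simp: cusp_rows_def)
  with g shimizu[of g] show ?thesis by auto
qed

lemma cusp_rows_dist:
  assumes v: "v \<in> cusp_rows" and w: "w \<in> cusp_rows" and ne: "v \<noteq> w"
  shows "\<bar>cusp_of v - cusp_of w\<bar> \<ge> 1 / (fst v * fst w)"
proof -
  from v obtain g s where g: "g \<in> \<Gamma>" "s \<in> {1, -1}" "g$2$1 = s * fst v" "g$2$2 = s * snd v" unfolding cusp_rows_def by blast
  from w obtain h t where h: "h \<in> \<Gamma>" "t \<in> {1, -1}" "h$2$1 = t * fst w" "h$2$2 = t * snd w" unfolding cusp_rows_def by blast
  have p: "fst v > 0" "fst w > 0" using v w by (auto simp: cusp_rows_def)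
  have no: "\<not> ((h$2$1 = g$2$1 \<and> h$2$2 = g$2$2) \<or> (h$2$1 = - g$2$1 \<and> h$2$2 = - g$2$2))"
    using ne p g(2) h(2) unfolding g h by (cases v; cases w) auto
  have "1 \<le> \<bar>g$2$1 * h$2$2 - h$2$1 * g$2$2\<bar>" using rows[OF g(1) h(1)] no by blast
  also have "\<dots> = \<bar>fst v * snd w - fst w * snd v\<bar>" using g(2) h(2) unfolding g h by auto
  also have "\<dots> = \<bar>cusp_of v - cusp_of w\<bar> * (fst v * fst w)"
  proof -
    have "fst v * snd w - fst w * snd v = (cusp_of v - cusp_of w) * (fst v * fst w)"
      using p by (simp add: cusp_of_def field_simps)
    then show ?thesis using p by (simp add: abs_mult)
  qed
  finally show ?thesis using p by (simp add: field_simps)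
qed

lemma cusp_rows_card:
  assumes t: "t > 0" and ab: "a \<le> b"
  shows "finite {v\<in>cusp_rows. fst v \<le> t \<and> cusp_of v \<in> {a..b}} \<and> real (card {v\<in>cusp_rows. fst v \<le> t \<and> cusp_of v \<in> {a..b}}) \<le> (b - a) * t\<^sup>2 + 1"
proof -
  have "\<bar>cusp_of u - cusp_of v\<bar> \<ge> 1 / t\<^sup>2" if "u \<in> cusp_rows" "v \<in> cusp_rows" "u \<noteq> v" "fst u \<le> t" "fst v \<le> t" for u v
  proof -
    have "fst u * fst v \<le> t * t" using that cusp_rows_ge1[of u] cusp_rows_ge1[of v] t by (intro mult_mono) auto
    then have "1 / t\<^sup>2 \<le> 1 / (fst u * fst v)"
      using cusp_rows_ge1[OF that(1)] cusp_rows_ge1[OF that(2)] t by (intro divide_left_mono) (auto simp: power2_eq_square intro!: mult_pos_pos)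
    also have "\<dots> \<le> \<bar>cusp_of u - cusp_of v\<bar>" using cusp_rows_dist that by blast
    finally show ?thesis .
  qed
  then have "finite {v\<in>cusp_rows. fst v \<le> t \<and> cusp_of v \<in> {a..b}} \<and> real (card {v\<in>cusp_rows. fst v \<le> t \<and> cusp_of v \<in> {a..b}}) \<le> (b - a) / (1 / t\<^sup>2) + 1"
    using t ab by (intro separated_reals_card[where f=cusp_of]) auto
  then show ?thesis by simp
qed

definition rows_below :: "real \<Rightarrow> (real \<times> real) set" where "rows_below t = {v\<in>cusp_rows. fst v \<le> t \<and> cusp_of v \<in> {-1..2}}"

lemma rows_below_card: "t > 0 \<Longrightarrow> finite (rows_below t) \<and> real (card (rows_below t)) \<le> 3 * t\<^sup>2 + 1"
  using cusp_rows_card[of t "-1" 2] by (simp add: rows_below_def)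

lemma rows_below_small: "t < 1 \<Longrightarrow> rows_below t = {}"
  using cusp_rows_ge1 by (force simp: rows_below_def)

lemma rows_below_sum: "t > 0 \<Longrightarrow> (\<Sum>v\<in>rows_below t. 1 / fst v) \<le> 16 * t"
proof -
  have "t \<le> 2^n \<Longrightarrow> t > 0 \<Longrightarrow> (\<Sum>v\<in>rows_below t. 1 / fst v) \<le> 16 * t" for n :: nat
  proof (induction n arbitrary: t)
    case 0
    show ?case
    proof (cases "t < 1")
      case False
      then have t1: "t = 1" using 0 by simp
      have "(\<Sum>v\<in>rows_below t. 1 / fst v) \<le> (\<Sum>v\<in>rows_below t. 1)"
      proof (intro sum_mono)
        fix v assume "v \<in> rows_below t"
        then show "1 / fst v \<le> 1" using cusp_rows_ge1[of v] by (simp add: rows_below_def)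
      qed
      also have "\<dots> \<le> 4" using rows_below_card[of t] t1 by simp
      finally show ?thesis using t1 by simp
    qed (use 0 rows_below_small in simp)
  next
    case (Suc n)
    show ?case
    proof (cases "t < 1")
      case False
      have fin: "finite (rows_below t)" using rows_below_card Suc by blast
      have "rows_below t = rows_below (t/2) \<union> (rows_below t - rows_below (t/2))" using Suc.prems by (auto simp: rows_below_def)
      then have "(\<Sum>v\<in>rows_below t. 1 / fst v) = (\<Sum>v\<in>rows_below (t/2). 1 / fst v) + (\<Sum>v\<in>rows_below t - rows_below (t/2). 1 / fst v)"
        using fin rows_below_card[of "t/2"] Suc.prems by (subst sum.union_disjoint[symmetric]) auto
      also have "(\<Sum>v\<in>rows_below (t/2). 1 / fst v) \<le> 16 * (t/2)" using Suc.prems by (intro Suc.IH) auto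
      also have "(\<Sum>v\<in>rows_below t - rows_below (t/2). 1 / fst v) \<le> (\<Sum>v\<in>rows_below t - rows_below (t/2). 2 / t)"
      proof (intro sum_mono)
        fix v assume "v \<in> rows_below t - rows_below (t/2)"
        then have "fst v > t / 2" by (auto simp: rows_below_def)
        then show "1 / fst v \<le> 2 / t" using Suc.prems by (simp add: field_simps)
      qed
      also have "\<dots> \<le> real (card (rows_below t)) * (2 / t)"
        using Suc.prems fin by (auto intro!: mult_right_mono card_mono divide_right_mono)
      also have "\<dots> \<le> (3 * t\<^sup>2 + 1) * (2 / t)" using rows_below_card[of t] Suc.prems by (intro mult_right_mono) auto
      also have "\<dots> \<le> 8 * t"
      proof -
        have "1 \<le> t\<^sup>2" using False by (simp add: one_le_power)
        then have "(3 * t\<^sup>2 + 1) * 2 \<le> 8 * t\<^sup>2" by simp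
        then have "(3 * t\<^sup>2 + 1) * 2 / t \<le> 8 * t\<^sup>2 / t" using Suc.prems by (intro divide_right_mono) auto
        then show ?thesis using Suc.prems by (simp add: power2_eq_square)
      qed
      finally show ?thesis by simp
    qed (use Suc rows_below_small in simp)
  qed
  moreover obtain n where "t < 2^n" using real_arch_pow[of 2 t] by auto
  ultimately show "t > 0 \<Longrightarrow> (\<Sum>v\<in>rows_below t. 1 / fst v) \<le> 16 * t" by (meson less_imp_le)
qed

end

context cusped_lattice
begin

lemma good_point:
  assumes Y: "Y > 0" and x: "x \<in> {0..1} - low_reals Y \<delta>" and d: "\<delta> > 0"
  obtains g where "g \<in> \<Gamma>" "(g$2$1)\<^sup>2 * Y < 1 / \<delta>" "(g$2$1 * x + g$2$2)\<^sup>2 < 2 * Y / \<delta>"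
    "\<bar>g$2$1\<bar> * \<bar>g$2$1 * x + g$2$2\<bar> \<le> 1 / \<delta>"
proof -
  from x obtain y g where yg: "Y < y" "y < 2 * Y" "g \<in> \<Gamma>" "Im (mobius g (Complex x y)) > \<delta>"
    by (auto simp: low_reals_def not_le)
  have y: "y > 0" using yg Y by simp
  define p where "p = g$2$1 * x + g$2$2"
  define q where "q = (g$2$1)\<^sup>2 * y\<^sup>2"
  have pq: "p\<^sup>2 + q > 0"
    using y det_row2[OF det1[OF yg(3)]] by (auto simp: p_def q_def sum_power2_gt_zero_iff simp flip: power_mult_distrib)
  have "\<delta> < y / (p\<^sup>2 + q)"
    using yg(4) mobius_Im[OF det1[OF yg(3)], of "Complex x y"] y
    by (simp add: cmod_autf p_def q_def power_mult_distrib del: of_real_mult)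
  then have main: "\<delta> * (p\<^sup>2 + q) < y" using pq by (simp add: field_simps)
  have "\<delta> * q \<le> \<delta> * (p\<^sup>2 + q)" "\<delta> * p\<^sup>2 \<le> \<delta> * (p\<^sup>2 + q)" using d by (auto simp: q_def)
  then have b: "\<delta> * q < y" "\<delta> * p\<^sup>2 < y" using main by linarith+
  have c2: "\<delta> * ((g$2$1)\<^sup>2 * y) < 1"
  proof -
    have "\<delta> * ((g$2$1)\<^sup>2 * y) * y < 1 * y" using b(1) by (simp add: q_def power2_eq_square mult.assoc)
    then show ?thesis using y by (simp only: mult_less_cancel_right_pos)
  qed
  have 1: "(g$2$1)\<^sup>2 * Y < 1 / \<delta>"
  proof -
    have "(g$2$1)\<^sup>2 * Y \<le> (g$2$1)\<^sup>2 * y" using yg by (intro mult_left_mono) auto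
    also have "\<dots> < 1 / \<delta>" using c2 d by (simp add: field_simps)
    finally show ?thesis .
  qed
  have p2: "p\<^sup>2 < y / \<delta>" using b(2) d by (simp add: field_simps)
  also have "y / \<delta> \<le> 2 * Y / \<delta>" using yg d by (intro divide_right_mono) auto
  finally have 2: "p\<^sup>2 < 2 * Y / \<delta>" .
  have "(\<bar>g$2$1\<bar> * \<bar>p\<bar>)\<^sup>2 = (g$2$1)\<^sup>2 * p\<^sup>2" by (simp add: power_mult_distrib)
  also have "\<dots> \<le> (g$2$1)\<^sup>2 * (y / \<delta>)" using p2 by (intro mult_left_mono) auto
  also have "\<dots> \<le> (1 / \<delta>)\<^sup>2"
    using c2 d by (simp add: field_simps power2_eq_square)
  finally have 3: "\<bar>g$2$1\<bar> * \<bar>p\<bar> \<le> 1 / \<delta>" by (rule power2_le_imp_le) (use d in auto)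
  show ?thesis using that[OF yg(3) 1] 2 3 by (simp add: p_def)
qed

lemma cusp_count:
  obtains \<rho> \<kappa> T0 where "0 < \<rho>" "\<rho> < 1/2" "0 < \<kappa>" "T0 \<ge> 1"
    "\<And>T. T \<ge> T0 \<Longrightarrow> real (card (rows_below T - rows_below (\<rho> * T))) \<ge> \<kappa> * T\<^sup>2"
proof -
  obtain \<delta>' where \<delta>': "\<delta>' > 0" "\<And>Y. 0 < Y \<Longrightarrow> Y \<le> 1 \<Longrightarrow> measure lborel (low_reals Y \<delta>') \<le> 1/2"
  proof -
    have "\<exists>\<delta>>0. \<forall>Y. 0 < Y \<and> Y \<le> 1 \<longrightarrow> measure lborel (low_reals Y \<delta>) \<le> 1/2" by (rule recurrence) simp
    then show ?thesis using that by blast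
  qed
  define \<delta> where "\<delta> = min \<delta>' 1"
  have d: "\<delta> > 0" "\<delta> \<le> 1" using \<delta>' by (auto simp: \<delta>_def)
  have bad: "measure lborel (low_reals Y \<delta>) \<le> 1/2" if Y: "0 < Y" "Y \<le> 1" for Y
  proof -
    have "\<delta> \<le> \<delta>'" by (simp add: \<delta>_def)
    then have "low_reals Y \<delta> \<subseteq> low_reals Y \<delta>'" unfolding low_reals_def by (blast intro: order_trans)
    moreover have "low_reals Y \<delta>' \<in> fmeasurable lborel"
    proof (rule fmeasurableI2)
      show "{0..1::real} \<in> fmeasurable lborel" by (simp add: fmeasurable_def)
      show "low_reals Y \<delta>' \<subseteq> {0..1}" unfolding low_reals_def by blast
      show "low_reals Y \<delta>' \<in> sets lborel" using low_reals_borel[OF Y(1)] by simp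
    qed
    ultimately have "measure lborel (low_reals Y \<delta>) \<le> measure lborel (low_reals Y \<delta>')"
      using low_reals_borel[OF Y(1)] by (intro measure_mono_fmeasurable) auto
    then show ?thesis using \<delta>'(2)[OF Y] by linarith
  qed
  define \<rho> where "\<rho> = \<delta> / 256"
  define \<kappa> where "\<kappa> = \<delta> * \<rho> / 16"
  have rk: "\<rho> > 0" "\<kappa> > 0" "\<rho> < 1/2" using d by (auto simp: \<rho>_def \<kappa>_def)
  have "real (card (rows_below T - rows_below (\<rho> * T))) \<ge> \<kappa> * T\<^sup>2" if T: "T \<ge> 2 / \<delta>" for T
  proof -
    have "2 \<le> 2 / \<delta>" using d by (simp add: field_simps)
    then have T2: "T \<ge> 2" using T by linarith
    have dT: "\<delta> * T \<ge> 2" using T d by (simp add: field_simps)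
    define Y where "Y = 1 / (\<delta> * T\<^sup>2)"
    have Y: "Y > 0" using d T2 by (simp add: Y_def)
    have Yd: "Y \<le> \<delta> / 4"
    proof -
      have "2 * 2 \<le> (\<delta> * T) * (\<delta> * T)" using dT by (intro mult_mono) auto
      then have "4 \<le> \<delta> * (\<delta> * T\<^sup>2)" by (simp add: power2_eq_square mult_ac)
      then show ?thesis using d T2 by (simp add: Y_def field_simps)
    qed
    have Y1: "Y \<le> 1" using Yd d by linarith
    define r where "r v = 2 / (\<delta> * T * fst v)" for v :: "real \<times> real"
    have cov: "{0..1} - low_reals Y \<delta> \<subseteq> (\<Union>v\<in>rows_below T. {cusp_of v - r v..cusp_of v + r v})"
    proof
      fix x assume x: "x \<in> {0..1} - low_reals Y \<delta>"
      obtain g where g: "g \<in> \<Gamma>" "(g$2$1)\<^sup>2 * Y < 1 / \<delta>" "(g$2$1 * x + g$2$2)\<^sup>2 < 2 * Y / \<delta>"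
        using good_point[OF Y x d(1)] by metis
      have c0: "g$2$1 \<noteq> 0"
      proof
        assume c: "g$2$1 = 0"
        then have "(g$2$2)\<^sup>2 = 1" using upper_triangular g(1) by blast
        then have "1 < 2 * Y / \<delta>" using g(3) c by simp
        then show False using Yd d by (simp add: field_simps)
      qed
      define v where "v = (\<bar>g$2$1\<bar>, sgn (g$2$1) * g$2$2)"
      have v: "v \<in> cusp_rows" unfolding v_def by (rule cusp_rows_I[OF g(1) c0])
      have fv: "fst v = \<bar>g$2$1\<bar>" by (simp add: v_def)
      have fv1: "fst v \<ge> 1" using cusp_rows_ge1[OF v] .
      have "(fst v)\<^sup>2 * Y < 1 / \<delta>" using g(2) by (simp add: fv)
      then have "(fst v)\<^sup>2 * Y * (\<delta> * T\<^sup>2) < 1 / \<delta> * (\<delta> * T\<^sup>2)" using d T2 by (intro mult_strict_right_mono) auto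
      moreover have "Y * (\<delta> * T\<^sup>2) = 1" "1 / \<delta> * (\<delta> * T\<^sup>2) = T\<^sup>2" using d T2 by (auto simp: Y_def)
      ultimately have "(fst v)\<^sup>2 < T\<^sup>2" by (simp only: mult.assoc mult_1_right)
      then have vT: "fst v \<le> T" using T2 by (intro less_imp_le[OF power2_less_imp_less[of "fst v" T]]) auto
      have px: "g$2$1 * x + g$2$2 = g$2$1 * (x - cusp_of v)" using c0 by (simp add: cusp_of_def v_def sgn_if field_simps)
      have "(\<bar>g$2$1 * x + g$2$2\<bar>)\<^sup>2 < (2 / (\<delta> * T))\<^sup>2"
      proof -
        have "2 * Y / \<delta> = 2 / (\<delta> * T)\<^sup>2" by (simp add: Y_def power2_eq_square field_simps)
        also have "\<dots> \<le> 4 / (\<delta> * T)\<^sup>2" by (intro divide_right_mono) auto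
        finally show ?thesis using g(3) by (simp add: power_divide)
      qed
      then have "\<bar>g$2$1 * x + g$2$2\<bar> < 2 / (\<delta> * T)" by (rule power2_less_imp_less) (use d T2 in auto)
      then have "fst v * \<bar>x - cusp_of v\<bar> < 2 / (\<delta> * T)" unfolding px by (simp add: abs_mult fv)
      then have "\<bar>x - cusp_of v\<bar> * fst v < 2 / (\<delta> * T)" by (simp only: mult.commute)
      then have "\<bar>x - cusp_of v\<bar> < 2 / (\<delta> * T) / fst v" using fv1 by (subst pos_less_divide_eq) auto
      then have near: "\<bar>x - cusp_of v\<bar> \<le> r v" by (simp add: r_def)
      have "r v \<le> 1"
      proof -
        have "2 * 1 \<le> \<delta> * T * fst v" using dT fv1 by (intro mult_mono) auto
        then show ?thesis by (simp add: r_def)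
      qed
      then have "cusp_of v \<in> {-1..2}" using near x by (auto simp: abs_le_iff)
      then have "v \<in> rows_below T" using v vT by (simp add: rows_below_def)
      then show "x \<in> (\<Union>v\<in>rows_below T. {cusp_of v - r v..cusp_of v + r v})" using near by (force simp: abs_le_iff)
    qed
    have finW: "finite (rows_below T)" using rows_below_card[of T] T2 by simp
    have "\<rho> * T \<le> T" using rk T2 mult_right_mono[of \<rho> 1 T] by simp
    then have sW: "rows_below (\<rho> * T) \<subseteq> rows_below T" by (auto simp: rows_below_def)
    have Xb: "low_reals Y \<delta> \<in> sets borel" using low_reals_borel[OF Y] .
    have "1 \<le> measure lborel (low_reals Y \<delta>) + measure lborel ({0..1} - low_reals Y \<delta>)"
    proof -
      have f: "{0..1::real} \<in> fmeasurable lborel" by (simp add: fmeasurable_def)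
      have "measure lborel ({0..1} - low_reals Y \<delta>) = measure lborel {0..1::real} - measure lborel (low_reals Y \<delta>)"
        using Xb f by (intro measurable_measure_Diff) (auto simp: low_reals_def)
      then show ?thesis by simp
    qed
    then have "1/2 \<le> measure lborel ({0..1} - low_reals Y \<delta>)" using bad[OF Y Y1] by linarith
    also have "\<dots> \<le> measure lborel (\<Union>v\<in>rows_below T. {cusp_of v - r v..cusp_of v + r v})"
    proof (rule measure_mono_fmeasurable[OF cov])
      show "{0..1} - low_reals Y \<delta> \<in> sets lborel" using Xb by auto
      show "(\<Union>v\<in>rows_below T. {cusp_of v - r v..cusp_of v + r v}) \<in> fmeasurable lborel"
        using finW by (intro fmeasurable.finite_UN) auto
    qed
    also have "\<dots> \<le> (\<Sum>v\<in>rows_below T. measure lborel {cusp_of v - r v..cusp_of v + r v})"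
      using finW by (intro measure_UNION_le) auto
    also have "\<dots> = (\<Sum>v\<in>rows_below T. 4 / (\<delta> * T) * (1 / fst v))"
    proof (intro sum.cong refl)
      fix v assume "v \<in> rows_below T"
      then have "r v \<ge> 0" using cusp_rows_ge1[of v] d T2 by (auto simp: r_def rows_below_def)
      then have "measure lborel {cusp_of v - r v..cusp_of v + r v} = 2 * r v" by simp
      then show "measure lborel {cusp_of v - r v..cusp_of v + r v} = 4 / (\<delta> * T) * (1 / fst v)" by (simp add: r_def)
    qed
    also have "\<dots> = 4 / (\<delta> * T) * (\<Sum>v\<in>rows_below T. 1 / fst v)" by (simp only: sum_distrib_left)
    also have "(\<Sum>v\<in>rows_below T. 1 / fst v) = (\<Sum>v\<in>rows_below (\<rho> * T). 1 / fst v) + (\<Sum>v\<in>rows_below T - rows_below (\<rho> * T). 1 / fst v)"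
      using sum.subset_diff[OF sW finW] by (simp add: add.commute)
    also have "4 / (\<delta> * T) * \<dots> \<le> 4 / (\<delta> * T) * (16 * (\<rho> * T) + real (card (rows_below T - rows_below (\<rho> * T))) * (1 / (\<rho> * T)))"
    proof (intro mult_left_mono add_mono)
      show "(\<Sum>v\<in>rows_below (\<rho> * T). 1 / fst v) \<le> 16 * (\<rho> * T)" using rows_below_sum rk T2 by simp
      have "(\<Sum>v\<in>rows_below T - rows_below (\<rho> * T). 1 / fst v) \<le> (\<Sum>v\<in>rows_below T - rows_below (\<rho> * T). 1 / (\<rho> * T))"
      proof (intro sum_mono)
        fix v assume "v \<in> rows_below T - rows_below (\<rho> * T)"
        then have "fst v > \<rho> * T" by (auto simp: rows_below_def)
        moreover have "\<rho> * T > 0" using rk T2 by simp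
        ultimately show "1 / fst v \<le> 1 / (\<rho> * T)" by (intro divide_left_mono) auto
      qed
      then show "(\<Sum>v\<in>rows_below T - rows_below (\<rho> * T). 1 / fst v) \<le> real (card (rows_below T - rows_below (\<rho> * T))) * (1 / (\<rho> * T))" by simp
    qed (use d T2 in auto)
    also have "\<dots> = 1/4 + 4 * real (card (rows_below T - rows_below (\<rho> * T))) / (\<delta> * \<rho> * T\<^sup>2)"
      using d T2 by (simp add: \<rho>_def field_simps power2_eq_square)
    finally have "1/4 \<le> 4 * real (card (rows_below T - rows_below (\<rho> * T))) / (\<delta> * \<rho> * T\<^sup>2)" by simp
    moreover have "\<delta> * \<rho> * T\<^sup>2 > 0" using d rk T2 by simp
    ultimately have "\<delta> * \<rho> * T\<^sup>2 \<le> 16 * real (card (rows_below T - rows_below (\<rho> * T)))" by (simp add: field_simps)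
    then show ?thesis by (simp add: \<kappa>_def)
  qed
  moreover have "2 / \<delta> \<ge> 1" using d by (simp add: field_simps)
  ultimately show ?thesis using that[of \<rho> \<kappa> "2 / \<delta>"] rk by blast
qed

end

context cusped
begin

text \<open>A geodesic ray to \<open>x\<close> makes an excursion of size \<open>1 / \<bar>c (c x + d)\<bar>\<close> into the horoball at \<open>- d / c\<close>;
  the condition compares this size with \<open>N ln \<bar>c\<bar>\<close>.\<close>

definition excursion_reals :: "nat \<Rightarrow> real set" where
  "excursion_reals N = {x. \<exists>g\<in>\<Gamma>. real N \<le> \<bar>g$2$1\<bar> \<and> g$2$1 * x + g$2$2 \<noteq> 0 \<and>
     real N * (\<bar>g$2$1 * x + g$2$2\<bar> * (\<bar>g$2$1\<bar> * ln \<bar>g$2$1\<bar>)) \<le> 1}"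

definition deep_reals :: "real set" where "deep_reals = (\<Inter>N. excursion_reals N)"

lemma excursion_reals_borel [measurable]: "excursion_reals N \<in> sets borel"
proof -
  have "excursion_reals N = (\<Union>g\<in>{g\<in>\<Gamma>. real N \<le> \<bar>g$2$1\<bar>}. {x. g$2$1 * x + g$2$2 \<noteq> 0 \<and>
     real N * (\<bar>g$2$1 * x + g$2$2\<bar> * (\<bar>g$2$1\<bar> * ln \<bar>g$2$1\<bar>)) \<le> 1})"
    by (auto simp: excursion_reals_def)
  also have "\<dots> \<in> sets borel"
    using countable_group by (intro sets.countable_UN'') (auto intro: countable_subset)
  finally show ?thesis .
qed

lemma deep_reals_borel [measurable]: "deep_reals \<in> sets borel"
  unfolding deep_reals_def by measurable

lemma excursion_reals_mono: assumes "N \<le> M" "M \<ge> 1" shows "excursion_reals M \<subseteq> excursion_reals N"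
proof
  fix x assume "x \<in> excursion_reals M"
  then obtain g where g: "g \<in> \<Gamma>" "real M \<le> \<bar>g$2$1\<bar>" "g$2$1 * x + g$2$2 \<noteq> 0"
     "real M * (\<bar>g$2$1 * x + g$2$2\<bar> * (\<bar>g$2$1\<bar> * ln \<bar>g$2$1\<bar>)) \<le> 1" by (auto simp: excursion_reals_def)
  have "\<bar>g$2$1\<bar> \<ge> 1" using g(2) assms(2) by linarith
  then have "0 \<le> \<bar>g$2$1 * x + g$2$2\<bar> * (\<bar>g$2$1\<bar> * ln \<bar>g$2$1\<bar>)" by (intro mult_nonneg_nonneg) auto
  then have "real N * (\<bar>g$2$1 * x + g$2$2\<bar> * (\<bar>g$2$1\<bar> * ln \<bar>g$2$1\<bar>)) \<le>
      real M * (\<bar>g$2$1 * x + g$2$2\<bar> * (\<bar>g$2$1\<bar> * ln \<bar>g$2$1\<bar>))"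
    using assms(1) by (intro mult_right_mono) auto
  then have "real N * (\<bar>g$2$1 * x + g$2$2\<bar> * (\<bar>g$2$1\<bar> * ln \<bar>g$2$1\<bar>)) \<le> 1"
    using g(4) by (rule order_trans)
  moreover have "real N \<le> \<bar>g$2$1\<bar>" using g(2) assms(1) by linarith
  ultimately show "x \<in> excursion_reals N" unfolding excursion_reals_def using g(1,3) by blast
qed

definition cusps :: "real set" where "cusps = {x. \<exists>g\<in>\<Gamma>. g$2$1 \<noteq> 0 \<and> g$2$1 * x + g$2$2 = 0}"

lemma cusps_null: "cusps \<in> null_sets lborel"
proof -
  have "cusps \<subseteq> (\<lambda>g. - g$2$2 / g$2$1) ` \<Gamma>"
  proof
    fix x assume "x \<in> cusps"
    then obtain g where g: "g \<in> \<Gamma>" "g$2$1 \<noteq> 0" "g$2$1 * x + g$2$2 = 0" by (auto simp: cusps_def)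
    then have "x = - g$2$2 / g$2$1" by (simp add: field_simps eq_neg_iff_add_eq_0)
    with g show "x \<in> (\<lambda>g. - g$2$2 / g$2$1) ` \<Gamma>" by blast
  qed
  then have "countable cusps" using countable_group by (meson countable_image countable_subset)
  then show ?thesis by (rule countable_imp_null_set_lborel)
qed

lemma deep_reals_invariant:
  assumes x: "x \<in> deep_reals" and g: "g \<in> \<Gamma>" and j: "g$2$1 * x + g$2$2 \<noteq> 0"
  shows "(g$1$1 * x + g$1$2) / (g$2$1 * x + g$2$2) \<in> deep_reals"
proof -
  define y where "y = (g$1$1 * x + g$1$2) / (g$2$1 * x + g$2$2)"
  define J where "J = g$2$1 * x + g$2$2"
  have J0: "J \<noteq> 0" using j by (simp add: J_def)
  have dg: "g$1$1 * g$2$2 - g$1$2 * g$2$1 = 1" using det1[OF g] by (simp add: det_2)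
  have "y \<in> excursion_reals N" for N
  proof -
    define b where "b = max (max (4 * real N) (2 * \<bar>J\<bar>)) (max (2 * real N / \<bar>J\<bar>) (max (2 * \<bar>g$2$1\<bar> / \<bar>J\<bar>) 3))"
    obtain M :: nat where M: "b \<le> real M" using real_arch_simple by blast
    have Mb: "real M \<ge> 4 * real N" "real M \<ge> 2 * \<bar>J\<bar>" "real M \<ge> 2 * real N / \<bar>J\<bar>" "real M \<ge> 2 * \<bar>g$2$1\<bar> / \<bar>J\<bar>" "real M \<ge> 3"
      using M by (auto simp: b_def)
    from x have "x \<in> excursion_reals M" by (simp add: deep_reals_def)
    then obtain h where h: "h \<in> \<Gamma>" "real M \<le> \<bar>h$2$1\<bar>" "h$2$1 * x + h$2$2 \<noteq> 0"
      "real M * (\<bar>h$2$1 * x + h$2$2\<bar> * (\<bar>h$2$1\<bar> * ln \<bar>h$2$1\<bar>)) \<le> 1" by (auto simp: excursion_reals_def)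
    define c where "c = \<bar>h$2$1\<bar>"
    define e where "e = \<bar>h$2$1 * x + h$2$2\<bar>"
    have c: "c \<ge> 4 * real N" "c \<ge> 2 * \<bar>J\<bar>" "c \<ge> 2 * real N / \<bar>J\<bar>" "c \<ge> 2 * \<bar>g$2$1\<bar> / \<bar>J\<bar>" "c \<ge> 3"
      using Mb h(2) unfolding c_def by linarith+
    have lnc: "ln c \<ge> 1"
    proof -
      have "exp 1 \<le> c" using c(5) exp_le by linarith
      then have "ln (exp 1) \<le> ln c" using c(5) by (subst ln_le_cancel_iff) auto
      then show ?thesis by simp
    qed
    have e0: "e > 0" using h(3) by (simp add: e_def)
    have hM: "real M * (e * (c * ln c)) \<le> 1" using h(4) by (simp add: e_def c_def)
    have e1: "e \<le> 1"
    proof -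
      have "1 * (e * (1 * 1)) \<le> real M * (e * (c * ln c))"
        using Mb(5) e0 c(5) lnc by (intro mult_mono mult_nonneg_nonneg) auto
      then show ?thesis using hM by simp
    qed
    define k where "k = h ** adj2 g"
    have k: "k \<in> \<Gamma>" unfolding k_def by (intro mult_closed adj_closed h g)
    have k21: "k$2$1 = h$2$1 * J - g$2$1 * (h$2$1 * x + h$2$2)" by (simp add: k_def J_def algebra_simps)
    have ky: "k$2$1 * y + k$2$2 = (h$2$1 * x + h$2$2) / J"
    proof -
      have "(k$2$1 * y + k$2$2) * J = k$2$1 * (g$1$1 * x + g$1$2) + k$2$2 * (g$2$1 * x + g$2$2)"
      proof -
        have "y * J = g$1$1 * x + g$1$2" using J0 by (simp add: y_def J_def)
        then have "k$2$1 * (y * J) + k$2$2 * J = k$2$1 * (g$1$1 * x + g$1$2) + k$2$2 * J" by simp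
        then show ?thesis by (simp add: J_def algebra_simps)
      qed
      also have "\<dots> = (h$2$1 * x + h$2$2) * (g$1$1 * g$2$2 - g$1$2 * g$2$1)"
        by (simp add: k_def algebra_simps)
      finally show ?thesis using J0 by (simp add: dg field_simps)
    qed
    have gJ: "2 * \<bar>g$2$1\<bar> \<le> c * \<bar>J\<bar>" using c(4) J0 by (simp add: field_simps)
    have up: "\<bar>k$2$1\<bar> \<le> 2 * (c * \<bar>J\<bar>)"
    proof -
      have "\<bar>k$2$1\<bar> \<le> c * \<bar>J\<bar> + \<bar>g$2$1\<bar> * e"
        unfolding k21 c_def e_def
        using abs_triangle_ineq4[of "h$2$1 * J" "g$2$1 * (h$2$1 * x + h$2$2)"] by (simp only: abs_mult)
      also have "\<bar>g$2$1\<bar> * e \<le> \<bar>g$2$1\<bar> * 1" using e1 by (intro mult_left_mono) auto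
      finally show ?thesis using gJ by simp
    qed
    have low: "c * \<bar>J\<bar> / 2 \<le> \<bar>k$2$1\<bar>"
    proof -
      have "c * \<bar>J\<bar> - \<bar>g$2$1\<bar> * e \<le> \<bar>k$2$1\<bar>"
        unfolding k21 c_def e_def
        using abs_triangle_ineq2[of "h$2$1 * J" "g$2$1 * (h$2$1 * x + h$2$2)"] by (simp only: abs_mult)
      moreover have "\<bar>g$2$1\<bar> * e \<le> \<bar>g$2$1\<bar> * 1" using e1 by (intro mult_left_mono) auto
      ultimately show ?thesis using gJ by simp
    qed
    have cJ: "c * \<bar>J\<bar> > 0" using c(5) J0 by simp
    have kpos: "\<bar>k$2$1\<bar> > 0" using low cJ by linarith
    have Nk: "real N \<le> \<bar>k$2$1\<bar>"
    proof -
      have "2 * real N \<le> c * \<bar>J\<bar>" using c(3) J0 by (simp add: field_simps)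
      then show ?thesis using low by linarith
    qed
    have lnk: "ln \<bar>k$2$1\<bar> \<le> 2 * ln c"
    proof -
      have "c * (2 * \<bar>J\<bar>) \<le> c * c" using c(2,5) by (intro mult_left_mono) auto
      moreover have "2 * (c * \<bar>J\<bar>) = c * (2 * \<bar>J\<bar>)" by simp
      ultimately have "\<bar>k$2$1\<bar> \<le> c * c" using up by linarith
      then have "ln \<bar>k$2$1\<bar> \<le> ln (c * c)" using kpos c(5) by (subst ln_le_cancel_iff) auto
      also have "\<dots> = 2 * ln c" using c(5) by (simp add: ln_mult)
      finally show ?thesis .
    qed
    have "\<bar>k$2$1 * y + k$2$2\<bar> * (\<bar>k$2$1\<bar> * ln \<bar>k$2$1\<bar>) \<le> e / \<bar>J\<bar> * (2 * (c * \<bar>J\<bar>) * (2 * ln c))"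
    proof -
      have "\<bar>k$2$1\<bar> * ln \<bar>k$2$1\<bar> \<le> \<bar>k$2$1\<bar> * (2 * ln c)" using lnk by (intro mult_left_mono) auto
      also have "\<dots> \<le> 2 * (c * \<bar>J\<bar>) * (2 * ln c)" using up lnc by (intro mult_right_mono) auto
      finally have "e / \<bar>J\<bar> * (\<bar>k$2$1\<bar> * ln \<bar>k$2$1\<bar>) \<le> e / \<bar>J\<bar> * (2 * (c * \<bar>J\<bar>) * (2 * ln c))"
        using e0 J0 by (intro mult_left_mono) auto
      then show ?thesis unfolding ky by (simp add: abs_divide e_def)
    qed
    also have "\<dots> = 4 * (e * (c * ln c))" using J0 by simp
    finally have "real N * (\<bar>k$2$1 * y + k$2$2\<bar> * (\<bar>k$2$1\<bar> * ln \<bar>k$2$1\<bar>)) \<le> real N * (4 * (e * (c * ln c)))"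
      by (intro mult_left_mono) auto
    also have "\<dots> = (4 * real N) * (e * (c * ln c))" by simp
    also have "\<dots> \<le> real M * (e * (c * ln c))"
      using Mb(1) e0 c(5) lnc by (intro mult_right_mono mult_nonneg_nonneg) auto
    finally have "real N * (\<bar>k$2$1 * y + k$2$2\<bar> * (\<bar>k$2$1\<bar> * ln \<bar>k$2$1\<bar>)) \<le> 1" using hM by linarith
    moreover have "k$2$1 * y + k$2$2 \<noteq> 0" unfolding ky using h(3) J0 by simp
    ultimately show ?thesis using k Nk unfolding excursion_reals_def by blast
  qed
  then show ?thesis by (simp add: deep_reals_def y_def)
qed

lemma deep_reals_translate: "x \<in> deep_reals \<Longrightarrow> x + of_int n \<in> deep_reals"
  using deep_reals_invariant[of x "trans (of_int n)"] trans_closed[of n] by simp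

lemma deep_reals_translate_iff: "x + of_int n \<in> deep_reals \<longleftrightarrow> x \<in> deep_reals"
  using deep_reals_translate[of x n] deep_reals_translate[of "x + of_int n" "-n"] by auto

end

context cusped_lattice
begin

lemma excursion_reals_mass: "\<exists>c0>0. \<forall>N\<ge>1. measure lborel (excursion_reals N \<inter> {-2..3}) \<ge> c0"
proof -
  obtain \<rho> \<kappa> T0 where rk: "0 < \<rho>" "\<rho> < 1/2" "0 < \<kappa>" "T0 \<ge> 1"
    and count: "\<And>T. T \<ge> T0 \<Longrightarrow> real (card (rows_below T - rows_below (\<rho> * T))) \<ge> \<kappa> * T\<^sup>2"
    using cusp_count by blast
  define C where "C = 4 / \<kappa>"
  have C: "C > 0" using rk by (simp add: C_def)
  have "measure lborel (excursion_reals N \<inter> {-2..3}) \<ge> 1 / (2 * C)" if N: "N \<ge> 1" for N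
  proof -
    define n where "n = real N"
    have n1: "n \<ge> 1" using N by (simp add: n_def)
    define B where "B = 1 / \<rho>"
    have B: "B > 2" using rk by (simp add: B_def field_simps)
    have lnB: "ln B > 0" using B by simp
    define T where "T k = B ^ k" for k :: nat
    have TB: "T j \<le> \<rho> * T k" if "j < k" for j k
    proof -
      have "T j * B \<le> T k" unfolding T_def power_Suc2[symmetric] using that B by (intro power_increasing) auto
      then show ?thesis using rk by (simp add: B_def field_simps)
    qed
    obtain k1 where k1: "k1 \<ge> 1" "T k1 \<ge> T0" "\<rho> * T k1 \<ge> n" "T k1 \<ge> exp 16"
    proof -
      obtain k where k: "T0 + n / \<rho> + exp 16 < B ^ k" using real_arch_pow[of B] B by auto
      have "B ^ k \<le> B ^ Suc k" using B by (intro power_increasing) auto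
      moreover have "n / \<rho> > 0" using n1 rk by simp
      ultimately have "T (Suc k) \<ge> T0" "T (Suc k) \<ge> n / \<rho>" "T (Suc k) \<ge> exp 16"
        using k rk(4) exp_gt_zero[of "16::real"] unfolding T_def by linarith+
      then show ?thesis using that[of "Suc k"] rk by (simp add: field_simps)
    qed
    have Tmono: "T j \<le> T k" if "j \<le> k" for j k unfolding T_def using that B by (intro power_increasing) auto
    have Tk: "T k \<ge> T0" "\<rho> * T k \<ge> n" "T k \<ge> exp 16" "T k \<ge> 1" if "k \<ge> k1" for k
    proof -
      show a: "T k \<ge> T0" "T k \<ge> exp 16" "T k \<ge> 1" using Tmono[OF that] k1 rk by linarith+
      have "\<rho> * T k1 \<le> \<rho> * T k" using Tmono[OF that] rk by (intro mult_left_mono) auto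
      then show "\<rho> * T k \<ge> n" using k1 by linarith
    qed
    define L where "L k = ln (T k)" for k
    have L: "L k \<ge> 16" if "k \<ge> k1" for k
    proof -
      have "ln (exp 16) \<le> L k" unfolding L_def using Tk(3,4)[OF that] by (subst ln_le_cancel_iff) auto
      then show ?thesis by simp
    qed
    have Lk: "L k = real k * ln B" for k unfolding L_def T_def using B by (simp add: ln_realpow)
    define r where "r k = 1 / (n * (T k)\<^sup>2 * L k)" for k
    have r0: "r k > 0" and rT: "r k * (T k)\<^sup>2 = 1 / (n * L k)" if "k \<ge> k1" for k
      using Tk[OF that] L[OF that] n1 by (auto simp: r_def)
    have rT1: "2 * r k \<le> 1 / (T k)\<^sup>2" and r1: "r k \<le> 1" if k: "k \<ge> k1" for k
    proof -
      have "1 * 16 \<le> n * L k" using n1 L[OF k] by (intro mult_mono) auto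
      then have "1 / (n * L k) \<le> 1 / 16" by (intro divide_left_mono) auto
      then have "r k * (T k)\<^sup>2 \<le> 1 / 16" using rT[OF k] by simp
      then have a: "2 * r k * (T k)\<^sup>2 \<le> 1" by simp
      have T1: "(T k)\<^sup>2 \<ge> 1" using Tk(4)[OF k] by (simp add: one_le_power)
      show "2 * r k \<le> 1 / (T k)\<^sup>2" using a T1 by (subst pos_le_divide_eq) auto
      also have "\<dots> \<le> 1" by (subst divide_le_eq_1_pos) (use T1 in linarith)+
      finally show "r k \<le> 1" using r0[OF k] by simp
    qed
    have rdec: "r k \<le> r j" if "j \<le> k" "k1 \<le> j" for j k
    proof -
      have jk: "k1 \<le> k" using that by simp
      have "L j \<le> L k" unfolding Lk using that lnB by (intro mult_right_mono) auto
      moreover have "(T j)\<^sup>2 \<le> (T k)\<^sup>2" using Tmono[OF that(1)] Tk(4)[OF that(2)] by (intro power_mono) auto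
      ultimately have "n * (T j)\<^sup>2 * L j \<le> n * (T k)\<^sup>2 * L k"
        using n1 L[OF that(2)] L[OF jk] by (intro mult_mono) auto
      moreover have "n * (T j)\<^sup>2 * L j > 0" "n * (T k)\<^sup>2 * L k > 0"
        using n1 L[OF that(2)] Tk(4)[OF that(2)] L[OF jk] Tk(4)[OF jk] by auto
      ultimately show ?thesis unfolding r_def by (intro divide_left_mono) auto
    qed
    define Vk where "Vk k = rows_below (T k) - rows_below (\<rho> * T k)" for k
    define I where "I k v = {cusp_of v - r k<..<cusp_of v + r k}" for k v
    define A where "A k = (\<Union>v\<in>Vk k. I k v)" for k
    have finV: "finite (Vk k)" if "k \<ge> k1" for k
      using rows_below_card[of "T k"] Tk(4)[OF that] by (simp add: Vk_def)
    have VkD: "v \<in> cusp_rows" "fst v \<le> T k" "fst v > \<rho> * T k" "cusp_of v \<in> {-1..2}" if "v \<in> Vk k" for v k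
      using that by (auto simp: Vk_def rows_below_def)
    have mI: "measure lborel (I k v) = 2 * r k" if "k \<ge> k1" for k v
      using r0[OF that] by (simp add: I_def)
    have fI: "I k v \<in> fmeasurable lborel" for k v by (simp add: I_def)
    have disj: "disjoint_family_on (I k) (Vk k)" if k: "k \<ge> k1" for k
      unfolding disjoint_family_on_def
    proof (intro ballI impI, rule ccontr)
      fix v w assume vw: "v \<in> Vk k" "w \<in> Vk k" "v \<noteq> w" "I k v \<inter> I k w \<noteq> {}"
      have "1 / (T k)\<^sup>2 \<le> 1 / (fst v * fst w)"
      proof (rule divide_left_mono)
        have f: "fst v \<ge> 1" "fst w \<ge> 1" using cusp_rows_ge1 VkD vw by blast+
        then show "fst v * fst w \<le> (T k)\<^sup>2"
          unfolding power2_eq_square using VkD[OF vw(1)] VkD[OF vw(2)] by (intro mult_mono) auto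
        show "0 < (T k)\<^sup>2 * (fst v * fst w)" using f Tk(4)[OF k] by (intro mult_pos_pos) auto
      qed simp
      also have "\<dots> \<le> \<bar>cusp_of v - cusp_of w\<bar>" using cusp_rows_dist VkD vw by blast
      also have "\<dots> < 2 * r k" using vw(4) unfolding I_def by auto
      finally show False using rT1[OF k] by simp
    qed
    have mA: "measure lborel (A k) = real (card (Vk k)) * (2 * r k)" if k: "k \<ge> k1" for k
    proof -
      have "measure lborel (A k) = (\<Sum>v\<in>Vk k. measure lborel (I k v))"
        unfolding A_def
      proof (rule measure_finite_Union[OF finV[OF k]])
        show "I k ` Vk k \<subseteq> sets lborel" by (auto simp: I_def)
        show "disjoint_family_on (I k) (Vk k)" by (rule disj[OF k])
        show "emeasure lborel (I k v) \<noteq> \<infinity>" for v using fI[of k v] by (auto simp: fmeasurable_def)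
      qed
      then show ?thesis by (simp add: mI[OF k])
    qed
    have mAlow: "measure lborel (A k) \<ge> 2 * \<kappa> / (n * L k)" if k: "k \<ge> k1" for k
    proof -
      have "2 * \<kappa> / (n * L k) = 2 * (\<kappa> * (r k * (T k)\<^sup>2))" by (simp only: rT[OF k]) simp
      also have "\<dots> = \<kappa> * (T k)\<^sup>2 * (2 * r k)" by simp
      also have "\<dots> \<le> real (card (Vk k)) * (2 * r k)"
        unfolding Vk_def using count[OF Tk(1)[OF k]] r0[OF k] by (intro mult_right_mono) auto
      finally show ?thesis by (simp only: mA[OF k])
    qed
    have fA: "A k \<in> fmeasurable lborel" if k: "k \<ge> k1" for k
      unfolding A_def using finV[OF k] fI by (intro fmeasurable.finite_UN) auto
    have q: "measure lborel (A j \<inter> A k) \<le> C * measure lborel (A j) * measure lborel (A k)"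
      if jk: "k1 \<le> j" "j < k" for j k
    proof -
      have k: "k \<ge> k1" using jk by simp
      define X where "X v = {w\<in>Vk k. \<bar>cusp_of v - cusp_of w\<bar> < 2 * r j}" for v
      have finX: "finite (X v)" for v using finV[OF k] by (simp add: X_def)
      have cX: "real (card (X v)) \<le> 8 * r j * (T k)\<^sup>2" if v: "v \<in> Vk j" for v
      proof (cases "X v = {}")
        case True then show ?thesis using r0[OF jk(1)] by simp
      next
        case False
        then obtain w where w: "w \<in> Vk k" "\<bar>cusp_of v - cusp_of w\<bar> < 2 * r j" by (auto simp: X_def)
        have ne: "v \<noteq> w" using VkD(2)[OF v] VkD(3)[OF w(1)] TB[OF jk(2)] by auto
        have f: "fst v \<ge> 1" "fst w \<ge> 1" using cusp_rows_ge1 VkD v w by blast+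
        have Tp: "T j \<ge> 1" "T k \<ge> 1" using Tk(4) jk k by auto
        have "1 / (T j * T k) \<le> 1 / (fst v * fst w)"
        proof (rule divide_left_mono)
          show "fst v * fst w \<le> T j * T k"
            using f VkD[OF v] VkD[OF w(1)] by (intro mult_mono) auto
          show "0 < T j * T k * (fst v * fst w)" using f Tp by (intro mult_pos_pos) auto
        qed simp
        also have "\<dots> \<le> \<bar>cusp_of v - cusp_of w\<bar>" using cusp_rows_dist VkD v w ne by blast
        finally have "1 / (T j * T k) < 2 * r j" using w(2) by linarith
        then have s1: "1 < 2 * (r j * T j * T k)" using Tp by (simp add: field_simps)
        then have "1 * (T j * (n * L j)) < 2 * (r j * T j * T k) * (T j * (n * L j))"
          using Tp n1 L[OF jk(1)] by (intro mult_strict_right_mono mult_pos_pos) auto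
        also have "\<dots> = 2 * T k * (n * L j) * (r j * (T j)\<^sup>2)" by (simp add: power2_eq_square)
        also have "\<dots> = 2 * T k" unfolding rT[OF jk(1)] using n1 L[OF jk(1)] by simp
        finally have s2: "T j * (n * L j) < 2 * T k" by simp
        have "1 * 16 \<le> n * L j" using n1 L[OF jk(1)] by (intro mult_mono) auto
        then have "T j * 16 \<le> T j * (n * L j)" using Tp by (intro mult_left_mono) auto
        then have s3: "T j * 8 \<le> T k" using s2 by simp
        have "1 \<le> 4 * r j * (T k)\<^sup>2"
        proof -
          have "1 < 2 * (r j * T j * T k)" by (rule s1)
          also have "\<dots> \<le> 2 * (r j * T k * T k)"
            using s3 Tp r0[OF jk(1)] by (intro mult_left_mono mult_right_mono) auto
          also have "\<dots> \<le> 4 * r j * (T k)\<^sup>2" using r0[OF jk(1)] by (simp add: power2_eq_square)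
          finally show ?thesis by simp
        qed
        note one = this
        let ?S = "{w\<in>cusp_rows. fst w \<le> T k \<and> cusp_of w \<in> {cusp_of v - 2 * r j..cusp_of v + 2 * r j}}"
        have "X v \<subseteq> ?S" using VkD[of _ k] by (auto simp: X_def)
        moreover have S: "finite ?S \<and> real (card ?S) \<le> (cusp_of v + 2 * r j - (cusp_of v - 2 * r j)) * (T k)\<^sup>2 + 1"
          using Tp r0[OF jk(1)] by (intro cusp_rows_card) auto
        ultimately have "card (X v) \<le> card ?S" by (intro card_mono) auto
        then have "real (card (X v)) \<le> 4 * r j * (T k)\<^sup>2 + 1" using S by simp
        then show ?thesis using one by simp
      qed
      have "A j \<inter> A k \<subseteq> (\<Union>v\<in>Vk j. \<Union>w\<in>X v. I k w)"
      proof
        fix x assume "x \<in> A j \<inter> A k"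
        then obtain v w where vw: "v \<in> Vk j" "x \<in> I j v" "w \<in> Vk k" "x \<in> I k w" by (auto simp: A_def)
        have "\<bar>cusp_of v - cusp_of w\<bar> < 2 * r j" using vw rdec[of j k] jk by (auto simp: I_def abs_less_iff)
        then show "x \<in> (\<Union>v\<in>Vk j. \<Union>w\<in>X v. I k w)" using vw unfolding X_def by blast
      qed
      then have "measure lborel (A j \<inter> A k) \<le> measure lborel (\<Union>v\<in>Vk j. \<Union>w\<in>X v. I k w)"
        using fA[OF jk(1)] fA[OF k] finV[OF jk(1)] finX fI
        by (intro measure_mono_fmeasurable fmeasurable.finite_UN) auto
      also have "\<dots> \<le> (\<Sum>v\<in>Vk j. measure lborel (\<Union>w\<in>X v. I k w))"
        using finV[OF jk(1)] finX fI by (intro measure_UNION_le) (auto simp: I_def intro!: sets.finite_UN)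
      also have "\<dots> \<le> (\<Sum>v\<in>Vk j. 8 * r j * (T k)\<^sup>2 * (2 * r k))"
      proof (intro sum_mono)
        fix v assume v: "v \<in> Vk j"
        have "measure lborel (\<Union>w\<in>X v. I k w) \<le> (\<Sum>w\<in>X v. measure lborel (I k w))"
          using finX by (intro measure_UNION_le) (auto simp: I_def)
        also have "\<dots> = real (card (X v)) * (2 * r k)" by (simp add: mI[OF k])
        also have "\<dots> \<le> 8 * r j * (T k)\<^sup>2 * (2 * r k)" using cX[OF v] r0[OF k] by (intro mult_right_mono) auto
        finally show "measure lborel (\<Union>w\<in>X v. I k w) \<le> 8 * r j * (T k)\<^sup>2 * (2 * r k)" .
      qed
      also have "\<dots> = measure lborel (A j) * (8 * (r k * (T k)\<^sup>2))"
        by (simp add: mA[OF jk(1)])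
      also have "\<dots> = measure lborel (A j) * (C * (2 * \<kappa> / (n * L k)))"
        unfolding rT[OF k] C_def using rk by simp
      also have "\<dots> \<le> measure lborel (A j) * (C * measure lborel (A k))"
        using mAlow[OF k] C by (intro mult_left_mono) auto
      finally show ?thesis by (simp add: mult_ac)
    qed
    have "\<exists>K. (\<Sum>k\<in>{k1..<K}. measure lborel (A k)) \<ge> 1 / C"
    proof (rule ccontr)
      assume neg: "\<not> ?thesis"
      define c where "c = 2 * \<kappa> / (n * ln B)"
      have c: "c > 0" using rk n1 lnB by (simp add: c_def)
      have "summable (\<lambda>i. c * inverse (real (i + k1)))"
      proof (rule summableI_nonneg_bounded)
        show "0 \<le> c * inverse (real (i + k1))" for i using c by simp
        fix i
        have "(\<Sum>i<i. c * inverse (real (i + k1))) \<le> (\<Sum>i<i. measure lborel (A (i + k1)))"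
        proof (intro sum_mono)
          fix l
          have "c * inverse (real (l + k1)) = 2 * \<kappa> / (n * L (l + k1))"
            unfolding Lk c_def using k1(1) by (simp add: field_simps)
          also have "\<dots> \<le> measure lborel (A (l + k1))" by (rule mAlow) simp
          finally show "c * inverse (real (l + k1)) \<le> measure lborel (A (l + k1))" .
        qed
        also have "\<dots> = (\<Sum>k\<in>{k1..<i + k1}. measure lborel (A k))"
          using sum.shift_bounds_nat_ivl[of "\<lambda>k. measure lborel (A k)" 0 k1 i] by (simp add: atLeast0LessThan)
        also have "\<dots> \<le> 1 / C" using neg by (meson less_imp_le not_le)
        finally show "(\<Sum>i<i. c * inverse (real (i + k1))) \<le> 1 / C" .
      qed
      then have "summable (\<lambda>i. inverse (real (i + k1)))" using c by (simp add: summable_cmult_iff)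
      then have "summable (\<lambda>i. inverse (real i))" by (subst (asm) summable_iff_shift[of "\<lambda>i. inverse (real i)"])
      then show False using not_summable_harmonic[where 'a=real] by simp
    qed
    then obtain K where K: "(\<Sum>k\<in>{k1..<K}. measure lborel (A k)) \<ge> 1 / C" by blast
    define U where "U = (\<Union>k\<in>{k1..<K}. A k)"
    have mU: "1 / (2 * C) \<le> measure lborel U"
      unfolding U_def
    proof (rule second_moment)
      fix i j assume ij: "i \<in> {k1..<K}" "j \<in> {k1..<K}" "i \<noteq> j"
      show "measure lborel (A i \<inter> A j) \<le> C * measure lborel (A i) * measure lborel (A j)"
      proof (cases "i < j")
        case True then show ?thesis using q ij by simp
      next
        case False
        then have "measure lborel (A j \<inter> A i) \<le> C * measure lborel (A j) * measure lborel (A i)"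
          using q ij by simp
        then show ?thesis by (simp add: Int_commute mult_ac)
      qed
    qed (use fA C K in \<open>auto simp: fmeasurable_def\<close>)
    have Uf: "U \<in> fmeasurable lborel" unfolding U_def using fA by (intro fmeasurable.finite_UN) auto
    have "U - cusps \<subseteq> excursion_reals N \<inter> {-2..3}"
    proof
      fix x assume x: "x \<in> U - cusps"
      then obtain k v where kv: "k \<ge> k1" "v \<in> Vk k" "x \<in> I k v" by (auto simp: U_def A_def)
      note v = VkD[OF kv(2)]
      obtain g where g: "g \<in> \<Gamma>" "\<bar>g$2$1\<bar> = fst v" "\<And>x. \<bar>g$2$1 * x + g$2$2\<bar> = fst v * \<bar>x - cusp_of v\<bar>"
        using cusp_rows_D[OF v(1)] by blast
      have f1: "fst v \<ge> 1" using cusp_rows_ge1[OF v(1)] .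
      have dx: "\<bar>x - cusp_of v\<bar> < r k" using kv(3) by (auto simp: I_def abs_less_iff)
      have "g$2$1 \<noteq> 0" using g(2) f1 by auto
      then have nz: "g$2$1 * x + g$2$2 \<noteq> 0" using x g(1) by (auto simp: cusps_def)
      have "n * (fst v * \<bar>x - cusp_of v\<bar> * (fst v * ln (fst v))) = n * \<bar>x - cusp_of v\<bar> * (fst v)\<^sup>2 * ln (fst v)"
        by (simp add: power2_eq_square)
      also have "\<dots> \<le> n * r k * (T k)\<^sup>2 * L k"
      proof -
        have "(fst v)\<^sup>2 \<le> (T k)\<^sup>2" using v(2) f1 by (intro power_mono) auto
        moreover have "ln (fst v) \<le> L k" unfolding L_def using v(2) f1 by (subst ln_le_cancel_iff) auto
        ultimately show ?thesis using dx n1 f1 r0[OF kv(1)] by (intro mult_mono) auto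
      qed
      also have "\<dots> = (r k * (T k)\<^sup>2) * (n * L k)" by simp
      also have "\<dots> = 1" unfolding rT[OF kv(1)] using n1 L[OF kv(1)] by simp
      finally have "n * (\<bar>g$2$1 * x + g$2$2\<bar> * (\<bar>g$2$1\<bar> * ln \<bar>g$2$1\<bar>)) \<le> 1" unfolding g by simp
      moreover have "n \<le> \<bar>g$2$1\<bar>" unfolding g(2) using v(3) Tk(2)[OF kv(1)] by linarith
      ultimately have "x \<in> excursion_reals N" using g(1) nz by (auto simp: excursion_reals_def n_def)
      moreover have "x \<in> {-2..3}" using dx v(4) r1[OF kv(1)] by (auto simp: abs_less_iff)
      ultimately show "x \<in> excursion_reals N \<inter> {-2..3}" by blast
    qed
    moreover have "measure lborel (U - cusps) = measure lborel U"
      using Uf cusps_null by (intro measure_Diff_null_set fmeasurableD)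
    moreover have "U - cusps \<in> sets lborel" using Uf cusps_null by (intro sets.Diff fmeasurableD null_setsD2)
    moreover have "excursion_reals N \<inter> {-2..3} \<in> fmeasurable lborel"
      by (rule fmeasurableI2[of "{-2..3::real}"]) (auto simp: fmeasurable_def)
    ultimately have "measure lborel U \<le> measure lborel (excursion_reals N \<inter> {-2..3})"
      using measure_mono_fmeasurable[of "U - cusps" "excursion_reals N \<inter> {-2..3}" lborel] by simp
    with mU show ?thesis by linarith
  qed
  then show ?thesis using C by (intro exI[of _ "1 / (2 * C)"]) auto
qed

lemma deep_reals_mass: "\<exists>c0>0. emeasure lborel (deep_reals \<inter> {-2..3}) \<ge> ennreal c0"
proof -
  obtain c0 where c0: "c0 > 0" "\<And>N. N \<ge> 1 \<Longrightarrow> measure lborel (excursion_reals N \<inter> {-2..3}) \<ge> c0"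
    using excursion_reals_mass by blast
  have fin: "emeasure lborel (excursion_reals N \<inter> {-2..3}) < \<infinity>" for N
  proof -
    have "emeasure lborel (excursion_reals N \<inter> {-2..3}) \<le> emeasure lborel {-2..3::real}" by (intro emeasure_mono) auto
    then show ?thesis by (rule le_less_trans) simp
  qed
  have "(\<lambda>N. emeasure lborel (excursion_reals (Suc N) \<inter> {-2..3})) \<longlonglongrightarrow> emeasure lborel (\<Inter>N. excursion_reals (Suc N) \<inter> {-2..3})"
  proof (rule Lim_emeasure_decseq)
    show "decseq (\<lambda>N. excursion_reals (Suc N) \<inter> {-2..3})"
    proof -
      have "excursion_reals (Suc n) \<subseteq> excursion_reals (Suc m)" if "m \<le> n" for m n using that by (intro excursion_reals_mono) auto
      then show ?thesis unfolding decseq_def by blast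
    qed
    show "emeasure lborel (excursion_reals (Suc N) \<inter> {-2..3}) \<noteq> \<infinity>" for N using fin[of "Suc N"] by (simp add: less_top)
  qed auto
  moreover have "ennreal c0 \<le> emeasure lborel (excursion_reals (Suc N) \<inter> {-2..3})" for N
  proof -
    have "ennreal c0 \<le> ennreal (measure lborel (excursion_reals (Suc N) \<inter> {-2..3}))" using c0(2)[of "Suc N"] by (intro ennreal_leI) auto
    also have "\<dots> = emeasure lborel (excursion_reals (Suc N) \<inter> {-2..3})"
      using fin[of "Suc N"] by (intro emeasure_eq_ennreal_measure[symmetric]) (auto simp: less_top)
    finally show ?thesis .
  qed
  ultimately have "ennreal c0 \<le> emeasure lborel (\<Inter>N. excursion_reals (Suc N) \<inter> {-2..3})"
    by (intro LIMSEQ_le_const) auto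
  also have "(\<Inter>N. excursion_reals (Suc N) \<inter> {-2..3}) = deep_reals \<inter> {-2..3}"
  proof -
    have "excursion_reals (Suc N) \<subseteq> excursion_reals N" for N by (intro excursion_reals_mono) auto
    then have "(\<Inter>N. excursion_reals (Suc N)) \<subseteq> deep_reals" unfolding deep_reals_def by blast
    moreover have "deep_reals \<subseteq> (\<Inter>N. excursion_reals (Suc N))" unfolding deep_reals_def by blast
    ultimately show ?thesis by blast
  qed
  finally show ?thesis using c0(1) by blast
qed

end

section \<open>The zero-one law\<close>

lemma emeasure_image_lower:
  fixes \<phi> h :: "real \<Rightarrow> real"
  assumes S: "S \<in> sets borel" "S \<subseteq> {u..v}"
    and der: "\<And>x. x \<in> {u..v} \<Longrightarrow> (\<phi> has_field_derivative h x) (at x)"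
    and cont: "continuous_on {u..v} h" and k: "\<And>x. x \<in> {u..v} \<Longrightarrow> \<bar>h x\<bar> \<ge> k" and inj: "inj_on \<phi> {u..v}"
    and T: "\<phi> ` S \<subseteq> T" "T \<in> sets borel" and k0: "k \<ge> 0"
  shows "ennreal k * emeasure lborel S \<le> emeasure lborel T"
proof -
  have Sl: "S \<in> lmeasurable"
    by (rule fmeasurableI2[of "{u..v}"]) (use S in auto)
  have i1: "(\<lambda>x. \<bar>h x\<bar>) absolutely_integrable_on {u..v}"
    by (intro absolutely_integrable_continuous_real continuous_on_rabs cont)
  then have i2: "(\<lambda>x. \<bar>h x\<bar>) absolutely_integrable_on S"
    by (rule set_integrable_subset) (use S in auto)
  have iff: "(\<lambda>x. \<bar>h x\<bar> *\<^sub>R (1::real)) absolutely_integrable_on S \<and> integral S (\<lambda>x. \<bar>h x\<bar> *\<^sub>R (1::real)) = b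
      \<longleftrightarrow> (\<lambda>x. 1::real) absolutely_integrable_on \<phi> ` S \<and> integral (\<phi> ` S) (\<lambda>x. 1::real) = b" for b
  proof (rule has_absolute_integral_change_of_variables_real)
    show "S \<in> sets lebesgue" using Sl by auto
    show "(\<phi> has_field_derivative h x) (at x within S)" if "x \<in> S" for x
    proof -
      have "x \<in> {u..v}" using S(2) that by blast
      then show ?thesis using der has_field_derivative_at_within by blast
    qed
    show "inj_on \<phi> S" using inj S(2) by (rule inj_on_subset)
  qed
  have A: "(\<lambda>x. 1::real) absolutely_integrable_on \<phi> ` S" "integral (\<phi> ` S) (\<lambda>x. 1::real) = integral S (\<lambda>x. \<bar>h x\<bar>)"
    using iff[of "integral S (\<lambda>x. \<bar>h x\<bar>)"] i2 by auto
  have im: "\<phi> ` S \<in> lmeasurable"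
    using A(1) by (simp add: lmeasurable_iff_integrable_on absolutely_integrable_on_def)
  have "k * measure lebesgue S = integral S (\<lambda>x. k)"
    using Sl by (simp add: lmeasure_integral integral_mult_right[of S k "\<lambda>x. 1", simplified])
  also have "\<dots> \<le> integral S (\<lambda>x. \<bar>h x\<bar>)"
  proof (rule integral_le)
    show "(\<lambda>x. k) integrable_on S" using Sl integrable_on_const by blast
    show "(\<lambda>x. \<bar>h x\<bar>) integrable_on S" using i2 by (simp add: absolutely_integrable_on_def)
    show "k \<le> \<bar>h x\<bar>" if "x \<in> S" for x using k S(2) that by auto
  qed
  also have "\<dots> = measure lebesgue (\<phi> ` S)" using A(2) im by (simp add: lmeasure_integral)
  finally have le: "k * measure lebesgue S \<le> measure lebesgue (\<phi> ` S)" .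
  have "emeasure lborel S = emeasure lebesgue S" using S by simp
  also have "\<dots> = ennreal (measure lebesgue S)" using Sl by (simp add: emeasure_eq_measure2)
  finally have "ennreal k * emeasure lborel S = ennreal (k * measure lebesgue S)"
    using k0 by (simp add: ennreal_mult)
  also have "\<dots> \<le> ennreal (measure lebesgue (\<phi> ` S))" using le by (rule ennreal_leI)
  also have "\<dots> = emeasure lebesgue (\<phi> ` S)" using im by (simp add: emeasure_eq_measure2)
  also have "\<dots> \<le> emeasure lebesgue T" using T by (intro emeasure_mono) auto
  also have "\<dots> = emeasure lborel T" using T by simp
  finally show ?thesis .
qed

context cusped
begin

definition recurrent_reals :: "nat \<Rightarrow> real set" where
  "recurrent_reals A = {x. \<forall>N::nat. \<exists>g\<in>\<Gamma>. real N \<le> \<bar>g$2$1\<bar> \<and> \<bar>g$2$1\<bar> * \<bar>g$2$1 * x + g$2$2\<bar> \<le> real A}"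

lemma recurrent_reals_borel [measurable]: "recurrent_reals A \<in> sets borel"
proof -
  have "recurrent_reals A = (\<Inter>N::nat. \<Union>g\<in>{g\<in>\<Gamma>. real N \<le> \<bar>g$2$1\<bar>}. {x. \<bar>g$2$1\<bar> * \<bar>g$2$1 * x + g$2$2\<bar> \<le> real A})"
    by (auto simp: recurrent_reals_def)
  also have "\<dots> \<in> sets borel"
    using countable_group
    by (intro sets.countable_INT'' sets.countable_UN'') (auto intro: countable_subset)
  finally show ?thesis .
qed

text \<open>Near \<open>x\<close> the set \<open>deep_reals\<close> contains the image of a full period of \<open>deep_reals\<close> under \<open>g\<^sup>-\<^sup>1\<close>,
  whose distortion is bounded.\<close>

lemma deep_reals_density:
  assumes c0: "c0 > 0" "emeasure lborel (deep_reals \<inter> {-2..3}) \<ge> ennreal c0" and x: "x \<in> recurrent_reals A" and \<eta>: "\<eta> > 0"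
  shows "\<exists>s. 0 < s \<and> s < \<eta> \<and> emeasure lborel (deep_reals \<inter> ball x s) \<ge> ennreal (c0 / (49 * (real A + 2)) * s)"
proof -
  obtain N0 :: nat where N0: "(real A + 2) / \<eta> < real N0"
    using reals_Archimedean2 by blast
  define N where "N = Suc N0"
  have N: "(real A + 2) / \<eta> < real N" "N \<ge> 1" using N0 by (auto simp: N_def)
  obtain g where g: "g \<in> \<Gamma>" "real N \<le> \<bar>g$2$1\<bar>" "\<bar>g$2$1\<bar> * \<bar>g$2$1 * x + g$2$2\<bar> \<le> real A"
    using x by (auto simp: recurrent_reals_def)
  define a b c d where "a = g$1$1" "b = g$1$2" "c = g$2$1" "d = g$2$2"
  note abcd = a_b_c_d_def
  have dg: "a * d - b * c = 1" using det1[OF g(1)] by (simp add: det_2 abcd)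
  have c1: "\<bar>c\<bar> \<ge> 1" using g(2) N(2) unfolding abcd by linarith
  then have cnz: "c \<noteq> 0" by auto
  have c2: "c\<^sup>2 \<ge> \<bar>c\<bar>" using c1 mult_left_mono[OF c1, of "\<bar>c\<bar>"] by (simp add: power2_eq_square flip: abs_mult)
  define p where "p = - d / c"
  have xp: "c\<^sup>2 * \<bar>x - p\<bar> \<le> real A"
  proof -
    have "c * x + d = c * (x - p)" using cnz by (simp add: p_def field_simps)
    then have "\<bar>c\<bar> * (\<bar>c\<bar> * \<bar>x - p\<bar>) \<le> real A" using g(3) unfolding abcd[symmetric] by (simp only: abs_mult)
    then show ?thesis by (simp add: power2_eq_square mult.assoc[symmetric] flip: abs_mult)
  qed
  define s where "s = (real A + 2) / c\<^sup>2"
  have s0: "s > 0" using cnz by (simp add: s_def)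
  have s\<eta>: "s < \<eta>"
  proof -
    have "(real A + 2) / \<eta> < c\<^sup>2" using N(1) g(2) c2 unfolding abcd by linarith
    then show ?thesis using \<eta> cnz by (simp add: s_def field_simps)
  qed
  define m where "m = \<lfloor>a / c\<rfloor> - 4"
  define u v where "u = real_of_int m - 2" and "v = real_of_int m + 3"
  have ac: "1 \<le> a / c - t \<and> a / c - t < 7" if "t \<in> {u..v}" for t
    using that unfolding u_def v_def m_def by auto linarith+
  define \<phi> where "\<phi> t = p + 1 / (c\<^sup>2 * (a / c - t))" for t
  define h where "h t = 1 / (c\<^sup>2 * (a / c - t)\<^sup>2)" for t
  define S where "S = deep_reals \<inter> {u..v}"
  have "emeasure lborel (deep_reals \<inter> {-2..3}) = emeasure lborel S"
  proof -
    have eq: "real_of_int m + y \<in> deep_reals \<longleftrightarrow> y \<in> deep_reals" for y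
      using deep_reals_translate_iff[of y m] by (simp only: add.commute)
    have "emeasure lborel S = emeasure (distr lborel borel ((+) (real_of_int m))) S"
      by (simp add: lborel_distr_plus)
    also have "\<dots> = emeasure lborel ((+) (real_of_int m) -` S \<inter> space lborel)"
      by (intro emeasure_distr) (auto simp: S_def)
    also have "(+) (real_of_int m) -` S \<inter> space lborel = deep_reals \<inter> {-2..3}"
      by (auto simp: S_def u_def v_def eq)
    finally show ?thesis ..
  qed
  with c0 have massS: "emeasure lborel S \<ge> ennreal c0" by simp
  have "ennreal (1 / (49 * c\<^sup>2)) * emeasure lborel S \<le> emeasure lborel (deep_reals \<inter> ball x s)"
  proof (rule emeasure_image_lower[where \<phi>=\<phi> and h=h])
    show "S \<in> sets borel" "S \<subseteq> {u..v}" "deep_reals \<inter> ball x s \<in> sets borel" by (auto simp: S_def)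
    show "(\<phi> has_field_derivative h t) (at t)" if "t \<in> {u..v}" for t
    proof -
      have nz: "a / c - t \<noteq> 0" using ac[OF that] by auto
      have val: "0 + (0 * (c\<^sup>2 * X) - 1 * (c\<^sup>2 * (0 - 1))) / (c\<^sup>2 * X * (c\<^sup>2 * X)) = 1 / (c\<^sup>2 * X\<^sup>2)"
        if "X \<noteq> 0" for X using that cnz by (simp add: power2_eq_square)
      have "((\<lambda>t. p + 1 / (c\<^sup>2 * (a / c - t))) has_field_derivative
          0 + (0 * (c\<^sup>2 * (a / c - t)) - 1 * (c\<^sup>2 * (0 - 1))) / (c\<^sup>2 * (a / c - t) * (c\<^sup>2 * (a / c - t)))) (at t)"
        using nz cnz by (intro DERIV_add DERIV_const DERIV_divide DERIV_cmult DERIV_diff DERIV_ident) simp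
      then show ?thesis unfolding \<phi>_def[abs_def] h_def val[OF nz] .
    qed
    show "continuous_on {u..v} h"
      unfolding h_def using ac cnz by (force intro!: continuous_intros)
    show "1 / (49 * c\<^sup>2) \<le> \<bar>h t\<bar>" if "t \<in> {u..v}" for t
    proof -
      have "(a / c - t)\<^sup>2 \<le> 7\<^sup>2" using ac[OF that] by (intro power_mono) auto
      then have "c\<^sup>2 * (a / c - t)\<^sup>2 \<le> c\<^sup>2 * 7\<^sup>2" by (rule mult_left_mono) simp
      then have "c\<^sup>2 * (a / c - t)\<^sup>2 \<le> 49 * c\<^sup>2" by simp
      moreover have "c\<^sup>2 * (a / c - t)\<^sup>2 > 0" using ac[OF that] cnz by simp
      ultimately show ?thesis unfolding h_def using cnz by (simp add: divide_left_mono)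
    qed
    show "inj_on \<phi> {u..v}"
    proof (rule inj_onI)
      fix t t' assume t: "t \<in> {u..v}" "t' \<in> {u..v}" "\<phi> t = \<phi> t'"
      have "1 / (c\<^sup>2 * (a / c - t)) = 1 / (c\<^sup>2 * (a / c - t'))" using t(3) unfolding \<phi>_def by (simp only: add_left_cancel)
      then have "1 = (0::real) \<or> c\<^sup>2 * (a / c - t) = c\<^sup>2 * (a / c - t')" by (rule divide_cancel_left[THEN iffD1])
      then show "t = t'" using cnz by simp
    qed
    show "\<phi> ` S \<subseteq> deep_reals \<inter> ball x s"
    proof
      fix y assume "y \<in> \<phi> ` S"
      then obtain t where t: "t \<in> deep_reals" "t \<in> {u..v}" "y = \<phi> t" by (auto simp: S_def)
      have q: "a / c - t \<ge> 1" using ac[OF t(2)] by simp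
      have "a - c * t = c * (a / c - t)" using cnz by (simp add: right_diff_distrib)
      then have act: "a - c * t \<noteq> 0" using q cnz by simp
      have "\<phi> t = (d * t - b) / (a - c * t)"
      proof -
        have e1: "c\<^sup>2 * (a / c - t) = c * (a - c * t)" using cnz by (simp add: power2_eq_square field_simps)
        have "\<phi> t * (c * (a - c * t)) = (- d * (a - c * t) + 1)"
          unfolding \<phi>_def e1 p_def using cnz act by (simp add: field_simps)
        also have "\<dots> = c * (d * t - b)" using dg by (simp add: algebra_simps)
        finally have "c * (\<phi> t * (a - c * t)) = c * (d * t - b)" by (simp only: mult.left_commute)
        then have "c = 0 \<or> \<phi> t * (a - c * t) = d * t - b" by (simp only: mult_cancel_left)
        then have "\<phi> t * (a - c * t) = d * t - b" using cnz by blast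
        then show ?thesis using act by (intro eq_divide_imp)
      qed
      then have "y \<in> deep_reals"
        using deep_reals_invariant[OF t(1) adj_closed[OF g(1)]] act t(3) by (simp add: abcd algebra_simps)
      moreover have "\<bar>y - x\<bar> < s"
      proof -
        have "c\<^sup>2 * 1 \<le> c\<^sup>2 * (a / c - t)" using q by (intro mult_left_mono) auto
        then have "1 / (c\<^sup>2 * (a / c - t)) \<le> 1 / c\<^sup>2" using cnz q by (intro divide_left_mono) auto
        moreover have "1 / (c\<^sup>2 * (a / c - t)) > 0" using cnz q by simp
        ultimately have "\<bar>y - p\<bar> \<le> 1 / c\<^sup>2" by (simp add: t(3) \<phi>_def)
        moreover have "\<bar>x - p\<bar> \<le> real A / c\<^sup>2" using xp cnz by (simp add: field_simps)
        moreover have "\<bar>y - x\<bar> \<le> \<bar>y - p\<bar> + \<bar>x - p\<bar>" by linarith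
        ultimately have "\<bar>y - x\<bar> \<le> 1 / c\<^sup>2 + real A / c\<^sup>2" by linarith
        also have "\<dots> = (1 + real A) / c\<^sup>2" by (simp add: add_divide_distrib)
        also have "\<dots> < s" unfolding s_def using cnz by (intro divide_strict_right_mono) auto
        finally show ?thesis .
      qed
      ultimately show "y \<in> deep_reals \<inter> ball x s" by (simp add: dist_real_def abs_minus_commute)
    qed
  qed simp
  moreover have "ennreal (c0 / (49 * (real A + 2)) * s) \<le> ennreal (1 / (49 * c\<^sup>2)) * emeasure lborel S"
  proof -
    have "c0 / (49 * K) * (K / c\<^sup>2) = 1 / (49 * c\<^sup>2) * c0" if "K \<noteq> 0" for K using that by simp
    from this[of "real A + 2"] have "c0 / (49 * (real A + 2)) * s = 1 / (49 * c\<^sup>2) * c0" unfolding s_def by linarith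
    then have "ennreal (c0 / (49 * (real A + 2)) * s) = ennreal (1 / (49 * c\<^sup>2)) * ennreal c0"
      using c0 by (simp only:) (rule ennreal_mult, auto)
    also have "\<dots> \<le> ennreal (1 / (49 * c\<^sup>2)) * emeasure lborel S" using massS by (rule mult_left_mono) simp
    finally show ?thesis .
  qed
  ultimately show ?thesis using s0 s\<eta> order_trans by blast
qed

end

context cusped_lattice
begin

lemma recurrent_point:
  assumes x: "x \<in> {0..1}" "x \<notin> cusps" and \<delta>: "\<delta> > 0" and A: "1 / \<delta> \<le> real A"
    and inf: "\<And>k0. \<exists>k\<ge>k0. x \<notin> low_reals ((1/2)^k) \<delta>"
  shows "x \<in> recurrent_reals A"
proof -
  have good: "\<exists>g\<in>\<Gamma>. \<bar>g$2$1 * x + g$2$2\<bar> < e \<and> \<bar>g$2$1\<bar> * \<bar>g$2$1 * x + g$2$2\<bar> \<le> real A" if e: "e > 0" for e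
  proof -
    have "\<delta> * e\<^sup>2 / 2 > 0" using \<delta> e by simp
    then obtain k0 where k0: "(1/2::real)^k0 < \<delta> * e\<^sup>2 / 2" using real_arch_pow_inv[of "\<delta> * e\<^sup>2 / 2" "1/2"] by auto
    obtain k where k: "k \<ge> k0" "x \<notin> low_reals ((1/2)^k) \<delta>" using inf by blast
    have "(1/2::real)^k \<le> (1/2)^k0" using k(1) by (intro power_decreasing) auto
    then have "2 * (1/2)^k < \<delta> * e\<^sup>2" using k0 by linarith
    then have "2 * (1/2)^k < e\<^sup>2 * \<delta>" by (simp only: mult.commute)
    then have Y: "2 * (1/2)^k / \<delta> < e\<^sup>2" using \<delta> by (simp only: pos_divide_less_eq)
    have "x \<in> {0..1} - low_reals ((1/2)^k) \<delta>" using x k by simp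
    then obtain g where g: "g \<in> \<Gamma>" "(g$2$1 * x + g$2$2)\<^sup>2 < 2 * (1/2)^k / \<delta>"
      "\<bar>g$2$1\<bar> * \<bar>g$2$1 * x + g$2$2\<bar> \<le> 1 / \<delta>"
      using good_point[of "(1/2)^k" x \<delta>] \<delta> by (metis zero_less_divide_1_iff zero_less_numeral zero_less_power)
    have "\<bar>g$2$1 * x + g$2$2\<bar>\<^sup>2 < e\<^sup>2" using g(2) Y by simp
    then have "\<bar>g$2$1 * x + g$2$2\<bar> < e" by (rule power2_less_imp_less) (use e in simp)
    moreover have "\<bar>g$2$1\<bar> * \<bar>g$2$1 * x + g$2$2\<bar> \<le> real A" using g(3) A by (rule order_trans)
    ultimately show ?thesis using g(1) by blast
  qed
  show ?thesis
    unfolding recurrent_reals_def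
  proof (intro CollectI allI)
    fix N :: nat
    define e where "e = 1 / (2 * (real N + 1))"
    have e: "e > 0" "e \<le> 1/2" by (auto simp: e_def field_simps)
    obtain g where g: "g \<in> \<Gamma>" "\<bar>g$2$1 * x + g$2$2\<bar> < e" "\<bar>g$2$1\<bar> * \<bar>g$2$1 * x + g$2$2\<bar> \<le> real A"
      using good[OF e(1)] by blast
    show "\<exists>g\<in>\<Gamma>. real N \<le> \<bar>g$2$1\<bar> \<and> \<bar>g$2$1\<bar> * \<bar>g$2$1 * x + g$2$2\<bar> \<le> real A"
    proof (cases "real N \<le> \<bar>g$2$1\<bar>")
      case True then show ?thesis using g by blast
    next
      case False
      define w where "w = \<bar>g$2$1 * x + g$2$2\<bar>"
      have w: "w > 0"
        using x(2) g(1) det_row2[OF det1[OF g(1)]] by (cases "g$2$1 = 0") (auto simp: w_def cusps_def)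
      obtain h where h: "h \<in> \<Gamma>" "\<bar>h$2$1 * x + h$2$2\<bar> < min w e" "\<bar>h$2$1\<bar> * \<bar>h$2$1 * x + h$2$2\<bar> \<le> real A"
        using good[of "min w e"] w e(1) by auto
      show ?thesis
      proof (cases "real N \<le> \<bar>h$2$1\<bar>")
        case True then show ?thesis using h by blast
      next
        case F2: False
        have "\<bar>g$2$1 * h$2$2 - h$2$1 * g$2$2\<bar> = \<bar>g$2$1 * (h$2$1 * x + h$2$2) - h$2$1 * (g$2$1 * x + g$2$2)\<bar>"
          by (simp add: algebra_simps)
        also have "\<dots> \<le> \<bar>g$2$1\<bar> * \<bar>h$2$1 * x + h$2$2\<bar> + \<bar>h$2$1\<bar> * \<bar>g$2$1 * x + g$2$2\<bar>"
          unfolding abs_mult[symmetric] by (rule abs_triangle_ineq4)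
        also have "\<dots> \<le> (real N * e) + (real N * e)"
          using False F2 g(2) h(2) by (intro add_mono mult_mono) auto
        also have "\<dots> < 1"
        proof -
          have "e * (2 * (real N + 1)) = 1" by (simp add: e_def)
          then have "real N * e + real N * e + 2 * e = 1" by (simp add: algebra_simps)
          then show ?thesis using e(1) by linarith
        qed
        finally have "\<not> \<bar>g$2$1 * h$2$2 - h$2$1 * g$2$2\<bar> \<ge> 1" by simp
        then have "(h$2$1 = g$2$1 \<and> h$2$2 = g$2$2) \<or> (h$2$1 = - g$2$1 \<and> h$2$2 = - g$2$2)"
          using rows[OF g(1) h(1)] by blast
        then have "\<bar>h$2$1 * x + h$2$2\<bar> = w"
        proof
          assume "h$2$1 = - g$2$1 \<and> h$2$2 = - g$2$2"
          then have "h$2$1 * x + h$2$2 = - (g$2$1 * x + g$2$2)" by simp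
          then show ?thesis unfolding w_def by (simp only: abs_minus_cancel)
        qed (simp add: w_def)
        with h(2) show ?thesis by simp
      qed
    qed
  qed
qed

lemma nonrecurrent_null: "({0..1} - (\<Union>A. recurrent_reals A)) - cusps \<in> null_sets lborel"
proof -
  define Z where "Z = ({0..1} - (\<Union>A. recurrent_reals A)) - cusps"
  have Qb: "cusps \<in> sets borel" using cusps_null by auto
  have Zb: "Z \<in> sets borel" unfolding Z_def using Qb by (intro sets.Diff sets.countable_UN) auto
  have bound: "emeasure lborel Z \<le> ennreal \<epsilon>" if e: "\<epsilon> > 0" for \<epsilon>
  proof -
    obtain \<delta> where \<delta>: "\<delta> > 0" "\<And>Y. 0 < Y \<Longrightarrow> Y \<le> 1 \<Longrightarrow> measure lborel (low_reals Y \<delta>) \<le> \<epsilon>"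
      using recurrence[OF e] by blast
    obtain A :: nat where A: "1 / \<delta> \<le> real A" using real_arch_simple by blast
    define D where "D k0 = (\<Inter>k\<in>{k0..}. low_reals ((1/2)^k) \<delta>)" for k0 :: nat
    have Xb: "low_reals ((1/2)^k) \<delta> \<in> sets borel" for k :: nat by (rule low_reals_borel) simp
    have Db: "D k0 \<in> sets borel" for k0
      unfolding D_def using Xb by (intro sets.countable_INT'') auto
    have De: "emeasure lborel (D k0) \<le> ennreal \<epsilon>" for k0
    proof -
      have "emeasure lborel (D k0) \<le> emeasure lborel (low_reals ((1/2)^k0) \<delta>)"
        using Xb by (intro emeasure_mono) (auto simp: D_def)
      also have "\<dots> = ennreal (measure lborel (low_reals ((1/2)^k0) \<delta>))"
      proof (rule emeasure_eq_ennreal_measure)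
        have "emeasure lborel (low_reals ((1/2)^k0) \<delta>) \<le> emeasure lborel {0..1::real}"
          by (intro emeasure_mono) (auto simp: low_reals_def)
        then show "emeasure lborel (low_reals ((1/2)^k0) \<delta>) \<noteq> \<top>" by (auto simp: top_unique)
      qed
      also have "\<dots> \<le> ennreal \<epsilon>" by (intro ennreal_leI \<delta>(2)) (auto simp: power_le_one)
      finally show ?thesis .
    qed
    have inc: "incseq D" unfolding incseq_def D_def by (auto intro: order_trans)
    have "Z \<subseteq> (\<Union>k0. D k0)"
    proof
      fix x assume x: "x \<in> Z"
      show "x \<in> (\<Union>k0. D k0)"
      proof (rule ccontr)
        assume "x \<notin> (\<Union>k0. D k0)"
        then have "\<exists>k\<ge>k0. x \<notin> low_reals ((1/2)^k) \<delta>" for k0 by (auto simp: D_def)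
        then have "x \<in> recurrent_reals A" using x by (intro recurrent_point[OF _ _ \<delta>(1) A]) (auto simp: Z_def)
        with x show False by (auto simp: Z_def)
      qed
    qed
    then have "emeasure lborel Z \<le> emeasure lborel (\<Union>k0. D k0)" using Db by (intro emeasure_mono) auto
    also have "\<dots> = (SUP k0. emeasure lborel (D k0))"
      using Db inc by (intro SUP_emeasure_incseq[symmetric]) auto
    also have "\<dots> \<le> ennreal \<epsilon>" using De by (intro SUP_least) auto
    finally show ?thesis .
  qed
  have "emeasure lborel Z \<le> 0"
    by (rule ennreal_le_epsilon) (use bound in simp)
  then show ?thesis using Zb unfolding Z_def[symmetric] by (intro null_setsI) auto
qed

theorem deep_reals_conull: "negligible (- deep_reals)"
proof -
  obtain c0 where c0: "c0 > 0" "emeasure lborel (deep_reals \<inter> {-2..3}) \<ge> ennreal c0" using deep_reals_mass by blast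
  have nA: "negligible (recurrent_reals A - deep_reals)" for A
  proof (rule density_null[where E=deep_reals and c="c0 / (49 * (real A + 2))"])
    show "0 < c0 / (49 * (real A + 2))" using c0 by simp
    show "\<exists>s>0. s < \<eta> \<and> ennreal (c0 / (49 * (real A + 2)) * s) \<le> emeasure lborel (deep_reals \<inter> ball x s)"
      if "x \<in> recurrent_reals A - deep_reals" "0 < \<eta>" for x \<eta>
      using deep_reals_density[OF c0 _ that(2), of x A] that(1) by auto
  qed auto
  have nU: "negligible (\<Union>A. recurrent_reals A - deep_reals)" by (intro negligible_Union_nat nA)
  have n0: "negligible (({0..1} - (\<Union>A. recurrent_reals A)) - cusps)" "negligible cusps"
    using nonrecurrent_null cusps_null by (auto simp: negligible_iff_null_sets intro: null_sets_completionI)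
  have n1: "negligible ({0..1} - deep_reals)"
  proof (rule negligible_subset)
    show "negligible ((\<Union>A. recurrent_reals A - deep_reals) \<union> ((({0..1} - (\<Union>A. recurrent_reals A)) - cusps) \<union> cusps))"
      by (intro negligible_Un nU n0)
  qed auto
  have nn: "negligible ((+) (real_of_int m) ` ({0..1} - deep_reals))" for m
    using n1 by (rule negligible_translation)
  have "negligible (\<Union>i::nat. (+) (real_of_int (from_nat_into UNIV i)) ` ({0..1} - deep_reals))"
    by (intro negligible_Union_nat nn)
  moreover have "- deep_reals \<subseteq> (\<Union>i::nat. (+) (real_of_int (from_nat_into UNIV i)) ` ({0..1} - deep_reals))"
  proof
    fix x assume x: "x \<in> - deep_reals"
    obtain i where i: "from_nat_into UNIV i = \<lfloor>x\<rfloor>"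
      using from_nat_into_surj[of "UNIV :: int set" "\<lfloor>x\<rfloor>"] by auto
    have "x - of_int \<lfloor>x\<rfloor> \<notin> deep_reals" using x deep_reals_translate[of "x - of_int \<lfloor>x\<rfloor>" "\<lfloor>x\<rfloor>"] by auto
    moreover have "x - of_int \<lfloor>x\<rfloor> \<in> {0..1}" by auto linarith+
    ultimately have "x \<in> (+) (real_of_int (from_nat_into UNIV i)) ` ({0..1} - deep_reals)"
      unfolding i by (intro image_eqI[of _ _ "x - of_int \<lfloor>x\<rfloor>"]) auto
    then show "x \<in> (\<Union>i::nat. (+) (real_of_int (from_nat_into UNIV i)) ` ({0..1} - deep_reals))" by blast
  qed
  ultimately show ?thesis by (rule negligible_subset)
qed

end

section \<open>Exponential decay of return probabilities\<close>

definition convolve :: "(real^2^2) pmf \<Rightarrow> (real^2^2) pmf \<Rightarrow> (real^2^2) pmf" where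
  "convolve p r = bind_pmf p (\<lambda>g. map_pmf ((**) g) r)"

primrec walk_law :: "(real^2^2) pmf \<Rightarrow> nat \<Rightarrow> (real^2^2) pmf" where
  "walk_law \<mu> 0 = return_pmf (mat 1)"
| "walk_law \<mu> (Suc n) = convolve \<mu> (walk_law \<mu> n)"

text \<open>The geometric average of the convolution powers has full support, and decay of its powers is
  transferred back to \<open>\<mu>\<close> through the resolvent identity.\<close>

definition geometric_law :: "(real^2^2) pmf \<Rightarrow> (real^2^2) pmf" where
  "geometric_law \<mu> = bind_pmf (geometric_pmf (1/2)) (walk_law \<mu>)"

definition left_average :: "(real^2^2) pmf \<Rightarrow> (real^2^2 \<Rightarrow> ennreal) \<Rightarrow> real^2^2 \<Rightarrow> ennreal" where
  "left_average p f x = (\<integral>\<^sup>+g. f (adj2 g ** x) \<partial>measure_pmf p)"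

lemma nn_integral_convolve: "(\<integral>\<^sup>+k. F k \<partial>measure_pmf (convolve p r)) = (\<integral>\<^sup>+g. \<integral>\<^sup>+h. F (g ** h) \<partial>measure_pmf r \<partial>measure_pmf p)"
  by (simp add: convolve_def)

lemma set_pmf_convolve: "set_pmf (convolve p r) = {g ** h | g h. g \<in> set_pmf p \<and> h \<in> set_pmf r}"
  by (auto simp: convolve_def)

lemma left_average_mono: "(\<And>y. f y \<le> h y) \<Longrightarrow> left_average p f x \<le> left_average p h x"
  unfolding left_average_def by (rule nn_integral_mono) auto

lemma left_average_cmult: "left_average p (\<lambda>y. c * f y) x = c * left_average p f x"
  unfolding left_average_def by (rule nn_integral_cmult) auto

lemma pmf_left_mult:
  fixes r :: "(real^2^2) pmf"
  assumes "det g = 1" shows "pmf (map_pmf ((**) g) r) x = pmf r (adj2 g ** x)"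
proof -
  have inj: "inj ((**) g :: real^2^2 \<Rightarrow> real^2^2)" by (rule inj_on_inverseI[of _ "(**) (adj2 g)"]) (simp add: adj2_cancel[OF assms])
  have "pmf (map_pmf ((**) g) r) (g ** (adj2 g ** x)) = pmf r (adj2 g ** x)"
    by (rule pmf_map_inj'[OF inj])
  then show ?thesis by (simp add: adj2_cancel[OF assms])
qed

lemma left_average_pmf:
  assumes "\<And>g. g \<in> set_pmf p \<Longrightarrow> det g = 1"
  shows "ennreal (pmf (convolve p r) x) = left_average p (\<lambda>y. ennreal (pmf r y)) x"
  unfolding convolve_def left_average_def ennreal_pmf_bind
  by (intro nn_integral_cong_AE AE_pmfI) (simp add: pmf_left_mult assms)

lemma nn_integral_geometric_law:
  "(\<integral>\<^sup>+k. F k \<partial>measure_pmf (geometric_law \<mu>)) = F (mat 1) / 2 + (\<integral>\<^sup>+g. \<integral>\<^sup>+h. F (g ** h) \<partial>measure_pmf (geometric_law \<mu>) \<partial>measure_pmf \<mu>) / 2"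
proof -
  define w where "w n = ennreal ((1/2)^n / 2)" for n :: nat
  define I where "I n F = (\<integral>\<^sup>+k. F k \<partial>measure_pmf (walk_law \<mu> n))" for n and F :: "real^2^2 \<Rightarrow> ennreal"
  have geometric_law: "(\<integral>\<^sup>+k. F k \<partial>measure_pmf (geometric_law \<mu>)) = (\<Sum>n. w n * I n F)" for F :: "real^2^2 \<Rightarrow> ennreal"
  proof -
    have "(\<integral>\<^sup>+k. F k \<partial>measure_pmf (geometric_law \<mu>)) = (\<integral>\<^sup>+n. I n F \<partial>measure_pmf (geometric_pmf (1/2)))"
      by (simp add: geometric_law_def I_def)
    also have "\<dots> = (\<integral>\<^sup>+n. w n * I n F \<partial>count_space UNIV)"
      by (simp add: nn_integral_measure_pmf w_def)
    also have "\<dots> = (\<Sum>n. w n * I n F)" by (rule nn_integral_count_space_nat)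
    finally show ?thesis .
  qed
  have wS: "w (Suc n) = w n / 2" for n
    by (simp add: w_def ennreal_divide_numeral)
  have IS: "I (Suc n) F = (\<integral>\<^sup>+g. I n (\<lambda>h. F (g ** h)) \<partial>measure_pmf \<mu>)" for n
    by (simp add: I_def nn_integral_convolve)
  have "(\<Sum>n. w n * I n F) = (\<Sum>n. w (n + 1) * I (n + 1) F) + (\<Sum>n<1. w n * I n F)"
    by (rule suminf_offset) auto
  also have "(\<Sum>n<1. w n * I n F) = F (mat 1) / 2"
    by (simp add: w_def I_def divide_ennreal_def mult.commute flip: ennreal_numeral inverse_ennreal)
  also have "(\<Sum>n. w (n + 1) * I (n + 1) F) = (\<integral>\<^sup>+g. \<integral>\<^sup>+h. F (g ** h) \<partial>measure_pmf (geometric_law \<mu>) \<partial>measure_pmf \<mu>) / 2"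
  proof -
    have "(\<Sum>n. w (n + 1) * I (n + 1) F) = (\<Sum>n. (w n * I (Suc n) F) / 2)"
      using wS by (simp add: divide_ennreal_def mult_ac)
    also have "\<dots> = (\<Sum>n. w n * I (Suc n) F) / 2"
      by (simp add: divide_ennreal_def)
    also have "(\<Sum>n. w n * I (Suc n) F) = (\<Sum>n. \<integral>\<^sup>+g. w n * I n (\<lambda>h. F (g ** h)) \<partial>measure_pmf \<mu>)"
      unfolding IS by (intro suminf_cong nn_integral_cmult[symmetric]) auto
    also have "\<dots> = (\<integral>\<^sup>+g. (\<Sum>n. w n * I n (\<lambda>h. F (g ** h))) \<partial>measure_pmf \<mu>)"
      by (intro nn_integral_suminf[symmetric]) auto
    finally show ?thesis unfolding geometric_law .
  qed
  finally show ?thesis unfolding geometric_law by (simp add: add.commute)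
qed

lemma adj2_one [simp]: "adj2 (mat 1) = mat 1"
  by (simp add: mat2_eq_iff)

lemma left_average_geometric_law: "left_average (geometric_law \<mu>) f x = f x / 2 + left_average \<mu> (left_average (geometric_law \<mu>) f) x / 2"
  unfolding left_average_def by (subst nn_integral_geometric_law) (simp add: adj2_mult matrix_mul_assoc)

lemma walk_law_closed:
  assumes G: "subgroup G SL2R" and \<mu>: "set_pmf \<mu> \<subseteq> G"
  shows "set_pmf (walk_law \<mu> n) \<subseteq> G"
  by (induction n) (use subgroup_SL2R_D[OF G] \<mu> in \<open>auto simp: set_pmf_convolve subset_eq\<close>)

lemma walk_law_add: "g \<in> set_pmf (walk_law \<mu> n) \<Longrightarrow> h \<in> set_pmf (walk_law \<mu> m) \<Longrightarrow> g ** h \<in> set_pmf (walk_law \<mu> (n + m))"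
proof (induction n arbitrary: g)
  case (Suc n)
  then obtain a b where ab: "a \<in> set_pmf \<mu>" "b \<in> set_pmf (walk_law \<mu> n)" "g = a ** b" by (auto simp: set_pmf_convolve)
  have "b ** h \<in> set_pmf (walk_law \<mu> (n + m))" using Suc ab by blast
  then show ?case using ab by (auto simp: set_pmf_convolve matrix_mul_assoc[symmetric])
qed simp

lemma geometric_law_support:
  assumes G: "subgroup G SL2R" and \<mu>: "set_pmf \<mu> \<subseteq> G" and gen: "semigroup_generate SL2R (set_pmf \<mu>) = G"
  shows "set_pmf (geometric_law \<mu>) = G"
proof -
  have geometric_law: "set_pmf (geometric_law \<mu>) = (\<Union>n. set_pmf (walk_law \<mu> n))"
    by (simp add: geometric_law_def set_pmf_geometric)
  have "\<exists>n. g \<in> set_pmf (walk_law \<mu> n)" if "g \<in> semigroup_generate SL2R (set_pmf \<mu>)" for g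
    using that
  proof induction
    case (incl s)
    then have "s \<in> set_pmf (walk_law \<mu> (Suc 0))" by (auto simp: set_pmf_convolve)
    then show ?case by blast
  next
    case (mult g h)
    then show ?case using walk_law_add by (auto simp del: walk_law.simps) metis
  qed
  then show ?thesis unfolding geometric_law using walk_law_closed[OF G \<mu>] gen by blast
qed

locale group_space =
  fixes G :: "(real^2^2) set"
  assumes G: "subgroup G SL2R" and countable_G: "countable G"
begin

lemmas Gd = subgroup_SL2R_D[OF G]

abbreviation "cG \<equiv> count_space G"

definition l2_mass :: "(real^2^2 \<Rightarrow> real) \<Rightarrow> (real^2^2) set \<Rightarrow> ennreal" where
  "l2_mass f X = (\<integral>\<^sup>+x. ennreal ((f x)\<^sup>2) * indicator X x \<partial>cG)"

lemma left_bij: "g \<in> G \<Longrightarrow> bij_betw ((**) g) G G"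
  by (rule bij_betw_byWitness[where f'="(**) (adj2 g)"]) (auto simp: adj2_cancel Gd)

lemma l2_mass_shift:
  assumes g: "g \<in> G" shows "l2_mass f ((**) g ` X) = l2_mass (\<lambda>x. f (g ** x)) X"
proof -
  have "l2_mass f ((**) g ` X) = (\<integral>\<^sup>+x. ennreal ((f (g ** x))\<^sup>2) * indicator ((**) g ` X) (g ** x) \<partial>cG)"
    unfolding l2_mass_def by (rule nn_integral_bij_count_space[symmetric]) (rule left_bij[OF g])
  also have "\<dots> = l2_mass (\<lambda>x. f (g ** x)) X"
    unfolding l2_mass_def
  proof (intro nn_integral_cong)
    fix x
    have "g ** x \<in> (**) g ` X \<longleftrightarrow> x \<in> X"
    proof
      assume "g ** x \<in> (**) g ` X"
      then obtain y where y: "y \<in> X" "g ** x = g ** y" by auto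
      then have "adj2 g ** (g ** x) = adj2 g ** (g ** y)" by simp
      then have "x = y" by (simp add: adj2_cancel[OF Gd(1)[OF g]])
      with y show "x \<in> X" by simp
    qed simp
    then show "ennreal ((f (g ** x))\<^sup>2) * indicator ((**) g ` X) (g ** x) = ennreal ((f (g ** x))\<^sup>2) * indicator X x"
      by (simp add: indicator_def)
  qed
  finally show ?thesis .
qed

lemma l2_mass_mono: "X \<subseteq> Y \<Longrightarrow> l2_mass f X \<le> l2_mass f Y"
  unfolding l2_mass_def by (intro nn_integral_mono mult_left_mono) (auto split: split_indicator)

lemma l2_mass_disjoint:
  assumes "X \<inter> Y = {}" shows "l2_mass f (X \<union> Y) = l2_mass f X + l2_mass f Y"
  unfolding l2_mass_def by (subst nn_integral_add[symmetric])
    (use assms in \<open>auto intro!: nn_integral_cong simp: indicator_add[OF assms, symmetric] distrib_left split: split_indicator\<close>)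

lemma l2_mass_union: "l2_mass f (X \<union> Y) \<le> l2_mass f X + l2_mass f Y"
  unfolding l2_mass_def by (subst nn_integral_add[symmetric])
    (auto intro!: nn_integral_mono split: split_indicator)

lemma l2_mass_perturb:
  "l2_mass f X \<le> ennreal (5/4) * l2_mass h X + ennreal 5 * l2_mass (\<lambda>x. f x - h x) G"
proof -
  have pt: "(u::real)\<^sup>2 \<le> 5/4 * v\<^sup>2 + 5 * (u - v)\<^sup>2" for u v
  proof -
    have "5/4 * v\<^sup>2 + 5 * (u - v)\<^sup>2 - u\<^sup>2 = (2 * u - 5/2 * v)\<^sup>2"
      by (simp add: power2_eq_square algebra_simps)
    then show ?thesis by (smt (verit) zero_le_power2)
  qed
  have "l2_mass f X \<le> (\<integral>\<^sup>+x. ennreal (5/4) * (ennreal ((h x)\<^sup>2) * indicator X x) + ennreal 5 * (ennreal ((f x - h x)\<^sup>2) * indicator G x) \<partial>cG)"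
    unfolding l2_mass_def
  proof (intro nn_integral_mono)
    fix x assume "x \<in> space cG"
    then have x: "x \<in> G" by simp
    show "ennreal ((f x)\<^sup>2) * indicator X x \<le> ennreal (5/4) * (ennreal ((h x)\<^sup>2) * indicator X x) + ennreal 5 * (ennreal ((f x - h x)\<^sup>2) * indicator G x)"
    proof (cases "x \<in> X")
      case True
      have "ennreal ((f x)\<^sup>2) \<le> ennreal (5/4 * (h x)\<^sup>2 + 5 * (f x - h x)\<^sup>2)" using pt by (rule ennreal_leI)
      also have "\<dots> = ennreal (5/4 * (h x)\<^sup>2) + ennreal (5 * (f x - h x)\<^sup>2)" by (rule ennreal_plus) auto
      also have "\<dots> = ennreal (5/4) * ennreal ((h x)\<^sup>2) + ennreal 5 * ennreal ((f x - h x)\<^sup>2)"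
        by (intro arg_cong2[where f="(+)"] ennreal_mult) auto
      finally show ?thesis using True x by simp
    qed simp
  qed
  also have "\<dots> = ennreal (5/4) * l2_mass h X + ennreal 5 * l2_mass (\<lambda>x. f x - h x) G"
    unfolding l2_mass_def by (simp add: nn_integral_add nn_integral_cmult)
  finally show ?thesis .
qed

text \<open>Ping-pong: three disjoint translates of \<open>A\<close> cannot carry almost equal masses if \<open>A\<close> has
  nearly half of the total mass.\<close>

lemma three_translates:
  assumes a: "a \<in> G" and A: "A \<subseteq> G" and dj: "A \<inter> (**) a ` A = {}" "A \<inter> (**) (a ** a) ` A = {}"
    "(**) a ` A \<inter> (**) (a ** a) ` A = {}"
    and n: "l2_mass f G = ennreal n" "n \<ge> 0"
    and inv: "l2_mass (\<lambda>x. f x - f (a ** x)) G \<le> ennreal (n / 30)" "l2_mass (\<lambda>x. f x - f (a ** a ** x)) G \<le> ennreal (n / 30)"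
  shows "l2_mass f A \<le> ennreal (19/39 * n)"
proof -
  have aG: "a ** a \<in> G" using Gd a by blast
  have sub: "(**) a ` A \<subseteq> G" "(**) (a ** a) ` A \<subseteq> G" using A a aG Gd(4) by blast+
  have le: "l2_mass f X \<le> ennreal n" if "X \<subseteq> G" for X using l2_mass_mono[OF that, of f] n by simp
  have fin: "\<exists>r\<ge>0. l2_mass f X = ennreal r" if "X \<subseteq> G" for X
    using le[OF that] by (cases "l2_mass f X") (auto simp: top_unique)
  obtain x0 x1 x2 where x: "l2_mass f A = ennreal x0" "l2_mass f ((**) a ` A) = ennreal x1" "l2_mass f ((**) (a ** a) ` A) = ennreal x2"
    "x0 \<ge> 0" "x1 \<ge> 0" "x2 \<ge> 0" using fin[OF A] fin[OF sub(1)] fin[OF sub(2)] by blast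
  have p: "x0 \<le> 5/4 * x1 + n / 6"
  proof -
    have "ennreal x0 \<le> ennreal (5/4) * ennreal x1 + ennreal 5 * ennreal (n / 30)"
      using l2_mass_perturb[of f A "\<lambda>x. f (a ** x)"] inv(1) unfolding x(1) l2_mass_shift[OF a, symmetric] x(2)
      by (meson add_left_mono mult_left_mono order_trans zero_le)
    also have "ennreal (5/4) * ennreal x1 = ennreal (5/4 * x1)" using x by (intro ennreal_mult[symmetric]) auto
    also have "ennreal 5 * ennreal (n / 30) = ennreal (n / 6)" using n by (subst ennreal_mult[symmetric]) auto
    also have "ennreal (5/4 * x1) + ennreal (n / 6) = ennreal (5/4 * x1 + n / 6)"
      using x n by (intro ennreal_plus[symmetric]) auto
    finally show ?thesis using x n by (subst (asm) ennreal_le_iff) auto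
  qed
  have p2: "x0 \<le> 5/4 * x2 + n / 6"
  proof -
    have "ennreal x0 \<le> ennreal (5/4) * ennreal x2 + ennreal 5 * ennreal (n / 30)"
      using l2_mass_perturb[of f A "\<lambda>x. f (a ** a ** x)"] inv(2) unfolding x(1) l2_mass_shift[OF aG, symmetric] x(3)
      by (meson add_left_mono mult_left_mono order_trans zero_le)
    also have "ennreal (5/4) * ennreal x2 = ennreal (5/4 * x2)" using x by (intro ennreal_mult[symmetric]) auto
    also have "ennreal 5 * ennreal (n / 30) = ennreal (n / 6)" using n by (subst ennreal_mult[symmetric]) auto
    also have "ennreal (5/4 * x2) + ennreal (n / 6) = ennreal (5/4 * x2 + n / 6)"
      using x n by (intro ennreal_plus[symmetric]) auto
    finally show ?thesis using x n by (subst (asm) ennreal_le_iff) auto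
  qed
  have "l2_mass f ((A \<union> (**) a ` A) \<union> (**) (a ** a) ` A) = ennreal x0 + ennreal x1 + ennreal x2"
    using dj by (subst l2_mass_disjoint, blast, subst l2_mass_disjoint) (auto simp: x)
  also have "\<dots> = ennreal (x0 + x1 + x2)" using x by simp
  finally have "ennreal (x0 + x1 + x2) \<le> ennreal n" using le[of "(A \<union> (**) a ` A) \<union> (**) (a ** a) ` A"] A sub by simp
  then have "x0 + x1 + x2 \<le> n" using n by simp
  then have "x0 \<le> 19/39 * n" using p p2 by linarith
  then show ?thesis unfolding x(1) by (rule ennreal_leI)
qed

lemma exists_displaced:
  assumes a: "a \<in> G" and A: "A \<subseteq> G" "A \<inter> (**) a ` A = {}" "A \<inter> (**) (a ** a) ` A = {}"
    "(**) a ` A \<inter> (**) (a ** a) ` A = {}"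
    and b: "b \<in> G" and B: "B \<subseteq> G" "B \<inter> (**) b ` B = {}" "B \<inter> (**) (b ** b) ` B = {}"
    "(**) b ` B \<inter> (**) (b ** b) ` B = {}"
    and AB: "G \<subseteq> A \<union> B" and n: "l2_mass f G = ennreal n" "n > 0"
  shows "\<exists>s\<in>{a, a ** a, b, b ** b}. l2_mass (\<lambda>x. f x - f (s ** x)) G > ennreal (n / 30)"
proof (rule ccontr)
  assume neg: "\<not> ?thesis"
  have "l2_mass f A \<le> ennreal (19/39 * n)"
    by (rule three_translates[OF a A n(1)]) (use neg n in \<open>auto simp: not_less\<close>)
  moreover have "l2_mass f B \<le> ennreal (19/39 * n)"
    by (rule three_translates[OF b B n(1)]) (use neg n in \<open>auto simp: not_less\<close>)
  ultimately have "l2_mass f A + l2_mass f B \<le> ennreal (19/39 * n) + ennreal (19/39 * n)" by (rule add_mono)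
  moreover have "l2_mass f G \<le> l2_mass f A + l2_mass f B" using l2_mass_mono[OF AB] l2_mass_union by (rule order_trans)
  ultimately have "ennreal n \<le> ennreal (19/39 * n) + ennreal (19/39 * n)" unfolding n by (rule order_trans[rotated])
  also have "\<dots> = ennreal (19/39 * n + 19/39 * n)" using n by (intro ennreal_plus[symmetric]) auto
  finally have "n \<le> 19/39 * n + 19/39 * n" using n by (subst (asm) ennreal_le_iff) auto
  then show False using n by simp
qed

lemma variance_two_atoms:
  fixes q :: "(real^2^2) pmf" and X :: "real^2^2 \<Rightarrow> real"
  assumes X: "\<And>g. 0 \<le> X g \<and> X g \<le> 1" and m: "pmf q g \<ge> m" "pmf q h \<ge> m" "m > 0"
  shows "(measure_pmf.expectation q X)\<^sup>2 + m / 2 * (X g - X h)\<^sup>2 \<le> measure_pmf.expectation q (\<lambda>k. (X k)\<^sup>2)"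
proof -
  define e where "e = measure_pmf.expectation q X"
  have bnd: "integrable (measure_pmf q) F" if "\<And>k. \<bar>F k\<bar> \<le> 4" for F :: "real^2^2 \<Rightarrow> real"
    using that by (intro measure_pmf.integrable_const_bound[where B=4]) auto
  have Xi: "integrable (measure_pmf q) X"
  proof (rule bnd)
    show "\<bar>X k\<bar> \<le> 4" for k using X[of k] by simp
  qed
  have X2i: "integrable (measure_pmf q) (\<lambda>k. (X k)\<^sup>2)"
  proof (rule bnd)
    fix k have "(X k)\<^sup>2 \<le> 1" using X[of k] by (simp add: power_le_one)
    then show "\<bar>(X k)\<^sup>2\<bar> \<le> 4" by simp
  qed
  have e01: "0 \<le> e" "e \<le> 1"
  proof -
    show "0 \<le> e" unfolding e_def using X by (intro integral_nonneg_AE) auto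
    have "e \<le> measure_pmf.expectation q (\<lambda>_. 1)" unfolding e_def using X Xi by (intro integral_mono) auto
    then show "e \<le> 1" by simp
  qed
  have d1: "\<bar>X k - e\<bar> \<le> 1" for k using X[of k] e01 by (auto simp: abs_le_iff)
  have d2: "(X k - e)\<^sup>2 \<le> 1" for k using d1[of k] by (simp add: abs_square_le_1)
  have vi: "integrable (measure_pmf q) (\<lambda>k. (X k - e)\<^sup>2)"
  proof (rule bnd)
    show "\<bar>(X k - e)\<^sup>2\<bar> \<le> 4" for k using d2[of k] by simp
  qed
  have "measure_pmf.expectation q (\<lambda>k. (X k - e)\<^sup>2) = measure_pmf.expectation q (\<lambda>k. (X k)\<^sup>2 - 2 * e * X k + e\<^sup>2)"
    by (intro Bochner_Integration.integral_cong) (auto simp: power2_eq_square algebra_simps)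
  also have "\<dots> = measure_pmf.expectation q (\<lambda>k. (X k)\<^sup>2) - e\<^sup>2"
    using Xi X2i by (simp add: e_def[symmetric] power2_eq_square)
  finally have var: "measure_pmf.expectation q (\<lambda>k. (X k - e)\<^sup>2) = measure_pmf.expectation q (\<lambda>k. (X k)\<^sup>2) - e\<^sup>2" .
  have "m / 2 * (X g - X h)\<^sup>2 \<le> measure_pmf.expectation q (\<lambda>k. (X k - e)\<^sup>2)"
  proof (cases "g = h")
    case True
    then show ?thesis by (auto intro!: integral_nonneg_AE)
  next
    case False
    have "(X g - X h)\<^sup>2 \<le> 2 * (X g - e)\<^sup>2 + 2 * (X h - e)\<^sup>2"
    proof -
      have "2 * (X g - e)\<^sup>2 + 2 * (X h - e)\<^sup>2 - (X g - X h)\<^sup>2 = ((X g - e) + (X h - e))\<^sup>2"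
        by (simp add: power2_eq_square algebra_simps)
      then show ?thesis by (smt (verit) zero_le_power2)
    qed
    then have "m / 2 * (X g - X h)\<^sup>2 \<le> m / 2 * (2 * (X g - e)\<^sup>2 + 2 * (X h - e)\<^sup>2)" using m by (intro mult_left_mono) auto
    also have "\<dots> = (X g - e)\<^sup>2 * m + (X h - e)\<^sup>2 * m" by (simp add: algebra_simps)
    also have "\<dots> \<le> (X g - e)\<^sup>2 * pmf q g + (X h - e)\<^sup>2 * pmf q h"
      using m by (intro add_mono mult_left_mono) auto
    also have "\<dots> = (\<Sum>k\<in>{g, h}. (X k - e)\<^sup>2 * indicator {g, h} k * pmf q k)" using False by simp
    also have "\<dots> = measure_pmf.expectation q (\<lambda>k. (X k - e)\<^sup>2 * indicator {g, h} k)"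
      by (rule integral_measure_pmf_real[symmetric]) (auto simp: indicator_def split: if_splits)
    also have "\<dots> \<le> measure_pmf.expectation q (\<lambda>k. (X k - e)\<^sup>2)"
    proof (rule integral_mono[OF bnd vi])
      show "\<bar>(X k - e)\<^sup>2 * indicator {g, h} k\<bar> \<le> 4" for k
        using d2[of k] by (cases "k \<in> {g, h}") (auto simp: indicator_def)
      show "(X k - e)\<^sup>2 * indicator {g, h} k \<le> (X k - e)\<^sup>2" for k by (simp add: indicator_def)
    qed
    finally show ?thesis .
  qed
  then have "m / 2 * (X g - X h)\<^sup>2 \<le> measure_pmf.expectation q (\<lambda>k. (X k)\<^sup>2) - e\<^sup>2" unfolding var .
  then show ?thesis unfolding e_def[symmetric] by linarith
qed

lemma contraction:
  assumes q: "set_pmf q \<subseteq> G" and s: "s \<in> G" and m: "pmf q (mat 1) \<ge> m" "pmf q (adj2 s) \<ge> m" "m > 0"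
  shows "l2_mass (pmf (convolve q r)) G + ennreal (m / 2) * l2_mass (\<lambda>x. pmf r x - pmf r (s ** x)) G \<le> l2_mass (pmf r) G"
proof -
  have pt: "ennreal ((pmf (convolve q r) x)\<^sup>2) + ennreal (m / 2) * ennreal ((pmf r x - pmf r (s ** x))\<^sup>2)
      \<le> (\<integral>\<^sup>+g. ennreal ((pmf r (adj2 g ** x))\<^sup>2) \<partial>measure_pmf q)" for x
  proof -
    define X where "X g = pmf r (adj2 g ** x)" for g
    have X: "0 \<le> X g \<and> X g \<le> 1" for g by (simp add: X_def pmf_le_1)
    have cv: "pmf (convolve q r) x = measure_pmf.expectation q X"
      unfolding convolve_def pmf_bind X_def
      by (intro integral_cong_AE AE_pmfI) (use q Gd(1) in \<open>auto simp: pmf_left_mult subset_eq\<close>)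
    have "(pmf (convolve q r) x)\<^sup>2 + m / 2 * (X (mat 1) - X (adj2 s))\<^sup>2 \<le> measure_pmf.expectation q (\<lambda>k. (X k)\<^sup>2)"
      unfolding cv by (rule variance_two_atoms[OF X m])
    then have le: "(pmf (convolve q r) x)\<^sup>2 + m / 2 * (pmf r x - pmf r (s ** x))\<^sup>2 \<le> measure_pmf.expectation q (\<lambda>k. (X k)\<^sup>2)"
      by (simp add: X_def)
    have "ennreal ((pmf (convolve q r) x)\<^sup>2) + ennreal (m / 2) * ennreal ((pmf r x - pmf r (s ** x))\<^sup>2)
       = ennreal ((pmf (convolve q r) x)\<^sup>2 + m / 2 * (pmf r x - pmf r (s ** x))\<^sup>2)"
    proof -
      have "ennreal (m / 2) * ennreal ((pmf r x - pmf r (s ** x))\<^sup>2) = ennreal (m / 2 * (pmf r x - pmf r (s ** x))\<^sup>2)"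
        using m by (intro ennreal_mult[symmetric]) auto
      then show ?thesis using m by (simp only:) (intro ennreal_plus[symmetric], auto)
    qed
    also have "\<dots> \<le> ennreal (measure_pmf.expectation q (\<lambda>k. (X k)\<^sup>2))" using le by (rule ennreal_leI)
    also have "\<dots> = (\<integral>\<^sup>+g. ennreal ((X g)\<^sup>2) \<partial>measure_pmf q)"
    proof (rule nn_integral_eq_integral[symmetric])
      show "integrable (measure_pmf q) (\<lambda>k. (X k)\<^sup>2)"
        using X by (intro measure_pmf.integrable_const_bound[where B=1]) (auto simp: power_le_one)
    qed auto
    finally show ?thesis by (simp add: X_def)
  qed
  have "l2_mass (pmf (convolve q r)) G + ennreal (m / 2) * l2_mass (\<lambda>x. pmf r x - pmf r (s ** x)) G
     = (\<integral>\<^sup>+x. ennreal ((pmf (convolve q r) x)\<^sup>2) * indicator G x + ennreal (m / 2) * (ennreal ((pmf r x - pmf r (s ** x))\<^sup>2) * indicator G x) \<partial>cG)"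
    unfolding l2_mass_def by (simp add: nn_integral_add nn_integral_cmult)
  also have "\<dots> \<le> (\<integral>\<^sup>+x. \<integral>\<^sup>+g. ennreal ((pmf r (adj2 g ** x))\<^sup>2) \<partial>measure_pmf q \<partial>cG)"
    using pt by (intro nn_integral_mono) simp
  also have "\<dots> = (\<integral>\<^sup>+g. \<integral>\<^sup>+x. ennreal ((pmf r (adj2 g ** x))\<^sup>2) \<partial>cG \<partial>measure_pmf q)"
    by (rule nn_integral_count_space_nn_integral[symmetric]) (auto intro: countable_G)
  also have "\<dots> = (\<integral>\<^sup>+g. l2_mass (pmf r) G \<partial>measure_pmf q)"
  proof (intro nn_integral_cong_AE AE_pmfI)
    fix g assume "g \<in> set_pmf q"
    then have g: "adj2 g \<in> G" using q Gd by blast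
    have "(\<integral>\<^sup>+x. ennreal ((pmf r (adj2 g ** x))\<^sup>2) \<partial>cG) = l2_mass (\<lambda>x. pmf r (adj2 g ** x)) G"
      unfolding l2_mass_def by (intro nn_integral_cong) simp
    also have "\<dots> = l2_mass (pmf r) ((**) (adj2 g) ` G)" by (rule l2_mass_shift[OF g, symmetric])
    also have "(**) (adj2 g) ` G = G" using left_bij[OF g] by (rule bij_betw_imp_surj_on)
    finally show "(\<integral>\<^sup>+x. ennreal ((pmf r (adj2 g ** x))\<^sup>2) \<partial>cG) = l2_mass (pmf r) G" .
  qed
  also have "\<dots> = l2_mass (pmf r) G" by simp
  finally show ?thesis .
qed

lemma l2_mass_pmf_le_1: "l2_mass (pmf r) G \<le> 1"
proof -
  have "l2_mass (pmf r) G \<le> (\<integral>\<^sup>+x. ennreal (pmf r x) \<partial>cG)"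
    unfolding l2_mass_def
  proof (intro nn_integral_mono)
    fix x
    have "(pmf r x)\<^sup>2 \<le> pmf r x" using pmf_le_1[of r x] pmf_nonneg[of r x]
      by (simp add: power2_eq_square mult_left_le_one_le)
    then show "ennreal ((pmf r x)\<^sup>2) * indicator G x \<le> ennreal (pmf r x)"
      by (auto intro: ennreal_leI split: split_indicator)
  qed
  also have "\<dots> = emeasure (measure_pmf r) G" by (rule nn_integral_pmf)
  also have "\<dots> \<le> 1" by (rule measure_pmf.emeasure_le_1)
  finally show ?thesis .
qed

lemma l2_decay:
  assumes a: "a \<in> G" and A: "A \<subseteq> G" "A \<inter> (**) a ` A = {}" "A \<inter> (**) (a ** a) ` A = {}"
    "(**) a ` A \<inter> (**) (a ** a) ` A = {}"
    and b: "b \<in> G" and B: "B \<subseteq> G" "B \<inter> (**) b ` B = {}" "B \<inter> (**) (b ** b) ` B = {}"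
    "(**) b ` B \<inter> (**) (b ** b) ` B = {}"
    and AB: "G \<subseteq> A \<union> B" and q: "set_pmf q = G"
  obtains \<beta> where "0 < \<beta>" "\<beta> < 1" "\<And>k x. pmf (walk_law q k) x \<le> \<beta>^k"
proof -
  define m where "m = Min {pmf q (mat 1), pmf q (adj2 a), pmf q (adj2 (a ** a)), pmf q (adj2 b), pmf q (adj2 (b ** b))}"
  have in_q: "mat 1 \<in> set_pmf q" "adj2 a \<in> set_pmf q" "adj2 (a ** a) \<in> set_pmf q" "adj2 b \<in> set_pmf q" "adj2 (b ** b) \<in> set_pmf q"
    unfolding q using a b Gd by blast+
  have m0: "m > 0" unfolding m_def using in_q by (auto simp: pmf_positive_iff)
  have m1: "m \<le> 1" unfolding m_def using pmf_le_1[of q "mat 1"] by (simp add: min_le_iff_disj)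
  have mle: "m \<le> pmf q (mat 1)" "\<And>s. s \<in> {a, a ** a, b, b ** b} \<Longrightarrow> m \<le> pmf q (adj2 s)"
    unfolding m_def by (auto intro!: Min_le)
  define \<kappa> where "\<kappa> = m / 60"
  have k: "0 < \<kappa>" "\<kappa> < 1" using m0 m1 by (auto simp: \<kappa>_def)
  have step: "l2_mass (pmf (convolve q r)) G \<le> ennreal ((1 - \<kappa>) * n)" if n: "l2_mass (pmf r) G = ennreal n" "n \<ge> 0" for r n
  proof -
    have ex: "\<exists>s\<in>{a, a ** a, b, b ** b}. l2_mass (\<lambda>x. pmf r x - pmf r (s ** x)) G \<ge> ennreal (n / 30)"
    proof (cases "n = 0")
      case False
      then have "n > 0" using n by simp
      from exists_displaced[OF a A b B AB n(1) this] show ?thesis by (meson less_imp_le)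
    qed auto
    then obtain s where s: "s \<in> {a, a ** a, b, b ** b}" "l2_mass (\<lambda>x. pmf r x - pmf r (s ** x)) G \<ge> ennreal (n / 30)" by blast
    have sG: "s \<in> G" using s(1) a b Gd by blast
    have c: "l2_mass (pmf (convolve q r)) G + ennreal (m / 2) * l2_mass (\<lambda>x. pmf r x - pmf r (s ** x)) G \<le> ennreal n"
      using contraction[OF _ sG mle(1) mle(2)[OF s(1)] m0, of r] q n by simp
    have "l2_mass (pmf (convolve q r)) G + ennreal (m / 2) * ennreal (n / 30) \<le>
       l2_mass (pmf (convolve q r)) G + ennreal (m / 2) * l2_mass (\<lambda>x. pmf r x - pmf r (s ** x)) G"
      using s(2) by (intro add_left_mono mult_left_mono) auto
    with c have c2: "l2_mass (pmf (convolve q r)) G + ennreal (m / 2) * ennreal (n / 30) \<le> ennreal n" by (rule order_trans[rotated])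
    obtain y where y: "l2_mass (pmf (convolve q r)) G = ennreal y" "y \<ge> 0"
      using l2_mass_pmf_le_1[of "convolve q r"] by (cases "l2_mass (pmf (convolve q r)) G") (auto simp: top_unique)
    have "ennreal (m / 2) * ennreal (n / 30) = ennreal (\<kappa> * n)"
      using m0 n by (subst ennreal_mult[symmetric]) (auto simp: \<kappa>_def)
    then have "ennreal (y + \<kappa> * n) \<le> ennreal n" using c2 y n k by simp
    then have "y + \<kappa> * n \<le> n" using n by simp
    then show ?thesis unfolding y(1) by (intro ennreal_leI) (simp add: algebra_simps)
  qed
  have decay: "l2_mass (pmf (walk_law q k)) G \<le> ennreal ((1 - \<kappa>)^k)" for k
  proof (induction k)
    case 0 show ?case using l2_mass_pmf_le_1[of "walk_law q 0"] by (simp only: power_0 ennreal_1)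
  next
    case (Suc k)
    obtain y where y: "l2_mass (pmf (walk_law q k)) G = ennreal y" "y \<ge> 0"
      using l2_mass_pmf_le_1[of "walk_law q k"] by (cases "l2_mass (pmf (walk_law q k)) G") (auto simp: top_unique)
    have yk: "y \<le> (1 - \<kappa>)^k" using Suc y k by (simp add: ennreal_le_iff)
    have "l2_mass (pmf (walk_law q (Suc k))) G \<le> ennreal ((1 - \<kappa>) * y)" using step[OF y] by simp
    also have "\<dots> \<le> ennreal ((1 - \<kappa>)^Suc k)" using yk k by (intro ennreal_leI) (simp add: mult_left_mono)
    finally show ?case .
  qed
  define \<beta> where "\<beta> = sqrt (1 - \<kappa>)"
  have b: "0 < \<beta>" "\<beta> < 1" using k by (auto simp: \<beta>_def)
  have "pmf (walk_law q k) x \<le> \<beta>^k" for k x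
  proof (cases "x \<in> G")
    case True
    have "ennreal ((pmf (walk_law q k) x)\<^sup>2) = (\<integral>\<^sup>+y. ennreal ((pmf (walk_law q k) x)\<^sup>2) * indicator {x} y \<partial>cG)"
      using True by (simp add: nn_integral_cmult nn_integral_indicator)
    also have "\<dots> \<le> l2_mass (pmf (walk_law q k)) G"
      unfolding l2_mass_def by (intro nn_integral_mono) (auto split: split_indicator)
    also have "\<dots> \<le> ennreal ((1 - \<kappa>)^k)" by (rule decay)
    finally have "(pmf (walk_law q k) x)\<^sup>2 \<le> (1 - \<kappa>)^k" using k by (subst (asm) ennreal_le_iff) auto
    also have "(1 - \<kappa>)^k = (\<beta>^k)\<^sup>2"
    proof -
      have "\<beta>\<^sup>2 = 1 - \<kappa>" using k by (simp add: \<beta>_def)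
      then show ?thesis by (metis power_mult mult.commute)
    qed
    finally show ?thesis by (rule power2_le_imp_le) (use b in simp)
  next
    case False
    then have "x \<notin> set_pmf (walk_law q k)" using walk_law_closed[OF G, of q k] q by blast
    then show ?thesis using b by (simp add: set_pmf_iff)
  qed
  with b show ?thesis using that by blast
qed

theorem spectral_decay:
  assumes a: "a \<in> G" and A: "A \<subseteq> G" "A \<inter> (**) a ` A = {}" "A \<inter> (**) (a ** a) ` A = {}"
    "(**) a ` A \<inter> (**) (a ** a) ` A = {}"
    and b: "b \<in> G" and B: "B \<subseteq> G" "B \<inter> (**) b ` B = {}" "B \<inter> (**) (b ** b) ` B = {}"
    "(**) b ` B \<inter> (**) (b ** b) ` B = {}"
    and AB: "G \<subseteq> A \<union> B" and \<mu>: "set_pmf \<mu> \<subseteq> G" and gen: "semigroup_generate SL2R (set_pmf \<mu>) = G"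
  obtains C \<rho> where "C > 0" "0 < \<rho>" "\<rho> < 1" "\<And>n x. pmf (walk_law \<mu> n) x \<le> C * \<rho>^n"
proof -
  define q where "q = geometric_law \<mu>"
  have q: "set_pmf q = G" unfolding q_def by (rule geometric_law_support[OF G \<mu> gen])
  obtain \<beta> where \<beta>: "0 < \<beta>" "\<beta> < 1" "\<And>k x. pmf (walk_law q k) x \<le> \<beta>^k"
    using l2_decay[OF a A b B AB q] by blast
  obtain t where t: "1 < t" "t < 2" "t * \<beta> < 1"
  proof -
    have "1 < min 2 (1 / \<beta>)" using \<beta> by (simp add: field_simps)
    then obtain t where "1 < t" "t < min 2 (1 / \<beta>)" using dense by blast
    then show ?thesis using that[of t] \<beta> by (simp add: field_simps)
  qed
  define u where "u x = (\<Sum>k. ennreal (t^k) * ennreal (pmf (walk_law q k) x))" for x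
  define K where "K = 1 / (1 - t * \<beta>)"
  have K: "K > 0" using t by (simp add: K_def)
  have uK: "u x \<le> ennreal K" for x
  proof -
    have "u x \<le> (\<Sum>k. ennreal ((t * \<beta>)^k))"
      unfolding u_def
    proof (rule suminf_le)
      fix k
      have "ennreal (t^k) * ennreal (pmf (walk_law q k) x) = ennreal (t^k * pmf (walk_law q k) x)" using t by (intro ennreal_mult[symmetric]) auto
      also have "\<dots> \<le> ennreal (t^k * \<beta>^k)" using \<beta>(3)[of k x] t by (intro ennreal_leI mult_left_mono) auto
      finally show "ennreal (t^k) * ennreal (pmf (walk_law q k) x) \<le> ennreal ((t * \<beta>)^k)" by (simp add: power_mult_distrib)
    qed auto
    also have "\<dots> = ennreal (\<Sum>k. (t * \<beta>)^k)"
      using t \<beta> by (intro suminf_ennreal2 summable_geometric) auto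
    also have "(\<Sum>k. (t * \<beta>)^k) = K" unfolding K_def using t \<beta> by (intro suminf_geometric) auto
    finally show ?thesis .
  qed
  define v where "v = left_average q u"
  have det_q: "det g = 1" if "g \<in> set_pmf q" for g using that q Gd by blast
  have det_\<mu>: "det g = 1" if "g \<in> set_pmf \<mu>" for g using that \<mu> Gd by blast
  have vs: "v x = (\<Sum>k. ennreal (t^k) * ennreal (pmf (walk_law q (Suc k)) x))" for x
  proof -
    have "v x = (\<integral>\<^sup>+g. (\<Sum>k. ennreal (t^k) * ennreal (pmf (walk_law q k) (adj2 g ** x))) \<partial>measure_pmf q)"
      by (simp add: v_def left_average_def u_def)
    also have "\<dots> = (\<Sum>k. \<integral>\<^sup>+g. ennreal (t^k) * ennreal (pmf (walk_law q k) (adj2 g ** x)) \<partial>measure_pmf q)"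
      by (rule nn_integral_suminf) auto
    also have "\<dots> = (\<Sum>k. ennreal (t^k) * ennreal (pmf (walk_law q (Suc k)) x))"
    proof (intro suminf_cong)
      fix k
      have "(\<integral>\<^sup>+g. ennreal (t^k) * ennreal (pmf (walk_law q k) (adj2 g ** x)) \<partial>measure_pmf q)
         = ennreal (t^k) * left_average q (\<lambda>y. ennreal (pmf (walk_law q k) y)) x"
        unfolding left_average_def by (rule nn_integral_cmult) auto
      then show "(\<integral>\<^sup>+g. ennreal (t^k) * ennreal (pmf (walk_law q k) (adj2 g ** x)) \<partial>measure_pmf q) = ennreal (t^k) * ennreal (pmf (walk_law q (Suc k)) x)"
        using left_average_pmf[OF det_q, where r="walk_law q k" and x=x] by simp
    qed
    finally show ?thesis .
  qed
  have uv: "ennreal t * v x \<le> u x" for x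
  proof -
    have "ennreal t * v x = (\<Sum>k. ennreal t * (ennreal (t^k) * ennreal (pmf (walk_law q (Suc k)) x)))"
      unfolding vs by (rule ennreal_suminf_cmult[symmetric])
    also have "\<dots> = (\<Sum>k. ennreal (t^(k+1)) * ennreal (pmf (walk_law q (k+1)) x))"
      using t by (simp add: ennreal_mult mult.assoc)
    also have "\<dots> \<le> (\<Sum>k. ennreal (t^(k+1)) * ennreal (pmf (walk_law q (k+1)) x)) + (\<Sum>k<1. ennreal (t^k) * ennreal (pmf (walk_law q k) x))"
      by simp
    also have "\<dots> = u x"
      unfolding u_def by (rule suminf_offset[symmetric]) auto
    finally show ?thesis .
  qed
  have vres: "v x = u x / 2 + left_average \<mu> v x / 2" for x
    unfolding v_def q_def by (rule left_average_geometric_law)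
  have vu: "v x \<le> u x" for x
  proof -
    have "1 * v x \<le> ennreal t * v x" using t by (intro mult_right_mono) auto
    then show ?thesis using uv[of x] by simp
  qed
  have sup: "left_average \<mu> v x \<le> ennreal (2 - t) * v x" for x
  proof -
    obtain v' where v': "v x = ennreal v'" "v' \<ge> 0" using vu[of x] uK[of x] by (cases "v x") (auto simp: top_unique)
    obtain u' where u': "u x = ennreal u'" "u' \<ge> 0" using uK[of x] by (cases "u x") (auto simp: top_unique)
    have "left_average \<mu> v x / 2 \<le> v x" using vres[of x] by (metis add.commute le_iff_add)
    then have "left_average \<mu> v x / 2 < \<top>" unfolding v'(1) using ennreal_less_top le_less_trans by blast
    then have "left_average \<mu> v x \<noteq> \<top>" by (auto simp: ennreal_top_divide)
    then obtain w where w: "left_average \<mu> v x = ennreal w" "w \<ge> 0" by (cases "left_average \<mu> v x") auto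
    have "ennreal v' = ennreal (u' / 2 + w / 2)"
      using vres[of x] u' w unfolding v'(1) by (simp add: ennreal_divide_numeral ennreal_plus)
    then have e: "v' = u' / 2 + w / 2" using ennreal_inj[of v' "u' / 2 + w / 2"] v'(2) u'(2) w(2) by (simp del: ennreal_plus)
    have "ennreal (t * v') \<le> ennreal u'" using uv[of x] t unfolding v'(1) u'(1) by (simp add: ennreal_mult v')
    then have "t * v' \<le> u'" using u' by simp
    moreover have "u' = 2 * v' - w" using e by simp
    moreover have "(2 - t) * v' = 2 * v' - t * v'" by (simp add: algebra_simps)
    ultimately have "w \<le> (2 - t) * v'" by linarith
    then have "ennreal w \<le> ennreal ((2 - t) * v')" by (rule ennreal_leI)
    also have "\<dots> = ennreal (2 - t) * ennreal v'" using t v' by (intro ennreal_mult) auto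
    finally show ?thesis using w v' by simp
  qed
  have dom: "ennreal (pmf (walk_law \<mu> n) x) \<le> ennreal (2 * (2 - t)^n) * v x" for n x
  proof (induction n arbitrary: x)
    case 0
    have "ennreal (pmf (walk_law \<mu> 0) x) = ennreal (t^0) * ennreal (pmf (walk_law q 0) x)" by simp
    also have "\<dots> \<le> u x" unfolding u_def
      using sum_le_suminf[where f="\<lambda>k. ennreal (t^k) * ennreal (pmf (walk_law q k) x)" and I="{0}"] by simp
    also have "u x \<le> 2 * v x"
    proof -
      have "2 * (u x / 2) \<le> 2 * v x" using vres[of x] by (intro mult_left_mono) auto
      moreover have "2 * (u x / 2) = u x" by (simp add: ennreal_times_divide mult.commute[of 2] ennreal_mult_divide_eq)
      ultimately show ?thesis by simp
    qed
    finally show ?case by simp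
  next
    case (Suc n)
    have "ennreal (pmf (walk_law \<mu> (Suc n)) x) = left_average \<mu> (\<lambda>y. ennreal (pmf (walk_law \<mu> n) y)) x"
      using left_average_pmf[OF det_\<mu>, where r="walk_law \<mu> n" and x=x] by simp
    also have "\<dots> \<le> left_average \<mu> (\<lambda>y. ennreal (2 * (2 - t)^n) * v y) x" by (rule left_average_mono) (rule Suc)
    also have "\<dots> = ennreal (2 * (2 - t)^n) * left_average \<mu> v x" by (rule left_average_cmult)
    also have "\<dots> \<le> ennreal (2 * (2 - t)^n) * (ennreal (2 - t) * v x)" by (intro mult_left_mono sup) auto
    also have "\<dots> = ennreal (2 * (2 - t)^Suc n) * v x"
      using t by (simp add: mult.assoc[symmetric] ennreal_mult[symmetric] mult_ac)
    finally show ?case .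
  qed
  have fin: "pmf (walk_law \<mu> n) x \<le> (2 * K) * (2 - t)^n" for n x
  proof -
    have "v x \<le> ennreal K" using vu[of x] uK[of x] by (rule order_trans)
    then have "ennreal (2 * (2 - t)^n) * v x \<le> ennreal (2 * (2 - t)^n) * ennreal K" by (rule mult_left_mono) simp
    with dom[of n x] have "ennreal (pmf (walk_law \<mu> n) x) \<le> ennreal (2 * (2 - t)^n) * ennreal K" by (rule order_trans)
    also have "\<dots> = ennreal (2 * (2 - t)^n * K)" using t K by (intro ennreal_mult[symmetric]) auto
    finally have "pmf (walk_law \<mu> n) x \<le> 2 * (2 - t)^n * K" using t K by (subst (asm) ennreal_le_iff) auto
    then show ?thesis by (simp add: mult_ac)
  qed
  show ?thesis by (rule that[of "2 * K" "2 - t"]) (use K t fin in auto)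
qed

end

section \<open>Almost sure growth of the random walk\<close>

lemma walk_case_nat: "walk (case_nat g \<omega>) (Suc n) = g ** walk \<omega> n"
  by (induction n) (simp_all add: matrix_mul_assoc)

interpretation increments: prob_space "increment_space \<mu>"
  unfolding increment_space_def by (rule prob_space_PiM) (rule measure_pmf.prob_space_axioms)

lemma space_increment_space [simp]: "space (increment_space \<mu>) = UNIV"
  by (simp add: increment_space_def space_PiM)

lemma measurable_case_nat_increments:
  "(\<lambda>(g, \<omega>). case_nat g \<omega>) \<in> measure_pmf \<mu> \<Otimes>\<^sub>M increment_space \<mu> \<rightarrow>\<^sub>M increment_space \<mu>"
  unfolding increment_space_def by measurable

lemma nn_integral_increment_space:
  assumes F [measurable]: "F \<in> borel_measurable (increment_space \<mu>)"
  shows "(\<integral>\<^sup>+\<omega>. F \<omega> \<partial>increment_space \<mu>) = (\<integral>\<^sup>+g. \<integral>\<^sup>+\<omega>. F (case_nat g \<omega>) \<partial>increment_space \<mu> \<partial>measure_pmf \<mu>)"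
proof -
  let ?S = "increment_space \<mu>"
  interpret sequence_space "measure_pmf \<mu>" by unfold_locales
  note [measurable] = measurable_case_nat_increments
  have "(\<integral>\<^sup>+\<omega>. F \<omega> \<partial>?S) = (\<integral>\<^sup>+\<omega>. F \<omega> \<partial>distr (measure_pmf \<mu> \<Otimes>\<^sub>M ?S) ?S (\<lambda>(g, \<omega>). case_nat g \<omega>))"
    unfolding increment_space_def PiM_iter ..
  also have "\<dots> = (\<integral>\<^sup>+p. F (case p of (g, \<omega>) \<Rightarrow> case_nat g \<omega>) \<partial>(measure_pmf \<mu> \<Otimes>\<^sub>M ?S))"
    by (intro nn_integral_distr) measurable
  also have "\<dots> = (\<integral>\<^sup>+g. \<integral>\<^sup>+\<omega>. F (case_nat g \<omega>) \<partial>?S \<partial>measure_pmf \<mu>)"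
    by (subst increments.nn_integral_fst[symmetric]) (simp_all add: split_beta')
  finally show ?thesis .
qed

lemma nn_integral_walk:
  assumes "F \<in> borel_measurable borel"
  shows "(\<integral>\<^sup>+\<omega>. F (walk \<omega> n) \<partial>increment_space \<mu>) = (\<integral>\<^sup>+x. F x \<partial>measure_pmf (walk_law \<mu> n))"
  using assms
proof (induction n arbitrary: F)
  case (Suc n)
  have G: "(\<lambda>x. F (g ** x)) \<in> borel_measurable borel" for g :: "real^2^2"
  proof -
    have "continuous_on UNIV (\<lambda>x :: real^2^2. g ** x)" unfolding matrix_matrix_mult_def by (intro continuous_intros)
    then show ?thesis by (intro measurable_compose[OF borel_measurable_continuous_onI Suc.prems])
  qed
  have "(\<integral>\<^sup>+\<omega>. F (walk \<omega> (Suc n)) \<partial>increment_space \<mu>)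
     = (\<integral>\<^sup>+g. \<integral>\<^sup>+\<omega>. F (walk (case_nat g \<omega>) (Suc n)) \<partial>increment_space \<mu> \<partial>measure_pmf \<mu>)"
    by (rule nn_integral_increment_space) (rule measurable_compose[OF measurable_walk Suc.prems])
  also have "\<dots> = (\<integral>\<^sup>+g. \<integral>\<^sup>+\<omega>. F (g ** walk \<omega> n) \<partial>increment_space \<mu> \<partial>measure_pmf \<mu>)"
    by (simp only: walk_case_nat)
  also have "\<dots> = (\<integral>\<^sup>+g. \<integral>\<^sup>+x. F (g ** x) \<partial>measure_pmf (walk_law \<mu> n) \<partial>measure_pmf \<mu>)"
    by (simp only: Suc.IH[OF G])
  also have "\<dots> = (\<integral>\<^sup>+x. F x \<partial>measure_pmf (walk_law \<mu> (Suc n)))" by (simp add: nn_integral_convolve)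
  finally show ?case .
qed (simp add: increments.emeasure_space_1[simplified])

lemma emeasure_walk:
  assumes "X \<in> sets borel"
  shows "emeasure (increment_space \<mu>) {\<omega>. walk \<omega> n \<in> X} = emeasure (measure_pmf (walk_law \<mu> n)) X"
proof -
  have m: "{\<omega>. walk \<omega> n \<in> X} \<in> sets (increment_space \<mu>)"
    using measurable_sets[OF measurable_walk assms, of n \<mu>] by (simp add: vimage_def)
  have "emeasure (increment_space \<mu>) {\<omega>. walk \<omega> n \<in> X} = (\<integral>\<^sup>+\<omega>. indicator X (walk \<omega> n) \<partial>increment_space \<mu>)"
  proof -
    have "(\<lambda>\<omega>. indicator X (walk \<omega> n)) = (indicator {\<omega>. walk \<omega> n \<in> X} :: _ \<Rightarrow> ennreal)" by (auto simp: indicator_def)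
    then show ?thesis using m by simp
  qed
  also have "\<dots> = (\<integral>\<^sup>+x. indicator X x \<partial>measure_pmf (walk_law \<mu> n))" by (rule nn_integral_walk) (use assms in simp)
  finally show ?thesis by simp
qed

lemma AE_increment: "AE \<omega> in increment_space \<mu>. \<forall>n. \<omega> n \<in> set_pmf \<mu>"
  unfolding AE_all_countable increment_space_def
  by (intro allI AE_PiM_component) (auto simp: measure_pmf.prob_space_axioms AE_measure_pmf)

lemma walk_growth:
  assumes G: "subgroup G SL2R" and gap: "gap G \<delta>" "\<delta> > 0" and \<mu>: "set_pmf \<mu> \<subseteq> G"
    and C: "C > 0" and \<rho>: "0 < \<rho>" "\<rho> < 1" and decay: "\<And>n x. pmf (walk_law \<mu> n) x \<le> C * \<rho>^n"
  obtains b where "b > 0" "AE \<omega> in increment_space \<mu>. eventually (\<lambda>n. exp (b * real n) \<le> norm (walk \<omega> n)) sequentially"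
proof -
  define b where "b = - ln \<rho> / 16"
  have b: "b > 0" using \<rho> by (simp add: b_def)
  have e8: "exp (b * real n)^8 * \<rho>^n = (sqrt \<rho>)^n" for n
  proof -
    have "exp (b * real n)^8 * \<rho>^n = exp (8 * (b * real n)) * exp (ln \<rho>)^n" using \<rho> by (simp add: exp_of_nat_mult[symmetric])
    also have "\<dots> = exp (8 * (b * real n) + real n * ln \<rho>)" by (simp add: exp_add exp_of_nat_mult[symmetric])
    also have "8 * (b * real n) + real n * ln \<rho> = real n * (ln \<rho> / 2)" by (simp add: b_def field_simps)
    also have "exp \<dots> = (exp (ln \<rho> / 2))^n" by (rule exp_of_nat_mult)
    also have "exp (ln \<rho> / 2) = sqrt \<rho>" using \<rho> by (simp flip: ln_sqrt)
    finally show ?thesis .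
  qed
  define A where "A n = {\<omega>. norm (walk \<omega> n) < exp (b * real n)}" for n
  have A_eq: "A n = {\<omega>. walk \<omega> n \<in> ball 0 (exp (b * real n))}" for n by (auto simp: A_def)
  have Am: "A n \<in> sets (increment_space \<mu>)" for n
    using measurable_sets[OF measurable_walk, of "ball 0 (exp (b * real n))" n \<mu>] by (simp add: A_eq vimage_def)
  define K where "K = (8 / \<delta> + 2)^4 * C"
  have bound: "measure (increment_space \<mu>) (A n) \<le> K * (sqrt \<rho>)^n" for n
  proof -
    define R where "R = exp (b * real n)"
    have R: "R \<ge> 1" using b by (simp add: R_def)
    define T where "T = {g\<in>G. norm g \<le> R}"
    have T: "finite T" "real (card T) \<le> (8 * R\<^sup>2 / \<delta> + 2)^4" using gap_card[OF G gap, of R] R by (auto simp: T_def)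
    have "measure (increment_space \<mu>) (A n) = measure (measure_pmf (walk_law \<mu> n)) (ball 0 R)"
      unfolding A_eq measure_def R_def by (subst emeasure_walk) auto
    also have "\<dots> \<le> measure (measure_pmf (walk_law \<mu> n)) T"
    proof (rule measure_pmf.finite_measure_mono_AE)
      show "AE x in measure_pmf (walk_law \<mu> n). x \<in> ball 0 R \<longrightarrow> x \<in> T"
        by (rule AE_pmfI) (use walk_law_closed[OF G \<mu>, of n] in \<open>auto simp: T_def\<close>)
    qed auto
    also have "\<dots> = (\<Sum>x\<in>T. pmf (walk_law \<mu> n) x)" by (rule measure_measure_pmf_finite[OF T(1)])
    also have "\<dots> \<le> (\<Sum>x\<in>T. C * \<rho>^n)" by (intro sum_mono decay)
    also have "\<dots> = real (card T) * (C * \<rho>^n)" by simp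
    also have "\<dots> \<le> ((8 / \<delta> + 2)^4 * R^8) * (C * \<rho>^n)"
    proof (intro mult_right_mono)
      have "(8 * R\<^sup>2 / \<delta> + 2)^4 \<le> ((8 / \<delta> + 2) * R\<^sup>2)^4"
      proof (intro power_mono)
        have "1 \<le> R\<^sup>2" using R by simp
        then show "8 * R\<^sup>2 / \<delta> + 2 \<le> (8 / \<delta> + 2) * R\<^sup>2" by (simp add: algebra_simps)
      qed (use gap in auto)
      also have "\<dots> = (8 / \<delta> + 2)^4 * R^8" by (simp add: power_mult_distrib flip: power_mult)
      finally show "real (card T) \<le> (8 / \<delta> + 2)^4 * R^8" using T by linarith
    qed (use C \<rho> in auto)
    also have "\<dots> = K * (R^8 * \<rho>^n)" by (simp add: K_def mult_ac)
    also have "R^8 * \<rho>^n = (sqrt \<rho>)^n" unfolding R_def by (rule e8)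
    finally show ?thesis .
  qed
  have "summable (\<lambda>n. measure (increment_space \<mu>) (A n))"
  proof (rule summable_comparison_test')
    show "summable (\<lambda>n. K * (sqrt \<rho>)^n)" using \<rho> by (intro summable_mult summable_geometric) auto
    show "norm (measure (increment_space \<mu>) (A n)) \<le> K * (sqrt \<rho>)^n" if "0 \<le> n" for n using bound[of n] by simp
  qed
  then have "AE \<omega> in increment_space \<mu>. eventually (\<lambda>n. \<omega> \<in> space (increment_space \<mu>) - A n) sequentially"
    by (intro borel_cantelli_AE1 Am) (auto simp: increments.emeasure_finite less_top[symmetric])
  then have "AE \<omega> in increment_space \<mu>. eventually (\<lambda>n. exp (b * real n) \<le> norm (walk \<omega> n)) sequentially"
    by (rule AE_mp) (rule AE_I2, auto simp: A_def not_less elim!: eventually_mono)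
  with b show ?thesis by (rule that)
qed

lemma measurable_increment: "(\<lambda>\<omega>. f (\<omega> n)) \<in> borel_measurable (increment_space \<mu>)" for f :: "real^2^2 \<Rightarrow> 'b::topological_space"
  unfolding increment_space_def by (rule measurable_compose[OF measurable_component_singleton]) auto

lemma distr_increment: "distr (increment_space \<mu>) (measure_pmf \<mu>) (\<lambda>\<omega>. \<omega> n) = measure_pmf \<mu>"
  unfolding increment_space_def by (rule distr_PiM_component) (auto simp: measure_pmf.prob_space_axioms)

lemma nn_integral_increment:
  "(\<integral>\<^sup>+\<omega>. F (\<omega> n) \<partial>increment_space \<mu>) = (\<integral>\<^sup>+g. F g \<partial>measure_pmf \<mu>)"
proof -
  have "(\<integral>\<^sup>+g. F g \<partial>distr (increment_space \<mu>) (measure_pmf \<mu>) (\<lambda>\<omega>. \<omega> n)) = (\<integral>\<^sup>+\<omega>. F (\<omega> n) \<partial>increment_space \<mu>)"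
    by (rule nn_integral_distr) (auto simp: increment_space_def)
  then show ?thesis by (simp add: distr_increment)
qed

lemma sublinear_increments:
  fixes X :: "real^2^2 \<Rightarrow> real"
  assumes X: "\<And>g. 0 \<le> X g" and fin: "(\<integral>\<^sup>+g. ennreal (X g) \<partial>measure_pmf \<mu>) < \<infinity>"
  shows "AE \<omega> in increment_space \<mu>. \<forall>\<epsilon>>0. eventually (\<lambda>n. X (\<omega> n) \<le> \<epsilon> * real n) sequentially"
proof -
  have one: "AE \<omega> in increment_space \<mu>. eventually (\<lambda>n. X (\<omega> n) \<le> \<epsilon> * real n) sequentially" if e: "\<epsilon> > 0" for \<epsilon>
  proof -
    define A where "A n = {\<omega>. X (\<omega> n) > \<epsilon> * real n}" for n
    have Am: "A n \<in> sets (increment_space \<mu>)" for n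
      using measurable_sets[OF measurable_increment[of X n \<mu>], of "{\<epsilon> * real n<..}"] by (simp add: A_def vimage_def)
    have emA: "emeasure (increment_space \<mu>) (A n) = (\<integral>\<^sup>+g. indicator {\<epsilon> * real n<..} (X g) \<partial>measure_pmf \<mu>)" for n
    proof -
      have "emeasure (increment_space \<mu>) (A n) = (\<integral>\<^sup>+\<omega>. indicator {\<epsilon> * real n<..} (X (\<omega> n)) \<partial>increment_space \<mu>)"
      proof -
        have "(\<lambda>\<omega>. indicator {\<epsilon> * real n<..} (X (\<omega> n))) = (indicator (A n) :: _ \<Rightarrow> ennreal)" by (auto simp: indicator_def A_def)
        then show ?thesis using Am[of n] by simp
      qed
      then show ?thesis using nn_integral_increment[where F="\<lambda>g. indicator {\<epsilon> * real n<..} (X g)"] by simp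
    qed
    have count: "(\<Sum>n. indicator {\<epsilon> * real n<..} x) \<le> ennreal (x / \<epsilon>) + 1" if x: "0 \<le> x" for x
    proof -
      define m where "m = nat \<lceil>x / \<epsilon>\<rceil>"
      have z: "indicator {\<epsilon> * real n<..} x = (0::ennreal)" if "n \<ge> m" for n
      proof -
        have "x / \<epsilon> \<le> real n" using that by (simp add: m_def)
        then have "x \<le> \<epsilon> * real n" using e by (simp add: field_simps)
        then show ?thesis by simp
      qed
      have "(\<Sum>n. indicator {\<epsilon> * real n<..} x) = (\<Sum>n<m. indicator {\<epsilon> * real n<..} x :: ennreal)"
        by (rule suminf_finite) (use z in auto)
      also have "\<dots> \<le> (\<Sum>n<m. 1)" by (intro sum_mono) (simp add: indicator_def)
      also have "\<dots> = ennreal (real m)" by (simp add: ennreal_of_nat_eq_real_of_nat)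
      also have "\<dots> \<le> ennreal (x / \<epsilon> + 1)"
      proof (rule ennreal_leI)
        have "0 \<le> x / \<epsilon>" using x e by simp
        then show "real m \<le> x / \<epsilon> + 1" unfolding m_def by linarith
      qed
      finally show ?thesis using x e by simp
    qed
    have "(\<Sum>n. emeasure (increment_space \<mu>) (A n)) = (\<integral>\<^sup>+g. (\<Sum>n. indicator {\<epsilon> * real n<..} (X g)) \<partial>measure_pmf \<mu>)"
      unfolding emA by (rule nn_integral_suminf[symmetric]) auto
    also have "\<dots> \<le> (\<integral>\<^sup>+g. ennreal (1 / \<epsilon>) * ennreal (X g) + 1 \<partial>measure_pmf \<mu>)"
    proof (intro nn_integral_mono)
      fix g
      have "ennreal (X g / \<epsilon>) = ennreal (1 / \<epsilon>) * ennreal (X g)" using X[of g] e by (subst ennreal_mult[symmetric]) auto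
      then show "(\<Sum>n. indicator {\<epsilon> * real n<..} (X g)) \<le> ennreal (1 / \<epsilon>) * ennreal (X g) + 1" using count[OF X[of g]] by simp
    qed
    also have "\<dots> = ennreal (1 / \<epsilon>) * (\<integral>\<^sup>+g. ennreal (X g) \<partial>measure_pmf \<mu>) + 1"
      by (simp add: nn_integral_add nn_integral_cmult)
    also have "\<dots> < \<infinity>" using fin by (simp add: ennreal_mult_less_top)
    finally have "(\<Sum>n. emeasure (increment_space \<mu>) (A n)) < \<infinity>" .
    then have "(\<Sum>n. ennreal (measure (increment_space \<mu>) (A n))) \<noteq> \<top>"
      by (simp add: increments.emeasure_eq_measure)
    then have "summable (\<lambda>n. measure (increment_space \<mu>) (A n))" by (intro summable_suminf_not_top) auto
    then have "AE \<omega> in increment_space \<mu>. eventually (\<lambda>n. \<omega> \<in> space (increment_space \<mu>) - A n) sequentially"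
      by (intro borel_cantelli_AE1 Am) (auto simp: increments.emeasure_finite less_top[symmetric])
    then show ?thesis
      by (rule AE_mp) (rule AE_I2, auto simp: A_def not_less elim!: eventually_mono)
  qed
  have "AE \<omega> in increment_space \<mu>. \<forall>k. eventually (\<lambda>n. X (\<omega> n) \<le> (1 / real (Suc k)) * real n) sequentially"
    unfolding AE_all_countable by (intro allI one) simp
  then show ?thesis
  proof (rule AE_mp, intro AE_I2 impI allI)
    fix \<omega> and \<epsilon> :: real
    assume *: "\<forall>k. eventually (\<lambda>n. X (\<omega> n) \<le> (1 / real (Suc k)) * real n) sequentially" and e: "\<epsilon> > 0"
    obtain k where k: "1 / real (Suc k) < \<epsilon>" using nat_approx_posE[OF e] by blast
    from * have "eventually (\<lambda>n. X (\<omega> n) \<le> (1 / real (Suc k)) * real n) sequentially" by blast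
    then show "eventually (\<lambda>n. X (\<omega> n) \<le> \<epsilon> * real n) sequentially"
    proof (rule eventually_mono)
      fix n assume "X (\<omega> n) \<le> (1 / real (Suc k)) * real n"
      also have "\<dots> \<le> \<epsilon> * real n" using k by (intro mult_right_mono) auto
      finally show "X (\<omega> n) \<le> \<epsilon> * real n" .
    qed
  qed
qed

primrec running_max :: "(real^2^2 \<Rightarrow> real) \<Rightarrow> nat \<Rightarrow> (nat \<Rightarrow> real^2^2) \<Rightarrow> real" where
  "running_max f 0 \<omega> = 0"
| "running_max f (Suc N) \<omega> = max 0 (f (\<omega> 0) + running_max f N (\<lambda>n. \<omega> (Suc n)))"

lemma running_max_mono: "running_max f N \<omega> \<le> running_max f (Suc N) \<omega>"
proof (induction N arbitrary: \<omega>)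
  case (Suc N)
  then show ?case using Suc[of "\<lambda>n. \<omega> (Suc n)"] unfolding running_max.simps(2)[of f N] running_max.simps(2)[of f "Suc N"]
    by (intro max.mono add_left_mono) auto
qed simp

lemma running_max_nonneg: "0 \<le> running_max f N \<omega>" by (cases N) auto

lemma running_max_ge: "n \<le> N \<Longrightarrow> (\<Sum>i<n. f (\<omega> i)) \<le> running_max f N \<omega>"
proof (induction N arbitrary: n \<omega>)
  case (Suc N)
  show ?case
  proof (cases n)
    case (Suc m)
    have "(\<Sum>i<n. f (\<omega> i)) = f (\<omega> 0) + (\<Sum>i<m. f (\<omega> (Suc i)))" unfolding Suc by (rule sum.lessThan_Suc_shift)
    also have "\<dots> \<le> f (\<omega> 0) + running_max f N (\<lambda>n. \<omega> (Suc n))"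
      using Suc.IH[of m "\<lambda>n. \<omega> (Suc n)"] Suc.prems \<open>n = Suc m\<close> by simp
    finally show ?thesis by simp
  qed simp
qed simp

lemma measurable_shift: "(\<lambda>\<omega> n. \<omega> (Suc n)) \<in> increment_space \<mu> \<rightarrow>\<^sub>M increment_space \<mu>"
  unfolding increment_space_def by (rule measurable_PiM_single') (auto simp: space_PiM)

lemma nn_integral_shift:
  assumes F [measurable]: "F \<in> borel_measurable (increment_space \<mu>)"
  shows "(\<integral>\<^sup>+\<omega>. F (\<lambda>n. \<omega> (Suc n)) \<partial>increment_space \<mu>) = (\<integral>\<^sup>+\<omega>. F \<omega> \<partial>increment_space \<mu>)"
  by (subst nn_integral_increment_space) (simp_all add: measurable_compose[OF measurable_shift F])

lemma measurable_running_max: "running_max f N \<in> borel_measurable (increment_space \<mu>)"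
proof (induction N)
  case (Suc N)
  have [measurable]: "(\<lambda>\<omega>. f (\<omega> 0)) \<in> borel_measurable (increment_space \<mu>)" by (rule measurable_increment)
  have [measurable]: "(\<lambda>\<omega>. running_max f N (\<lambda>n. \<omega> (Suc n))) \<in> borel_measurable (increment_space \<mu>)"
    by (rule measurable_compose[OF measurable_shift Suc])
  show ?case by simp
qed simp

text \<open>Garsia's argument: on the event where the running maximum is positive, \<open>f (\<omega> 0)\<close> dominates
  a coboundary.\<close>

lemma maximal_inequality:
  fixes X :: "real^2^2 \<Rightarrow> real"
  assumes X: "\<And>g. 0 \<le> X g" and int: "integrable (measure_pmf \<mu>) X" and c: "c > 0"
  shows "c * measure (increment_space \<mu>) {\<omega>. running_max (\<lambda>g. X g - c) N \<omega> > 0} \<le> measure_pmf.expectation \<mu> X"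
proof -
  let ?M = "increment_space \<mu>"
  define f where "f g = X g - c" for g
  define E where "E = {\<omega>. running_max f N \<omega> > 0}"
  note [measurable] = measurable_running_max
  have Em [measurable]: "E \<in> sets ?M"
    using measurable_sets[OF measurable_running_max[of f N \<mu>], of "{0<..}"] by (simp add: E_def vimage_def)
  have Xm: "(\<lambda>\<omega>. X (\<omega> 0)) \<in> borel_measurable ?M" by (rule measurable_increment)
  have Xint: "integrable ?M (\<lambda>\<omega>. X (\<omega> i))" "integral\<^sup>L ?M (\<lambda>\<omega>. X (\<omega> i)) = measure_pmf.expectation \<mu> X" for i
  proof -
    have m: "(\<lambda>\<omega>. \<omega> i) \<in> ?M \<rightarrow>\<^sub>M measure_pmf \<mu>" by (simp add: increment_space_def)
    show "integrable ?M (\<lambda>\<omega>. X (\<omega> i))"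
      using integrable_distr[OF m, of X] int by (simp add: distr_increment)
    show "integral\<^sup>L ?M (\<lambda>\<omega>. X (\<omega> i)) = measure_pmf.expectation \<mu> X"
      using integral_distr[OF m, of X] by (simp add: distr_increment)
  qed
  have le: "running_max f k \<omega> \<le> (\<Sum>i<k. X (\<omega> i))" for k \<omega>
  proof (induction k arbitrary: \<omega>)
    case (Suc k)
    have "f (\<omega> 0) + running_max f k (\<lambda>n. \<omega> (Suc n)) \<le> X (\<omega> 0) + (\<Sum>i<k. X (\<omega> (Suc i)))"
      using Suc[of "\<lambda>n. \<omega> (Suc n)"] c unfolding f_def by linarith
    also have "\<dots> = (\<Sum>i<Suc k. X (\<omega> i))" by (rule sum.lessThan_Suc_shift[symmetric])
    finally show ?case using X by (simp add: sum_nonneg)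
  qed simp
  have Mint: "integrable ?M (running_max f N)"
  proof (rule Bochner_Integration.integrable_bound)
    show "integrable ?M (\<lambda>\<omega>. \<Sum>i<N. X (\<omega> i))" by (intro Bochner_Integration.integrable_sum Xint)
    show "AE \<omega> in ?M. norm (running_max f N \<omega>) \<le> norm (\<Sum>i<N. X (\<omega> i))"
    proof (rule AE_I2)
      fix \<omega> show "norm (running_max f N \<omega>) \<le> norm (\<Sum>i<N. X (\<omega> i))"
        using le[of N \<omega>] running_max_nonneg[of f N \<omega>] by simp
    qed
  qed simp
  have Sm [measurable]: "(\<lambda>\<omega>. running_max f N (\<lambda>n. \<omega> (Suc n))) \<in> borel_measurable ?M"
    by (rule measurable_compose[OF measurable_shift measurable_running_max])
  have nn: "(\<integral>\<^sup>+\<omega>. ennreal (running_max f N (\<lambda>n. \<omega> (Suc n))) \<partial>?M) = (\<integral>\<^sup>+\<omega>. ennreal (running_max f N \<omega>) \<partial>?M)"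
    by (rule nn_integral_shift) simp
  have Sint: "integrable ?M (\<lambda>\<omega>. running_max f N (\<lambda>n. \<omega> (Suc n)))"
  proof (rule integrableI_nonneg[OF Sm])
    show "(\<integral>\<^sup>+\<omega>. ennreal (running_max f N (\<lambda>n. \<omega> (Suc n))) \<partial>?M) < \<infinity>"
      unfolding nn by (subst nn_integral_eq_integral[OF Mint]) (auto simp: running_max_nonneg)
  qed (auto simp: running_max_nonneg)
  have Seq: "integral\<^sup>L ?M (\<lambda>\<omega>. running_max f N (\<lambda>n. \<omega> (Suc n))) = integral\<^sup>L ?M (running_max f N)"
    using nn by (simp add: integral_eq_nn_integral running_max_nonneg)
  have pt: "running_max f N \<omega> - running_max f N (\<lambda>n. \<omega> (Suc n)) \<le> X (\<omega> 0) - c * indicator E \<omega>" for \<omega>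
  proof (cases "\<omega> \<in> E")
    case True
    then obtain N' where N': "N = Suc N'" by (cases N) (auto simp: E_def)
    have "running_max f N \<omega> = f (\<omega> 0) + running_max f N' (\<lambda>n. \<omega> (Suc n))"
      using True unfolding E_def N' by (auto simp: max_def split: if_splits)
    also have "\<dots> \<le> f (\<omega> 0) + running_max f N (\<lambda>n. \<omega> (Suc n))"
      unfolding N' by (intro add_left_mono running_max_mono)
    finally show ?thesis using True by (simp add: f_def)
  next
    case False
    then have "running_max f N \<omega> \<le> 0" by (simp add: E_def not_less)
    then show ?thesis using False X[of "\<omega> 0"] running_max_nonneg[of f N "\<lambda>n. \<omega> (Suc n)"] by simp
  qed
  have "0 = integral\<^sup>L ?M (\<lambda>\<omega>. running_max f N \<omega> - running_max f N (\<lambda>n. \<omega> (Suc n)))"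
    using Mint Sint by (simp add: Seq)
  also have "\<dots> \<le> integral\<^sup>L ?M (\<lambda>\<omega>. X (\<omega> 0) - c * indicator E \<omega>)"
    using Mint Sint Xint by (intro integral_mono pt) (auto simp: increments.emeasure_finite less_top[symmetric])
  also have "\<dots> = measure_pmf.expectation \<mu> X - c * measure ?M E"
    using Xint by (simp add: increments.emeasure_finite less_top[symmetric])
  finally show ?thesis by (simp add: E_def f_def[abs_def])
qed

lemma linear_growth:
  fixes X :: "real^2^2 \<Rightarrow> real"
  assumes X: "\<And>g. 0 \<le> X g" and fin: "(\<integral>\<^sup>+g. ennreal (X g) \<partial>measure_pmf \<mu>) < \<infinity>"
  shows "AE \<omega> in increment_space \<mu>. \<exists>C. \<forall>n. (\<Sum>i<n. X (\<omega> i)) \<le> C * real n"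
proof -
  let ?M = "increment_space \<mu>"
  have int: "integrable (measure_pmf \<mu>) X" by (rule integrableI_nonneg) (use X fin in auto)
  define e where "e = measure_pmf.expectation \<mu> X"
  define E where "E c N = {\<omega>. running_max (\<lambda>g. X g - real (Suc c)) N \<omega> > 0}" for c N
  have Em [measurable]: "E c N \<in> sets ?M" for c N
    using measurable_sets[OF measurable_running_max[of "\<lambda>g. X g - real (Suc c)" N \<mu>], of "{0<..}"] by (simp add: E_def vimage_def)
  have E1: "measure ?M (E c N) \<le> e / real (Suc c)" for c N
    using maximal_inequality[OF X int, of "real (Suc c)" N] by (simp add: E_def e_def field_simps)
  have E2: "measure ?M (\<Union>N. E c N) \<le> e / real (Suc c)" for c
  proof -
    have "incseq (E c)" unfolding E_def
      by (intro incseq_SucI subsetI, simp only: mem_Collect_eq) (rule less_le_trans[OF _ running_max_mono])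
    then have "(\<lambda>N. measure ?M (E c N)) \<longlonglongrightarrow> measure ?M (\<Union>N. E c N)"
      by (intro increments.finite_Lim_measure_incseq) auto
    then show ?thesis by (rule LIMSEQ_le_const2) (use E1 in auto)
  qed
  define Z where "Z = (\<Inter>c. \<Union>N. E c N)"
  have Zm: "Z \<in> sets ?M" unfolding Z_def by measurable
  have "measure ?M Z \<le> e / real (Suc c)" for c
  proof -
    have "measure ?M Z \<le> measure ?M (\<Union>N. E c N)" unfolding Z_def by (intro increments.finite_measure_mono) auto
    then show ?thesis using E2[of c] by linarith
  qed
  moreover have "(\<lambda>c. e / real (Suc c)) \<longlonglongrightarrow> 0" by (rule LIMSEQ_Suc) (rule lim_const_over_n)
  ultimately have "measure ?M Z \<le> 0" by (intro LIMSEQ_le_const[of "\<lambda>c. e / real (Suc c)" 0]) auto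
  then have "emeasure ?M Z = 0" by (simp add: increments.emeasure_eq_measure measure_le_0_iff)
  then have "AE \<omega> in ?M. \<omega> \<notin> Z" using Zm by (intro AE_not_in) auto
  then show ?thesis
  proof (rule AE_mp, intro AE_I2 impI)
    fix \<omega> assume "\<omega> \<notin> Z"
    then obtain c where c: "\<omega> \<notin> E c N" for N by (auto simp: Z_def)
    have "(\<Sum>i<n. X (\<omega> i)) \<le> real (Suc c) * real n" for n
    proof -
      have "(\<Sum>i<n. X (\<omega> i) - real (Suc c)) \<le> 0"
        using running_max_ge[of n n "\<lambda>g. X g - real (Suc c)" \<omega>] c[of n] by (simp add: E_def not_less)
      then show ?thesis by (simp add: sum_subtractf mult.commute)
    qed
    then show "\<exists>C. \<forall>n. (\<Sum>i<n. X (\<omega> i)) \<le> C * real n" by blast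
  qed
qed

section \<open>Exponential decay for lattices with a cusp\<close>

lemma (in cusped_lattice) exists_nontriangular: "\<exists>g\<in>\<Gamma>. g$2$1 \<noteq> 0"
proof -
  have "deep_reals \<noteq> {}"
    using deep_reals_conull non_negligible_UNIV[where 'a=real] by force
  then obtain x where "x \<in> excursion_reals 1" by (auto simp: deep_reals_def)
  then obtain g where "g \<in> \<Gamma>" "1 \<le> \<bar>g$2$1\<bar>" unfolding excursion_reals_def by auto
  then show ?thesis by (intro bexI[of _ g]) auto
qed

lemma cusped_decay:
  assumes G: "subgroup G SL2R" and P: "det P = 1" and cl: "cusped_lattice (conjugate_by P G) \<delta>"
    and \<mu>: "set_pmf \<mu> \<subseteq> G" and gen: "semigroup_generate SL2R (set_pmf \<mu>) = G"
  obtains C \<rho> where "C > 0" "0 < \<rho>" "\<rho> < 1" "\<And>n x. pmf (walk_law \<mu> n) x \<le> C * \<rho>^n"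
proof -
  interpret cusped_lattice "conjugate_by P G" \<delta> by (rule cl)
  note Gd = subgroup_SL2R_D[OF G]
  have toG: "h \<in> conjugate_by P G \<Longrightarrow> P ** h ** adj2 P \<in> G" for h using conjugate_by_mem[OF P] by blast
  have cG: "countable G"
  proof -
    have "G \<subseteq> (\<lambda>A. P ** A ** adj2 P) ` conjugate_by P G"
      unfolding conjugate_by_def image_image by (auto simp: adj2_cancel[OF P] adj2_inverse[OF P] matrix_mul_assoc intro!: image_eqI)
    then show ?thesis using countable_group countable_image countable_subset by blast
  qed
  interpret group_space G by (rule group_space.intro[OF G cG])
  obtain h where h: "h \<in> conjugate_by P G" "h$2$1 \<noteq> 0" using exists_nontriangular by blast
  have dh: "det h = 1" using det1 h by blast
  define c where "c = h$2$1"
  have c: "\<bar>c\<bar> \<ge> 1" unfolding c_def by (rule shimizu) (use h in auto)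
  obtain ki :: int where ki: "real_of_int ki \<ge> 2 * (\<bar>h$1$1\<bar> + \<bar>h$2$2 / c\<bar> + 2)" using ex_le_of_int by blast
  define k where "k = real_of_int ki"
  have k: "k \<ge> 2 * (\<bar>h$1$1\<bar> + \<bar>h$2$2 / c\<bar> + 2)" using ki by (simp add: k_def)
  define \<alpha> \<beta> where "\<alpha> = \<bar>h$1$1\<bar>" and "\<beta> = \<bar>h$2$2 / c\<bar>"
  have ab: "0 \<le> \<alpha>" "0 \<le> \<beta>" by (simp_all add: \<alpha>_def \<beta>_def)
  have k: "k \<ge> 2 * \<alpha> + 2 * \<beta> + 4" using k by (simp add: \<alpha>_def \<beta>_def)
  have k0: "k > 0" using k ab by linarith
  define r where "r x = Re (mobius (adj2 P ** x) \<i>)" for x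
  define a where "a = P ** trans k ** adj2 P"
  have a: "a \<in> G" unfolding a_def by (rule toG[OF trans_closed[of ki, folded k_def]])
  have ra: "r (a ** x) = r x + k" if "x \<in> G" for x
  proof -
    have "adj2 P ** (a ** x) = trans k ** (adj2 P ** x)"
      unfolding a_def by (simp add: adj2_cancel[OF P] matrix_mul_assoc[symmetric])
    moreover have "mobius (trans k ** (adj2 P ** x)) \<i> = mobius (adj2 P ** x) \<i> + of_real k"
    proof -
      have "mobius (trans k ** (adj2 P ** x)) \<i> = mobius (trans k) (mobius (adj2 P ** x) \<i>)"
        by (rule mobius_mult) (use Gd(1)[OF that] P in \<open>auto simp: det_mul\<close>)
      then show ?thesis by (simp add: mobius_def[of "trans k"])
    qed
    ultimately show ?thesis by (simp add: r_def)
  qed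
  define A where "A = {x\<in>G. \<bar>r x\<bar> < k / 2}"
  define g where "g = P ** h ** adj2 P"
  have g: "g \<in> G" unfolding g_def by (rule toG[OF h(1)])
  have dg: "det g = 1" by (rule Gd(1)[OF g])
  define B where "B = (**) g ` A"
  define b where "b = g ** a ** adj2 g"
  have b: "b \<in> G" unfolding b_def by (intro Gd(4) Gd(2) a g)
  have AG: "A \<subseteq> G" by (auto simp: A_def)
  have A1: "A \<inter> (**) a ` A = {}"
    using ra k0 unfolding A_def by fastforce
  have raa: "r ((a ** a) ** x) = r x + 2 * k" if x: "x \<in> G" for x
    using ra[OF Gd(4)[OF a x]] ra[OF x] by (simp add: matrix_mul_assoc)
  have A2: "A \<inter> (**) (a ** a) ` A = {}"
    using raa k0 unfolding A_def by fastforce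
  have shift: "(**) (a ** a) ` A = (**) a ` (**) a ` A" by (simp add: image_image matrix_mul_assoc)
  have inj: "inj ((**) s :: real^2^2 \<Rightarrow> real^2^2)" if "s \<in> G" for s
    by (rule inj_on_inverseI[of _ "(**) (adj2 s)"]) (simp add: adj2_cancel Gd(1)[OF that])
  have A3: "(**) a ` A \<inter> (**) (a ** a) ` A = {}"
    unfolding shift image_Int[OF inj[OF a], symmetric] A1 by simp
  have bg: "(**) b ` B = (**) g ` (**) a ` A"
    by (simp add: B_def b_def image_image matrix_mul_assoc[symmetric] adj2_cancel[OF dg])
  have bbg: "(**) (b ** b) ` B = (**) g ` (**) (a ** a) ` A"
    by (simp add: B_def b_def image_image matrix_mul_assoc[symmetric] adj2_cancel[OF dg])
  have BG: "B \<subseteq> G" unfolding B_def using AG Gd(4)[OF g] by blast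
  have B: "B \<inter> (**) b ` B = {}" "B \<inter> (**) (b ** b) ` B = {}" "(**) b ` B \<inter> (**) (b ** b) ` B = {}"
    unfolding bg bbg unfolding B_def image_Int[OF inj[OF g], symmetric] A1 A2 A3 by simp_all
  have cover: "G \<subseteq> A \<union> B"
  proof
    fix x assume x: "x \<in> G"
    show "x \<in> A \<union> B"
    proof (cases "\<bar>r x\<bar> < k / 2")
      case False
      define z where "z = mobius (adj2 P ** x) \<i>"
      have dPx: "det (adj2 P ** x) = 1" using P Gd(1)[OF x] by (simp add: det_mul)
      have z: "Im z > 0" unfolding z_def by (rule mobius_Im_pos) (use dPx in auto)
      have rz: "\<bar>Re z\<bar> \<ge> k / 2" using False by (simp add: r_def z_def)
      have dh': "det (adj2 h) = 1" using dh by simp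
      have h': "adj2 h $ 1 $ 1 = h$2$2" "adj2 h $ 2 $ 1 = - c" "adj2 h $ 1 $ 2 = - h$1$2" "adj2 h $ 2 $ 2 = h$1$1" by (simp_all add: c_def)
      have den: "cmod (autf (adj2 h) z) \<ge> 1"
      proof -
        have "1 \<le> \<bar>c\<bar> * \<bar>Re z\<bar> - \<bar>h$1$1\<bar>"
        proof -
          have "\<bar>Re z\<bar> \<le> \<bar>c\<bar> * \<bar>Re z\<bar>" using c mult_right_mono[of 1 "\<bar>c\<bar>" "\<bar>Re z\<bar>"] by simp
          then show ?thesis using k rz ab unfolding \<alpha>_def[symmetric] by linarith
        qed
        also have "\<dots> \<le> \<bar>- c * Re z + h$1$1\<bar>" by (simp flip: abs_mult)
        also have "\<dots> = \<bar>Re (autf (adj2 h) z)\<bar>" by (simp add: c_def)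
        also have "\<dots> \<le> cmod (autf (adj2 h) z)" by (rule abs_Re_le_cmod)
        finally show ?thesis .
      qed
      have nz: "autf (adj2 h) z \<noteq> 0" using den by force
      have c0: "c \<noteq> 0" using c by auto
      have eq: "mobius (adj2 h) z + of_real (h$2$2 / c) = 1 / (of_real c * autf (adj2 h) z)"
      proof -
        have "(of_real (h$2$2) * z + of_real (- h$1$2)) * of_real c + of_real (h$2$2) * autf (adj2 h) z = of_real (h$1$1 * h$2$2 - h$1$2 * h$2$1)"
          by (simp add: c_def algebra_simps)
        also have "h$1$1 * h$2$2 - h$1$2 * h$2$1 = 1" using dh by (simp add: det_2)
        finally have "(of_real (h$2$2) * z + of_real (- h$1$2)) * of_real c + of_real (h$2$2) * autf (adj2 h) z = (1::complex)" by simp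
        then show ?thesis using nz c0 unfolding mobius_def h'(1,3)
          by (simp add: divide_simps del: adj2_nth)
      qed
      have "cmod (mobius (adj2 h) z + of_real (h$2$2 / c)) \<le> 1"
      proof -
        have "1 \<le> \<bar>c\<bar> * cmod (autf (adj2 h) z)" using c den mult_mono[of 1 "\<bar>c\<bar>" 1 "cmod (autf (adj2 h) z)"] by simp
        then show ?thesis unfolding eq by (simp add: norm_divide norm_mult del: adj2_nth)
      qed
      then have "\<bar>Re (mobius (adj2 h) z) + h$2$2 / c\<bar> \<le> 1"
        using abs_Re_le_cmod[of "mobius (adj2 h) z + of_real (h$2$2 / c)"] by (simp del: of_real_divide)
      then have "\<bar>Re (mobius (adj2 h) z)\<bar> < k / 2" using k ab abs_triangle_ineq4[of "Re (mobius (adj2 h) z) + h$2$2 / c" "h$2$2 / c"] unfolding \<beta>_def[symmetric] add_diff_cancel by linarith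
      moreover have "mobius (adj2 P ** (adj2 g ** x)) \<i> = mobius (adj2 h) z"
      proof -
        have "adj2 P ** (adj2 g ** x) = adj2 h ** (adj2 P ** x)"
          unfolding g_def by (simp add: adj2_mult adj2_cancel[OF P] matrix_mul_assoc[symmetric])
        then show ?thesis unfolding z_def using mobius_mult[OF dh' dPx, of \<i>] by simp
      qed
      ultimately have "adj2 g ** x \<in> A" using Gd(4)[OF Gd(2)[OF g] x] by (simp add: A_def r_def)
      then show ?thesis unfolding B_def by (intro UnI2 image_eqI[of _ _ "adj2 g ** x"]) (simp_all add: adj2_cancel[OF dg])
    qed (use x in \<open>auto simp: A_def\<close>)
  qed
  show ?thesis using spectral_decay[OF a AG A1 A2 A3 b BG B cover \<mu> gen] that by blast
qed

section \<open>Word length\<close>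

definition mat_prod :: "(real^2^2) list \<Rightarrow> real^2^2" where "mat_prod xs = foldr (**) xs (mat 1)"

lemma mat_prod_simps [simp]: "mat_prod [] = mat 1" "mat_prod (x # xs) = x ** mat_prod xs"
  by (simp_all add: mat_prod_def)

lemma mat_prod_append: "mat_prod (xs @ ys) = mat_prod xs ** mat_prod ys"
  by (induction xs) (simp_all add: matrix_mul_assoc)

locale finitely_generated =
  fixes G S :: "(real^2^2) set"
  assumes sub: "subgroup G SL2R" and fin: "finite S" and gen: "generate SL2R S = G"
begin

lemmas Gd = subgroup_SL2R_D[OF sub]

abbreviation "letters \<equiv> S \<union> adj2 ` S"

abbreviation "wlen \<equiv> word_length SL2R S"

lemma letters_G: "letters \<subseteq> G"
  using generate.incl[of _ S SL2R] gen Gd(2) by auto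

lemma m_inv_letters: "S \<union> m_inv SL2R ` S = letters"
proof -
  have "m_inv SL2R s = adj2 s" if "s \<in> S" for s using m_inv_SL2R letters_G that Gd(1) by blast
  then show ?thesis by auto
qed

lemma wlen_eq: "wlen g = (LEAST n. \<exists>xs. length xs = n \<and> set xs \<subseteq> letters \<and> mat_prod xs = g)"
  unfolding word_length_def m_inv_letters by (simp add: mat_prod_def SL2R_def)

lemma word_exists: "g \<in> G \<Longrightarrow> \<exists>xs. set xs \<subseteq> letters \<and> mat_prod xs = g"
  unfolding gen[symmetric]
proof (induction rule: generate.induct)
  case one
  show ?case by (rule exI[of _ "[]"]) simp
next
  case (incl h)
  then show ?case by (intro exI[of _ "[h]"]) simp
next
  case (inv h)
  then have "m_inv SL2R h = adj2 h" using m_inv_SL2R letters_G Gd(1) by blast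
  then show ?case using inv by (intro exI[of _ "[adj2 h]"]) simp
next
  case (eng g h)
  then obtain xs ys where "set xs \<subseteq> letters" "mat_prod xs = g" "set ys \<subseteq> letters" "mat_prod ys = h" by blast
  then show ?case by (intro exI[of _ "xs @ ys"]) (simp add: mat_prod_append)
qed

lemma wlen_word:
  assumes "g \<in> G" obtains xs where "length xs = wlen g" "set xs \<subseteq> letters" "mat_prod xs = g"
  using LeastI_ex[of "\<lambda>n. \<exists>xs. length xs = n \<and> set xs \<subseteq> letters \<and> mat_prod xs = g"] word_exists[OF assms]
  unfolding wlen_eq by blast

lemma wlen_le: "set xs \<subseteq> letters \<Longrightarrow> wlen (mat_prod xs) \<le> length xs"
  unfolding wlen_eq by (rule Least_le) blast

lemma wlen_one [simp]: "wlen (mat 1) = 0"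
  using wlen_le[of "[]"] by simp

lemma wlen_mult: assumes "g \<in> G" "h \<in> G" shows "wlen (g ** h) \<le> wlen g + wlen h"
proof -
  obtain xs ys where "length xs = wlen g" "set xs \<subseteq> letters" "mat_prod xs = g"
    and "length ys = wlen h" "set ys \<subseteq> letters" "mat_prod ys = h"
    using wlen_word assms by metis
  then show ?thesis using wlen_le[of "xs @ ys"] by (simp add: mat_prod_append)
qed

lemma word_metric_one: "word_metric SL2R S (\<one>\<^bsub>SL2R\<^esub>) g = wlen g"
  using m_inv_SL2R[of "mat 1"] by (simp add: word_metric_def)

lemma walk_G: "(\<And>i. \<omega> i \<in> G) \<Longrightarrow> walk \<omega> n \<in> G"
  by (induction n) (auto intro: Gd)

lemma wlen_walk: "(\<And>i. \<omega> i \<in> G) \<Longrightarrow> wlen (walk \<omega> n) \<le> (\<Sum>i<n. wlen (\<omega> i))"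
proof (induction n)
  case (Suc n)
  then show ?case using wlen_mult[OF walk_G[of \<omega> n], of "\<omega> n"] by force
qed simp

lemma norm_word_growth:
  obtains a where "a > 0" "\<And>g. g \<in> G \<Longrightarrow> norm g \<le> norm (mat 1 :: real^2^2) * exp (a * real (wlen g))"
proof -
  define K where "K = Max (insert 2 (norm ` letters))"
  have K: "2 \<le> K" "x \<in> letters \<Longrightarrow> norm x \<le> K" for x
    unfolding K_def using fin by (auto intro!: Max_ge)
  have "norm (mat_prod xs) \<le> norm (mat 1 :: real^2^2) * K ^ length xs" if "set xs \<subseteq> letters" for xs
    using that
  proof (induction xs)
    case (Cons x xs)
    have "norm (mat_prod (x # xs)) \<le> norm x * norm (mat_prod xs)" by (simp add: norm_mat2_mult)
    also have "\<dots> \<le> K * (norm (mat 1 :: real^2^2) * K ^ length xs)"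
      using Cons K(2)[of x] K(1) by (intro mult_mono) auto
    finally show ?case by (simp add: mult_ac)
  qed simp
  then have w: "norm (mat_prod xs) \<le> norm (mat 1 :: real^2^2) * K ^ length xs" if "set xs \<subseteq> letters" for xs using that .
  have K': "K ^ n = exp (ln K * real n)" for n using K by (simp add: mult.commute exp_of_nat_mult)
  show ?thesis
  proof (rule that[of "ln K"])
    show "ln K > 0" using K by (simp add: ln_gt_zero)
    fix g assume "g \<in> G"
    then obtain xs where "length xs = wlen g" "set xs \<subseteq> letters" "mat_prod xs = g" using wlen_word by blast
    then show "norm g \<le> norm (mat 1 :: real^2^2) * exp (ln K * real (wlen g))" using w[of xs] unfolding K' by simp
  qed
qed

end

lemma (in cusped) orbit_height:
  assumes g: "g \<in> \<Gamma>" and z: "Im z > 0" shows "Im (mobius g z) \<le> max (Im z) (1 / Im z)"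
proof -
  have im: "Im (mobius g z) = Im z / (cmod (autf g z))\<^sup>2" using mobius_Im[OF det1[OF g] z] .
  show ?thesis
  proof (cases "g$2$1 = 0")
    case True
    then have "(cmod (autf g z))\<^sup>2 = 1" using upper_triangular[OF g True] by (simp add: cmod_autf)
    then show ?thesis using im by simp
  next
    case False
    then have "1 \<le> (g$2$1)\<^sup>2" using shimizu[OF g] by (simp add: one_le_power abs_le_square_iff[of 1, simplified])
    then have "(Im z)\<^sup>2 \<le> (g$2$1)\<^sup>2 * (Im z)\<^sup>2" using mult_right_mono[of 1 "(g$2$1)\<^sup>2" "(Im z)\<^sup>2"] by simp
    also have "\<dots> \<le> (cmod (autf g z))\<^sup>2" by (simp add: cmod_autf power_mult_distrib)
    finally have "(Im z)\<^sup>2 \<le> (cmod (autf g z))\<^sup>2" .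
    moreover have "0 < (cmod (autf g z))\<^sup>2"
      by (rule less_le_trans[OF _ \<open>(Im z)\<^sup>2 \<le> (cmod (autf g z))\<^sup>2\<close>]) (use z in simp)
    ultimately have "Im (mobius g z) \<le> Im z / (Im z)\<^sup>2" unfolding im using z by (intro divide_left_mono mult_pos_pos) auto
    then show ?thesis using z by (simp add: power2_eq_square)
  qed
qed

lemma mobius_dist:
  assumes A: "det A = 1" and z: "Im z > 0" and w: "Im w > 0"
  shows "cmod (mobius A z - mobius A w) = cmod (z - w) * sqrt (Im (mobius A z) * Im (mobius A w)) / sqrt (Im z * Im w)"
proof -
  have nz: "autf A z \<noteq> 0" "autf A w \<noteq> 0" using autf_nz A z w by blast+
  have "Im (mobius A z) * Im (mobius A w) = (Im z * Im w) / (cmod (autf A z) * cmod (autf A w))\<^sup>2"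
    unfolding mobius_Im[OF A z] mobius_Im[OF A w] by (simp add: power_mult_distrib)
  then have "sqrt (Im (mobius A z) * Im (mobius A w)) = sqrt (Im z * Im w) / (cmod (autf A z) * cmod (autf A w))"
    by (simp add: real_sqrt_divide)
  then show ?thesis unfolding mobius_diff[OF A nz] using z w by (simp add: norm_divide norm_mult)
qed

lemma displacement:
  assumes fg: "finitely_generated G S" and P: "det P = 1" and cl: "cusped (conjugate_by P G) \<delta>" and z0: "Im z0 > 0"
  obtains D where "D > 0" "\<And>\<gamma> w. \<gamma> \<in> conjugate_by P G \<Longrightarrow> w \<in> G \<Longrightarrow>
    \<bar>Re (mobius (\<gamma> ** (adj2 P ** w ** P)) z0) - Re (mobius \<gamma> z0)\<bar> \<le> D * real (word_length SL2R S w)"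
proof -
  interpret finitely_generated G S by (rule fg)
  interpret C: cusped "conjugate_by P G" \<delta> by (rule cl)
  define H where "H = max (Im z0) (1 / Im z0)"
  have H0: "H > 0" using z0 by (simp add: H_def less_max_iff_disj)
  define q where "q s = adj2 P ** s ** P" for s
  have q: "q s \<in> conjugate_by P G" if "s \<in> G" for s using that by (auto simp: q_def conjugate_by_def)
  define F where "F s = cmod (z0 - mobius (q s) z0) * H / sqrt (Im z0 * Im (mobius (q s) z0))" for s
  define D where "D = Max (insert 1 (F ` letters))"
  have D: "1 \<le> D" "s \<in> letters \<Longrightarrow> F s \<le> D" for s unfolding D_def using fin by (auto intro!: Max_ge)
  have step: "\<bar>Re (mobius (\<gamma> ** q s) z0) - Re (mobius \<gamma> z0)\<bar> \<le> D" if \<gamma>: "\<gamma> \<in> conjugate_by P G" and s: "s \<in> letters" for \<gamma> s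
  proof -
    have sG: "s \<in> G" using s letters_G by blast
    have d: "det \<gamma> = 1" "det (q s) = 1" using \<gamma> q[OF sG] C.det1 by blast+
    have io: "Im (mobius (q s) z0) > 0" by (rule mobius_Im_pos[OF d(2) z0])
    have m: "mobius (\<gamma> ** q s) z0 = mobius \<gamma> (mobius (q s) z0)" by (rule mobius_mult[OF d z0])
    have h1: "Im (mobius \<gamma> z0) \<le> H" unfolding H_def by (rule C.orbit_height[OF \<gamma> z0])
    have h2: "Im (mobius \<gamma> (mobius (q s) z0)) \<le> H" unfolding H_def m[symmetric]
      by (rule C.orbit_height[OF C.mult_closed[OF \<gamma> q[OF sG]] z0])
    have p: "0 < Im (mobius \<gamma> z0)" "0 < Im (mobius \<gamma> (mobius (q s) z0))"
      by (rule mobius_Im_pos[OF d(1) z0], rule mobius_Im_pos[OF d(1) io])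
    have "\<bar>Re (mobius (\<gamma> ** q s) z0) - Re (mobius \<gamma> z0)\<bar> \<le> cmod (mobius \<gamma> z0 - mobius \<gamma> (mobius (q s) z0))"
      unfolding m using abs_Re_le_cmod[of "mobius \<gamma> z0 - mobius \<gamma> (mobius (q s) z0)"] by (simp add: abs_minus_commute)
    also have "\<dots> = cmod (z0 - mobius (q s) z0) * sqrt (Im (mobius \<gamma> z0) * Im (mobius \<gamma> (mobius (q s) z0))) / sqrt (Im z0 * Im (mobius (q s) z0))"
      by (rule mobius_dist[OF d(1) z0 io])
    also have "\<dots> \<le> F s"
    proof -
      have "sqrt (Im (mobius \<gamma> z0) * Im (mobius \<gamma> (mobius (q s) z0))) \<le> sqrt (H * H)"
        using h1 h2 p H0 by (intro real_sqrt_le_mono mult_mono) auto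
      then show ?thesis unfolding F_def using H0 by (intro divide_right_mono mult_left_mono) (use z0 io in auto)
    qed
    also have "\<dots> \<le> D" by (rule D(2)[OF s])
    finally show ?thesis .
  qed
  have word: "\<bar>Re (mobius (\<gamma> ** q (mat_prod xs)) z0) - Re (mobius \<gamma> z0)\<bar> \<le> D * real (length xs)"
    if "\<gamma> \<in> conjugate_by P G" "set xs \<subseteq> letters" for \<gamma> xs
    using that
  proof (induction xs arbitrary: \<gamma>)
    case Nil
    then show ?case by (simp add: q_def adj2_inverse[OF P])
  next
    case (Cons s xs)
    have s: "s \<in> letters" using Cons by simp
    then have g: "\<gamma> ** q s \<in> conjugate_by P G" using C.mult_closed[OF Cons.prems(1)] q letters_G by blast
    have "q (mat_prod (s # xs)) = q s ** q (mat_prod xs)"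
      by (simp add: q_def matrix_mul_assoc[symmetric] adj2_cancel[OF P])
    then have "\<gamma> ** q (mat_prod (s # xs)) = (\<gamma> ** q s) ** q (mat_prod xs)" by (simp add: matrix_mul_assoc)
    then show ?case using Cons.IH[OF g] step[OF Cons.prems(1) s] Cons.prems(2) by (simp add: algebra_simps)
  qed
  show ?thesis
  proof (rule that[of D])
    show "D > 0" using D(1) by simp
    fix \<gamma> w assume \<gamma>: "\<gamma> \<in> conjugate_by P G" and w: "w \<in> G"
    obtain xs where xs: "length xs = wlen w" "set xs \<subseteq> letters" "mat_prod xs = w" using wlen_word[OF w] .
    show "\<bar>Re (mobius (\<gamma> ** (adj2 P ** w ** P)) z0) - Re (mobius \<gamma> z0)\<bar> \<le> D * real (wlen w)"
      using word[OF \<gamma> xs(2)] unfolding xs by (simp add: q_def)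
  qed
qed

section \<open>Limits of the walk avoid deeply penetrated cusps\<close>

lemma abs_le_cmod_linear:
  assumes z: "Im z > 0"
  shows "\<bar>p\<bar> + \<bar>q\<bar> \<le> (1 + (1 + cmod z) / Im z) * cmod (of_real p * z + of_real q)"
proof -
  define y where "y = cmod (of_real p * z + of_real q)"
  have "\<bar>p\<bar> * Im z = \<bar>Im (of_real p * z + of_real q)\<bar>" using z by (simp add: abs_mult)
  also have "\<dots> \<le> y" unfolding y_def by (rule abs_Im_le_cmod)
  finally have p: "\<bar>p\<bar> \<le> y / Im z" using z by (simp add: pos_le_divide_eq)
  have "\<bar>q\<bar> = cmod ((of_real p * z + of_real q) - of_real p * z)" by simp
  also have "\<dots> \<le> y + \<bar>p\<bar> * cmod z" unfolding y_def by (rule order_trans[OF norm_triangle_ineq4]) (simp add: norm_mult)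
  also have "\<dots> \<le> y + y / Im z * cmod z" using p by (intro add_left_mono mult_right_mono) auto
  finally have "\<bar>p\<bar> + \<bar>q\<bar> \<le> y / Im z + (y + y / Im z * cmod z)" using p by linarith
  also have "\<dots> = (1 + (1 + cmod z) / Im z) * y" using z by (simp add: field_simps)
  finally show ?thesis by (simp add: y_def)
qed

lemma norm_le_autf:
  assumes z: "Im z > 0" and A: "det A = 1" and R: "cmod (mobius A z) \<le> R"
  shows "norm A \<le> (1 + (1 + cmod z) / Im z) * (R + 1) * cmod (autf A z)"
proof -
  define k where "k = 1 + (1 + cmod z) / Im z"
  have k: "k \<ge> 0" using z by (simp add: k_def)
  have nz: "autf A z \<noteq> 0" using autf_nz[OF A z] .
  have "of_real (A$1$1) * z + of_real (A$1$2) = mobius A z * autf A z" using nz by (simp add: mobius_def)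
  then have "cmod (of_real (A$1$1) * z + of_real (A$1$2)) = cmod (mobius A z) * cmod (autf A z)" by (simp add: norm_mult)
  also have "\<dots> \<le> R * cmod (autf A z)" using R by (intro mult_right_mono) auto
  finally have 1: "\<bar>A$1$1\<bar> + \<bar>A$1$2\<bar> \<le> k * (R * cmod (autf A z))"
    using abs_le_cmod_linear[OF z, of "A$1$1" "A$1$2"] k unfolding k_def[symmetric] by (meson mult_left_mono order_trans)
  have 2: "\<bar>A$2$1\<bar> + \<bar>A$2$2\<bar> \<le> k * cmod (autf A z)"
    unfolding k_def by (rule abs_le_cmod_linear[OF z])
  have "norm A \<le> \<bar>A$1$1\<bar> + \<bar>A$1$2\<bar> + \<bar>A$2$1\<bar> + \<bar>A$2$2\<bar>" by (rule norm_le_sum4)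
  also have "\<dots> \<le> k * (R * cmod (autf A z)) + k * cmod (autf A z)" using 1 2 by linarith
  also have "\<dots> = k * (R + 1) * cmod (autf A z)" by (simp add: algebra_simps)
  finally show ?thesis by (simp add: k_def)
qed

lemma mobius_step:
  assumes z: "Im z > 0" and A: "det A = 1" and g: "det g = 1"
  shows "cmod (mobius A z - mobius (A ** g) z) \<le> (cmod z + 1)\<^sup>2 * norm g / (cmod (autf A z) * cmod (autf (A ** g) z))"
proof -
  have gz: "Im (mobius g z) > 0" by (rule mobius_Im_pos[OF g z])
  have nz: "autf A z \<noteq> 0" "autf A (mobius g z) \<noteq> 0" "autf g z \<noteq> 0" using autf_nz A g z gz by blast+
  have "mobius A z - mobius (A ** g) z = (z - mobius g z) / (autf A z * autf A (mobius g z))"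
    unfolding mobius_mult[OF A g z] by (rule mobius_diff[OF A nz(1,2)])
  also have "\<dots> = (z * autf g z - mobius g z * autf g z) / (autf A z * (autf A (mobius g z) * autf g z))"
  proof -
    have "(p - q) / (a * b) = (p * e - q * e) / (a * (b * e))" if "e \<noteq> 0" for p q a b e :: complex
      using that by (simp add: left_diff_distrib[symmetric] mult.assoc[symmetric])
    then show ?thesis using nz(3) by blast
  qed
  also have "autf A (mobius g z) * autf g z = autf (A ** g) z" by (rule autf_mult[OF g z, symmetric])
  also have "mobius g z * autf g z = of_real (g$1$1) * z + of_real (g$1$2)" using nz by (simp add: mobius_def)
  finally have "cmod (mobius A z - mobius (A ** g) z) =
      cmod (z * autf g z - (of_real (g$1$1) * z + of_real (g$1$2))) / (cmod (autf A z) * cmod (autf (A ** g) z))"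
    by (simp add: norm_divide norm_mult del: mat2_mult)
  also have "\<dots> \<le> ((cmod z + 1)\<^sup>2 * norm g) / (cmod (autf A z) * cmod (autf (A ** g) z))"
  proof (rule divide_right_mono)
    have lin: "cmod (of_real (g$i$1) * z + of_real (g$i$2)) \<le> (cmod z + 1) * norm g" for i
    proof -
      have "cmod (of_real (g$i$1) * z + of_real (g$i$2)) \<le> \<bar>g$i$1\<bar> * cmod z + \<bar>g$i$2\<bar>"
        by (rule order_trans[OF norm_triangle_ineq]) (simp add: norm_mult)
      also have "\<dots> \<le> norm g * cmod z + norm g" using norm_mat2_nth[of g i] by (intro add_mono mult_right_mono) auto
      finally show ?thesis by (simp add: algebra_simps)
    qed
    have "cmod (z * autf g z - (of_real (g$1$1) * z + of_real (g$1$2))) \<le> cmod z * cmod (autf g z) + cmod (of_real (g$1$1) * z + of_real (g$1$2))"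
      by (rule order_trans[OF norm_triangle_ineq4]) (simp add: norm_mult)
    also have "\<dots> \<le> cmod z * ((cmod z + 1) * norm g) + (cmod z + 1) * norm g"
      by (intro add_mono mult_left_mono lin) auto
    also have "\<dots> = (cmod z + 1)\<^sup>2 * norm g" by (simp add: power2_eq_square algebra_simps)
    finally show "cmod (z * autf g z - (of_real (g$1$1) * z + of_real (g$1$2))) \<le> (cmod z + 1)\<^sup>2 * norm g" .
  qed simp
  finally show ?thesis .
qed

lemma exponential_limit:
  fixes z :: "nat \<Rightarrow> 'a::real_normed_vector"
  assumes b: "b > 0" and step: "\<And>n. n \<ge> n0 \<Longrightarrow> norm (z n - z (Suc n)) \<le> K * exp (- b * real n)"
    and lim: "z \<longlonglongrightarrow> x" and n: "n \<ge> n0"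
  shows "norm (z n - x) \<le> K / (1 - exp (- b)) * exp (- b * real n)"
proof -
  define K4 where "K4 = K / (1 - exp (- b))"
  have K0: "0 \<le> K * exp (- b * real n0)" using step[of n0] norm_ge_zero order_trans by blast
  then have K: "K \<ge> 0" by (simp add: zero_le_mult_iff)
  have e: "exp (- b) < 1" using b by simp
  have K4: "K4 \<ge> 0" "K = K4 * (1 - exp (- b))" using K e by (auto simp: K4_def)
  have tel: "norm (z n - z (n + m)) \<le> K4 * exp (- b * real n) - K4 * exp (- b * real (n + m))" for m
  proof (induction m)
    case (Suc m)
    have "norm (z n - z (n + Suc m)) \<le> norm (z n - z (n + m)) + norm (z (n + m) - z (Suc (n + m)))"
      using norm_triangle_ineq[of "z n - z (n + m)" "z (n + m) - z (Suc (n + m))"] by simp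
    also have "\<dots> \<le> (K4 * exp (- b * real n) - K4 * exp (- b * real (n + m))) + K * exp (- b * real (n + m))"
      using Suc step[of "n + m"] n by (intro add_mono) auto
    also have "K * exp (- b * real (n + m)) = K4 * exp (- b * real (n + m)) - K4 * exp (- b * real (n + Suc m))"
    proof -
      have "exp (- b * real (n + Suc m)) = exp (- b * real (n + m)) * exp (- b)" by (simp add: algebra_simps flip: exp_add)
      then show ?thesis unfolding K4(2) by (simp add: algebra_simps)
    qed
    finally show ?case by simp
  qed simp
  have "(\<lambda>m. norm (z n - z (m + n))) \<longlonglongrightarrow> norm (z n - x)"
    by (intro tendsto_norm tendsto_diff tendsto_const LIMSEQ_ignore_initial_segment lim)
  then have "norm (z n - x) \<le> K4 * exp (- b * real n)"
  proof (rule LIMSEQ_le_const2)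
    have "norm (z n - z (m + n)) \<le> K4 * exp (- b * real n)" for m
    proof -
      have "0 \<le> K4 * exp (- b * real (n + m))" using K4 by simp
      then show ?thesis using tel[of m] by (simp add: add.commute)
    qed
    then show "\<exists>N. \<forall>m\<ge>N. norm (z n - z (m + n)) \<le> K4 * exp (- b * real n)" by blast
  qed
  then show ?thesis by (simp add: K4_def)
qed

lemma mobius_minus_cusp:
  assumes A: "det A = 1" and c: "A$2$1 \<noteq> 0" and nz: "autf A z \<noteq> 0"
  shows "mobius A z - of_real (A$1$1 / A$2$1) = - 1 / (of_real (A$2$1) * autf A z)"
proof -
  have "(of_real (A$1$1) * z + of_real (A$1$2)) * of_real (A$2$1) - of_real (A$1$1) * autf A z = - of_real (A$1$1 * A$2$2 - A$1$2 * A$2$1)"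
    by (simp add: algebra_simps)
  also have "A$1$1 * A$2$2 - A$1$2 * A$2$1 = 1" using A by (simp add: det_2)
  finally have "(of_real (A$1$1) * z + of_real (A$1$2)) * of_real (A$2$1) - of_real (A$1$1) * autf A z = - (1::complex)" by simp
  then show ?thesis using nz c unfolding mobius_def by (simp add: divide_simps)
qed

lemma cusp_shadow:
  assumes A: "det A = 1" and c: "A$2$1 \<noteq> 0" and x: "A$2$1 * x + A$2$2 \<noteq> 0"
    and z: "cmod (z - of_real x) \<le> \<bar>A$2$1 * x + A$2$2\<bar> / (4 * \<bar>A$2$1\<bar>)"
  shows "\<bar>Re (mobius A z) - A$1$1 / A$2$1\<bar> \<ge> 2 / 3 / (\<bar>A$2$1\<bar> * \<bar>A$2$1 * x + A$2$2\<bar>)"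
proof -
  define c where "c = A$2$1"
  define j where "j = A$2$1 * x + A$2$2"
  have nz: "c \<noteq> 0" "j \<noteq> 0" using assms by (auto simp: c_def j_def)
  have ax: "autf A (of_real x) = of_real j" by (simp add: j_def)
  have az: "autf A z = of_real j + of_real c * (z - of_real x)" by (simp add: j_def c_def algebra_simps)
  have "cmod (of_real c * (z - of_real x)) \<le> \<bar>c\<bar> * (\<bar>j\<bar> / (4 * \<bar>c\<bar>))"
    unfolding norm_mult norm_of_real c_def j_def by (rule mult_left_mono[OF z abs_ge_zero])
  also have "\<dots> = \<bar>j\<bar> / 4" using nz by simp
  finally have "cmod (of_real c * (z - of_real x)) \<le> \<bar>j\<bar> / 4" .
  then have lo: "cmod (autf A z) \<ge> 3 / 4 * \<bar>j\<bar>"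
    using norm_diff_ineq[of "of_real j :: complex" "of_real c * (z - of_real x)"] unfolding az by simp
  then have az0: "autf A z \<noteq> 0" using nz by auto
  have ax0: "autf A (of_real x) \<noteq> 0" unfolding ax using nz by simp
  define M where "M = 1 / (\<bar>c\<bar> * \<bar>j\<bar>)"
  have M: "M > 0" using nz by (simp add: M_def)
  have "cmod (mobius A z - mobius A (of_real x)) = cmod (z - of_real x) / (cmod (autf A z) * \<bar>j\<bar>)"
    unfolding mobius_diff[OF A az0 ax0] ax by (simp add: norm_divide norm_mult del: of_real_add of_real_mult)
  also have "\<dots> \<le> (\<bar>j\<bar> / (4 * \<bar>c\<bar>)) / ((3 / 4 * \<bar>j\<bar>) * \<bar>j\<bar>)"
    using z lo nz by (intro frac_le mult_right_mono) (auto simp: c_def j_def)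
  also have "\<dots> = M / 3" using nz by (simp add: M_def field_simps)
  finally have d: "cmod (mobius A z - mobius A (of_real x)) \<le> M / 3" .
  define p where "p = A$1$1 / c"
  have "cmod (mobius A (of_real x) - of_real p) = M"
    unfolding p_def c_def mobius_minus_cusp[OF A \<open>A$2$1 \<noteq> 0\<close> ax0] unfolding ax
    by (simp add: norm_divide norm_mult M_def c_def del: of_real_add of_real_mult)
  moreover have "mobius A (of_real x) - of_real p = of_real (Re (mobius A (of_real x)) - p)"
  proof -
    have "mobius A (of_real x) = of_real ((A$1$1 * x + A$1$2) / (A$2$1 * x + A$2$2))" by (simp add: mobius_def)
    then show ?thesis by simp
  qed
  ultimately have e: "\<bar>Re (mobius A (of_real x)) - p\<bar> = M" by (metis norm_of_real)
  have "\<bar>Re (mobius A z) - Re (mobius A (of_real x))\<bar> \<le> M / 3"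
    using abs_Re_le_cmod[of "mobius A z - mobius A (of_real x)"] d by simp
  then have "\<bar>Re (mobius A z) - p\<bar> \<ge> 2 / 3 * M" using e by linarith
  then show ?thesis by (simp add: M_def p_def c_def j_def)
qed

lemma (in cusped_lattice) limit_not_in_deep_reals:
  fixes W :: "nat \<Rightarrow> real^2^2"
  assumes W: "\<And>n. W n \<in> \<Gamma>" and z0: "Im z0 > 0" and b: "b > 0"
    and growth: "eventually (\<lambda>n. exp (b * real n) \<le> norm (W n)) sequentially"
    and step: "eventually (\<lambda>n. norm (adj2 (W n) ** W (Suc n)) \<le> K * exp (b * real n)) sequentially"
    and lim: "(\<lambda>n. mobius (W n) z0) \<longlonglongrightarrow> of_real x"
    and D: "\<And>\<gamma> n. \<gamma> \<in> \<Gamma> \<Longrightarrow> \<bar>Re (mobius (\<gamma> ** W n) z0) - Re (mobius \<gamma> z0)\<bar> \<le> D * real n" "D > 0"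
  shows "x \<notin> deep_reals"
proof
  assume x: "x \<in> deep_reals"
  define z where "z n = mobius (W n) z0" for n
  have dW: "det (W n) = 1" for n using W det1 by blast
  define R where "R = \<bar>x\<bar> + 1"
  define K1 where "K1 = (1 + (1 + cmod z0) / Im z0) * (R + 1)"
  have "R \<ge> 1" by (simp add: R_def)
  then have K1: "K1 > 0" unfolding K1_def using z0 by (intro mult_pos_pos add_pos_nonneg[OF zero_less_one] divide_nonneg_pos) auto
  have zR: "eventually (\<lambda>n. cmod (z n) < R) sequentially"
    using order_tendstoD(2)[OF tendsto_norm[OF lim], of R] by (simp add: R_def z_def)
  have all: "eventually (\<lambda>n. cmod (z n) < R \<and> exp (b * real n) \<le> norm (W n) \<and> norm (adj2 (W n) ** W (Suc n)) \<le> K * exp (b * real n)) sequentially"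
    using zR growth step by (intro eventually_conj)
  then obtain n0 where n0: "\<And>n. n \<ge> n0 \<Longrightarrow> cmod (z n) < R" "\<And>n. n \<ge> n0 \<Longrightarrow> exp (b * real n) \<le> norm (W n)"
    "\<And>n. n \<ge> n0 \<Longrightarrow> norm (adj2 (W n) ** W (Suc n)) \<le> K * exp (b * real n)"
    unfolding eventually_sequentially by blast
  have "0 \<le> K * exp (b * real n0)" using n0(3)[of n0] norm_ge_zero order_trans by blast
  then have K: "K \<ge> 0" by (simp add: zero_le_mult_iff)
  have autW: "exp (b * real n) / K1 \<le> cmod (autf (W n) z0)" if n: "n \<ge> n0" for n
  proof -
    have "norm (W n) \<le> K1 * cmod (autf (W n) z0)"
      unfolding K1_def by (rule norm_le_autf[OF z0 dW]) (use n0(1)[OF n] in \<open>simp add: z_def\<close>)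
    then have "exp (b * real n) \<le> K1 * cmod (autf (W n) z0)" using n0(2)[OF n] by linarith
    then show ?thesis using K1 by (simp add: pos_divide_le_eq mult.commute)
  qed
  define K3 where "K3 = (cmod z0 + 1)\<^sup>2 * K * K1\<^sup>2"
  have zstep: "norm (z n - z (Suc n)) \<le> K3 * exp (- b * real n)" if n: "n \<ge> n0" for n
  proof -
    define g where "g = adj2 (W n) ** W (Suc n)"
    have dg: "det g = 1" by (simp add: g_def det_mul dW)
    have Wg: "W n ** g = W (Suc n)" by (simp add: g_def adj2_cancel[OF dW])
    have "norm (z n - z (Suc n)) \<le> (cmod z0 + 1)\<^sup>2 * norm g / (cmod (autf (W n) z0) * cmod (autf (W (Suc n)) z0))"
      using mobius_step[OF z0 dW[of n] dg] unfolding Wg z_def .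
    also have "\<dots> \<le> (cmod z0 + 1)\<^sup>2 * (K * exp (b * real n)) / (exp (b * real n) / K1 * (exp (b * real n) / K1))"
    proof (rule frac_le)
      show "(cmod z0 + 1)\<^sup>2 * norm g \<le> (cmod z0 + 1)\<^sup>2 * (K * exp (b * real n))"
        unfolding g_def by (intro mult_left_mono n0(3)[OF n]) auto
      show "exp (b * real n) / K1 * (exp (b * real n) / K1) \<le> cmod (autf (W n) z0) * cmod (autf (W (Suc n)) z0)"
      proof (intro mult_mono autW[OF n])
        have "exp (b * real n) / K1 \<le> exp (b * real (Suc n)) / K1" using b K1 by (intro divide_right_mono) auto
        also have "\<dots> \<le> cmod (autf (W (Suc n)) z0)" using autW[of "Suc n"] n by simp
        finally show "exp (b * real n) / K1 \<le> cmod (autf (W (Suc n)) z0)" .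
      qed (use K1 in auto)
    qed (use K K1 in auto)
    also have "\<dots> = K3 * exp (- b * real n)"
    proof -
      have "exp (- b * real n) = 1 / exp (b * real n)" by (simp add: exp_minus inverse_eq_divide)
      then show ?thesis using K1 by (simp add: K3_def power2_eq_square field_simps)
    qed
    finally show ?thesis .
  qed
  define K4 where "K4 = max 1 (K3 / (1 - exp (- b)))"
  have K4: "K4 \<ge> 1" by (simp add: K4_def)
  have conv: "cmod (z n - of_real x) \<le> K4 * exp (- b * real n)" if n: "n \<ge> n0" for n
  proof -
    have "cmod (z n - of_real x) \<le> K3 / (1 - exp (- b)) * exp (- b * real n)"
      by (rule exponential_limit[OF b zstep _ n]) (use lim in \<open>simp_all add: z_def\<close>)
    also have "\<dots> \<le> K4 * exp (- b * real n)" by (intro mult_right_mono) (auto simp: K4_def)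
    finally show ?thesis .
  qed
  define Q0 where "Q0 = 1 / Im z0 + D * (real n0 + 1 + ln (4 * K4) / b)"
  have Q0: "Q0 \<ge> 0" unfolding Q0_def using z0 D(2) b K4 by (intro add_nonneg_nonneg mult_nonneg_nonneg divide_nonneg_pos) (auto simp: ln_ge_zero)
  obtain s :: nat where s: "real s > 2 * (Q0 + 4 * D / b) + 2" using reals_Archimedean2 by blast
  have "4 * D / b \<ge> 0" using D(2) b by simp
  then have s2: "real s \<ge> 2" using s Q0 by (simp add: distrib_left)
  define N where "N = s^2"
  have "x \<in> excursion_reals N" using x by (auto simp: deep_reals_def)
  then obtain \<gamma> where \<gamma>: "\<gamma> \<in> \<Gamma>" "real N \<le> \<bar>\<gamma>$2$1\<bar>" "\<gamma>$2$1 * x + \<gamma>$2$2 \<noteq> 0"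
    "real N * (\<bar>\<gamma>$2$1 * x + \<gamma>$2$2\<bar> * (\<bar>\<gamma>$2$1\<bar> * ln \<bar>\<gamma>$2$1\<bar>)) \<le> 1"
    unfolding excursion_reals_def by blast
  define c where "c = \<bar>\<gamma>$2$1\<bar>"
  define j where "j = \<bar>\<gamma>$2$1 * x + \<gamma>$2$2\<bar>"
  define M where "M = 1 / (c * j)"
  have d\<gamma>: "det \<gamma> = 1" by (rule det1[OF \<gamma>(1)])
  have Ns: "real N = (real s)\<^sup>2" by (simp add: N_def)
  have N4: "real N \<ge> 4"
  proof -
    have "(2::real)\<^sup>2 \<le> (real s)\<^sup>2" by (rule power_mono) (use s2 in auto)
    then show ?thesis by (simp add: Ns)
  qed
  have c4: "c \<ge> 4" using \<gamma>(2) N4 by (simp add: c_def)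
  have j0: "j > 0" using \<gamma>(3) by (simp add: j_def)
  have M0: "M > 0" using c4 j0 by (simp add: M_def)
  have lnc: "ln c \<ge> 1"
  proof -
    have "exp 1 \<le> c" using exp_le c4 by linarith
    then show ?thesis using c4 by (simp add: ln_ge_iff)
  qed
  have "real N * (j * (c * ln c)) \<le> 1" using \<gamma>(4) by (simp add: c_def j_def)
  then have MN: "real N * ln c \<le> M" unfolding M_def using c4 j0 by (simp add: field_simps)
  have "real N * 1 \<le> real N * ln c" using lnc by (intro mult_left_mono) auto
  then have MN1: "real N \<le> M" using MN by linarith
  have M4: "M \<ge> 4" using MN1 N4 by linarith
  define t where "t = ln (4 * K4 * c\<^sup>2 * M) / b"
  have t_eq: "t = ln (4 * K4) / b + (2 * ln c + ln M) / b"
    unfolding t_def using K4 c4 M0 by (simp add: ln_mult ln_realpow add_divide_distrib)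
  have t0: "t \<ge> 0" unfolding t_eq using K4 lnc M4 b by (intro add_nonneg_nonneg divide_nonneg_pos) (auto simp: ln_ge_zero)
  define n where "n = n0 + nat \<lceil>t\<rceil>"
  have nt: "t \<le> real n" unfolding n_def using t0 by linarith
  have nu: "real n \<le> real n0 + 1 + t" unfolding n_def using t0 by linarith
  have nn0: "n \<ge> n0" by (simp add: n_def)
  have "exp (- b * real n) \<le> exp (- ln (4 * K4 * c\<^sup>2 * M))"
  proof -
    have "ln (4 * K4 * c\<^sup>2 * M) = b * t" using b by (simp add: t_def)
    also have "\<dots> \<le> b * real n" using nt b by simp
    finally show ?thesis by simp
  qed
  also have "\<dots> = 1 / (4 * K4 * c\<^sup>2 * M)" using K4 c4 M0 by (simp add: exp_minus inverse_eq_divide)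
  finally have "K4 * exp (- b * real n) \<le> K4 * (1 / (4 * K4 * c\<^sup>2 * M))" using K4 by (intro mult_left_mono) auto
  also have "\<dots> = j / (4 * c)" using K4 c4 j0 by (simp add: M_def power2_eq_square field_simps)
  finally have "cmod (z n - of_real x) \<le> j / (4 * c)" using conv[OF nn0] by linarith
  then have sh: "\<bar>Re (mobius \<gamma> (z n)) - \<gamma>$1$1 / \<gamma>$2$1\<bar> \<ge> 2 / 3 * M"
    using cusp_shadow[OF d\<gamma> _ \<gamma>(3), of "z n"] c4 by (auto simp: c_def j_def M_def)
  have base: "\<bar>Re (mobius \<gamma> z0) - \<gamma>$1$1 / \<gamma>$2$1\<bar> \<le> 1 / Im z0"
  proof -
    have c0: "\<gamma>$2$1 \<noteq> 0" using c4 by (auto simp: c_def)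
    have "\<bar>Re (mobius \<gamma> z0) - \<gamma>$1$1 / \<gamma>$2$1\<bar> \<le> cmod (mobius \<gamma> z0 - of_real (\<gamma>$1$1 / \<gamma>$2$1))"
      using abs_Re_le_cmod[of "mobius \<gamma> z0 - of_real (\<gamma>$1$1 / \<gamma>$2$1)"] by (simp del: of_real_divide)
    also have "\<dots> = 1 / (c * cmod (autf \<gamma> z0))"
      unfolding mobius_minus_cusp[OF d\<gamma> c0 autf_nz[OF d\<gamma> z0]] by (simp add: norm_divide norm_mult c_def)
    also have "\<dots> \<le> 1 / Im z0"
    proof -
      have "1 * (1 * Im z0) \<le> c * (c * Im z0)" using c4 z0 by (intro mult_mono) auto
      also have "c * Im z0 = \<bar>Im (autf \<gamma> z0)\<bar>" using z0 by (simp add: c_def abs_mult)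
      also have "c * \<dots> \<le> c * cmod (autf \<gamma> z0)" using c4 by (intro mult_left_mono abs_Im_le_cmod) auto
      finally show ?thesis using z0 by (intro divide_left_mono) auto
    qed
    finally show ?thesis .
  qed
  have "\<bar>Re (mobius \<gamma> (z n)) - Re (mobius \<gamma> z0)\<bar> \<le> D * real n"
    using D(1)[OF \<gamma>(1), of n] unfolding mobius_mult[OF d\<gamma> dW z0] z_def .
  then have "2 / 3 * M \<le> 1 / Im z0 + D * real n" using sh base by linarith
  also have "\<dots> \<le> 1 / Im z0 + D * (real n0 + 1 + t)" using nu D(2) by simp
  also have "\<dots> = Q0 + D / b * (2 * ln c + ln M)" unfolding Q0_def t_eq by (simp add: algebra_simps add_divide_distrib)
  also have "\<dots> \<le> M / s * Q0 + D / b * (4 * (M / s))"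
  proof (intro add_mono mult_left_mono)
    have sM: "s \<le> M / s"
      using MN1 s2 unfolding Ns by (simp add: pos_le_divide_eq power2_eq_square)
    then have "1 \<le> M / s" using s2 by linarith
    then show "Q0 \<le> M / s * Q0" using mult_right_mono[of 1 "M / s" Q0] Q0 by simp
    have lc: "ln c \<le> M / s"
    proof -
      have "real s * 1 * ln c \<le> real s * real s * ln c" using s2 lnc by (intro mult_right_mono mult_left_mono) auto
      also have "\<dots> \<le> M" using MN unfolding Ns by (simp add: power2_eq_square)
      finally show ?thesis using s2 by (simp add: pos_le_divide_eq mult.commute)
    qed
    have "ln (sqrt M) \<le> sqrt M - 1" by (rule ln_le_minus_one) (use M0 in simp)
    then have "ln M \<le> 2 * sqrt M" using M0 by (simp add: ln_sqrt)
    also have "sqrt M \<le> M / s"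
    proof -
      have "real s \<le> sqrt M" using MN1 unfolding Ns by (rule real_le_rsqrt)
      then have "real s * sqrt M \<le> sqrt M * sqrt M" using M0 by (intro mult_right_mono) auto
      also have "\<dots> = M" using M0 by simp
      finally show ?thesis using s2 by (simp add: pos_le_divide_eq mult.commute)
    qed
    finally have "ln M \<le> 2 * (M / s)" by simp
    then show "2 * ln c + ln M \<le> 4 * (M / s)" using lc by linarith
  qed (use D(2) b in auto)
  also have "\<dots> = M / s * (Q0 + 4 * D / b)" by (simp add: algebra_simps)
  also have "\<dots> \<le> M / s * (s / 2)" using s M0 by (intro mult_left_mono) auto
  also have "\<dots> = M / 2" using s2 by simp
  finally show False using M0 by simp
qed

section \<open>The boundary circle\<close>

text \<open>The Moebius map of \<open>A\<close> on the boundary of the upper half plane, in the coordinate of the unit circle: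
  the quotient of the following two functions.\<close>

definition circle_num :: "real^2^2 \<Rightarrow> complex \<Rightarrow> complex" where
  "circle_num A \<xi> = of_real (A$1$1) * (\<i> * (1 + \<xi>)) + of_real (A$1$2) * (1 - \<xi>)"

definition circle_den :: "real^2^2 \<Rightarrow> complex \<Rightarrow> complex" where
  "circle_den A \<xi> = of_real (A$2$1) * (\<i> * (1 + \<xi>)) + of_real (A$2$2) * (1 - \<xi>)"

lemma circle_cayley:
  assumes z: "Im z > 0"
  shows "circle_num A (cayley z) / circle_den A (cayley z) = mobius A z"
proof -
  have nz: "z + \<i> \<noteq> 0" using z by (auto simp: complex_eq_iff)
  have 1: "\<i> * (1 + cayley z) = 2 * \<i> / (z + \<i>) * z" using nz by (simp add: cayley_def field_simps)
  have 2: "1 - cayley z = 2 * \<i> / (z + \<i>)" using nz by (simp add: cayley_def field_simps)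
  have "circle_num A (cayley z) = 2 * \<i> / (z + \<i>) * (of_real (A$1$1) * z + of_real (A$1$2))"
    unfolding circle_num_def 1 2 by (simp add: algebra_simps)
  moreover have "circle_den A (cayley z) = 2 * \<i> / (z + \<i>) * (of_real (A$2$1) * z + of_real (A$2$2))"
    unfolding circle_den_def 1 2 by (simp add: algebra_simps)
  ultimately show ?thesis using nz by (simp add: mobius_def)
qed

lemma circle_cis:
  "circle_num A (cis \<theta>) = 2 * \<i> * cis (\<theta> / 2) * of_real (A$1$1 * cos (\<theta> / 2) - A$1$2 * sin (\<theta> / 2))"
  "circle_den A (cis \<theta>) = 2 * \<i> * cis (\<theta> / 2) * of_real (A$2$1 * cos (\<theta> / 2) - A$2$2 * sin (\<theta> / 2))"
proof -
  define t where "t = \<theta> / 2"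
  have sq: "cis \<theta> = cis t * cis t" by (simp add: cis_mult t_def)
  have inv: "1 = cis t * cis (- t)" by (simp add: cis_mult)
  have 1: "1 + cis \<theta> = cis t * of_real (2 * cos t)"
  proof -
    have "1 + cis \<theta> = cis t * (cis (- t) + cis t)" unfolding sq by (subst inv) (simp only: distrib_left)
    then show ?thesis by (simp add: complex_eq_iff)
  qed
  have 2: "1 - cis \<theta> = cis t * (- 2 * \<i> * of_real (sin t))"
  proof -
    have "1 - cis \<theta> = cis t * (cis (- t) - cis t)" unfolding sq by (subst inv) (simp only: right_diff_distrib)
    then show ?thesis by (simp add: complex_eq_iff)
  qed
  show "circle_num A (cis \<theta>) = 2 * \<i> * cis (\<theta> / 2) * of_real (A$1$1 * cos (\<theta> / 2) - A$1$2 * sin (\<theta> / 2))"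
    unfolding circle_num_def 1 2 t_def[symmetric] by (simp add: algebra_simps)
  show "circle_den A (cis \<theta>) = 2 * \<i> * cis (\<theta> / 2) * of_real (A$2$1 * cos (\<theta> / 2) - A$2$2 * sin (\<theta> / 2))"
    unfolding circle_den_def 1 2 t_def[symmetric] by (simp add: algebra_simps)
qed

lemma half_angle:
  assumes "0 < t" "t < pi" shows "t = pi / 2 - arctan (cos t / sin t)"
proof -
  have "cos t / sin t = tan (pi / 2 - t)" by (simp add: tan_def cos_diff sin_diff)
  moreover have "arctan (tan (pi / 2 - t)) = pi / 2 - t" by (rule arctan_tan) (use assms in auto)
  ultimately show ?thesis by simp
qed

definition circle_bad :: "real^2^2 \<Rightarrow> real set \<Rightarrow> complex set" where
  "circle_bad A E = {\<xi>\<in>sphere 0 1. circle_den A \<xi> = 0 \<or> Re (circle_num A \<xi> / circle_den A \<xi>) \<notin> E}"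

lemma circle_bad_borel:
  assumes E: "E \<in> sets borel" shows "circle_bad A E \<in> sets borel_circle"
proof -
  have m [measurable]: "circle_num A \<in> borel_measurable borel" "circle_den A \<in> borel_measurable borel"
    unfolding circle_num_def[abs_def] circle_den_def[abs_def] by measurable
  have "circle_bad A E = sphere 0 1 \<inter> {\<xi>. circle_den A \<xi> = 0 \<or> Re (circle_num A \<xi> / circle_den A \<xi>) \<notin> E}"
    by (auto simp: circle_bad_def)
  moreover have "{\<xi>. circle_den A \<xi> = 0 \<or> Re (circle_num A \<xi> / circle_den A \<xi>) \<notin> E} \<in> sets borel"
  proof -
    have q: "(\<lambda>\<xi>. Re (circle_num A \<xi> / circle_den A \<xi>)) \<in> borel_measurable borel" by measurable
    have "{\<xi>. circle_den A \<xi> = 0 \<or> Re (circle_num A \<xi> / circle_den A \<xi>) \<notin> E}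
      = circle_den A -` {0} \<union> (\<lambda>\<xi>. Re (circle_num A \<xi> / circle_den A \<xi>)) -` (- E)" by auto
    also have "\<dots> \<in> sets borel"
      using measurable_sets_borel[OF m(2), of "{0}"] measurable_sets_borel[OF q, of "- E"] E by (intro sets.Un) auto
    finally show ?thesis .
  qed
  ultimately have "circle_bad A E \<in> sets borel" using sets.Int[OF borel_closed[OF closed_sphere[of "0::complex" 1]]] by simp
  moreover have "circle_bad A E \<subseteq> sphere 0 1" by (auto simp: circle_bad_def)
  ultimately show ?thesis unfolding borel_circle_def by (subst sets_restrict_space_iff) auto
qed

lemma circle_bad_null:
  assumes A: "det A = 1" and E [measurable]: "E \<in> sets borel" and neg: "negligible (- E)"
  shows "emeasure lebesgue_circle (circle_bad A E) = 0"
proof -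
  define X where "X = {\<theta>\<in>{0..<2*pi}. cis \<theta> \<in> circle_bad A E}"
  have "cis \<in> borel_measurable borel" by (intro borel_measurable_continuous_onI continuous_intros)
  then have "cis \<in> borel_measurable lborel" by simp
  then have cis: "cis \<in> restrict_space lborel {0..<2*pi} \<rightarrow>\<^sub>M borel_circle"
    unfolding borel_circle_def by (intro measurable_restrict_space2 measurable_restrict_space1) auto
  have pre: "cis -` circle_bad A E \<inter> space (restrict_space lborel {0..<2*pi}) = X" by (auto simp: X_def space_restrict_space)
  have Xr: "X \<in> sets (restrict_space lborel {0..<2*pi})"
    using measurable_sets[OF cis circle_bad_borel[OF E], of A] unfolding pre .
  have Xb: "X \<in> sets borel" using Xr by (subst (asm) sets_restrict_space_iff) auto
  define h where "h s = pi - 2 * arctan ((A$2$2 * s - A$1$2) / (A$2$1 * s - A$1$1))" for s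
  define Y where "Y = - E - {s. A$2$1 * s = A$1$1}"
  have "h differentiable_on Y"
  proof -
    have "\<exists>d. (h has_real_derivative d) (at s)" if "s \<in> Y" for s
    proof -
      have "A$2$1 * s - A$1$1 \<noteq> 0" using that by (simp add: Y_def)
      then show ?thesis unfolding h_def by (intro exI) (rule derivative_eq_intros | simp)+
    qed
    then show ?thesis unfolding differentiable_on_def
      by (meson differentiable_at_withinI real_differentiable_def)
  qed
  moreover have "negligible Y" using neg by (rule negligible_subset) (auto simp: Y_def)
  ultimately have "negligible (h ` Y)" by (intro negligible_differentiable_image_negligible) auto
  then have "negligible (h ` Y \<union> {0, pi - 2 * arctan (A$2$2 / A$2$1)})" by (rule negligible_Un) (rule negligible_finite, simp)
  moreover have "X \<subseteq> h ` Y \<union> {0, pi - 2 * arctan (A$2$2 / A$2$1)}"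
  proof
    fix \<theta> assume \<theta>: "\<theta> \<in> X"
    define t where "t = \<theta> / 2"
    have t: "0 \<le> t" "t < pi" using \<theta> by (auto simp: X_def t_def)
    define u v where "u = A$1$1 * cos t - A$1$2 * sin t" and "v = A$2$1 * cos t - A$2$2 * sin t"
    have dt: "A$1$1 * A$2$2 - A$1$2 * A$2$1 = 1" using A by (simp add: det_2)
    have c: "cos t = A$2$2 * u - A$1$2 * v"
    proof -
      have "A$2$2 * u - A$1$2 * v = (A$1$1 * A$2$2 - A$1$2 * A$2$1) * cos t" by (simp add: u_def v_def algebra_simps)
      then show ?thesis using dt by simp
    qed
    have s: "sin t = A$2$1 * u - A$1$1 * v"
    proof -
      have "A$2$1 * u - A$1$1 * v = (A$1$1 * A$2$2 - A$1$2 * A$2$1) * sin t" by (simp add: u_def v_def algebra_simps)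
      then show ?thesis using dt by simp
    qed
    show "\<theta> \<in> h ` Y \<union> {0, pi - 2 * arctan (A$2$2 / A$2$1)}"
    proof (cases "t = 0")
      case False
      then have ht: "\<theta> = pi - 2 * arctan (cos t / sin t)" using half_angle[of t] t by (simp add: t_def)
      have s0: "sin t \<noteq> 0" using sin_gt_zero[of t] t False by simp
      show ?thesis
      proof (cases "v = 0")
        case True
        then have "u \<noteq> 0" using s s0 by auto
        then have "cos t / sin t = A$2$2 / A$2$1" unfolding c s using True by simp
        then show ?thesis using ht by simp
      next
        case False
        define r where "r = u / v"
        have u: "u = r * v" using False by (simp add: r_def)
        have c': "cos t = (A$2$2 * r - A$1$2) * v" unfolding c u by (simp add: algebra_simps)
        have s': "sin t = (A$2$1 * r - A$1$1) * v" unfolding s u by (simp add: algebra_simps)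
        have "\<theta> = h r" unfolding h_def ht c' s' using False by simp
        moreover have "r \<in> Y"
        proof -
          have nz: "2 * \<i> * cis t \<noteq> 0" by simp
          have "circle_den A (cis \<theta>) \<noteq> 0" unfolding circle_cis t_def[symmetric] v_def[symmetric] using False by simp
          moreover have "circle_num A (cis \<theta>) / circle_den A (cis \<theta>) = of_real r"
            unfolding circle_cis t_def[symmetric] v_def[symmetric] u_def[symmetric] mult_divide_mult_cancel_left[OF nz] by (simp add: r_def)
          ultimately have "r \<notin> E" using \<theta> by (auto simp: X_def circle_bad_def)
          moreover have "A$2$1 * r \<noteq> A$1$1" using s0 s' by auto
          ultimately show ?thesis by (simp add: Y_def)
        qed
        ultimately show ?thesis by blast
      qed
    qed (simp add: t_def)
  qed
  ultimately have "negligible X" by (rule negligible_subset)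
  then have "emeasure lborel X = 0"
    using Xb by (simp add: negligible_iff_null_sets null_sets_completion_iff null_sets_def)
  moreover have "emeasure lebesgue_circle (circle_bad A E) = emeasure lborel X"
  proof -
    have "emeasure lebesgue_circle (circle_bad A E) = emeasure (restrict_space lborel {0..<2*pi}) X"
      unfolding lebesgue_circle_def pre[symmetric] by (rule emeasure_distr[OF cis circle_bad_borel[OF E]])
    also have "\<dots> = emeasure lborel X" by (rule emeasure_restrict_space) (auto simp: X_def)
    finally show ?thesis .
  qed
  ultimately show ?thesis by simp
qed

lemma circle_real:
  assumes "cmod \<xi> = 1" shows "circle_num A \<xi> / circle_den A \<xi> = of_real (Re (circle_num A \<xi> / circle_den A \<xi>))"
proof -
  obtain \<theta> where \<theta>: "\<xi> = cis \<theta>" using assms by (metis cis_Arg norm_eq_zero zero_neq_one sgn_div_norm scaleR_one div_by_1 inverse_1)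
  have nz: "2 * \<i> * cis (\<theta> / 2) \<noteq> 0" by simp
  show ?thesis unfolding \<theta> circle_cis mult_divide_mult_cancel_left[OF nz]
    by (simp only: of_real_divide[symmetric] Re_complex_of_real)
qed

section \<open>Singularity of the harmonic measure\<close>

lemma eventually_exp_dominates:
  assumes "b > 0" shows "eventually (\<lambda>n. K \<le> exp (b * real n)) sequentially"
proof -
  have "filterlim (\<lambda>n. exp (b * real n)) at_top sequentially"
    using assms by (intro filterlim_compose[OF exp_at_top] filterlim_tendsto_pos_mult_at_top[OF tendsto_const _ filterlim_real_sequentially])
  then show ?thesis by (simp add: filterlim_at_top)
qed

theorem corollary1p2:
  fixes G S :: "(real^2^2) set" and \<mu> :: "(real^2^2) pmf" and x0 :: complex
  assumes "fuchsian G"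
    and "finite_covolume G"
    and "\<not> cocompact G"
    and "finite S" and "generate SL2R S = G"
    and "set_pmf \<mu> \<subseteq> G"
    and "(\<integral>\<^sup>+ g. of_nat (word_metric SL2R S \<one>\<^bsub>SL2R\<^esub> g) \<partial>measure_pmf \<mu>) < \<infinity>"
    and "semigroup_generate SL2R (set_pmf \<mu>) = G"
    and "x0 \<in> upper_half_plane"
  shows "mutually_singular (harmonic_measure \<mu> x0) lebesgue_circle"
proof -
  have subG: "subgroup G SL2R" using assms(1) by (simp add: fuchsian_def)
  have x0: "Im x0 > 0" using assms(9) by (simp add: upper_half_plane_def)
  obtain \<delta> where \<delta>: "\<delta> > 0" "gap G \<delta>" using fuchsian_gap[OF assms(1)] .
  obtain A where A: "A \<in> G" "A \<noteq> mat 1" "A$1$1 + A$2$2 = 2" using exists_parabolic[OF assms(1-3)] by blast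
  obtain P where P: "det P = 1" "trans 1 \<in> conjugate_by P G" using parabolic_normal_form[OF subG A] by blast
  obtain \<delta>' where \<delta>': "\<delta>' > 0" "gap (conjugate_by P G) \<delta>'" using conjugate_by_gap[OF P(1) \<delta>(2,1)] by blast
  have cl: "cusped_lattice (conjugate_by P G) \<delta>'"
    by (intro cusped_lattice.intro cusped.intro cusped_lattice_axioms.intro conjugate_by_subgroup[OF subG P(1)] P(2) \<delta>'
      conjugate_by_finite_covolume[OF subG P(1) assms(2)])
  interpret cusped_lattice "conjugate_by P G" \<delta>' by (rule cl)
  have fg: "finitely_generated G S" by (rule finitely_generated.intro[OF subG assms(4,5)])
  interpret F: finitely_generated G S by (rule fg)
  obtain C \<rho> where C: "C > 0" "0 < \<rho>" "\<rho> < 1" "\<And>n x. pmf (walk_law \<mu> n) x \<le> C * \<rho>^n"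
    using cusped_decay[OF subG P(1) cl assms(6,8)] by blast
  obtain b where b: "b > 0"
    and growth: "AE \<omega> in increment_space \<mu>. eventually (\<lambda>n. exp (b * real n) \<le> norm (walk \<omega> n)) sequentially"
    using walk_growth[OF subG \<delta>(2,1) assms(6) C] by blast
  obtain a where a: "a > 0" "\<And>g. g \<in> G \<Longrightarrow> norm g \<le> norm (mat 1 :: real^2^2) * exp (a * real (F.wlen g))"
    using F.norm_word_growth by blast
  define z0 where "z0 = mobius (adj2 P) x0"
  have z0: "Im z0 > 0" unfolding z0_def by (rule mobius_Im_pos) (use P x0 in auto)
  have dQ: "det (adj2 P) = 1" using P by simp
  obtain D where D: "D > 0" "\<And>\<gamma> w. \<gamma> \<in> conjugate_by P G \<Longrightarrow> w \<in> G \<Longrightarrow>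
      \<bar>Re (mobius (\<gamma> ** (adj2 P ** w ** P)) z0) - Re (mobius \<gamma> z0)\<bar> \<le> D * real (F.wlen w)"
    using displacement[OF fg P(1) cusped_axioms z0] by blast
  have moment: "(\<integral>\<^sup>+g. ennreal (real (F.wlen g)) \<partial>measure_pmf \<mu>) < \<infinity>"
    using assms(7) unfolding F.word_metric_one by (simp add: ennreal_of_nat_eq_real_of_nat)
  let ?B = "circle_bad (adj2 P) deep_reals"
  have inG: "AE \<omega> in increment_space \<mu>. \<forall>n. \<omega> n \<in> G"
    using AE_increment by (rule AE_mp) (rule AE_I2, use assms(6) in blast)
  have lin: "AE \<omega> in increment_space \<mu>. \<exists>C. \<forall>n. (\<Sum>i<n. real (F.wlen (\<omega> i))) \<le> C * real n"
    by (rule linear_growth[OF _ moment]) simp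
  have subl: "AE \<omega> in increment_space \<mu>. \<forall>\<epsilon>>0. eventually (\<lambda>n. real (F.wlen (\<omega> n)) \<le> \<epsilon> * real n) sequentially"
    by (rule sublinear_increments[OF _ moment]) simp
  have nP: "norm P > 0" using P by (auto simp: det_2)
  have good: "\<not> (\<exists>\<xi>\<in>sphere 0 1 - ?B. walk_tendsto x0 \<omega> \<xi>)"
    if \<omega>: "\<And>n. \<omega> n \<in> G" and g: "eventually (\<lambda>n. exp (b * real n) \<le> norm (walk \<omega> n)) sequentially"
      and L: "\<And>n. (\<Sum>i<n. real (F.wlen (\<omega> i))) \<le> L * real n"
      and s: "\<And>\<epsilon>. \<epsilon> > 0 \<Longrightarrow> eventually (\<lambda>n. real (F.wlen (\<omega> n)) \<le> \<epsilon> * real n) sequentially" for \<omega> L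
  proof
    assume "\<exists>\<xi>\<in>sphere 0 1 - ?B. walk_tendsto x0 \<omega> \<xi>"
    then obtain \<xi> where \<xi>: "cmod \<xi> = 1" "circle_den (adj2 P) \<xi> \<noteq> 0" "Re (circle_num (adj2 P) \<xi> / circle_den (adj2 P) \<xi>) \<in> deep_reals"
      and tend: "(\<lambda>n. cayley (mobius (walk \<omega> n) x0)) \<longlonglongrightarrow> \<xi>"
      by (auto simp: circle_bad_def walk_tendsto_def)
    define x where "x = Re (circle_num (adj2 P) \<xi> / circle_den (adj2 P) \<xi>)"
    have wG: "walk \<omega> n \<in> G" for n by (rule F.walk_G[OF \<omega>])
    have dw: "det (walk \<omega> n) = 1" for n by (rule F.Gd(1)[OF wG])
    define W where "W n = adj2 P ** walk \<omega> n ** P" for n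
    have W: "W n \<in> conjugate_by P G" for n unfolding W_def conjugate_by_def using wG by blast
    have dW: "det (W n) = 1" for n by (rule det1[OF W])
    have WQ: "mobius (W n) z0 = mobius (adj2 P) (mobius (walk \<omega> n) x0)" for n
    proof -
      have "mobius (W n) z0 = mobius (W n ** adj2 P) x0" unfolding z0_def by (rule mobius_mult[OF dW dQ x0, symmetric])
      also have "W n ** adj2 P = adj2 P ** walk \<omega> n" by (simp add: W_def adj2_cancel[OF P(1)] matrix_mul_assoc[symmetric] adj2_inverse[OF P(1)])
      also have "mobius \<dots> x0 = mobius (adj2 P) (mobius (walk \<omega> n) x0)" by (rule mobius_mult[OF dQ dw x0])
      finally show ?thesis .
    qed
    have "(\<lambda>n. circle_num (adj2 P) (cayley (mobius (walk \<omega> n) x0)) / circle_den (adj2 P) (cayley (mobius (walk \<omega> n) x0)))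
        \<longlonglongrightarrow> circle_num (adj2 P) \<xi> / circle_den (adj2 P) \<xi>"
    proof (rule tendsto_divide[OF _ _ \<xi>(2)])
      show "(\<lambda>n. circle_num (adj2 P) (cayley (mobius (walk \<omega> n) x0))) \<longlonglongrightarrow> circle_num (adj2 P) \<xi>"
        unfolding circle_num_def by (intro tendsto_intros tend)
      show "(\<lambda>n. circle_den (adj2 P) (cayley (mobius (walk \<omega> n) x0))) \<longlonglongrightarrow> circle_den (adj2 P) \<xi>"
        unfolding circle_den_def by (intro tendsto_intros tend)
    qed
    then have lim: "(\<lambda>n. mobius (W n) z0) \<longlonglongrightarrow> of_real x"
      unfolding WQ circle_cayley[OF mobius_Im_pos[OF dw x0]] x_def circle_real[OF \<xi>(1), symmetric] .
    have e1: "eventually (\<lambda>n. exp (b / 2 * real n) \<le> norm (W n)) sequentially"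
    proof (rule eventually_mp[OF _ eventually_conj[OF g eventually_exp_dominates[of "b / 2" "(norm P)\<^sup>2"]]], intro always_eventually allI impI)
      fix n assume n: "exp (b * real n) \<le> norm (walk \<omega> n) \<and> (norm P)\<^sup>2 \<le> exp (b / 2 * real n)"
      have "walk \<omega> n = P ** (W n ** adj2 P)"
        by (simp add: W_def adj2_cancel[OF P(1)] matrix_mul_assoc[symmetric] adj2_inverse[OF P(1)])
      then have "norm (walk \<omega> n) \<le> norm P * norm (W n ** adj2 P)" by (simp only: norm_mat2_mult)
      also have "\<dots> \<le> norm P * (norm (W n) * norm P)"
        using norm_mat2_mult[of "W n" "adj2 P"] by (intro mult_left_mono) auto
      also have "\<dots> = (norm P)\<^sup>2 * norm (W n)" by (simp add: power2_eq_square)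
      also have "\<dots> \<le> exp (b / 2 * real n) * norm (W n)" using n by (intro mult_right_mono) auto
      finally have "exp (b * real n) \<le> exp (b / 2 * real n) * norm (W n)" using n by linarith
      moreover have "exp (b * real n) = exp (b / 2 * real n) * exp (b / 2 * real n)" by (simp flip: exp_add)
      ultimately show "exp (b / 2 * real n) \<le> norm (W n)" by simp
    qed (use b in simp)
    have e2: "eventually (\<lambda>n. norm (adj2 (W n) ** W (Suc n)) \<le> ((norm P)\<^sup>2 * norm (mat 1 :: real^2^2)) * exp (b / 2 * real n)) sequentially"
    proof (rule eventually_mono[OF s[of "b / (2 * a)"]])
      show "b / (2 * a) > 0" using a b by simp
      fix n assume n: "real (F.wlen (\<omega> n)) \<le> b / (2 * a) * real n"
      have "adj2 (W n) ** W (Suc n) = adj2 P ** (\<omega> n ** P)"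
      proof -
        have "adj2 (W n) = adj2 P ** (adj2 (walk \<omega> n) ** P)" by (simp add: W_def adj2_mult)
        moreover have "W (Suc n) = adj2 P ** (walk \<omega> n ** (\<omega> n ** P))" by (simp add: W_def matrix_mul_assoc)
        ultimately show ?thesis by (simp add: adj2_cancel[OF P(1)] adj2_cancel[OF dw] matrix_mul_assoc[symmetric])
      qed
      then have "norm (adj2 (W n) ** W (Suc n)) \<le> norm P * norm (\<omega> n ** P)" using norm_mat2_mult[of "adj2 P" "\<omega> n ** P"] by simp
      also have "\<dots> \<le> norm P * (norm (\<omega> n) * norm P)" by (intro mult_left_mono norm_mat2_mult) auto
      also have "\<dots> = (norm P)\<^sup>2 * norm (\<omega> n)" by (simp add: power2_eq_square)
      also have "\<dots> \<le> (norm P)\<^sup>2 * (norm (mat 1 :: real^2^2) * exp (a * real (F.wlen (\<omega> n))))"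
        by (intro mult_left_mono a(2) \<omega>) auto
      also have "\<dots> \<le> (norm P)\<^sup>2 * (norm (mat 1 :: real^2^2) * exp (b / 2 * real n))"
      proof (intro mult_left_mono)
        have "a * real (F.wlen (\<omega> n)) \<le> a * (b / (2 * a) * real n)" using n a by (intro mult_left_mono) auto
        also have "\<dots> = b / 2 * real n" using a by simp
        finally show "exp (a * real (F.wlen (\<omega> n))) \<le> exp (b / 2 * real n)" by simp
      qed auto
      finally show "norm (adj2 (W n) ** W (Suc n)) \<le> ((norm P)\<^sup>2 * norm (mat 1 :: real^2^2)) * exp (b / 2 * real n)"
        by (simp add: mult.assoc)
    qed
    have "x \<notin> deep_reals"
    proof (rule limit_not_in_deep_reals[OF W z0 _ e1 e2 lim])
      show "b / 2 > 0" using b by simp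
      show "D * (\<bar>L\<bar> + 1) > 0" using D by simp
      fix \<gamma> n assume \<gamma>: "\<gamma> \<in> conjugate_by P G"
      have "real (F.wlen (walk \<omega> n)) \<le> (\<Sum>i<n. real (F.wlen (\<omega> i)))"
        using F.wlen_walk[of \<omega> n, OF \<omega>] by (simp flip: of_nat_sum)
      also have "\<dots> \<le> L * real n" by (rule L)
      also have "\<dots> \<le> (\<bar>L\<bar> + 1) * real n" by (intro mult_right_mono) auto
      finally have "D * real (F.wlen (walk \<omega> n)) \<le> D * ((\<bar>L\<bar> + 1) * real n)" using D by (intro mult_left_mono) auto
      then show "\<bar>Re (mobius (\<gamma> ** W n) z0) - Re (mobius \<gamma> z0)\<bar> \<le> D * (\<bar>L\<bar> + 1) * real n"
        using D(2)[OF \<gamma> wG, of n] unfolding W_def by (simp only: mult.assoc)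
    qed
    then show False using \<xi>(3) by (simp add: x_def)
  qed
  have AEgood: "AE \<omega> in increment_space \<mu>. \<not> (\<exists>\<xi>\<in>sphere 0 1 - ?B. walk_tendsto x0 \<omega> \<xi>)"
    using inG growth lin subl
  proof eventually_elim
    case (elim \<omega>)
    obtain L where "\<And>n. (\<Sum>i<n. real (F.wlen (\<omega> i))) \<le> L * real n" using elim(3) by blast
    then show ?case using good[of \<omega> L] elim by blast
  qed
  have B: "?B \<in> sets borel_circle" by (rule circle_bad_borel) simp
  have Bc: "sphere 0 1 - ?B \<in> sets borel_circle" using sets.compl_sets[OF B] by simp
  have "emeasure (harmonic_measure \<mu> x0) (sphere 0 1 - ?B) = 0"
    unfolding emeasure_harmonic_measure[OF Bc]
  proof -
    obtain N where N: "N \<in> null_sets (increment_space \<mu>)"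
      "{\<omega> \<in> space (increment_space \<mu>). \<exists>\<xi>\<in>sphere 0 1 - ?B. walk_tendsto x0 \<omega> \<xi>} \<subseteq> N"
      using AEgood unfolding eventually_ae_filter by auto
    then have "emeasure (increment_space \<mu>) {\<omega> \<in> space (increment_space \<mu>). \<exists>\<xi>\<in>sphere 0 1 - ?B. walk_tendsto x0 \<omega> \<xi>}
        \<le> emeasure (increment_space \<mu>) N" by (intro emeasure_mono) auto
    also have "\<dots> = 0" using N by auto
    finally show "emeasure (increment_space \<mu>) {\<omega> \<in> space (increment_space \<mu>). \<exists>\<xi>\<in>sphere 0 1 - ?B. walk_tendsto x0 \<omega> \<xi>} = 0"
      by simp
  qed
  moreover have "emeasure lebesgue_circle ?B = 0" by (rule circle_bad_null[OF dQ _ deep_reals_conull]) simp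
  moreover have "?B \<in> sets (harmonic_measure \<mu> x0) \<inter> sets lebesgue_circle" using B by (simp add: lebesgue_circle_def)
  ultimately show ?thesis unfolding mutually_singular_def by (intro bexI[of _ ?B]) simp_all
qed

end
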